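(* Let $n\ge1$, $\alpha>-1$, $q\ge1$, $\Phi_1,\Phi_2\in\mathscr U^q$, and $\rho_i(t)=\frac{1}{t\Phi_i^{-1}(1/t)}$ for $i=1,2$. Suppose that: (i) $\Phi_2$ satisfies the Dini condition: there is $C>0$ with $\int_0^t\frac{\Phi_2(s)}{s^2}ds\le C\frac{\Phi_2(t)}{t}$ for all $t>0$; (ii) $t\mapsto\frac{\Phi_2^{-1}\circ\Phi_1(t)}{t}$ is non-increasing. Let $\Phi$ be the growth function determined by $\rho_\Phi:=\frac{\rho_1}{\rho_2}$, where $\rho_\Phi(t)=\frac{1}{t\Phi^{-1}(1/t)}$. Then the Hankel operator $h_b$ extends into a bounded operator from $\mathcal A_\alpha^{\Phi_1}(\mathbb B^n)$ into $\mathcal A_\alpha^{\Phi_2}(\mathbb B^n)$ if and only if its symbol $b$ belongs to $\Gamma_{\alpha,\rho_\Phi}(\mathbb B^n)=(\mathcal A_\alpha^{\Phi}(\mathbb B^n))^*$.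
   Context: $\mathbb B^n$ is the unit ball of $\mathbb C^n$, $d\nu$ is Lebesgue measure on it, and $d\nu_\alpha(z)=c_\alpha(1-|z|^2)^\alpha d\nu(z)$ with $\nu_\alpha(\mathbb B^n)=1$. A growth function is a continuous non-decreasing function from $[0,\infty)$ onto itself. $\mathscr U^q$ ($q\ge1$): growth functions $\Phi$ of upper type $q$ ($\Phi(st)\le Ct^q\Phi(s)$ for all $s>0$, $t\ge1$, some $C>0$) with $\Phi(t)/t$ non-decreasing. Growth functions are equivalent if $c\Phi_1(ct)\le\Phi_2(t)\le c^{-1}\Phi_1(c^{-1}t)$ for some $c>0$; equivalent growth functions define the same spaces and are not distinguished. By convention members of $\mathscr U^q$ are supposed convex and $C^1$ with $\Phi'(t)\simeq\Phi(t)/t$. Note that $\Phi^{-1}(t)=t\Phi_1^{-1}(t)/\Phi_2^{-1}(t)$. $\mathcal A_\alpha^\Phi(\mathbb B^n)$ is the space of holomorphic $f$ on $\mathbb B^n$ with $\int_{\mathbb B^n}\Phi(|f|)\,d\nu_\alpha<\infty$, with (quasi-)norm $\|f\|^{lux}_{\alpha,\Phi}=\inf\{\lambda>0:\int\Phi(|f|/\lambda)\,d\nu_\alpha\le1\}$. $\mathcal A^2_\alpha$ is the case $\Phi(t)=t^2$. $P_\alpha f(z)=\int_{\mathbb B^n}\frac{f(\xi)}{(1-\langle z,\xi\rangle)^{n+1+\alpha}}d\nu_\alpha(\xi)$ is the Bergman projection. For a symbol $b\in\mathcal A_\alpha^2(\mathbb B^n)$ the small Hankel operator is defined on bounded holomorphic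 $f$ by $h_b(f)=P_\alpha(b\overline f)$. "$h_b$ extends into a bounded operator from $\mathcal A_\alpha^{\Phi_1}$ into $\mathcal A_\alpha^{\Phi_2}$" means there is $C$ with $\|h_b(f)\|^{lux}_{\alpha,\Phi_2}\le C\|f\|^{lux}_{\alpha,\Phi_1}$ for all bounded holomorphic $f$. $Rf(z)=\sum_{j}z_j\frac{\partial f}{\partial z_j}(z)$. A positive function $\rho$ is of upper type $\gamma$ on $[0,1]$ if $\rho(st)\le Cs^\gamma\rho(t)$ for $s>1$, $st\le1$. For $\rho$ of upper type $\gamma$ (some $\gamma\ge0$), $\Gamma_{\alpha,\rho}(\mathbb B^n)$ is the space of holomorphic $f$ on $\mathbb B^n$ such that for some integer $k>\gamma(n+1+\alpha)$ and some $C>0$, $|R^kf(z)|\le C(1-|z|^2)^{-k}\rho\big((1-|z|^2)^{n+1+\alpha}\big)$ for all $z\in\mathbb B^n$; it does not depend on the choice of such $k$. The identification $\Gamma_{\alpha,\rho_\Phi}=(\mathcal A_\alpha^\Phi)^*$ is under the pairing $\langle f,g\rangle_\alpha=\lim_{r\to1}\int_{\mathbb B^n}f(rz)\overline{g(z)}\,d\nu_\alpha(z)$. *)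

theory Defs
  imports "HOL-Analysis.Analysis"
begin

section \<open>Growth functions\<close>

text \<open>Growth functions live on \<open>[0,\<infinity>)\<close>; their values at negative reals are irrelevant, and the
  inverse of a growth function is taken on \<open>{0..}\<close>.\<close>

definition growth_function :: "(real \<Rightarrow> real) \<Rightarrow> bool" where
  "growth_function \<Phi> \<longleftrightarrow>
     continuous_on {0..} \<Phi> \<and> mono_on {0..} \<Phi> \<and> \<Phi> ` {0..} = {0..}"

abbreviation growth_inv :: "(real \<Rightarrow> real) \<Rightarrow> real \<Rightarrow> real" where
  "growth_inv \<Phi> \<equiv> inv_into {0..} \<Phi>"

definition growth_upper_type :: "real \<Rightarrow> (real \<Rightarrow> real) \<Rightarrow> bool" where
  "growth_upper_type q \<Phi> \<longleftrightarrow>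
     (\<exists>C>0. \<forall>s>0. \<forall>t\<ge>1. \<Phi> (s * t) \<le> C * t powr q * \<Phi> s)"

text \<open>The last two conditions are the standing convention on members of the class: they are
  convex and continuously differentiable, with \<open>\<Phi>'(t)\<close> comparable to \<open>\<Phi>(t)/t\<close>. Differentiability
  is asked for on \<open>(0,\<infinity>)\<close>; by convexity this already makes \<open>\<Phi>\<close> continuously differentiable
  up to \<open>0\<close>.\<close>

definition growth_U :: "real \<Rightarrow> (real \<Rightarrow> real) set" where
  "growth_U q = {\<Phi>. growth_function \<Phi> \<and> growth_upper_type q \<Phi> \<and>
     mono_on {0<..} (\<lambda>t. \<Phi> t / t) \<and>
     convex_on {0..} \<Phi> \<and>
     (\<exists>\<phi>. continuous_on {0<..} \<phi> \<and>
          (\<forall>t>0. (\<Phi> has_real_derivative \<phi> t) (at t)) \<and>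
          (\<exists>c>0. \<forall>t>0. c * (\<Phi> t / t) \<le> \<phi> t \<and> \<phi> t \<le> inverse c * (\<Phi> t / t)))}"

text \<open>A nonnegative (extended) integral, so that the condition includes convergence at \<open>0\<close>.\<close>

definition dini_condition :: "(real \<Rightarrow> real) \<Rightarrow> bool" where
  "dini_condition \<Phi> \<longleftrightarrow>
     (\<exists>C>0. \<forall>t>0. (\<integral>\<^sup>+s\<in>{0<..<t}. ennreal (\<Phi> s / s\<^sup>2) \<partial>lborel) \<le> ennreal (C * (\<Phi> t / t)))"

definition rho :: "(real \<Rightarrow> real) \<Rightarrow> real \<Rightarrow> real" where
  "rho \<Phi> t = 1 / (t * growth_inv \<Phi> (1 / t))"


section \<open>Analysis on the unit ball of \<open>\<complex>\<^sup>n\<close>\<close>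

definition herm :: "complex ^ 'n \<Rightarrow> complex ^ 'n \<Rightarrow> complex" where
  "herm z w = (\<Sum>j\<in>UNIV. z $ j * cnj (w $ j))"

definition holomorphic_ball :: "(complex ^ 'n \<Rightarrow> complex) \<Rightarrow> bool" where
  "holomorphic_ball f \<longleftrightarrow>
     (\<forall>z\<in>ball 0 1. \<exists>D. (f has_derivative D) (at z) \<and> (\<forall>c v. D (c *s v) = c * D v))"

text \<open>The measure \<open>\<nu>\<^sub>\<alpha>\<close>. It is carried by the ball, so values of functions outside the ball never
  enter an integral. The denominator is \<open>1/c\<^sub>\<alpha>\<close>, which is finite and positive for \<open>\<alpha> > -1\<close>.\<close>

definition nu :: "real \<Rightarrow> (complex ^ 'n) measure" where
  "nu \<alpha> = density (restrict_space lborel (ball 0 1))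
     (\<lambda>z. ennreal ((1 - (norm z)\<^sup>2) powr \<alpha> /
        (LINT w:ball (0 :: complex ^ 'n) 1|lborel. (1 - (norm w)\<^sup>2) powr \<alpha>)))"

definition bergman_orlicz :: "real \<Rightarrow> (real \<Rightarrow> real) \<Rightarrow> (complex ^ 'n \<Rightarrow> complex) set" where
  "bergman_orlicz \<alpha> \<Phi> =
     {f. holomorphic_ball f \<and> (\<integral>\<^sup>+z. ennreal (\<Phi> (cmod (f z))) \<partial>nu \<alpha>) < \<infinity>}"

text \<open>Extended-valued: the infimum is \<open>\<infinity>\<close> when no \<open>\<mu>\<close> is admissible.\<close>

definition lux_norm :: "real \<Rightarrow> (real \<Rightarrow> real) \<Rightarrow> (complex ^ 'n \<Rightarrow> complex) \<Rightarrow> ennreal" where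
  "lux_norm \<alpha> \<Phi> f =
     Inf {ennreal \<mu> |\<mu>. \<mu> > 0 \<and> (\<integral>\<^sup>+z. ennreal (\<Phi> (cmod (f z) / \<mu>)) \<partial>nu \<alpha>) \<le> 1}"

text \<open>For \<open>z, \<xi>\<close> in the ball, \<open>1 - \<langle>z,\<xi>\<rangle>\<close> has positive real part, so the principal branch of the
  power is the intended one.\<close>

definition bergman_proj ::
  "real \<Rightarrow> (complex ^ 'n \<Rightarrow> complex) \<Rightarrow> complex ^ 'n \<Rightarrow> complex" where
  "bergman_proj \<alpha> f z =
     (LINT \<xi>|nu \<alpha>. f \<xi> / (1 - herm z \<xi>) powr complex_of_real (real CARD('n) + 1 + \<alpha>))"

definition hankel ::
  "real \<Rightarrow> (complex ^ 'n \<Rightarrow> complex) \<Rightarrow> (complex ^ 'n \<Rightarrow> complex) \<Rightarrow> complex ^ 'n \<Rightarrow> complex" where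
  "hankel \<alpha> b f = bergman_proj \<alpha> (\<lambda>z. b z * cnj (f z))"

definition hankel_bounded ::
  "real \<Rightarrow> (real \<Rightarrow> real) \<Rightarrow> (real \<Rightarrow> real) \<Rightarrow> (complex ^ 'n \<Rightarrow> complex) \<Rightarrow> bool" where
  "hankel_bounded \<alpha> \<Phi>1 \<Phi>2 b \<longleftrightarrow>
     (\<exists>C>0. \<forall>f. holomorphic_ball f \<and> bounded (f ` ball 0 1) \<longrightarrow>
        lux_norm \<alpha> \<Phi>2 (hankel \<alpha> b f) \<le> ennreal C * lux_norm \<alpha> \<Phi>1 f)"


section \<open>The spaces \<open>\<Gamma>\<close> and the dual of a Bergman--Orlicz space\<close>

definition partial_deriv :: "'n \<Rightarrow> (complex ^ 'n \<Rightarrow> complex) \<Rightarrow> complex ^ 'n \<Rightarrow> complex" where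
  "partial_deriv j f z = deriv (\<lambda>w. f (\<chi> i. if i = j then w else z $ i)) (z $ j)"

definition radial_deriv :: "(complex ^ 'n \<Rightarrow> complex) \<Rightarrow> complex ^ 'n \<Rightarrow> complex" where
  "radial_deriv f z = (\<Sum>j\<in>UNIV. z $ j * partial_deriv j f z)"

definition upper_type_unit :: "real \<Rightarrow> (real \<Rightarrow> real) \<Rightarrow> bool" where
  "upper_type_unit \<gamma> \<rho> \<longleftrightarrow>
     (\<exists>C>0. \<forall>s t. s > 1 \<and> t > 0 \<and> s * t \<le> 1 \<longrightarrow> \<rho> (s * t) \<le> C * s powr \<gamma> * \<rho> t)"

text \<open>The space does not depend on the exponent \<open>\<gamma>\<close> nor on \<open>k\<close>: of two admissible values of \<open>k\<close>,
  both are admissible for the smaller of the two exponents.\<close>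

definition Gamma_space :: "real \<Rightarrow> (real \<Rightarrow> real) \<Rightarrow> (complex ^ 'n \<Rightarrow> complex) set" where
  "Gamma_space \<alpha> \<rho> = {f. holomorphic_ball f \<and>
     (\<exists>\<gamma>\<ge>0. upper_type_unit \<gamma> \<rho> \<and>
       (\<exists>k::nat. real k > \<gamma> * (real CARD('n) + 1 + \<alpha>) \<and>
         (\<exists>C>0. \<forall>z\<in>ball 0 1. cmod ((radial_deriv ^^ k) f z)
            \<le> C * (1 - (norm z)\<^sup>2) powr (- real k)
                * \<rho> ((1 - (norm z)\<^sup>2) powr (real CARD('n) + 1 + \<alpha>)))))}"

definition orlicz_dual ::
  "real \<Rightarrow> (real \<Rightarrow> real) \<Rightarrow> ((complex ^ 'n \<Rightarrow> complex) \<Rightarrow> complex) set" where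
  "orlicz_dual \<alpha> \<Phi> = {L.
     (\<forall>f\<in>bergman_orlicz \<alpha> \<Phi>. \<forall>g\<in>bergman_orlicz \<alpha> \<Phi>. L (\<lambda>z. f z + g z) = L f + L g) \<and>
     (\<forall>f\<in>bergman_orlicz \<alpha> \<Phi>. \<forall>c. L (\<lambda>z. c * f z) = c * L f) \<and>
     (\<exists>C>0. \<forall>f\<in>bergman_orlicz \<alpha> \<Phi>. ennreal (cmod (L f)) \<le> ennreal C * lux_norm \<alpha> \<Phi> f)}"

text \<open>\<open>\<langle>f,g\<rangle>\<^sub>\<alpha>\<close> exists and equals \<open>l\<close>.\<close>

definition has_pairing ::
  "real \<Rightarrow> (complex ^ 'n \<Rightarrow> complex) \<Rightarrow> (complex ^ 'n \<Rightarrow> complex) \<Rightarrow> complex \<Rightarrow> bool" where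
  "has_pairing \<alpha> f g l \<longleftrightarrow>
     ((\<lambda>r. LINT z|nu \<alpha>. f (r *\<^sub>R z) * cnj (g z)) \<longlongrightarrow> l) (at_left 1)"

definition represents ::
  "real \<Rightarrow> (real \<Rightarrow> real) \<Rightarrow> (complex ^ 'n \<Rightarrow> complex) \<Rightarrow> ((complex ^ 'n \<Rightarrow> complex) \<Rightarrow> complex) \<Rightarrow> bool" where
  "represents \<alpha> \<Phi> g L \<longleftrightarrow> (\<forall>f\<in>bergman_orlicz \<alpha> \<Phi>. has_pairing \<alpha> f g (L f))"

text \<open>\<open>G = (A\<^sub>\<alpha>\<^sup>\<Phi>)\<^sup>*\<close> under the pairing: each \<open>g \<in> G\<close> induces a bounded functional, and each bounded
  functional is induced by some \<open>g \<in> G\<close>, unique as a function on the ball.\<close>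

definition is_dual_of_orlicz ::
  "real \<Rightarrow> (real \<Rightarrow> real) \<Rightarrow> (complex ^ 'n \<Rightarrow> complex) set \<Rightarrow> bool" where
  "is_dual_of_orlicz \<alpha> \<Phi> G \<longleftrightarrow>
     (\<forall>g\<in>G. \<exists>L\<in>orlicz_dual \<alpha> \<Phi>. represents \<alpha> \<Phi> g L) \<and>
     (\<forall>L\<in>orlicz_dual \<alpha> \<Phi>. \<exists>g\<in>G. represents \<alpha> \<Phi> g L \<and>
        (\<forall>g'\<in>G. represents \<alpha> \<Phi> g' L \<longrightarrow> (\<forall>z\<in>ball 0 1. g' z = g z)))"

end

theory Submission
  imports Defs "HOL-Complex_Analysis.Complex_Analysis"
begin

text \<open>Put \<open>N = n + 1 + \<alpha>\<close>. Expanding a holomorphic function in homogeneous parts and comparing with Gaussian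
  integrals gives the reproducing formula, hence \<open>\<integral>|1 - \<langle>z, w\<rangle>|\<^sup>-\<^sup>2\<^sup>N d\<nu>\<^sub>\<alpha>(z) = (1 - |w|\<^sup>2)\<^sup>-\<^sup>N\<close>; all other kernel
  estimates follow from this identity. Sub-mean-value estimates give \<open>|f(w)| \<lesssim> \<parallel>f\<parallel> \<Phi>\<^sup>-\<^sup>1((1 - |w|\<^sup>2)\<^sup>-\<^sup>N)\<close>, and a
  kernel \<open>(1 - \<langle>\<cdot>, w\<rangle>)\<^sup>-\<^sup>s\<close> with \<open>s \<ge> 4N\<close> attains this bound up to a constant.

  If \<open>b \<in> \<Gamma>\<close>, an integration by parts replaces \<open>b\<close> by a radial derivative \<open>D\<close> of order \<open>k\<close> and
  \<open>(1 - |\<xi>|\<^sup>2)\<^sup>k |D(\<xi>)| \<lesssim> \<rho>\<^sub>\<Phi>((1 - |\<xi>|\<^sup>2)\<^sup>N)\<close>. Then \<open>h\<^sub>b f\<close> is dominated by the positive Bergman operator applied to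
  \<open>|f| \<rho>\<^sub>\<Phi>\<close>. That operator is bounded for \<open>\<Phi>\<^sub>2\<close>, since the Dini condition gives a lower type above \<open>1\<close>, and the
  pointwise bound on \<open>f\<close> together with the monotonicity of \<open>\<Phi>\<^sub>2\<^sup>-\<^sup>1 \<circ> \<Phi>\<^sub>1(t)/t\<close> gives \<open>\<Phi>\<^sub>2(|f| \<rho>\<^sub>\<Phi>) \<le> \<Phi>\<^sub>1(|f|)\<close> after
  scaling. Conversely \<open>R\<^sup>k b(w) = h\<^sub>b(f\<^sub>w)(w)\<close> for a combination \<open>f\<^sub>w\<close> of kernels. For the duality, \<open>b\<close> is
  paired with \<open>f\<close> through \<open>D\<close>; a functional \<open>L\<close> is represented by \<open>w \<mapsto> cnj (L K\<^sub>w)\<close>, because dilates are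
  superpositions of reproducing kernels \<open>K\<^sub>w\<close> and converge to \<open>f\<close> in norm.\<close>

section \<open>Lebesgue measure on \<open>\<complex>\<^sup>n\<close>\<close>

text \<open>The third function is known only through its inverse, \<Phi>^{-1}(t) = t
  \<Phi>_1^{-1}(t) / \<Phi>_2^{-1}(t). It need not be convex: the hypotheses give it lower type 1/2
  and upper type 1, so its Luxemburg functional need not satisfy the triangle inequality. This
  shapes the proof. Pointwise estimates are proved for sqrt |f|, by a self-improving supremum in the
  reproducing formula, and are carried to \<Phi> because lower type 1/2 says that \<Phi>(x^2)/x is
  non-decreasing. Bounded functionals are never extended or separated; they are recovered from their
  values on kernels. The only symmetries used are the rotations z -> e^{it} z, dilations and, under
  a Gaussian, translations. There is no surface measure and there are no automorphisms of the ball: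
  multiplying f by a power of the kernel at w does the work of moving w to the origin. Inverses are
  arbitrary selections of preimages, hence the many arguments through strict inequalities.\<close>

lemma nn_integral_lborel_translation:
  fixes f :: "'a::euclidean_space \<Rightarrow> ennreal"
  assumes [measurable]: "f \<in> borel_measurable borel"
  shows "(\<integral>\<^sup>+x. f (c + x) \<partial>lborel) = (\<integral>\<^sup>+x. f x \<partial>lborel)"
proof -
  have "(\<integral>\<^sup>+x. f x \<partial>lborel) = (\<integral>\<^sup>+x. f x \<partial>distr lborel borel ((+) c))"
    by (simp add: lborel_distr_plus)
  also have "\<dots> = (\<integral>\<^sup>+x. f (c + x) \<partial>lborel)"
    by (subst nn_integral_distr) auto
  finally show ?thesis by simp
qed

lemma nn_integral_lborel_scaling:
  fixes f :: "'a::euclidean_space \<Rightarrow> ennreal"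
  assumes [measurable]: "f \<in> borel_measurable borel" and "r > 0"
  shows "(\<integral>\<^sup>+x. f x \<partial>lborel) = ennreal (r ^ DIM('a)) * (\<integral>\<^sup>+x. f (r *\<^sub>R x) \<partial>lborel)"
proof -
  have "(\<integral>\<^sup>+x. f x \<partial>lborel) =
        (\<integral>\<^sup>+x. f x \<partial>density (distr lborel borel (\<lambda>x. 0 + r *\<^sub>R x)) (\<lambda>_. ennreal (\<bar>r\<bar> ^ DIM('a))))"
    using lborel_affine[of r "0::'a"] assms by simp
  also have "\<dots> = ennreal (r ^ DIM('a)) * (\<integral>\<^sup>+x. f (r *\<^sub>R x) \<partial>lborel)"
    using assms(2) by (simp add: nn_integral_density nn_integral_distr nn_integral_cmult)
  finally show ?thesis .
qed

text \<open>Uniqueness of Haar measure, specialised: integrate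
  \<open>1\<^sub>A (T x + y) 1\<^sub>B y\<close> over \<open>x, y\<close> in both orders, with \<open>B\<close> the unit ball.\<close>

lemma lborel_distr_isometry:
  fixes T :: "'a::euclidean_space \<Rightarrow> 'a"
  assumes lin: "linear T" and iso: "\<And>x. norm (T x) = norm x"
  shows "distr lborel borel T = lborel"
proof (rule measure_eqI)
  show "sets (distr lborel borel T) = sets lborel" by simp
  fix A assume "A \<in> sets (distr lborel borel T)"
  then have A[measurable]: "A \<in> sets borel" by simp
  have "continuous_on UNIV T" using lin by (rule linear_continuous_on[OF linear_conv_bounded_linear[THEN iffD1]])
  then have T[measurable]: "T \<in> borel_measurable borel" by (rule borel_measurable_continuous_onI)
  have inj: "inj T"
    using linear_injective_0[OF lin] iso by (metis norm_eq_zero)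
  have surj: "surj T" by (rule linear_inj_imp_surj[OF lin inj])
  define B where "B = ball (0::'a) 1"
  have [measurable]: "B \<in> sets borel" by (simp add: B_def)
  have eB: "emeasure lborel (ball y 1) = emeasure lborel B" for y :: 'a
    by (simp add: B_def emeasure_ball)
  have Bpos: "emeasure lborel B \<noteq> 0" "emeasure lborel B \<noteq> \<infinity>"
    using less_imp_neq[OF unit_ball_vol_pos[of "real DIM('a)"]] by (auto simp: B_def emeasure_ball)
  have "(\<integral>\<^sup>+y. \<integral>\<^sup>+x. indicator A (T x + y) * indicator B y \<partial>lborel \<partial>lborel)
      = (\<integral>\<^sup>+y. emeasure lborel (T -` A) * indicator B y \<partial>lborel)"
  proof (rule nn_integral_cong)
    fix y
    obtain y' where y': "y = T y'" using surj by auto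
    have "(\<integral>\<^sup>+x. indicator A (T x + y) \<partial>lborel) = (\<integral>\<^sup>+x. indicator A (T (y' + x)) \<partial>lborel)"
      by (simp add: y' linear_add[OF lin] add.commute)
    also have "\<dots> = (\<integral>\<^sup>+x. indicator A (T x) \<partial>lborel)"
      by (rule nn_integral_lborel_translation) measurable
    also have "\<dots> = (\<integral>\<^sup>+x. indicator (T -` A) x \<partial>lborel)"
      by (intro nn_integral_cong) (auto simp: indicator_def)
    also have "\<dots> = emeasure lborel (T -` A)"
      using measurable_sets_borel[OF T A] by simp
    finally show "(\<integral>\<^sup>+x. indicator A (T x + y) * indicator B y \<partial>lborel)
      = emeasure lborel (T -` A) * indicator B y"
      by (subst nn_integral_multc) auto
  qed
  also have "\<dots> = emeasure lborel (T -` A) * emeasure lborel B"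
    by (subst nn_integral_cmult) auto
  finally have 1: "emeasure lborel (T -` A) * emeasure lborel B =
     (\<integral>\<^sup>+y. \<integral>\<^sup>+x. indicator A (T x + y) * indicator B y \<partial>lborel \<partial>lborel)" by simp
  also have "\<dots> = (\<integral>\<^sup>+x. \<integral>\<^sup>+y. indicator A (T x + y) * indicator B y \<partial>lborel \<partial>lborel)"
    by (rule lborel_pair.Fubini') measurable
  also have "\<dots> = (\<integral>\<^sup>+x. \<integral>\<^sup>+y. indicator A y * indicator B (y - T x) \<partial>lborel \<partial>lborel)"
  proof (rule nn_integral_cong)
    fix x
    show "(\<integral>\<^sup>+y. indicator A (T x + y) * indicator B y \<partial>lborel) =
      (\<integral>\<^sup>+y. indicator A y * indicator B (y - T x) \<partial>lborel)"
      using nn_integral_lborel_translation[of "\<lambda>y. indicator A y * indicator B (y - T x)" "T x"]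
      by simp
  qed
  also have "\<dots> = (\<integral>\<^sup>+y. \<integral>\<^sup>+x. indicator A y * indicator B (y - T x) \<partial>lborel \<partial>lborel)"
    by (rule lborel_pair.Fubini') measurable
  also have "\<dots> = (\<integral>\<^sup>+y. indicator A y * emeasure lborel B \<partial>lborel)"
  proof (rule nn_integral_cong)
    fix y
    obtain y' where y': "y = T y'" using surj by auto
    have "y - T x \<in> B \<longleftrightarrow> x \<in> ball y' 1" for x
      using iso[of "y' - x"] by (auto simp: y' B_def indicator_def linear_diff[OF lin] dist_norm norm_minus_commute)
    then have "(\<integral>\<^sup>+x. indicator B (y - T x) \<partial>lborel) = (\<integral>\<^sup>+x. indicator (ball y' 1) x \<partial>lborel)"
      by (intro nn_integral_cong) (simp add: indicator_def of_bool_def)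
    also have "\<dots> = emeasure lborel B" by (simp add: eB)
    finally have "(\<integral>\<^sup>+x. indicator B (y - T x) \<partial>lborel) = emeasure lborel B" .
    then show "(\<integral>\<^sup>+x. indicator A y * indicator B (y - T x) \<partial>lborel) = indicator A y * emeasure lborel B"
      by (subst nn_integral_cmult) auto
  qed
  also have "\<dots> = emeasure lborel A * emeasure lborel B"
    by (subst nn_integral_multc) auto
  finally have "emeasure lborel (T -` A) = emeasure lborel A"
    using Bpos by (simp add: ennreal_mult_cancel_left mult.commute[of _ "emeasure lborel B"])
  then show "emeasure (distr lborel borel T) A = emeasure lborel A"
    by (simp add: emeasure_distr)
qed

lemma norm_cscale: "norm (c *s z) = cmod c * norm (z :: complex ^ 'n)"
  by (simp add: norm_vec_def norm_mult L2_set_right_distrib)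

lemma linear_cscale: "linear (\<lambda>z. c *s (z :: complex ^ 'n))"
  by (rule linearI) (auto simp: vec_eq_iff algebra_simps scaleR_conv_of_real)

lemma scaleR_cscale: "r *\<^sub>R z = complex_of_real r *s (z :: complex ^ 'n)"
  by (simp add: vec_eq_iff) (simp add: scaleR_conv_of_real)

lemma continuous_on_cscale[continuous_intros]:
  "continuous_on A f \<Longrightarrow> continuous_on A g \<Longrightarrow> continuous_on A (\<lambda>x. f x *s (g x :: complex ^ 'n))"
  unfolding vector_scalar_mult_def by (intro continuous_intros)

lemma measurable_cscale[measurable]: "(\<lambda>z. c *s (z :: complex ^ 'n)) \<in> borel_measurable borel"
  by (intro borel_measurable_continuous_onI continuous_intros)

lemma lborel_distr_rotation:
  assumes "cmod c = 1"
  shows "distr lborel borel (\<lambda>z. c *s (z :: complex ^ 'n)) = lborel"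
  by (rule lborel_distr_isometry[OF linear_cscale]) (simp add: norm_cscale assms)

lemma integral_lborel_rotation:
  fixes f :: "complex ^ 'n \<Rightarrow> complex"
  assumes "cmod c = 1" and [measurable]: "f \<in> borel_measurable borel"
  shows "integral\<^sup>L lborel (\<lambda>z. f (c *s z)) = integral\<^sup>L lborel f"
proof -
  have "integral\<^sup>L lborel f = integral\<^sup>L (distr lborel borel (\<lambda>z. c *s z)) f"
    by (simp add: lborel_distr_rotation[OF assms(1)])
  also have "\<dots> = integral\<^sup>L lborel (\<lambda>z. f (c *s z))"
    by (rule integral_distr) auto
  finally show ?thesis by simp
qed

lemma measurable_mem_ball[measurable]: "Measurable.pred borel (\<lambda>x :: 'a :: euclidean_space. x \<in> ball c r)"
  by (simp add: pred_def)

lemma borel_measurable_weight[measurable]: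
  "(\<lambda>z :: 'a :: euclidean_space. (1 - (norm z)\<^sup>2) powr \<alpha>) \<in> borel_measurable borel"
  by measurable

text \<open>The integral of g(z) (s - |z|^2)_+^\<alpha> e^{-s} over z and s is computed in both
  orders. Integrating in s first gives Gamma(\<alpha>+1) times the Gaussian integral; substituting z
  -> sqrt(s) z first gives the ball integral times a Gamma integral in s. This replaces polar
  coordinates, and infinite values are allowed.\<close>

lemma nn_radial_formula:
  fixes g :: "complex ^ 'n \<Rightarrow> ennreal"
  assumes [measurable]: "g \<in> borel_measurable borel" and "\<alpha> > -1"
    and hom: "\<And>t z. t > 0 \<Longrightarrow> g (t *\<^sub>R z) = ennreal (t ^ (2 * j)) * g z"
  shows "ennreal (Gamma (real CARD('n) + 1 + \<alpha> + real j)) *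
      (\<integral>\<^sup>+z. g z * ennreal (indicator (ball 0 1) z * (1 - (norm z)\<^sup>2) powr \<alpha>) \<partial>lborel)
    = ennreal (Gamma (\<alpha> + 1)) * (\<integral>\<^sup>+z. g z * ennreal (exp (- (norm z)\<^sup>2)) \<partial>lborel)"
proof -
  let ?n = "real CARD('n)"
  define K where "K = (\<integral>\<^sup>+z. g z * ennreal (indicator (ball 0 1) z * (1 - (norm z)\<^sup>2) powr \<alpha>) \<partial>lborel)"
  define \<phi> where "\<phi> z s = ennreal (indicator {(norm z)\<^sup>2<..} s * (s - (norm z)\<^sup>2) powr \<alpha> * exp (-s))"
    for z :: "complex ^ 'n" and s :: real
  have \<phi>m[measurable]: "(\<lambda>(z,s). \<phi> z s) \<in> borel_measurable (borel \<Otimes>\<^sub>M borel)"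
  proof -
    have "(\<lambda>(z,s). \<phi> z s) = (\<lambda>p::(complex ^ 'n) \<times> real. if (norm (fst p))\<^sup>2 < snd p then
       ennreal ((snd p - (norm (fst p))\<^sup>2) powr \<alpha> * exp (- snd p)) else 0)"
      by (auto simp: \<phi>_def indicator_def fun_eq_iff)
    also have "\<dots> \<in> borel_measurable (borel \<Otimes>\<^sub>M borel)" by measurable
    finally show ?thesis .
  qed
  have I1: "(\<integral>\<^sup>+s. \<phi> z s \<partial>lborel) = ennreal (Gamma (\<alpha> + 1)) * ennreal (exp (- (norm z)\<^sup>2))" for z :: "complex ^ 'n"
  proof -
    have "(\<integral>\<^sup>+s. \<phi> z s \<partial>lborel) = (\<integral>\<^sup>+s. \<phi> z ((norm z)\<^sup>2 + s) \<partial>lborel)"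
      by (rule nn_integral_lborel_translation[symmetric]) measurable
    also have "\<dots> = (\<integral>\<^sup>+t. ennreal (exp (- (norm z)\<^sup>2)) * ennreal (indicator {0..} t * t powr (\<alpha> + 1 - 1) / exp t) \<partial>lborel)"
      by (intro nn_integral_cong)
         (auto simp: \<phi>_def indicator_def exp_add exp_diff exp_minus field_simps simp flip: ennreal_mult'')
    also have "\<dots> = ennreal (Gamma (\<alpha> + 1)) * ennreal (exp (- (norm z)\<^sup>2))"
      using assms(2) by (subst nn_integral_cmult) (auto simp: Gamma_conv_nn_integral_real mult.commute)
    finally show ?thesis .
  qed
  have I2: "(\<integral>\<^sup>+z. g z * \<phi> z s \<partial>lborel) = 
      K * ennreal (indicator {0..} s * s powr (?n + 1 + \<alpha> + real j - 1) / exp s)" if "s \<noteq> 0" for s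
  proof (cases "s > 0")
    case True
    have "(\<integral>\<^sup>+z. g z * \<phi> z s \<partial>lborel) = ennreal (sqrt s ^ DIM(complex ^ 'n)) *
       (\<integral>\<^sup>+z. g (sqrt s *\<^sub>R z) * \<phi> (sqrt s *\<^sub>R z) s \<partial>lborel)"
      using True by (intro nn_integral_lborel_scaling) measurable
    also have "sqrt s ^ DIM(complex ^ 'n) = s powr ?n"
      using True by (simp add: DIM_cart power_mult mult.commute[of "CARD('n)"] powr_realpow)
    also have "(\<integral>\<^sup>+z. g (sqrt s *\<^sub>R z) * \<phi> (sqrt s *\<^sub>R z) s \<partial>lborel) = 
       (\<integral>\<^sup>+z. ennreal (s powr (j + \<alpha>) * exp (-s)) * (g z * ennreal (indicator (ball 0 1) z * (1 - (norm z)\<^sup>2) powr \<alpha>)) \<partial>lborel)"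
    proof (rule nn_integral_cong)
      fix z :: "complex ^ 'n"
      have g: "g (sqrt s *\<^sub>R z) = ennreal (s powr j) * g z"
        using hom[of "sqrt s" z] True by (simp add: power_mult powr_realpow)
      have n: "(norm (sqrt s *\<^sub>R z))\<^sup>2 = s * (norm z)\<^sup>2" using True by (simp add: power_mult_distrib)
      have "\<phi> (sqrt s *\<^sub>R z) s = ennreal (s powr \<alpha> * exp (-s) * (indicator (ball 0 1) z * (1 - (norm z)\<^sup>2) powr \<alpha>))"
      proof (cases "norm z < 1")
        case T: True
        then have "(norm z)\<^sup>2 < 1" by (simp add: power_less_one_iff)
        then have "s * (norm z)\<^sup>2 < s" "s - s * (norm z)\<^sup>2 = s * (1 - (norm z)\<^sup>2)"
          using True by (auto simp: algebra_simps)
        then show ?thesis using T True \<open>(norm z)\<^sup>2 < 1\<close> unfolding \<phi>_def n by (simp add: powr_mult mult_ac)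
      next
        case F: False
        then have "1 \<le> (norm z)\<^sup>2" by (simp add: power_less_one_iff flip: not_less)
        then have "\<not> s * (norm z)\<^sup>2 < s" using True by simp
        then show ?thesis using F unfolding \<phi>_def n by simp
      qed
      then show "g (sqrt s *\<^sub>R z) * \<phi> (sqrt s *\<^sub>R z) s = ennreal (s powr (j + \<alpha>) * exp (-s)) * (g z * ennreal (indicator (ball 0 1) z * (1 - (norm z)\<^sup>2) powr \<alpha>))"
        unfolding g by (simp add: powr_add ennreal_mult'' mult_ac)
    qed
    also have "\<dots> = ennreal (s powr (j + \<alpha>) * exp (-s)) * K"
      unfolding K_def by (rule nn_integral_cmult) measurable
    also have "ennreal (s powr ?n) * (ennreal (s powr (j + \<alpha>) * exp (-s)) * K) =
       K * ennreal (indicator {0..} s * s powr (?n + 1 + \<alpha> + real j - 1) / exp s)"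
      using True by (simp add: powr_add exp_minus divide_inverse mult_ac flip: ennreal_mult'')
    finally show ?thesis .
  next
    case False
    then have "\<phi> z s = 0" for z :: "complex ^ 'n"
      using that by (auto simp: \<phi>_def indicator_def) (smt (verit) zero_le_power2)
    then show ?thesis using False that by (simp add: indicator_def)
  qed
  have "(\<integral>\<^sup>+z. \<integral>\<^sup>+s. g z * \<phi> z s \<partial>lborel \<partial>lborel) = (\<integral>\<^sup>+s. \<integral>\<^sup>+z. g z * \<phi> z s \<partial>lborel \<partial>lborel)"
    by (rule lborel_pair.Fubini'[symmetric]) measurable
  also have "\<dots> = (\<integral>\<^sup>+s. K * ennreal (indicator {0..} s * s powr (?n + 1 + \<alpha> + real j - 1) / exp s) \<partial>lborel)"
    by (intro nn_integral_cong_AE) (use AE_lborel_singleton[of 0] I2 in auto)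
  also have "\<dots> = K * ennreal (Gamma (?n + 1 + \<alpha> + real j))"
    using assms(2) by (subst nn_integral_cmult) (auto simp: Gamma_conv_nn_integral_real)
  also have "(\<integral>\<^sup>+z. \<integral>\<^sup>+s. g z * \<phi> z s \<partial>lborel \<partial>lborel) = 
      (\<integral>\<^sup>+z. ennreal (Gamma (\<alpha> + 1)) * (g z * ennreal (exp (- (norm z)\<^sup>2))) \<partial>lborel)"
    by (intro nn_integral_cong) (simp add: nn_integral_cmult I1 mult_ac)
  also have "\<dots> = ennreal (Gamma (\<alpha> + 1)) * (\<integral>\<^sup>+z. g z * ennreal (exp (- (norm z)\<^sup>2)) \<partial>lborel)"
    by (rule nn_integral_cmult) measurable
  finally show ?thesis by (simp add: K_def mult.commute)
qed

text \<open>For g = 1 and \<alpha> = j = 0 the radial formula equates the Gaussian integral with n!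
  times the volume of the ball.\<close>

lemma nn_gaussian_finite: "(\<integral>\<^sup>+z. ennreal (exp (- (norm (z :: complex ^ 'n))\<^sup>2)) \<partial>lborel) < \<infinity>"
proof -
  have "(\<integral>\<^sup>+z. ennreal (exp (- (norm (z :: complex ^ 'n))\<^sup>2)) \<partial>lborel) =
     ennreal (Gamma (real CARD('n) + 1)) *
      (\<integral>\<^sup>+z. ennreal (indicator (ball 0 1) z * (1 - (norm (z :: complex ^ 'n))\<^sup>2) powr 0) \<partial>lborel)"
    using nn_radial_formula[of "\<lambda>z::complex ^ 'n. 1" 0 0] by simp
  also have "\<dots> \<le> ennreal (Gamma (real CARD('n) + 1)) * (\<integral>\<^sup>+z. indicator (ball (0::complex ^ 'n) 1) z \<partial>lborel)"
    by (intro mult_left_mono nn_integral_mono) (auto simp: indicator_def)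
  also have "\<dots> < \<infinity>"
    by (simp add: emeasure_ball ennreal_mult_less_top)
  finally show ?thesis .
qed

text \<open>By C|z| \<le> C^2/2 + |z|^2/2, half of the Gaussian absorbs the exponential and the
  other half remains integrable.\<close>

lemma integrable_gaussian_bound:
  fixes F :: "complex ^ 'n \<Rightarrow> 'b :: {banach, second_countable_topology}"
  assumes [measurable]: "F \<in> borel_measurable borel" and bd: "\<And>z. norm (F z) \<le> A * exp (C * norm z)"
  shows "integrable lborel (\<lambda>z. exp (- (norm z)\<^sup>2) *\<^sub>R F z)"
proof -
  let ?h = "\<lambda>z::complex ^ 'n. exp (- (norm z)\<^sup>2 / 2)"
  have fin: "(\<integral>\<^sup>+z. ennreal (?h z) \<partial>lborel) < \<infinity>"
  proof -
    have "(\<integral>\<^sup>+z. ennreal (?h z) \<partial>lborel) = ennreal (sqrt 2 ^ DIM(complex ^ 'n)) *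
      (\<integral>\<^sup>+z. ennreal (?h (sqrt 2 *\<^sub>R z)) \<partial>lborel)"
      by (intro nn_integral_lborel_scaling) auto
    also have "(\<integral>\<^sup>+z. ennreal (?h (sqrt 2 *\<^sub>R z)) \<partial>lborel) = (\<integral>\<^sup>+z. ennreal (exp (- (norm (z::complex ^ 'n))\<^sup>2)) \<partial>lborel)"
      by (simp add: power_mult_distrib)
    finally show ?thesis using nn_gaussian_finite[where 'n='n] by (simp add: ennreal_mult_less_top)
  qed
  have A: "0 \<le> A" using bd[of 0] norm_ge_zero[of "F 0"] by (simp del: norm_ge_zero)
  have "integrable lborel (\<lambda>z. (A * exp (C\<^sup>2 / 2)) * ?h z)"
    by (intro integrable_mult_right integrableI_nonneg fin) auto
  then show ?thesis
  proof (rule Bochner_Integration.integrable_bound)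
    show "AE z in lborel. norm (exp (- (norm z)\<^sup>2) *\<^sub>R F z) \<le> norm (A * exp (C\<^sup>2 / 2) * ?h z)"
    proof (rule AE_I2)
      fix z :: "complex ^ 'n"
      have "C * norm z \<le> C\<^sup>2 / 2 + (norm z)\<^sup>2 / 2"
        using sum_squares_bound[of C "norm z"] by simp
      then have "- (norm z)\<^sup>2 + C * norm z \<le> C\<^sup>2 / 2 - (norm z)\<^sup>2 / 2" by (simp add: field_simps)
      then have "exp (- (norm z)\<^sup>2) * exp (C * norm z) \<le> exp (C\<^sup>2 / 2) * ?h z"
        by (simp flip: exp_add)
      then have "A * (exp (- (norm z)\<^sup>2) * exp (C * norm z)) \<le> A * (exp (C\<^sup>2 / 2) * ?h z)"
        using A by (rule mult_left_mono)
      moreover have "norm (exp (- (norm z)\<^sup>2) *\<^sub>R F z) \<le> exp (- (norm z)\<^sup>2) * (A * exp (C * norm z))"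
        using mult_left_mono[OF bd[of z], of "exp (- (norm z)\<^sup>2)"] by simp
      ultimately have "norm (exp (- (norm z)\<^sup>2) *\<^sub>R F z) \<le> A * (exp (C\<^sup>2 / 2) * ?h z)"
        by (simp only: mult.left_commute)
      then show "norm (exp (- (norm z)\<^sup>2) *\<^sub>R F z) \<le> norm (A * exp (C\<^sup>2 / 2) * ?h z)"
        using A by (simp only: real_norm_def abs_mult abs_exp_cancel abs_of_nonneg mult.assoc)
    qed
  qed measurable
qed

text \<open>The value is pi^n, but it cancels in every formula about \<open>nu\<close>; only
  positivity is recorded.\<close>

definition gauss_vol :: "'n::finite itself \<Rightarrow> real" where
  "gauss_vol _ = (LINT z|lborel. exp (- (norm (z :: complex ^ 'n))\<^sup>2))"

lemma nn_gauss_vol: "(\<integral>\<^sup>+z. ennreal (exp (- (norm (z :: complex ^ 'n))\<^sup>2)) \<partial>lborel) = ennreal (gauss_vol TYPE('n))"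
  unfolding gauss_vol_def using nn_gaussian_finite
  by (intro nn_integral_eq_integral integrableI_nonneg) auto

lemma gauss_vol_pos: "gauss_vol TYPE('n::finite) > 0"
proof -
  have "(\<integral>\<^sup>+z. ennreal (exp (- (norm (z :: complex ^ 'n))\<^sup>2)) \<partial>lborel) \<noteq> 0"
  proof
    assume "(\<integral>\<^sup>+z. ennreal (exp (- (norm (z :: complex ^ 'n))\<^sup>2)) \<partial>lborel) = 0"
    then have "AE z in lborel. ennreal (exp (- (norm (z :: complex ^ 'n))\<^sup>2)) = 0"
      by (subst (asm) nn_integral_0_iff_AE) auto
    then have "AE z::complex ^ 'n in lborel. z \<in> {}" by simp
    then have "emeasure lborel (UNIV :: (complex ^ 'n) set) = 0"
      by (subst (asm) AE_iff_measurable[of UNIV]) auto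
    then show False by simp
  qed
  then show ?thesis unfolding nn_gauss_vol by (simp add: ennreal_eq_0_iff)
qed

section \<open>The measures \<open>\<nu>\<^sub>\<alpha>\<close>\<close>

abbreviation bdef :: "complex ^ 'n \<Rightarrow> real" where "bdef z \<equiv> 1 - (norm z)\<^sup>2"

lemma bdef_pos: "z \<in> ball 0 1 \<Longrightarrow> 0 < bdef z"
  by (simp add: power_less_one_iff)

lemma nn_radial_weight:
  assumes "\<alpha> > -1"
  shows "(\<integral>\<^sup>+z. ennreal (indicator (ball 0 1) z * (bdef (z :: complex ^ 'n)) powr \<alpha>) \<partial>lborel)
   = ennreal (Gamma (\<alpha> + 1) * gauss_vol TYPE('n) / Gamma (real CARD('n) + 1 + \<alpha>))"
proof -
  have G: "Gamma (real CARD('n) + 1 + \<alpha>) > 0" using assms by (intro Gamma_real_pos) auto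
  have "ennreal (Gamma (real CARD('n) + 1 + \<alpha>)) * 
    (\<integral>\<^sup>+z. ennreal (indicator (ball 0 1) z * (bdef (z :: complex ^ 'n)) powr \<alpha>) \<partial>lborel)
    = ennreal (Gamma (\<alpha> + 1) * gauss_vol TYPE('n))"
    using nn_radial_formula[of "\<lambda>z::complex ^ 'n. 1" \<alpha> 0] assms
    by (simp add: nn_gauss_vol ennreal_mult' less_imp_le[OF gauss_vol_pos])
  also have "\<dots> = ennreal (Gamma (real CARD('n) + 1 + \<alpha>)) * ennreal (Gamma (\<alpha> + 1) * gauss_vol TYPE('n) / Gamma (real CARD('n) + 1 + \<alpha>))"
    using G by (simp flip: ennreal_mult')
  finally show ?thesis using G by (subst (asm) ennreal_mult_cancel_left) auto
qed

definition nu_mass :: "'n::finite itself \<Rightarrow> real \<Rightarrow> real" where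
  "nu_mass _ \<alpha> = Gamma (\<alpha> + 1) * gauss_vol TYPE('n) / Gamma (real CARD('n) + 1 + \<alpha>)"

lemma nn_radial_weight':
  "\<alpha> > -1 \<Longrightarrow> (\<integral>\<^sup>+z. ennreal (indicator (ball 0 1) z * (bdef (z :: complex ^ 'n)) powr \<alpha>) \<partial>lborel)
   = ennreal (nu_mass TYPE('n) \<alpha>)"
  by (simp add: nn_radial_weight nu_mass_def)

lemma nu_mass_pos: "\<alpha> > -1 \<Longrightarrow> nu_mass TYPE('n::finite) \<alpha> > 0"
  unfolding nu_mass_def by (intro divide_pos_pos mult_pos_pos Gamma_real_pos gauss_vol_pos) auto

lemma nu_mass: 
  assumes "\<alpha> > -1"
  shows "(LINT w:ball (0 :: complex ^ 'n) 1|lborel. (bdef w) powr \<alpha>) = nu_mass TYPE('n) \<alpha>"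
proof -
  have "(LINT w:ball (0 :: complex ^ 'n) 1|lborel. (bdef w) powr \<alpha>) = 
    enn2real (\<integral>\<^sup>+z. ennreal (indicator (ball 0 1) z * (bdef (z :: complex ^ 'n)) powr \<alpha>) \<partial>lborel)"
    unfolding set_lebesgue_integral_def by (subst integral_eq_nn_integral) auto
  also have "\<dots> = nu_mass TYPE('n) \<alpha>"
    unfolding nn_radial_weight[OF assms] using nu_mass_pos[OF assms, where 'n='n] by (simp add: nu_mass_def)
  finally show ?thesis .
qed

lemma space_nu[simp]: "space (nu \<alpha>) = ball 0 1"
  by (simp add: nu_def space_restrict_space)

lemma sets_nu[measurable_cong]: "sets (nu \<alpha>) = sets (restrict_space borel (ball 0 1))"
  by (simp add: nu_def cong: sets_restrict_space_cong)

lemma nn_integral_nu: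
  assumes [measurable]: "g \<in> borel_measurable (nu \<alpha>)" and "\<alpha> > -1"
  shows "(\<integral>\<^sup>+z. g z \<partial>nu \<alpha>) = 
    (\<integral>\<^sup>+z. g z * ennreal (indicator (ball 0 1) z * bdef z powr \<alpha> / nu_mass TYPE('n) \<alpha>) \<partial>(lborel :: (complex ^ 'n) measure))"
proof -
  have [measurable]: "g \<in> borel_measurable (restrict_space lborel (ball 0 1))"
    using assms(1) by (simp add: nu_def)
  have "(\<integral>\<^sup>+z. g z \<partial>nu \<alpha>) = (\<integral>\<^sup>+z. ennreal (bdef z powr \<alpha> / nu_mass TYPE('n) \<alpha>) * g z \<partial>(restrict_space lborel (ball 0 1)))"
    unfolding nu_def nu_mass[OF assms(2)]
  proof (rule nn_integral_density)
    show "(\<lambda>z. ennreal (bdef z powr \<alpha> / nu_mass TYPE('n) \<alpha>)) \<in> borel_measurable (restrict_space lborel (ball 0 1))"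
      by (rule measurable_restrict_space1) measurable
  qed measurable
  also have "\<dots> = (\<integral>\<^sup>+z. ennreal (bdef z powr \<alpha> / nu_mass TYPE('n) \<alpha>) * g z * indicator (ball 0 1) z \<partial>lborel)"
    by (rule nn_integral_restrict_space) auto
  also have "\<dots> = (\<integral>\<^sup>+z. g z * ennreal (indicator (ball 0 1) z * bdef z powr \<alpha> / nu_mass TYPE('n) \<alpha>) \<partial>lborel)"
    by (intro nn_integral_cong) (auto simp: indicator_def mult.commute)
  finally show ?thesis .
qed

lemma emeasure_nu: assumes "\<alpha> > -1" shows "emeasure (nu \<alpha>) (ball 0 1 :: (complex ^ 'n) set) = 1"
proof -
  note p = nu_mass_pos[OF assms, where 'n='n]
  have "emeasure (nu \<alpha>) (ball 0 1 :: (complex ^ 'n) set) = (\<integral>\<^sup>+z. 1 \<partial>(nu \<alpha> :: (complex ^ 'n) measure))"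
    by simp
  also have "\<dots> = (\<integral>\<^sup>+z. ennreal (inverse (nu_mass TYPE('n) \<alpha>)) * ennreal (indicator (ball 0 1) z * bdef z powr \<alpha>) \<partial>(lborel :: (complex ^ 'n) measure))"
    using p by (subst nn_integral_nu[OF _ assms]) (auto simp: divide_inverse mult_ac simp flip: ennreal_mult'' ennreal_mult')
  also have "\<dots> = 1"
    using p by (subst nn_integral_cmult) (auto simp: nn_radial_weight'[OF assms] simp flip: ennreal_mult')
  finally show ?thesis .
qed

lemma finite_measure_nu: "\<alpha> > -1 \<Longrightarrow> finite_measure (nu \<alpha> :: (complex ^ 'n) measure)"
  by (rule finite_measureI) (simp add: emeasure_nu)

lemma nn_nu_radial:
  fixes g :: "complex ^ 'n \<Rightarrow> ennreal"
  assumes [measurable]: "g \<in> borel_measurable borel" and \<alpha>: "\<alpha> > -1"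
    and hom: "\<And>t z. t > 0 \<Longrightarrow> g (t *\<^sub>R z) = ennreal (t ^ (2 * j)) * g z"
  shows "(\<integral>\<^sup>+z. g z \<partial>nu \<alpha>) = 
     ennreal (Gamma (real CARD('n) + 1 + \<alpha>) / (Gamma (real CARD('n) + 1 + \<alpha> + real j) * gauss_vol TYPE('n))) *
     (\<integral>\<^sup>+z. g z * ennreal (exp (- (norm z)\<^sup>2)) \<partial>lborel)"
proof -
  note p = nu_mass_pos[OF \<alpha>, where 'n='n]
  let ?K = "\<integral>\<^sup>+z. g z * ennreal (indicator (ball 0 1) z * bdef z powr \<alpha>) \<partial>lborel"
  let ?N = "real CARD('n) + 1 + \<alpha>"
  have G: "Gamma ?N > 0" "Gamma (?N + real j) > 0" "Gamma (\<alpha>+1) > 0" "gauss_vol TYPE('n) > 0"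
    using \<alpha> by (auto intro!: Gamma_real_pos gauss_vol_pos)
  have [measurable]: "g \<in> borel_measurable (nu \<alpha>)"
    unfolding nu_def by (auto intro: measurable_restrict_space1)
  have "(\<integral>\<^sup>+z. g z \<partial>nu \<alpha>) = ennreal (inverse (nu_mass TYPE('n) \<alpha>)) * ?K"
  proof -
    have "(\<integral>\<^sup>+z. g z \<partial>nu \<alpha>) = (\<integral>\<^sup>+z. ennreal (inverse (nu_mass TYPE('n) \<alpha>)) * (g z * ennreal (indicator (ball 0 1) z * bdef z powr \<alpha>)) \<partial>lborel)"
      using p unfolding nn_integral_nu[OF \<open>g \<in> borel_measurable (nu \<alpha>)\<close> \<alpha>]
      by (intro nn_integral_cong) (simp add: divide_inverse ennreal_mult'' mult_ac)
    also have "\<dots> = ennreal (inverse (nu_mass TYPE('n) \<alpha>)) * ?K"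
      by (rule nn_integral_cmult) measurable
    finally show ?thesis .
  qed
  also have "\<dots> = ennreal (inverse (nu_mass TYPE('n) \<alpha>) / Gamma (?N + real j)) * (ennreal (Gamma (?N + real j)) * ?K)"
  proof -
    have "ennreal (inverse (nu_mass TYPE('n) \<alpha>)) = 
      ennreal (inverse (nu_mass TYPE('n) \<alpha>) / Gamma (?N + real j)) * ennreal (Gamma (?N + real j))"
      using G p by (subst ennreal_mult[symmetric]) auto
    then show ?thesis by (simp add: mult.assoc)
  qed
  also have "ennreal (Gamma (?N + real j)) * ?K = ennreal (Gamma (\<alpha> + 1)) * (\<integral>\<^sup>+z. g z * ennreal (exp (- (norm z)\<^sup>2)) \<partial>lborel)"
    by (rule nn_radial_formula) (use assms in auto)
  also have "ennreal (inverse (nu_mass TYPE('n) \<alpha>) / Gamma (?N + real j)) * \<dots> = 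
     ennreal (Gamma ?N / (Gamma (?N + real j) * gauss_vol TYPE('n))) * (\<integral>\<^sup>+z. g z * ennreal (exp (- (norm z)\<^sup>2)) \<partial>lborel)"
  proof -
    have "inverse (nu_mass TYPE('n) \<alpha>) / Gamma (?N + real j) * Gamma (\<alpha> + 1) = Gamma ?N / (Gamma (?N + real j) * gauss_vol TYPE('n))"
      using G by (simp add: nu_mass_def)
    then have "ennreal (inverse (nu_mass TYPE('n) \<alpha>) / Gamma (?N + real j)) * ennreal (Gamma (\<alpha> + 1)) =
      ennreal (Gamma ?N / (Gamma (?N + real j) * gauss_vol TYPE('n)))"
      using G p by (subst ennreal_mult[symmetric]) auto
    then show ?thesis by (simp add: mult.assoc[symmetric])
  qed
  finally show ?thesis .
qed

lemma nu_radial_real: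
  fixes g :: "complex ^ 'n \<Rightarrow> real"
  assumes [measurable]: "g \<in> borel_measurable borel" and \<alpha>: "\<alpha> > -1"
    and hom: "\<And>t z. t > 0 \<Longrightarrow> g (t *\<^sub>R z) = t ^ (2 * j) * g z"
    and int: "integrable lborel (\<lambda>z. exp (- (norm z)\<^sup>2) * g z)"
  shows "integrable (nu \<alpha>) g" "(LINT z|nu \<alpha>. g z) = 
     Gamma (real CARD('n) + 1 + \<alpha>) / (Gamma (real CARD('n) + 1 + \<alpha> + real j) * gauss_vol TYPE('n)) *
     (LINT z|lborel. exp (- (norm z)\<^sup>2) * g z)"
proof -
  define c where "c = Gamma (real CARD('n) + 1 + \<alpha>) / (Gamma (real CARD('n) + 1 + \<alpha> + real j) * gauss_vol TYPE('n))"
  have c: "c \<ge> 0" unfolding c_def using \<alpha> gauss_vol_pos[where 'n='n]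
    by (intro divide_nonneg_pos mult_pos_pos Gamma_real_pos less_imp_le[OF Gamma_real_pos]) auto
  have [measurable]: "g \<in> borel_measurable (nu \<alpha>)"
    unfolding nu_def by (auto intro: measurable_restrict_space1)
  have *: "(\<integral>\<^sup>+z. ennreal (h z) \<partial>nu \<alpha>) = ennreal c * (\<integral>\<^sup>+z. ennreal (exp (- (norm z)\<^sup>2) * h z) \<partial>lborel)"
    if "h \<in> borel_measurable borel" "\<And>t z. t > 0 \<Longrightarrow> h (t *\<^sub>R z) = t ^ (2 * j) * h z" for h :: "complex ^ 'n \<Rightarrow> real"
    unfolding c_def using that
    by (subst nn_nu_radial[of _ _ j]) (auto simp: \<alpha> ennreal_mult' ennreal_mult'' mult.commute)
  have fin: "(\<integral>\<^sup>+z. ennreal (exp (- (norm z)\<^sup>2) * \<bar>g z\<bar>) \<partial>lborel) < \<infinity>"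
    using int by (simp add: integrable_iff_bounded abs_mult)
  show i: "integrable (nu \<alpha>) g"
    unfolding integrable_iff_bounded using fin *[of "\<lambda>z. \<bar>g z\<bar>"] hom
    by (auto simp: abs_mult ennreal_mult_less_top)
  show "(LINT z|nu \<alpha>. g z) = c * (LINT z|lborel. exp (- (norm z)\<^sup>2) * g z)"
    unfolding real_lebesgue_integral_def[OF i] real_lebesgue_integral_def[OF int]
    using *[of g] *[of "\<lambda>z. - g z"] hom c by (simp add: enn2real_mult algebra_simps)
qed

lemma nu_radial:
  fixes g :: "complex ^ 'n \<Rightarrow> complex"
  assumes [measurable]: "g \<in> borel_measurable borel" and \<alpha>: "\<alpha> > -1"
    and hom: "\<And>t z. t > 0 \<Longrightarrow> g (t *\<^sub>R z) = of_real (t ^ (2 * j)) * g z"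
    and int: "integrable lborel (\<lambda>z. exp (- (norm z)\<^sup>2) *\<^sub>R g z)"
  shows "(LINT z|nu \<alpha>. g z) = 
     of_real (Gamma (real CARD('n) + 1 + \<alpha>) / (Gamma (real CARD('n) + 1 + \<alpha> + real j) * gauss_vol TYPE('n))) *
     (LINT z|lborel. exp (- (norm z)\<^sup>2) *\<^sub>R g z)"
proof -
  have iRe: "integrable lborel (\<lambda>z. exp (- (norm z)\<^sup>2) * Re (g z))" using integrable_Re[OF int] by simp
  have iIm: "integrable lborel (\<lambda>z. exp (- (norm z)\<^sup>2) * Im (g z))" using integrable_Im[OF int] by simp
  have r: "Re (g (t *\<^sub>R z)) = t ^ (2 * j) * Re (g z)" if "t > 0" for t z
    using hom[OF that, of z] by (simp flip: of_real_power)
  have i: "Im (g (t *\<^sub>R z)) = t ^ (2 * j) * Im (g z)" if "t > 0" for t z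
    using hom[OF that, of z] by (simp flip: of_real_power)
  have m: "(\<lambda>z. Re (g z)) \<in> borel_measurable borel" "(\<lambda>z. Im (g z)) \<in> borel_measurable borel" by measurable
  note RE = nu_radial_real[OF m(1) \<alpha> r iRe] note IM = nu_radial_real[OF m(2) \<alpha> i iIm]
  have "integrable (nu \<alpha>) (\<lambda>z. complex_of_real (Re (g z)) + \<i> * complex_of_real (Im (g z)))"
    by (intro Bochner_Integration.integrable_add integrable_mult_right integrable_of_real RE(1) IM(1))
  then have g: "integrable (nu \<alpha>) g" by (simp add: complex_eq[symmetric])
  show ?thesis
    by (intro complex_eqI)
       (simp_all add: integral_Re[OF g, symmetric] integral_Im[OF g, symmetric] RE(2) IM(2) 
         integral_Re[OF int, symmetric] integral_Im[OF int, symmetric] del: of_real_divide of_real_mult)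
qed

section \<open>The Hermitian form\<close>

lemma herm_add_left: "herm (x + y) w = herm x w + herm y w"
  by (simp add: herm_def algebra_simps sum.distrib)

lemma herm_add_right: "herm w (x + y) = herm w x + herm w y"
  by (simp add: herm_def algebra_simps sum.distrib)

lemma herm_cscale_left: "herm (c *s z) w = c * herm z w"
  by (simp add: herm_def sum_distrib_left mult_ac)

lemma herm_cscale_right: "herm z (c *s w) = cnj c * herm z w"
  by (simp add: herm_def sum_distrib_left mult_ac)

lemma cnj_herm: "cnj (herm z w) = herm w z"
  by (simp add: herm_def mult.commute)

lemma herm_self: "herm z z = of_real ((norm z)\<^sup>2)"
proof -
  have "herm z z = (\<Sum>j\<in>UNIV. of_real ((cmod (z $ j))\<^sup>2))"
    unfolding herm_def by (intro sum.cong refl) (simp only: complex_norm_square)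
  also have "\<dots> = of_real ((norm z)\<^sup>2)"
    by (simp add: norm_vec_def L2_set_def sum_nonneg)
  finally show ?thesis .
qed

lemma norm_herm_le: "cmod (herm z w) \<le> norm z * norm w"
proof -
  have "cmod (herm z w) \<le> (\<Sum>j\<in>UNIV. \<bar>cmod (z $ j)\<bar> * \<bar>cmod (w $ j)\<bar>)"
    unfolding herm_def by (rule order.trans[OF norm_sum]) (simp add: norm_mult)
  also have "\<dots> \<le> norm z * norm w"
    unfolding norm_vec_def by (rule L2_set_mult_ineq)
  finally show ?thesis .
qed

lemma norm_herm_less_1: "z \<in> ball 0 1 \<Longrightarrow> w \<in> cball 0 1 \<Longrightarrow> cmod (herm z w) < 1"
  using norm_herm_le[of z w] mult_left_mono[of "norm w" 1 "norm z"] by simp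

lemma norm_herm_less_1': "z \<in> cball 0 1 \<Longrightarrow> w \<in> ball 0 1 \<Longrightarrow> cmod (herm z w) < 1"
  using norm_herm_le[of z w] mult_right_mono[of "norm z" 1 "norm w"] by simp

lemma continuous_on_herm[continuous_intros]:
  "continuous_on A f \<Longrightarrow> continuous_on A g \<Longrightarrow> continuous_on A (\<lambda>x. herm (f x) (g x))"
  unfolding herm_def by (intro continuous_intros)

lemma measurable_herm[measurable]: 
  "(\<lambda>p. herm (fst p) (snd p)) \<in> borel_measurable borel"
  by (intro borel_measurable_continuous_onI continuous_intros)

lemma borel_measurable_herm[measurable]:
  assumes [measurable]: "f \<in> borel_measurable M" "g \<in> borel_measurable M"
  shows "(\<lambda>x. herm (f x) (g x)) \<in> borel_measurable M"
  using measurable_compose[OF borel_measurable_Pair[OF assms] measurable_herm] by simp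

section \<open>Holomorphic functions on the ball\<close>

lemma holomorphic_ball_continuous: "holomorphic_ball f \<Longrightarrow> continuous_on (ball 0 1) f"
  unfolding holomorphic_ball_def
  by (intro continuous_at_imp_continuous_on) (auto dest: has_derivative_continuous)

lemma holomorphic_slice:
  assumes f: "holomorphic_ball f" and S: "\<And>l. l \<in> S \<Longrightarrow> a + l *s b \<in> ball 0 1"
  shows "(\<lambda>l. f (a + l *s b)) holomorphic_on S"
proof -
  have "((\<lambda>l. f (a + l *s b)) has_field_derivative D b) (at l)"
    if "(f has_derivative D) (at (a + l *s b))" "\<forall>c v. D (c *s v) = c * D v" for D l
  proof -
    have "linear (\<lambda>l. l *s b)"
    proof (rule linearI)
      show "(r *\<^sub>R l) *s b = r *\<^sub>R (l *s b)" for r and l :: complex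
        unfolding scaleR_conv_of_real[of r l] by (simp add: scaleR_cscale vector_smult_assoc)
    qed (simp add: vec_eq_iff algebra_simps)
    then have "((\<lambda>l. l *s b) has_derivative (\<lambda>l. l *s b)) (at l)"
      by (intro bounded_linear_imp_has_derivative linear_conv_bounded_linear[THEN iffD1])
    then have "((\<lambda>l. a + l *s b) has_derivative (\<lambda>l. l *s b)) (at l)"
      by (auto intro!: derivative_eq_intros)
    from has_derivative_compose[OF this that(1)] show ?thesis
      using that(2) unfolding has_field_derivative_def by (simp add: mult_commute_abs)
  qed
  then show ?thesis
    unfolding holomorphic_on_def using f S
    by (metis holomorphic_ball_def field_differentiable_at_within field_differentiable_def)
qed

lemma holomorphic_slice0:
  assumes "holomorphic_ball f" and "\<And>l. l \<in> S \<Longrightarrow> l *s b \<in> ball 0 1"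
  shows "(\<lambda>l. f (l *s b)) holomorphic_on S"
  using holomorphic_slice[of f S 0 b] assms by simp

text \<open>Parametrised by the unit interval, so that an integral over \<open>{0..1}\<close> is
  already the mean over the circle.\<close>

definition ecirc :: "real \<Rightarrow> complex" where "ecirc t = cis (2 * pi * t)"

lemma norm_ecirc[simp]: "cmod (ecirc t) = 1" by (simp add: ecirc_def)
lemma ecirc_nz[simp]: "ecirc t \<noteq> 0" by (simp add: ecirc_def)
lemma cnj_ecirc: "cnj (ecirc t) = inverse (ecirc t)" by (simp add: ecirc_def cis_cnj cis_inverse)
lemma continuous_on_ecirc[continuous_intros]: "continuous_on A f \<Longrightarrow> continuous_on A (\<lambda>x. ecirc (f x))"
  unfolding ecirc_def by (intro continuous_intros)
lemma borel_measurable_ecirc[measurable]: "ecirc \<in> borel_measurable borel"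
  by (intro borel_measurable_continuous_onI continuous_intros)

lemma taylor_coeff_circle:
  assumes "continuous_on (cball 0 r) F" "F holomorphic_on ball 0 r" "r > 0"
  shows "integral {0..1} (\<lambda>t. F (of_real r * ecirc t) * inverse (ecirc t) ^ j) = of_real r ^ j * (deriv ^^ j) F 0 / fact j"
proof -
  have "((\<lambda>u. F u / (u - 0) ^ Suc j) has_contour_integral 2 * pi * \<i> / fact j * (deriv ^^ j) F 0) (circlepath 0 r)"
    using assms by (intro Cauchy_has_contour_integral_higher_derivative_circlepath) auto
  then have "((\<lambda>t. F (circlepath 0 r t) / (circlepath 0 r t - 0) ^ Suc j * vector_derivative (circlepath 0 r) (at t))
      has_integral (2 * pi * \<i> / fact j * (deriv ^^ j) F 0)) {0..1}"
    by (simp add: has_contour_integral)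
  also have "(\<lambda>t. F (circlepath 0 r t) / (circlepath 0 r t - 0) ^ Suc j * vector_derivative (circlepath 0 r) (at t))
    = (\<lambda>t. (2 * pi * \<i> / r ^ j) * (F (of_real r * ecirc t) * inverse (ecirc t) ^ j))"
  proof -
    have e: "exp (2 * complex_of_real pi * \<i> * complex_of_real t) = ecirc t" for t
      by (simp add: ecirc_def cis_conv_exp mult_ac)
    show ?thesis using \<open>r > 0\<close>
      unfolding vector_derivative_circlepath unfolding circlepath e
      by (auto simp: fun_eq_iff field_simps)
  qed
  finally have "((\<lambda>t. (r ^ j / (2 * pi * \<i>)) * ((2 * pi * \<i> / r ^ j) * (F (of_real r * ecirc t) * inverse (ecirc t) ^ j))) has_integral
     (r ^ j / (2 * pi * \<i>)) * (2 * pi * \<i> / fact j * (deriv ^^ j) F 0)) {0..1}"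
    by (rule has_integral_mult_right)
  then have "((\<lambda>t. F (of_real r * ecirc t) * inverse (ecirc t) ^ j) has_integral (of_real r ^ j * (deriv ^^ j) F 0 / fact j)) {0..1}"
    using \<open>r > 0\<close> by (simp add: field_simps)
  then show ?thesis by (rule integral_unique)
qed

text \<open>The homogeneous term of degree j in the expansion of f at the origin, read off the slice
  through x. Only small l matter, so it makes sense for every x, also outside the ball.\<close>

definition hom_part :: "(complex ^ 'n \<Rightarrow> complex) \<Rightarrow> nat \<Rightarrow> complex ^ 'n \<Rightarrow> complex" where
  "hom_part f j x = (deriv ^^ j) (\<lambda>l. f (l *s x)) 0 / fact j"

text \<open>The circle of radius 1/T keeps the slice inside the ball for all x of norm below T. A
  choice of T that is continuous in x, such as 1 + |x|, gives continuity on the whole space.\<close>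

lemma hom_part_integral:
  assumes f: "holomorphic_ball f" and T: "norm x < T"
  shows "hom_part f j x = of_real T ^ j * integral {0..1} (\<lambda>t. f ((ecirc t / of_real T) *s x) * inverse (ecirc t) ^ j)"
proof -
  have T0: "T > 0" using T norm_ge_zero[of x] by linarith
  have "norm (l *s x) < 1" if "cmod l \<le> 1 / T" for l
  proof -
    have "norm (l *s x) \<le> 1 / T * norm x" using that by (simp only: norm_cscale mult_right_mono norm_ge_zero)
    also have "\<dots> < 1" using T T0 by (simp add: field_simps)
    finally show ?thesis .
  qed
  then have h: "(\<lambda>l. f (l *s x)) holomorphic_on cball 0 (1/T)"
    by (intro holomorphic_slice0[OF f]) auto
  have "integral {0..1} (\<lambda>t. f ((of_real (1/T) * ecirc t) *s x) * inverse (ecirc t) ^ j) = of_real (1/T) ^ j * (deriv ^^ j) (\<lambda>l. f (l *s x)) 0 / fact j"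
    using T0 by (intro taylor_coeff_circle holomorphic_on_imp_continuous_on[OF h] holomorphic_on_subset[OF h]) auto
  then show ?thesis using T0 by (simp add: hom_part_def field_simps)
qed

lemma hom_part_sums:
  assumes f: "holomorphic_ball f" and x: "x \<in> ball 0 1"
  shows "(\<lambda>j. hom_part f j x) sums f x"
proof -
  obtain r where r: "1 < r" "r * norm x < 1"
  proof (cases "norm x = 0")
    case True then show ?thesis using that[of 2] by simp
  next
    case False
    obtain r where "1 < r" "r < 1 / norm x" using dense[of 1 "1 / norm x"] x False by auto
    then show ?thesis using that[of r] False by (simp add: field_simps)
  qed
  have "norm (l *s x) < 1" if "cmod l < r" for l
    using mult_right_mono[of "cmod l" r "norm x"] that r by (auto simp: norm_cscale)
  then have "(\<lambda>l. f (l *s x)) holomorphic_on ball 0 r"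
    by (intro holomorphic_slice0[OF f]) auto
  from holomorphic_power_series[OF this, of 1] r(1) show ?thesis
    by (simp add: hom_part_def)
qed

lemma hom_part_scale:
  assumes f: "holomorphic_ball f"
  shows "hom_part f j (c *s x) = c ^ j * hom_part f j x"
proof -
  define r where "r = 1 / (1 + norm x + norm (c *s x))"
  have r: "r > 0" by (simp add: r_def add_pos_nonneg)
  define r' where "r' = 1 / (1 + norm x)"
  have r': "r' > 0" by (simp add: r'_def add_pos_nonneg)
  have s: "norm (l *s x) < 1" if "cmod l < r'" for l
  proof -
    have "norm (l *s x) \<le> r' * norm x" using that by (simp only: norm_cscale mult_right_mono norm_ge_zero less_imp_le)
    also have "\<dots> < 1" unfolding r'_def by (simp add: divide_simps) (smt (verit) norm_ge_zero)
    finally show ?thesis .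
  qed
  have h: "(\<lambda>l. f (l *s x)) holomorphic_on ball 0 r'"
    by (intro holomorphic_slice0[OF f]) (use s in auto)
  have "(deriv ^^ j) (\<lambda>l. (\<lambda>l. f (l *s x)) (c * l)) 0 = c ^ j * (deriv ^^ j) (\<lambda>l. f (l *s x)) (c * 0)"
  proof (rule higher_deriv_compose_linear[OF h, of "ball 0 (r' / (1 + cmod c))"])
    show "c * w \<in> ball 0 r'" if "w \<in> ball 0 (r' / (1 + cmod c))" for w
    proof -
      have "cmod c * cmod w \<le> cmod c * (r' / (1 + cmod c))" using that by (intro mult_left_mono) auto
      also have "\<dots> < r'" using r' by (simp add: divide_simps) (smt (verit) norm_ge_zero mult_less_cancel_left_pos)
      finally show ?thesis by (simp add: norm_mult)
    qed
  qed (use r' in \<open>auto simp: add_pos_nonneg\<close>)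
  moreover have "(\<lambda>l. f ((c * l) *s x)) = (\<lambda>l. f (l *s (c *s x)))"
    by (simp add: mult.commute)
  ultimately show ?thesis by (simp add: hom_part_def)
qed

lemma continuous_on_hom_part:
  fixes f :: "complex ^ 'n \<Rightarrow> complex"
  assumes f: "holomorphic_ball f"
  shows "continuous_on UNIV (hom_part f j)"
proof -
  have nz: "1 + norm x \<noteq> 0" "complex_of_real (1 + norm x) \<noteq> 0" "0 < 1 + norm x" for x :: "complex ^ 'n"
  proof -
    show "0 < 1 + norm x" using norm_ge_zero[of x] by linarith
    then show "1 + norm x \<noteq> 0" by linarith
    then show "complex_of_real (1 + norm x) \<noteq> 0" by (simp only: of_real_eq_0_iff not_False_eq_True)
  qed
  have ib: "(ecirc t / complex_of_real (1 + norm x)) *s x \<in> ball 0 1" for t and x :: "complex ^ 'n"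
  proof -
    have "norm ((ecirc t / complex_of_real (1 + norm x)) *s x) = norm x / (1 + norm x)"
      using nz(3)[of x] unfolding norm_cscale by (simp add: norm_divide del: of_real_add)
    also have "\<dots> < 1" using nz(3)[of x] by (simp add: divide_less_eq)
    finally show ?thesis by simp
  qed
  have "continuous_on UNIV (\<lambda>x. complex_of_real (1 + norm x) ^ j * integral (cbox 0 1) (\<lambda>t. f ((ecirc t / of_real (1 + norm x)) *s x) * inverse (ecirc t) ^ j))"
  proof (intro continuous_intros integral_continuous_on_param)
    show "continuous_on (UNIV \<times> cbox 0 1) (\<lambda>(x, t). f ((ecirc t / complex_of_real (1 + norm x)) *s x) * inverse (ecirc t) ^ j)"
      unfolding split_beta
    proof (intro continuous_intros continuous_on_compose2[OF holomorphic_ball_continuous[OF f]])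
      show "(\<lambda>p :: (complex ^ 'n) \<times> real. (ecirc (snd p) / complex_of_real (1 + norm (fst p))) *s fst p) ` (UNIV \<times> cbox 0 1) \<subseteq> ball 0 1"
        using ib by blast
    qed (use nz in auto)
  qed
  also have "(\<lambda>x. complex_of_real (1 + norm x) ^ j * integral (cbox 0 1) (\<lambda>t. f ((ecirc t / of_real (1 + norm x)) *s x) * inverse (ecirc t) ^ j)) = hom_part f j"
    by (rule ext, subst hom_part_integral[OF f, where T="1 + norm _"]) auto
  finally show ?thesis .
qed

lemma measurable_hom_part[measurable]:
  "holomorphic_ball f \<Longrightarrow> hom_part f j \<in> borel_measurable borel"
  by (rule borel_measurable_continuous_onI[OF continuous_on_hom_part])

lemma hom_part_bound:
  fixes f :: "complex ^ 'n \<Rightarrow> complex"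
  assumes f: "holomorphic_ball f"
  obtains A where "A \<ge> 0" "\<And>x. cmod (hom_part f j x) \<le> A * norm x ^ j"
proof -
  have "compact (cball (0::complex ^ 'n) 1)" by simp
  have "bounded (hom_part f j ` cball 0 1)"
    by (intro compact_imp_bounded compact_continuous_image continuous_on_subset[OF continuous_on_hom_part[OF f]]) auto
  then obtain A where A: "\<And>x. x \<in> cball 0 1 \<Longrightarrow> cmod (hom_part f j x) \<le> A"
    unfolding bounded_iff by blast
  have A0: "A \<ge> 0" using A[of 0] norm_ge_zero[of "hom_part f j 0"] by (simp del: norm_ge_zero)
  show ?thesis
  proof (rule that[OF A0])
    fix x :: "complex ^ 'n"
    show "cmod (hom_part f j x) \<le> A * norm x ^ j"
    proof (cases "x = 0")
      case True
      then show ?thesis using hom_part_scale[OF f, of j 0 0] A[of 0] by (cases j) auto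
    next
      case False
      have "hom_part f j x = of_real (norm x) ^ j * hom_part f j (of_real (1 / norm x) *s x)"
        using False hom_part_scale[OF f, of j "of_real (norm x)" "of_real (1 / norm x) *s x"] 
        by (simp add: field_simps)
      moreover have "cmod (hom_part f j (of_real (1 / norm x) *s x)) \<le> A"
        by (rule A) (use False in \<open>simp add: norm_cscale norm_divide\<close>)
      ultimately show ?thesis
        using mult_left_mono[of "cmod (hom_part f j (of_real (1 / norm x) *s x))" A "norm x ^ j"]
        by (simp add: norm_mult norm_power mult.commute)
    qed
  qed
qed

text \<open>The mean value property, needed at points z + w anywhere in space. Instead of proving
  the homogeneous part holomorphic, it is written as a circle integral of f at points inside the
  ball; the two circle integrals are exchanged and the one-variable mean value property is applied
  to f.\<close>

lemma hom_part_mean_value: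
  assumes f: "holomorphic_ball f" and X: "X holomorphic_on UNIV"
  shows "integral {0..1} (\<lambda>t. hom_part f j (ecirc t *s z + w) * X (ecirc t)) = hom_part f j w * X 0"
proof -
  define T where "T = 1 + norm z + norm w"
  have T0: "T > 0" by (simp add: T_def add_pos_nonneg)
  have T: "norm (l *s z + w) < T" if "cmod l \<le> 1" for l
    using norm_triangle_ineq[of "l *s z" w] mult_right_mono[OF that, of "norm z"] by (simp add: T_def norm_cscale)
  let ?x = "\<lambda>s l. (ecirc s / of_real T) *s (l *s z + w)"
  have in_ball: "?x s l \<in> ball 0 1" if "cmod l \<le> 1" for s l
  proof -
    have "norm (?x s l) = norm (l *s z + w) / T" using T0 by (subst norm_cscale) (simp add: norm_divide)
    also have "\<dots> < 1" using T[OF that] T0 by (simp add: field_simps)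
    finally show ?thesis by simp
  qed
  have contX: "continuous_on A X" for A
    using X by (meson holomorphic_on_imp_continuous_on continuous_on_subset subset_UNIV)
  have c: "continuous_on (cbox (0,0) (1,1)) (\<lambda>(t, s). f (?x s (ecirc t)) * inverse (ecirc s) ^ j * X (ecirc t))"
    unfolding split_beta
    by (intro continuous_intros continuous_on_compose2[OF holomorphic_ball_continuous[OF f]] continuous_on_compose2[OF contX[of UNIV]])
       (use T0 in_ball in auto)
  have inner: "integral {0..1} (\<lambda>t. f (?x s (ecirc t)) * X (ecirc t)) = f (?x s 0) * X 0" for s
  proof -
    let ?F = "\<lambda>l. f (?x s l) * X l"
    have e: "?x s l = (ecirc s / of_real T) *s w + l *s ((ecirc s / of_real T) *s z)" for l
      by (simp add: vector_add_ldistrib add.commute mult.commute)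
    have h: "?F holomorphic_on cball 0 1"
    proof (intro holomorphic_intros)
      show "(\<lambda>l. f (?x s l)) holomorphic_on cball 0 1"
        unfolding e
      proof (rule holomorphic_slice[OF f])
        fix l :: complex assume "l \<in> cball 0 1"
        then show "(ecirc s / of_real T) *s w + l *s ((ecirc s / of_real T) *s z) \<in> ball 0 1"
          using in_ball[of l s] unfolding e by simp
      qed
      show "X holomorphic_on cball 0 1" by (rule holomorphic_on_subset[OF X]) auto
    qed
    show ?thesis
      using taylor_coeff_circle[of 1 ?F 0, OF holomorphic_on_imp_continuous_on[OF h] holomorphic_on_subset[OF h]]
      by (simp add: ball_subset_cball)
  qed
  have "integral {0..1} (\<lambda>t. hom_part f j (ecirc t *s z + w) * X (ecirc t)) 
     = integral {0..1} (\<lambda>t. of_real T ^ j * integral {0..1} (\<lambda>s. f (?x s (ecirc t)) * inverse (ecirc s) ^ j * X (ecirc t)))"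
  proof (rule integral_cong)
    fix t show "hom_part f j (ecirc t *s z + w) * X (ecirc t) = of_real T ^ j * integral {0..1} (\<lambda>s. f (?x s (ecirc t)) * inverse (ecirc s) ^ j * X (ecirc t))"
      by (subst integral_mult_left, subst hom_part_integral[OF f T]) (simp, rule mult.assoc)
  qed
  also have "\<dots> = of_real T ^ j * integral {0..1} (\<lambda>t. integral {0..1} (\<lambda>s. f (?x s (ecirc t)) * inverse (ecirc s) ^ j * X (ecirc t)))"
    by simp
  also have "\<dots> = of_real T ^ j * integral {0..1} (\<lambda>s. integral {0..1} (\<lambda>t. f (?x s (ecirc t)) * inverse (ecirc s) ^ j * X (ecirc t)))"
    using integral_swap_continuous[OF c] by simp
  also have "\<dots> = of_real T ^ j * integral {0..1} (\<lambda>s. inverse (ecirc s) ^ j * integral {0..1} (\<lambda>t. f (?x s (ecirc t)) * X (ecirc t)))"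
    by (subst integral_mult_right[symmetric]) (simp add: mult_ac)
  also have "\<dots> = of_real T ^ j * integral {0..1} (\<lambda>s. (f (?x s 0) * inverse (ecirc s) ^ j) * X 0)"
    unfolding inner by (simp add: mult_ac)
  also have "\<dots> = hom_part f j w * X 0"
    unfolding integral_mult_left using T[of 0]
    by (subst hom_part_integral[OF f, of w T]) (simp_all add: mult.assoc)
  finally show ?thesis .
qed

section \<open>The reproducing formula\<close>

lemma circle_average:
  fixes G :: "complex ^ 'n \<Rightarrow> complex"
  assumes [measurable]: "G \<in> borel_measurable borel" and int: "integrable lborel G"
  shows "integral\<^sup>L lborel G = (LINT z|lborel. (LINT t:{0..1}|lborel. G (ecirc t *s z)))"
    and "AE z in lborel. set_integrable lborel {0..1} (\<lambda>t. G (ecirc t *s z))"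
proof -
  have m[measurable]: "(\<lambda>p. ecirc (fst p) *s (snd p :: complex ^ 'n)) \<in> borel \<Otimes>\<^sub>M borel \<rightarrow>\<^sub>M borel"
    unfolding borel_prod by (intro borel_measurable_continuous_onI continuous_intros)
  let ?H = "\<lambda>t z. indicator {0..1} t *\<^sub>R G (ecirc t *s z)"
  have [measurable]: "(\<lambda>(t, z). ?H t z) \<in> borel_measurable (borel \<Otimes>\<^sub>M borel)"
    unfolding split_beta using measurable_compose[OF m assms(1)] by measurable
  have I: "integrable (lborel \<Otimes>\<^sub>M lborel) (\<lambda>(t, z). ?H t z)"
  proof (rule lborel_pair.Fubini_integrable)
    have eq: "(LINT z|lborel. norm (case (t, z) of (t, z) \<Rightarrow> ?H t z)) = indicator {0..1} t * (LINT z|lborel. norm (G z))" for t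
    proof -
      have "(LINT z|lborel. norm (G (ecirc t *s z))) = (LINT z|distr lborel borel (\<lambda>z. ecirc t *s z). norm (G z))"
        by (subst integral_distr) auto
      also have "\<dots> = (LINT z|lborel. norm (G z))" by (simp add: lborel_distr_rotation)
      finally show ?thesis by simp
    qed
    show "integrable lborel (\<lambda>t. LINT z|lborel. norm (case (t, z) of (t, z) \<Rightarrow> ?H t z))"
      unfolding eq by simp
    show "AE t in lborel. integrable lborel (\<lambda>z. case (t, z) of (t, z) \<Rightarrow> ?H t z)"
    proof (rule AE_I2)
      fix t
      have "integrable (distr lborel borel (\<lambda>z. ecirc t *s z)) G" by (simp add: lborel_distr_rotation int)
      then have "integrable lborel (\<lambda>z. G (ecirc t *s z))" by (subst (asm) integrable_distr_eq) auto
      then show "integrable lborel (\<lambda>z. case (t, z) of (t, z) \<Rightarrow> ?H t z)" by simp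
    qed
  qed measurable
  have "(LINT t|lborel. LINT z|lborel. ?H t z) = (LINT t|lborel. indicator {0..1::real} t *\<^sub>R integral\<^sup>L lborel G)"
    by (intro Bochner_Integration.integral_cong refl) (simp add: integral_lborel_rotation)
  also have "\<dots> = (LINT t|lborel. indicator {0..1::real} t) *\<^sub>R integral\<^sup>L lborel G"
    by (rule integral_scaleR_left) simp
  also have "\<dots> = integral\<^sup>L lborel G" by simp
  finally show "integral\<^sup>L lborel G = (LINT z|lborel. (LINT t:{0..1}|lborel. G (ecirc t *s z)))"
    using lborel_pair.Fubini_integral[OF I] by (simp add: set_lebesgue_integral_def)
  show "AE z in lborel. set_integrable lborel {0..1} (\<lambda>t. G (ecirc t *s z))"
    using lborel_pair.AE_integrable_snd[OF I] by (simp add: set_integrable_def)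
qed

text \<open>Rotation invariance and Fubini replace each integrand by its circle means. The circle
  means are gauge integrals; almost everywhere integrability on the circle lets them agree with the
  Lebesgue ones.\<close>

lemma circle_average_eq:
  fixes G1 G2 :: "complex ^ 'n \<Rightarrow> complex"
  assumes "G1 \<in> borel_measurable borel" "G2 \<in> borel_measurable borel"
    and "integrable lborel G1" "integrable lborel G2"
    and eq: "\<And>z. integral {0..1} (\<lambda>t. G1 (ecirc t *s z)) = integral {0..1} (\<lambda>t. G2 (ecirc t *s z))"
  shows "integral\<^sup>L lborel G1 = integral\<^sup>L lborel G2"
proof -
  have [measurable]: "G \<in> borel_measurable borel \<Longrightarrow> (\<lambda>z. LINT t:{0..1}|lborel. G (ecirc t *s z)) \<in> borel_measurable lborel" 
    for G :: "complex ^ 'n \<Rightarrow> complex"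
  proof -
    assume [measurable]: "G \<in> borel_measurable borel"
    have m[measurable]: "(\<lambda>p. ecirc (snd p) *s (fst p :: complex ^ 'n)) \<in> borel \<Otimes>\<^sub>M borel \<rightarrow>\<^sub>M borel"
      unfolding borel_prod by (intro borel_measurable_continuous_onI continuous_intros)
    show ?thesis unfolding set_lebesgue_integral_def
      by (rule lborel.borel_measurable_lebesgue_integral, unfold split_beta)
         (use measurable_compose[OF m, of G] in measurable)
  qed
  show ?thesis
    unfolding circle_average(1)[OF assms(1,3)] circle_average(1)[OF assms(2,4)]
  proof (rule integral_cong_AE)
    show "AE z in lborel. (LINT t:{0..1}|lborel. G1 (ecirc t *s z)) = (LINT t:{0..1}|lborel. G2 (ecirc t *s z))"
      using circle_average(2)[OF assms(1,3)] circle_average(2)[OF assms(2,4)]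
      by eventually_elim (simp add: set_borel_integral_eq_integral eq)
  qed (use assms in measurable)
qed

lemma higher_deriv_exp_linear: "(deriv ^^ j) (\<lambda>l. exp (c * l)) = (\<lambda>l. c ^ j * exp (c * l :: complex))"
proof (induction j)
  case (Suc j)
  show ?case unfolding funpow.simps comp_def Suc
    by (rule ext, rule DERIV_imp_deriv) (auto intro!: derivative_eq_intros)
qed simp

text \<open>This is the conjugate of the Taylor coefficient formula for l -> exp
  (\<open>cnj c\<close> l).\<close>

lemma circle_integral_exp:
  "integral {0..1} (\<lambda>t. ecirc t ^ j * exp (c * inverse (ecirc t))) = c ^ j / fact j"
proof -
  have "integral {0..1} (\<lambda>t. exp (cnj c * ecirc t) * inverse (ecirc t) ^ j) = cnj c ^ j / fact j"
  proof -
    have h: "(\<lambda>l. exp (cnj c * l)) holomorphic_on A" for A by (intro holomorphic_intros)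
    show ?thesis
      using taylor_coeff_circle[of 1 "\<lambda>l. exp (cnj c * l)" j, OF holomorphic_on_imp_continuous_on[OF h] h]
      by (simp add: higher_deriv_exp_linear)
  qed
  then have "cnj (integral {0..1} (\<lambda>t. exp (cnj c * ecirc t) * inverse (ecirc t) ^ j)) = c ^ j / fact j"
    by simp
  also have "cnj (integral {0..1} (\<lambda>t. exp (cnj c * ecirc t) * inverse (ecirc t) ^ j)) = 
     integral {0..1} (\<lambda>t. cnj (exp (cnj c * ecirc t) * inverse (ecirc t) ^ j))"
    by (simp add: integral_cnj)
  also have "(\<lambda>t. cnj (exp (cnj c * ecirc t) * inverse (ecirc t) ^ j)) = (\<lambda>t. ecirc t ^ j * exp (c * inverse (ecirc t)))"
    by (auto simp: exp_cnj cnj_ecirc mult.commute)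
  finally show ?thesis .
qed

lemma power_le_exp: "0 \<le> x \<Longrightarrow> x ^ j \<le> fact j * exp (x::real)"
proof -
  assume "0 \<le> x"
  then have "x ^ j /\<^sub>R fact j \<le> exp x"
    using sum_le_suminf[OF summable_exp_generic[of x], of "{j}"] unfolding exp_def by simp
  then show ?thesis by (simp add: field_simps)
qed

text \<open>The reproducing property of the Fock space. Translation by w turns the exponent -|z|^2 +
  <w,z> into -|z|^2 - <z,w>; apart from the rotation invariant weight the integrand is then
  holomorphic in z, and its circle mean is the value at z = 0.\<close>

lemma gauss_hom_part:
  fixes f :: "complex ^ 'n \<Rightarrow> complex"
  assumes f: "holomorphic_ball f"
  shows "(LINT z|lborel. exp (- (norm z)\<^sup>2) *\<^sub>R (hom_part f j z * exp (herm w z))) = of_real (gauss_vol TYPE('n)) * hom_part f j w"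
    and "(LINT z|lborel. exp (- (norm z)\<^sup>2) *\<^sub>R (hom_part f j z * herm w z ^ j)) = fact j * of_real (gauss_vol TYPE('n)) * hom_part f j w"
    and "integrable lborel (\<lambda>z. exp (- (norm z)\<^sup>2) *\<^sub>R (hom_part f j z * herm w z ^ j))"
proof -
  note [measurable] = measurable_hom_part[OF f]
  obtain A where A: "A \<ge> 0" "\<And>x. cmod (hom_part f j x) \<le> A * norm x ^ j" using hom_part_bound[OF f] by metis
  have A': "cmod (hom_part f j x) \<le> A * fact j * exp (norm x)" for x
    using mult_left_mono[OF power_le_exp[of "norm x" j] A(1)] A(2)[of x] by simp
  have e: "cmod (exp (herm w z)) \<le> exp (norm w * norm z)" for z
    using abs_Re_le_cmod[of "herm w z"] norm_herm_le[of w z] by simp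
  have e': "cmod (exp (- herm z w)) \<le> exp (norm w * norm z)" for z
    using abs_Re_le_cmod[of "herm z w"] norm_herm_le[of z w] by (simp add: mult.commute)
  have "norm (hom_part f j z * exp (herm w z)) \<le> (A * fact j) * exp ((1 + norm w) * norm z)" for z
    using mult_mono[OF A'[of z] e[of z]] A(1) by (simp add: norm_mult exp_add algebra_simps)
  then have i1: "integrable lborel (\<lambda>z. exp (- (norm z)\<^sup>2) *\<^sub>R (hom_part f j z * exp (herm w z)))"
    by (intro integrable_gaussian_bound) measurable
  have "norm (hom_part f j z * herm w z ^ j) \<le> (A * fact j * fact j) * exp ((1 + norm w) * norm z)" for z
  proof -
    have "cmod (herm w z ^ j) \<le> (norm w * norm z) ^ j" unfolding norm_power by (intro power_mono norm_herm_le) auto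
    also have "\<dots> \<le> fact j * exp (norm w * norm z)" by (intro power_le_exp) auto
    finally show ?thesis using mult_mono[OF A'[of z], of "cmod (herm w z ^ j)" "fact j * exp (norm w * norm z)"] A(1) 
      by (simp add: norm_mult exp_add algebra_simps)
  qed
  then show i2: "integrable lborel (\<lambda>z. exp (- (norm z)\<^sup>2) *\<^sub>R (hom_part f j z * herm w z ^ j))"
    by (intro integrable_gaussian_bound) measurable
  have i3: "integrable lborel (\<lambda>z. exp (- (norm z)\<^sup>2) *\<^sub>R (hom_part f j (z + w) * exp (- herm z w)))"
  proof (rule integrable_gaussian_bound)
    have "cmod (hom_part f j (z + w)) \<le> A * fact j * exp (norm w) * exp (norm z)" for z
    proof -
      have "exp (norm (z + w)) \<le> exp (norm w) * exp (norm z)"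
        using norm_triangle_ineq[of z w] by (simp add: add.commute flip: exp_add)
      from mult_left_mono[OF this, of "A * fact j"] A(1) show ?thesis
        using A'[of "z + w"] by (simp add: mult_ac)
    qed
    note h = this
    fix z
    show "norm (hom_part f j (z + w) * exp (- herm z w)) \<le> (A * fact j * exp (norm w)) * exp ((1 + norm w) * norm z)"
      using mult_mono[OF h[of z] e'[of z]] A(1) by (simp add: norm_mult exp_add algebra_simps)
  qed measurable
  have ig: "integrable lborel (\<lambda>z::complex ^ 'n. exp (- (norm z)\<^sup>2) *\<^sub>R (hom_part f j w))"
    by (rule integrable_gaussian_bound[where A="cmod (hom_part f j w)" and C=0]) auto
  have "(LINT z|lborel. exp (- (norm z)\<^sup>2) *\<^sub>R (hom_part f j z * exp (herm w z))) = 
    (LINT z|distr lborel borel ((+) w). exp (- (norm z)\<^sup>2) *\<^sub>R (hom_part f j z * exp (herm w z)))"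
    by (simp add: lborel_distr_plus)
  also have "\<dots> = (LINT z|lborel. exp (- (norm (w + z))\<^sup>2) *\<^sub>R (hom_part f j (w + z) * exp (herm w (w + z))))"
    by (rule integral_distr) measurable
  also have "\<dots> = (LINT z|lborel. exp (- (norm z)\<^sup>2) *\<^sub>R (hom_part f j (z + w) * exp (- herm z w)))"
  proof (rule Bochner_Integration.integral_cong[OF refl])
    fix z :: "complex ^ 'n"
    have "complex_of_real ((norm (w + z))\<^sup>2) = herm w w + herm z w + herm w z + herm z z"
      unfolding herm_self[symmetric] by (simp add: herm_add_left herm_add_right)
    then have "- complex_of_real ((norm (w + z))\<^sup>2) + herm w (w + z) = - complex_of_real ((norm z)\<^sup>2) + - herm z w"
      by (simp add: herm_add_right herm_self)
    then have "exp (- complex_of_real ((norm (w + z))\<^sup>2)) * exp (herm w (w + z)) = exp (- complex_of_real ((norm z)\<^sup>2)) * exp (- herm z w)"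
      by (simp only: exp_add[symmetric])
    then show "exp (- (norm (w + z))\<^sup>2) *\<^sub>R (hom_part f j (w + z) * exp (herm w (w + z))) =
         exp (- (norm z)\<^sup>2) *\<^sub>R (hom_part f j (z + w) * exp (- herm z w))"
      by (simp add: scaleR_conv_of_real exp_of_real[symmetric] add.commute mult_ac)
  qed
  also have "\<dots> = (LINT z|lborel. exp (- (norm (z::complex ^ 'n))\<^sup>2) *\<^sub>R (hom_part f j w))"
  proof (rule circle_average_eq[OF _ _ i3 ig])
    fix z
    have "(\<lambda>l. exp (- l * herm z w)) holomorphic_on UNIV" by (intro holomorphic_intros)
    from hom_part_mean_value[OF f this, of j z w]
    show "integral {0..1} (\<lambda>t. exp (- (norm (ecirc t *s z))\<^sup>2) *\<^sub>R (hom_part f j (ecirc t *s z + w) * exp (- herm (ecirc t *s z) w))) =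
      integral {0..1} (\<lambda>t. exp (- (norm (ecirc t *s z))\<^sup>2) *\<^sub>R hom_part f j w)"
      by (simp add: norm_cscale herm_cscale_left)
  qed measurable
  also have "\<dots> = of_real (gauss_vol TYPE('n)) * hom_part f j w"
    unfolding gauss_vol_def scaleR_conv_of_real by simp
  finally show 1: "(LINT z|lborel. exp (- (norm z)\<^sup>2) *\<^sub>R (hom_part f j z * exp (herm w z))) = of_real (gauss_vol TYPE('n)) * hom_part f j w" .
  \<comment> \<open>Averaging over rotations keeps only the term <w,z>^j / j! of the exponential
    series, since the other factor is homogeneous of degree j.\<close>
  have "(LINT z|lborel. exp (- (norm z)\<^sup>2) *\<^sub>R (hom_part f j z * exp (herm w z))) = 
    (LINT z|lborel. (exp (- (norm z)\<^sup>2) *\<^sub>R (hom_part f j z * herm w z ^ j)) / fact j)"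
  proof (rule circle_average_eq[OF _ _ i1])
    show "integrable lborel (\<lambda>z. exp (- (norm z)\<^sup>2) *\<^sub>R (hom_part f j z * herm w z ^ j) / fact j)" using i2 by simp
    fix z
    have "integral {0..1} (\<lambda>t. exp (- (norm (ecirc t *s z))\<^sup>2) *\<^sub>R (hom_part f j (ecirc t *s z) * exp (herm w (ecirc t *s z))))
       = integral {0..1} (\<lambda>t. exp (- (norm z)\<^sup>2) *\<^sub>R (hom_part f j z * (ecirc t ^ j * exp (herm w z * inverse (ecirc t)))))"
      by (simp add: norm_cscale herm_cscale_right hom_part_scale[OF f] cnj_ecirc mult_ac)
    also have "\<dots> = exp (- (norm z)\<^sup>2) *\<^sub>R (hom_part f j z * (herm w z ^ j / fact j))"
      by (simp add: circle_integral_exp)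
    also have "\<dots> = integral {0..1} (\<lambda>t. exp (- (norm (ecirc t *s z))\<^sup>2) *\<^sub>R (hom_part f j (ecirc t *s z) * herm w (ecirc t *s z) ^ j) / fact j)"
      by (simp add: norm_cscale herm_cscale_right hom_part_scale[OF f] cnj_ecirc field_simps)
    finally show "integral {0..1} (\<lambda>t. exp (- (norm (ecirc t *s z))\<^sup>2) *\<^sub>R (hom_part f j (ecirc t *s z) * exp (herm w (ecirc t *s z))))
      = integral {0..1} (\<lambda>t. exp (- (norm (ecirc t *s z))\<^sup>2) *\<^sub>R (hom_part f j (ecirc t *s z) * herm w (ecirc t *s z) ^ j) / fact j)" .
  qed measurable
  then have "(LINT z|lborel. exp (- (norm z)\<^sup>2) *\<^sub>R (hom_part f j z * herm w z ^ j)) / fact j = of_real (gauss_vol TYPE('n)) * hom_part f j w"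
    unfolding 1 by simp
  then show "(LINT z|lborel. exp (- (norm z)\<^sup>2) *\<^sub>R (hom_part f j z * herm w z ^ j)) = fact j * of_real (gauss_vol TYPE('n)) * hom_part f j w"
    by (simp add: field_simps)
qed

text \<open>With u = <z,w> and s = n + 1 + \<alpha> this is the Bergman kernel of the weight
  \<alpha>. The exponent s is kept free because radial derivatives raise it.\<close>

definition bker :: "real \<Rightarrow> complex \<Rightarrow> complex" where
  "bker s u = (1 - u) powr (- of_real s)"

lemma norm_bker: "cmod (bker s u) = cmod (1 - u) powr (- s)"
  unfolding bker_def by (subst norm_powr_real_powr') auto

lemma bker_add: "bker (s + t) u = bker s u * bker t u"
  by (simp add: bker_def powr_add[symmetric] algebra_simps)

lemma one_minus_pos: "cmod u < 1 \<Longrightarrow> 0 < Re (1 - u)"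
  using complex_Re_le_cmod[of u] by simp

lemma one_minus_nonpos: "cmod u < 1 \<Longrightarrow> 1 - u \<notin> \<real>\<^sub>\<le>\<^sub>0"
  using one_minus_pos[of u] by (auto simp: complex_nonpos_Reals_iff)

lemma one_minus_nz: "cmod u < 1 \<Longrightarrow> 1 - u \<noteq> 0"
  using one_minus_pos[of u] by auto

lemma cnj_bker: "cmod u < 1 \<Longrightarrow> cnj (bker s u) = bker s (cnj u)"
  unfolding bker_def using one_minus_pos[of u] by (subst cnj_powr) auto

lemma has_field_derivative_bker:
  assumes "cmod u < 1"
  shows "(bker s has_field_derivative of_real s * bker (s + 1) u) (at u)"
  unfolding bker_def
  by (rule derivative_eq_intros refl one_minus_nonpos[OF assms])+ simp

lemma holomorphic_bker: "A \<subseteq> ball 0 1 \<Longrightarrow> bker s holomorphic_on A"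
  unfolding holomorphic_on_def
  by (meson has_field_derivative_bker field_differentiable_def field_differentiable_at_within mem_ball_0 subsetD)

lemma continuous_on_bker[continuous_intros]:
  assumes "continuous_on A f" "\<And>x. x \<in> A \<Longrightarrow> cmod (f x) < 1"
  shows "continuous_on A (\<lambda>x. bker s (f x))"
  using assms by (intro continuous_on_compose2[OF holomorphic_on_imp_continuous_on[OF holomorphic_bker[of "ball 0 1"]] assms(1)]) auto

lemma bker_sums:
  assumes "cmod u < 1"
  shows "(\<lambda>j. of_real (pochhammer s j / fact j) * u ^ j) sums bker s u"
proof -
  have "(\<lambda>j. ((- complex_of_real s) gchoose j) * (- u) ^ j) sums (1 + (-u)) powr (- complex_of_real s)"
    by (rule gen_binomial_complex) (use assms in simp)
  also have "(\<lambda>j. ((- complex_of_real s) gchoose j) * (- u) ^ j) = (\<lambda>j. of_real (pochhammer s j / fact j) * u ^ j)"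
  proof
    fix j
    have "((- complex_of_real s) gchoose j) * (- u) ^ j = ((-1) ^ j * (-1) ^ j) * (pochhammer (of_real s) j / fact j * u ^ j)"
      unfolding gbinomial_pochhammer by (subst power_minus[of u]) simp
    then show "((- complex_of_real s) gchoose j) * (- u) ^ j = of_real (pochhammer s j / fact j) * u ^ j"
      by (simp add: pochhammer_of_real flip: power_mult_distrib)
  qed
  finally show ?thesis by (simp add: bker_def)
qed

lemma summable_bker_coeff:
  fixes x s :: real
  assumes "0 \<le> x" "x < 1" "s > 0"
  shows "summable (\<lambda>j. pochhammer s j / fact j * x ^ j)"
proof -
  have "summable (\<lambda>j. of_real (pochhammer s j / fact j) * complex_of_real x ^ j)"
    using bker_sums[of "of_real x" s] assms by (auto simp: sums_iff)
  then show ?thesis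
    by (simp only: of_real_power[symmetric] of_real_mult[symmetric] summable_complex_of_real)
qed

lemma nu_measurable_continuous:
  "continuous_on (ball 0 1) f \<Longrightarrow> f \<in> borel_measurable (nu \<alpha>)"
  using borel_measurable_continuous_on_restrict[of "ball 0 1" f]
  by (simp add: measurable_cong_sets[OF sets_nu refl])

lemma holomorphic_ball_measurable: "holomorphic_ball f \<Longrightarrow> f \<in> borel_measurable (nu \<alpha>)"
  by (rule nu_measurable_continuous[OF holomorphic_ball_continuous])

lemma measurable_ident_nu[measurable]: "(\<lambda>z. z) \<in> borel_measurable (nu \<alpha>)"
  by (simp add: measurable_cong_sets[OF sets_nu refl] measurable_restrict_space1)

text \<open>Moves integrals to \<open>lborel\<close>, where rotations act. The integrand is set to 0
  off the ball because f is only measurable inside it.\<close>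

lemma integral_nu:
  fixes f :: "complex ^ 'n \<Rightarrow> complex"
  assumes [measurable]: "f \<in> borel_measurable (nu \<alpha>)" and \<alpha>: "\<alpha> > -1"
  defines "g \<equiv> (\<lambda>z. (indicator (ball 0 1) z * bdef z powr \<alpha> / nu_mass TYPE('n) \<alpha>) *\<^sub>R (if z \<in> ball 0 1 then f z else 0))"
  shows "(LINT z|nu \<alpha>. f z) = (LINT z|lborel. g z)"
    and "integrable (nu \<alpha>) f \<longleftrightarrow> integrable lborel g"
    and "g \<in> borel_measurable borel"
proof -
  let ?R = "restrict_space lborel (ball 0 1 :: (complex ^ 'n) set)"
  have f[measurable]: "f \<in> borel_measurable ?R"
    using assms(1) by (simp add: nu_def)
  have f0[measurable]: "(\<lambda>z. if z \<in> ball 0 1 then f z else 0) \<in> borel_measurable borel"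
  proof -
    have "(\<lambda>z. indicator (ball 0 1) z *\<^sub>R f z) \<in> borel_measurable lborel"
      using f by (subst (asm) borel_measurable_restrict_space_iff) auto
    also have "(\<lambda>z. indicator (ball 0 1) z *\<^sub>R f z) = (\<lambda>z. if z \<in> ball 0 1 then f z else 0)"
      by (auto simp: indicator_def)
    finally show ?thesis by simp
  qed
  have "(\<lambda>z::complex ^ 'n. bdef z powr \<alpha> / nu_mass TYPE('n) \<alpha>) \<in> borel_measurable lborel"
    by (simp add: borel_measurable_divide borel_measurable_weight)
  then have [measurable]: "(\<lambda>z. bdef z powr \<alpha> / nu_mass TYPE('n) \<alpha>) \<in> borel_measurable ?R"
    by (rule measurable_restrict_space1)
  have nn: "AE z in ?R. 0 \<le> bdef z powr \<alpha> / nu_mass TYPE('n) \<alpha>"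
    using nu_mass_pos[OF \<alpha>, where 'n='n] by simp
  have nu: "nu \<alpha> = density ?R (\<lambda>z. ennreal (bdef z powr \<alpha> / nu_mass TYPE('n) \<alpha>))"
    unfolding nu_def nu_mass[OF \<alpha>] ..
  have g: "indicator (ball 0 1) z *\<^sub>R (bdef z powr \<alpha> / nu_mass TYPE('n) \<alpha>) *\<^sub>R f z = g z" for z
    by (simp add: g_def indicator_def)
  have e1: "integral\<^sup>L ?R h = (LINT z|lborel. indicator (ball 0 1) z *\<^sub>R h z)" for h :: "complex ^ 'n \<Rightarrow> complex"
    by (rule integral_restrict_space) simp
  have e2: "integrable ?R h \<longleftrightarrow> integrable lborel (\<lambda>z. indicator (ball 0 1) z *\<^sub>R h z)" for h :: "complex ^ 'n \<Rightarrow> complex"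
    by (rule integrable_restrict_space) simp
  show "(LINT z|nu \<alpha>. f z) = (LINT z|lborel. g z)"
    unfolding nu integral_density[OF f \<open>(\<lambda>z. bdef z powr \<alpha> / nu_mass TYPE('n) \<alpha>) \<in> borel_measurable ?R\<close> nn] e1 g ..
  show "integrable (nu \<alpha>) f \<longleftrightarrow> integrable lborel g"
    unfolding nu integrable_density[OF f \<open>(\<lambda>z. bdef z powr \<alpha> / nu_mass TYPE('n) \<alpha>) \<in> borel_measurable ?R\<close> nn] e2 g ..
  show "g \<in> borel_measurable borel" unfolding g_def by (intro borel_measurable_scaleR f0) measurable
qed

text \<open>On each circle about 0 only the part of degree j pairs with <w,z>^j. The remaining
  integrand is homogeneous of degree 2j, so the radial formula reduces the moment to the Gaussian
  one, at the price of Gamma(N)/Gamma(N+j), the inverse of the Pochhammer symbol.\<close>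

lemma integral_nu_hom_part:
  fixes f :: "complex ^ 'n \<Rightarrow> complex"
  assumes f: "holomorphic_ball f" and \<alpha>: "\<alpha> > -1" and int: "integrable (nu \<alpha>) f"
  shows "(LINT z|nu \<alpha>. f z * herm w z ^ j) = hom_part f j w * of_real (fact j / pochhammer (real CARD('n) + 1 + \<alpha>) j)"
    and "integrable (nu \<alpha>) (\<lambda>z. f z * herm w z ^ j)"
proof -
  let ?N = "real CARD('n) + 1 + \<alpha>"
  let ?w = "\<lambda>z::complex ^ 'n. indicator (ball 0 1) z * bdef z powr \<alpha> / nu_mass TYPE('n) \<alpha>"
  have [measurable]: "f \<in> borel_measurable (nu \<alpha>)" by (rule holomorphic_ball_measurable[OF f])
  note [measurable] = measurable_hom_part[OF f]
  interpret finite_measure "nu \<alpha> :: (complex ^ 'n) measure" by (rule finite_measure_nu[OF \<alpha>])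
  show i1: "integrable (nu \<alpha>) (\<lambda>z. f z * herm w z ^ j)"
  proof (rule Bochner_Integration.integrable_bound[OF integrable_mult_left[OF int, of "of_real (norm w ^ j)"]])
    show "AE z in nu \<alpha>. norm (f z * herm w z ^ j) \<le> norm (f z * complex_of_real (norm w ^ j))"
    proof (rule AE_I2)
      fix z :: "complex ^ 'n" assume "z \<in> space (nu \<alpha>)"
      then have "cmod (herm w z) \<le> norm w" using norm_herm_le[of w z] mult_left_mono[of "norm z" 1 "norm w"] by simp
      then have "cmod (herm w z) ^ j \<le> norm w ^ j" by (intro power_mono) auto
      then show "norm (f z * herm w z ^ j) \<le> norm (f z * complex_of_real (norm w ^ j))"
        by (simp add: norm_mult norm_power mult_left_mono)
    qed
  qed measurable
  obtain A where A: "A \<ge> 0" "\<And>x. cmod (hom_part f j x) \<le> A * norm x ^ j" using hom_part_bound[OF f] by metis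
  have i2: "integrable (nu \<alpha>) (\<lambda>z. hom_part f j z * herm w z ^ j)"
  proof (rule integrable_const_bound[where B="A * norm w ^ j"])
    show "AE z in nu \<alpha>. norm (hom_part f j z * herm w z ^ j) \<le> A * norm w ^ j"
    proof (rule AE_I2)
      fix z :: "complex ^ 'n" assume z: "z \<in> space (nu \<alpha>)"
      then have "cmod (herm w z) \<le> norm w" using norm_herm_le[of w z] mult_left_mono[of "norm z" 1 "norm w"] by simp
      then have 1: "cmod (herm w z) ^ j \<le> norm w ^ j" by (intro power_mono) auto
      have "norm z ^ j \<le> 1" using z by (intro power_le_one) auto
      then have "A * norm z ^ j \<le> A" using A(1) mult_left_mono[of "norm z ^ j" 1 A] by simp
      then have "cmod (hom_part f j z) \<le> A" using A(2)[of z] by linarith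
      from mult_mono[OF this 1 A(1)] show "norm (hom_part f j z * herm w z ^ j) \<le> A * norm w ^ j"
        by (simp add: norm_mult norm_power)
    qed
  qed measurable
  have m1: "(\<lambda>z. f z * herm w z ^ j) \<in> borel_measurable (nu \<alpha>)" by measurable
  have m2: "(\<lambda>z. hom_part f j z * herm w z ^ j) \<in> borel_measurable (nu \<alpha>)" by measurable
  have "(LINT z|nu \<alpha>. f z * herm w z ^ j) = (LINT z|nu \<alpha>. hom_part f j z * herm w z ^ j)"
    unfolding integral_nu(1)[OF m1 \<alpha>] integral_nu(1)[OF m2 \<alpha>]
  proof (rule circle_average_eq[OF integral_nu(3)[OF m1 \<alpha>] integral_nu(3)[OF m2 \<alpha>] i1[unfolded integral_nu(2)[OF m1 \<alpha>]] i2[unfolded integral_nu(2)[OF m2 \<alpha>]]])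
    fix z :: "complex ^ 'n"
    have iw: "?w (ecirc t *s z) = ?w z" "ecirc t *s z \<in> ball 0 1 \<longleftrightarrow> z \<in> ball 0 1" for t
      by (simp_all add: norm_cscale indicator_def)
    show "integral {0..1} (\<lambda>t. ?w (ecirc t *s z) *\<^sub>R (if ecirc t *s z \<in> ball 0 1 then f (ecirc t *s z) * herm w (ecirc t *s z) ^ j else 0))
      = integral {0..1} (\<lambda>t. ?w (ecirc t *s z) *\<^sub>R (if ecirc t *s z \<in> ball 0 1 then hom_part f j (ecirc t *s z) * herm w (ecirc t *s z) ^ j else 0))"
    proof (cases "z \<in> ball 0 1")
      case True
      have "integral {0..1} (\<lambda>t. f (ecirc t *s z) * herm w (ecirc t *s z) ^ j) = 
        integral {0..1} (\<lambda>t. (f ((ecirc t / of_real 1) *s z) * inverse (ecirc t) ^ j) * herm w z ^ j)"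
        by (simp add: herm_cscale_right cnj_ecirc mult_ac power_mult_distrib)
      also have "\<dots> = hom_part f j z * herm w z ^ j"
        unfolding integral_mult_left using hom_part_integral[OF f, of z 1 j] True by simp
      also have "\<dots> = integral {0..1} (\<lambda>t. hom_part f j (ecirc t *s z) * herm w (ecirc t *s z) ^ j)"
        by (simp add: herm_cscale_right cnj_ecirc hom_part_scale[OF f] field_simps)
      finally show ?thesis unfolding iw using True by simp
    next
      case False
      then show ?thesis unfolding iw by simp
    qed
  qed
  also have "\<dots> = of_real (Gamma ?N / (Gamma (?N + real j) * gauss_vol TYPE('n))) *
     (LINT z|lborel. exp (- (norm z)\<^sup>2) *\<^sub>R (hom_part f j z * herm w z ^ j))"
  proof (rule nu_radial[OF _ \<alpha> _ gauss_hom_part(3)[OF f]])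
    show "hom_part f j (t *\<^sub>R z) * herm w (t *\<^sub>R z) ^ j = complex_of_real (t ^ (2 * j)) * (hom_part f j z * herm w z ^ j)" if "0 < t" for t z
    proof -
      have "complex_of_real (t ^ (2 * j)) = of_real t ^ j * of_real t ^ j" by (simp add: mult_2 power_add)
      then show ?thesis by (simp only: scaleR_cscale hom_part_scale[OF f] herm_cscale_right power_mult_distrib complex_cnj_complex_of_real mult_ac)
    qed
  qed measurable
  also have "\<dots> = hom_part f j w * of_real (fact j / pochhammer ?N j)"
  proof -
    have "?N > 0" "?N \<notin> \<int>\<^sub>\<le>\<^sub>0" using \<alpha> by (auto elim!: nonpos_Ints_cases)
    then have "Gamma ?N / (Gamma (?N + real j) * gauss_vol TYPE('n)) * (fact j * gauss_vol TYPE('n)) = fact j / pochhammer ?N j"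
      using gauss_vol_pos[where 'n='n] Gamma_real_pos[of ?N] by (simp add: pochhammer_Gamma)
    then have "complex_of_real (Gamma ?N / (Gamma (?N + real j) * gauss_vol TYPE('n))) * (fact j * of_real (gauss_vol TYPE('n))) = of_real (fact j / pochhammer ?N j)"
      by (metis of_real_fact of_real_mult)
    then show ?thesis unfolding gauss_hom_part(2)[OF f] by (simp only: mult.assoc[symmetric]) (simp only: mult.commute)
  qed
  finally show "(LINT z|nu \<alpha>. f z * herm w z ^ j) = hom_part f j w * of_real (fact j / pochhammer ?N j)" .
qed

text \<open>The binomial coefficients of the kernel are exactly inverse to the factors in the
  moments of \<open>integral_nu_hom_part\<close>, so integrating the kernel series term by term
  leaves the sum of the homogeneous parts. For fixed w the series is dominated by the one at |w| <
  1, uniformly in z.\<close>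

theorem reproducing_formula:
  fixes f :: "complex ^ 'n \<Rightarrow> complex"
  assumes f: "holomorphic_ball f" and \<alpha>: "\<alpha> > -1" and int: "integrable (nu \<alpha>) f" and w: "w \<in> ball 0 1"
  shows "(LINT z|nu \<alpha>. f z * bker (real CARD('n) + 1 + \<alpha>) (herm w z)) = f w"
proof -
  let ?N = "real CARD('n) + 1 + \<alpha>"
  have N: "?N > 0" using \<alpha> by simp
  let ?c = "\<lambda>j. pochhammer ?N j / fact j"
  have cpos: "?c j > 0" for j using N by (simp add: pochhammer_pos)
  have [measurable]: "f \<in> borel_measurable (nu \<alpha>)" by (rule holomorphic_ball_measurable[OF f])
  have sm: "summable (\<lambda>j. ?c j * norm w ^ j)" using w N by (intro summable_bker_coeff) auto
  have hb: "cmod (herm w z) \<le> norm w" if "z \<in> ball 0 1" for z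
    using norm_herm_le[of w z] mult_left_mono[of "norm z" 1 "norm w"] that by simp
  have bd: "norm (f z * (of_real (?c j) * herm w z ^ j)) \<le> cmod (f z) * (?c j * norm w ^ j)" if "z \<in> ball 0 1" for j z
  proof -
    have "cmod (herm w z) ^ j \<le> norm w ^ j" using hb[OF that] by (intro power_mono) auto
    then have "cmod (f z) * (?c j * cmod (herm w z) ^ j) \<le> cmod (f z) * (?c j * norm w ^ j)"
      using cpos[of j] by (intro mult_left_mono) auto
    moreover have "norm (f z * (of_real (?c j) * herm w z ^ j)) = cmod (f z) * (?c j * cmod (herm w z) ^ j)"
      using cpos[of j] unfolding norm_mult norm_power norm_of_real by (simp only: abs_of_pos)
    ultimately show ?thesis by simp
  qed
  have i: "integrable (nu \<alpha>) (\<lambda>z. f z * (of_real (?c j) * herm w z ^ j))" for j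
    using integrable_mult_right[OF integral_nu_hom_part(2)[OF f \<alpha> int, of w j], of "of_real (?c j)"]
    by (simp only: mult.left_commute)
  have "(\<lambda>j. LINT z|nu \<alpha>. f z * (of_real (?c j) * herm w z ^ j)) sums (LINT z|nu \<alpha>. (\<Sum>j. f z * (of_real (?c j) * herm w z ^ j)))"
  proof (rule sums_integral[OF i])
    show "AE z in nu \<alpha>. summable (\<lambda>j. norm (f z * (of_real (?c j) * herm w z ^ j)))"
      by (rule AE_I2, rule summable_comparison_test'[OF summable_mult[OF sm]], subst real_norm_def, subst abs_of_nonneg) (use bd in auto)
    show "summable (\<lambda>j. LINT z|nu \<alpha>. norm (f z * (of_real (?c j) * herm w z ^ j)))"
    proof (rule summable_comparison_test'[OF summable_mult[OF sm, of "LINT z|nu \<alpha>. cmod (f z)"]])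
      fix j
      have "(LINT z|nu \<alpha>. norm (f z * (of_real (?c j) * herm w z ^ j))) \<le> (LINT z|nu \<alpha>. cmod (f z) * (?c j * norm w ^ j))"
        by (intro integral_mono integrable_norm i integrable_mult_left int) (use bd in auto)
      then show "norm (LINT z|nu \<alpha>. norm (f z * (of_real (?c j) * herm w z ^ j))) \<le> (LINT z|nu \<alpha>. cmod (f z)) * (?c j * norm w ^ j)"
        by simp
    qed
  qed
  also have "(LINT z|nu \<alpha>. (\<Sum>j. f z * (of_real (?c j) * herm w z ^ j))) = (LINT z|nu \<alpha>. f z * bker ?N (herm w z))"
  proof (rule Bochner_Integration.integral_cong[OF refl])
    fix z :: "complex ^ 'n" assume "z \<in> space (nu \<alpha>)"
    then have "cmod (herm w z) < 1" using w norm_herm_less_1[of w z] by simp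
    from sums_mult[OF bker_sums[OF this], of "f z" ?N] show "(\<Sum>j. f z * (of_real (?c j) * herm w z ^ j)) = f z * bker ?N (herm w z)"
      by (simp add: sums_iff)
  qed
  finally have 1: "(\<lambda>j. LINT z|nu \<alpha>. f z * (of_real (?c j) * herm w z ^ j)) sums (LINT z|nu \<alpha>. f z * bker ?N (herm w z))" .
  have "(LINT z|nu \<alpha>. f z * (of_real (?c j) * herm w z ^ j)) = hom_part f j w" for j
  proof -
    have "(LINT z|nu \<alpha>. f z * (of_real (?c j) * herm w z ^ j)) = of_real (?c j) * (LINT z|nu \<alpha>. f z * herm w z ^ j)"
      by (subst integral_mult_right_zero[symmetric]) (simp only: mult.left_commute)
    also have "\<dots> = (of_real (?c j) * of_real (fact j / pochhammer ?N j)) * hom_part f j w"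
      unfolding integral_nu_hom_part(1)[OF f \<alpha> int] by (simp only: mult_ac)
    also have "of_real (?c j) * of_real (fact j / pochhammer ?N j) = (1::complex)"
      unfolding of_real_mult[symmetric] using pochhammer_pos[OF N, of j] by simp
    finally show ?thesis by simp
  qed
  with 1 hom_part_sums[OF f w] show ?thesis by (simp add: sums_iff)
qed

lemma herm_diff_right: "herm w (x - y) = herm w x - herm w y"
  by (simp add: herm_def algebra_simps sum_subtractf)

section \<open>Algebra of holomorphic and of bounded holomorphic functions on the ball\<close>

lemma holomorphic_ballI:
  assumes "\<And>z. z \<in> ball 0 1 \<Longrightarrow> (f has_derivative D z) (at z)" "\<And>z c v. z \<in> ball 0 1 \<Longrightarrow> D z (c *s v) = c * D z v"
  shows "holomorphic_ball f"
  unfolding holomorphic_ball_def using assms by blast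

lemma holomorphic_ballE:
  assumes "holomorphic_ball f" "z \<in> ball 0 1"
  obtains D where "(f has_derivative D) (at z)" "\<And>c v. D (c *s v) = c * D v"
  using assms unfolding holomorphic_ball_def by blast

lemma holomorphic_ball_const[simp]: "holomorphic_ball (\<lambda>z. c)"
  by (rule holomorphic_ballI[where D="\<lambda>_ _. 0"]) auto

lemma holomorphic_ball_add:
  assumes "holomorphic_ball f" "holomorphic_ball g"
  shows "holomorphic_ball (\<lambda>z. f z + g z)"
  unfolding holomorphic_ball_def
proof
  fix z :: "complex ^ 'a" assume z: "z \<in> ball 0 1"
  obtain D where D: "(f has_derivative D) (at z)" "\<And>c v. D (c *s v) = c * D v" using holomorphic_ballE[OF assms(1) z] by blast
  obtain E where E: "(g has_derivative E) (at z)" "\<And>c v. E (c *s v) = c * E v" using holomorphic_ballE[OF assms(2) z] by blast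
  show "\<exists>F. ((\<lambda>z. f z + g z) has_derivative F) (at z) \<and> (\<forall>c v. F (c *s v) = c * F v)"
    using has_derivative_add[OF D(1) E(1)] D(2) E(2) by (auto simp: algebra_simps)
qed

lemma holomorphic_ball_mult:
  assumes "holomorphic_ball f" "holomorphic_ball g"
  shows "holomorphic_ball (\<lambda>z. f z * g z)"
  unfolding holomorphic_ball_def
proof
  fix z :: "complex ^ 'a" assume z: "z \<in> ball 0 1"
  obtain D where D: "(f has_derivative D) (at z)" "\<And>c v. D (c *s v) = c * D v" using holomorphic_ballE[OF assms(1) z] by blast
  obtain E where E: "(g has_derivative E) (at z)" "\<And>c v. E (c *s v) = c * E v" using holomorphic_ballE[OF assms(2) z] by blast
  show "\<exists>F. ((\<lambda>z. f z * g z) has_derivative F) (at z) \<and> (\<forall>c v. F (c *s v) = c * F v)"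
    using has_derivative_mult[OF D(1) E(1)] D(2) E(2) by (auto simp: algebra_simps)
qed

lemma holomorphic_ball_cmult: "holomorphic_ball f \<Longrightarrow> holomorphic_ball (\<lambda>z. c * f z)"
  by (rule holomorphic_ball_mult) auto

lemma holomorphic_ball_diff: "holomorphic_ball f \<Longrightarrow> holomorphic_ball g \<Longrightarrow> holomorphic_ball (\<lambda>z. f z - g z)"
  using holomorphic_ball_add[of f "\<lambda>z. (-1) * g z"] holomorphic_ball_cmult[of g "-1"] by simp

lemma holomorphic_ball_sum:
  "(\<And>i. i \<in> I \<Longrightarrow> holomorphic_ball (f i)) \<Longrightarrow> holomorphic_ball (\<lambda>z. \<Sum>i\<in>I. f i z)"
  by (induction I rule: infinite_finite_induct) (auto intro: holomorphic_ball_add)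

lemma holomorphic_ball_cong:
  assumes "holomorphic_ball f" "\<And>z. z \<in> ball 0 1 \<Longrightarrow> f z = g z"
  shows "holomorphic_ball g"
  unfolding holomorphic_ball_def
proof
  fix z :: "complex ^ 'a" assume z: "z \<in> ball 0 1"
  obtain D where D: "(f has_derivative D) (at z)" "\<And>c v. D (c *s v) = c * D v" using holomorphic_ballE[OF assms(1) z] by blast
  have "(g has_derivative D) (at z)"
    by (rule has_derivative_transform_within_open[OF D(1) open_ball z]) (use assms(2) in auto)
  then show "\<exists>F. (g has_derivative F) (at z) \<and> (\<forall>c v. F (c *s v) = c * F v)" using D(2) by blast
qed

lemma has_derivative_herm: "((\<lambda>z. herm z w) has_derivative (\<lambda>h. herm h w)) (at z)"
proof (rule bounded_linear_imp_has_derivative)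
  show "bounded_linear (\<lambda>h. herm h w)"
    by (rule bounded_linear_intro[where K="norm w"])
       (auto simp: herm_add_left scaleR_cscale herm_cscale_left scaleR_conv_of_real norm_herm_le)
qed

lemma holomorphic_ball_bker_herm:
  assumes "w \<in> ball 0 1"
  shows "holomorphic_ball (\<lambda>z. bker s (herm z w))"
proof (rule holomorphic_ballI[where D="\<lambda>z h. of_real s * bker (s + 1) (herm z w) * herm h w"])
  fix z :: "complex ^ 'a" assume "z \<in> ball 0 1"
  then have "cmod (herm z w) < 1" using assms norm_herm_less_1[of z w] by simp
  from has_field_derivative_bker[OF this, of s]
  have "(bker s has_derivative (*) (of_real s * bker (s + 1) (herm z w))) (at (herm z w))"
    by (simp add: has_field_derivative_def)
  from has_derivative_compose[OF has_derivative_herm this]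
  show "((\<lambda>z. bker s (herm z w)) has_derivative (\<lambda>h. of_real s * bker (s + 1) (herm z w) * herm h w)) (at z)" .
qed (auto simp: herm_cscale_left)

lemma holomorphic_ball_dilate:
  assumes f: "holomorphic_ball f" and r: "0 \<le> r" "r \<le> 1"
  shows "holomorphic_ball (\<lambda>z. f (r *\<^sub>R z))"
  unfolding holomorphic_ball_def
proof
  fix z :: "complex ^ 'a" assume z: "z \<in> ball 0 1"
  have "r * norm z < 1" using z r mult_left_le_one_le[of "norm z" r] by auto
  then have rz: "r *\<^sub>R z \<in> ball 0 1" using r by simp
  obtain D where D: "(f has_derivative D) (at (r *\<^sub>R z))" "\<And>c v. D (c *s v) = c * D v" using holomorphic_ballE[OF f rz] by blast
  have "((\<lambda>z. r *\<^sub>R z) has_derivative (\<lambda>h. r *\<^sub>R h)) (at z)" by (auto intro!: derivative_eq_intros)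
  from has_derivative_compose[OF this D(1)]
  show "\<exists>F. ((\<lambda>z. f (r *\<^sub>R z)) has_derivative F) (at z) \<and> (\<forall>c v. F (c *s v) = c * F v)"
    by (rule exI[of _ "\<lambda>h. D (r *\<^sub>R h)", OF conjI]) (simp add: scaleR_cscale D(2) vector_smult_assoc)
qed

definition Hinf :: "(complex ^ 'n \<Rightarrow> complex) \<Rightarrow> bool" where
  "Hinf f \<longleftrightarrow> holomorphic_ball f \<and> bounded (f ` ball 0 1)"

lemma HinfD: "Hinf f \<Longrightarrow> holomorphic_ball f" by (simp add: Hinf_def)

lemma HinfE:
  assumes "Hinf f" obtains B where "B \<ge> 0" "\<And>z. z \<in> ball 0 1 \<Longrightarrow> cmod (f z) \<le> B"
proof -
  obtain B where B: "\<And>z. z \<in> ball 0 1 \<Longrightarrow> cmod (f z) \<le> B" using assms unfolding Hinf_def bounded_iff by blast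
  have "0 \<le> B" using order.trans[OF norm_ge_zero B[of 0]] by simp
  with B show ?thesis using that by blast
qed

lemma HinfI: "holomorphic_ball f \<Longrightarrow> (\<And>z. z \<in> ball 0 1 \<Longrightarrow> cmod (f z) \<le> B) \<Longrightarrow> Hinf f"
  unfolding Hinf_def bounded_iff by blast

lemma Hinf_mult: assumes "Hinf f" "Hinf g" shows "Hinf (\<lambda>z. f z * g z)"
proof -
  obtain A where A: "A \<ge> 0" "\<And>z. z \<in> ball 0 1 \<Longrightarrow> cmod (f z) \<le> A" using HinfE[OF assms(1)] by blast
  obtain B where B: "B \<ge> 0" "\<And>z. z \<in> ball 0 1 \<Longrightarrow> cmod (g z) \<le> B" using HinfE[OF assms(2)] by blast
  show ?thesis
    by (rule HinfI[of _ "A * B"]) (use assms A B in \<open>auto simp: norm_mult Hinf_def intro!: holomorphic_ball_mult mult_mono\<close>)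
qed

lemma Hinf_const: "Hinf (\<lambda>_. c)" by (rule HinfI[of _ "cmod c"]) auto

lemma Hinf_cmult: "Hinf f \<Longrightarrow> Hinf (\<lambda>z. c * f z)" by (rule Hinf_mult[OF Hinf_const])

lemma Hinf_add: assumes "Hinf f" "Hinf g" shows "Hinf (\<lambda>z. f z + g z)"
proof -
  obtain A where A: "A \<ge> 0" "\<And>z. z \<in> ball 0 1 \<Longrightarrow> cmod (f z) \<le> A" using HinfE[OF assms(1)] by blast
  obtain B where B: "B \<ge> 0" "\<And>z. z \<in> ball 0 1 \<Longrightarrow> cmod (g z) \<le> B" using HinfE[OF assms(2)] by blast
  show ?thesis
    by (rule HinfI[of _ "A + B"]) (use assms A B in \<open>auto simp: Hinf_def intro!: holomorphic_ball_add norm_triangle_mono\<close>)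
qed

lemma Hinf_diff: "Hinf f \<Longrightarrow> Hinf g \<Longrightarrow> Hinf (\<lambda>z. f z - g z)"
  using Hinf_add[of f "\<lambda>z. (-1) * g z"] Hinf_cmult[of g "-1"] by simp

lemma Hinf_sum: "(\<And>i. i \<in> I \<Longrightarrow> Hinf (f i)) \<Longrightarrow> Hinf (\<lambda>z. \<Sum>i\<in>I. f i z)"
  by (induction I rule: infinite_finite_induct) (auto intro: Hinf_add Hinf_const)

lemma Hinf_bker: assumes w: "w \<in> ball 0 1" shows "Hinf (\<lambda>z. bker s (herm z w))"
proof -
  have "bounded ((\<lambda>z. bker s (herm z w)) ` cball 0 1)"
    by (intro compact_imp_bounded compact_continuous_image continuous_intros) (use w norm_herm_less_1' in auto)
  then have "bounded ((\<lambda>z. bker s (herm z w)) ` ball 0 1)"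
    by (rule bounded_subset) (use ball_subset_cball in blast)
  then show ?thesis using holomorphic_ball_bker_herm[OF w] by (simp add: Hinf_def)
qed

lemma Hinf_herm: "Hinf (\<lambda>z. herm z w)"
proof (rule HinfI)
  show "holomorphic_ball (\<lambda>z. herm z w)"
    by (rule holomorphic_ballI[OF has_derivative_herm]) (auto simp: herm_cscale_left)
  show "cmod (herm z w) \<le> norm w" if "z \<in> ball 0 1" for z
    using norm_herm_le[of z w] that mult_right_mono[of "norm z" 1 "norm w"] by simp
qed

lemma scaleR_in_ball: "0 \<le> r \<Longrightarrow> r \<le> 1 \<Longrightarrow> z \<in> ball 0 1 \<Longrightarrow> r *\<^sub>R z \<in> ball (0::'a::real_normed_vector) 1"
  using mult_left_le_one_le[of "norm z" r] by auto

lemma Hinf_dilate: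
  assumes f: "holomorphic_ball f" and r: "0 \<le> r" "r < 1"
  shows "Hinf (\<lambda>z. f (r *\<^sub>R z))"
proof -
  have "r *\<^sub>R z \<in> ball 0 1" if "z \<in> cball 0 1" for z :: "complex ^ 'a"
    using that r mult_left_mono[of "norm z" 1 r] by auto
  then have "bounded ((\<lambda>z. f (r *\<^sub>R z)) ` cball 0 1)"
    by (intro compact_imp_bounded compact_continuous_image continuous_intros 
        continuous_on_compose2[OF holomorphic_ball_continuous[OF f]]) auto
  then have "bounded ((\<lambda>z. f (r *\<^sub>R z)) ` ball 0 1)"
    by (rule bounded_subset) (use ball_subset_cball in blast)
  then show ?thesis using holomorphic_ball_dilate[OF f] r by (simp add: Hinf_def)
qed

lemma Hinf_integrable:
  assumes "Hinf f" "\<alpha> > -1" shows "integrable (nu \<alpha>) f"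
proof -
  obtain B where B: "B \<ge> 0" "\<And>z. z \<in> ball 0 1 \<Longrightarrow> cmod (f z) \<le> B" using HinfE[OF assms(1)] by blast
  interpret finite_measure "nu \<alpha> :: (complex ^ 'a) measure" by (rule finite_measure_nu[OF assms(2)])
  show ?thesis
    by (rule integrable_const_bound[of _ B]) (use B assms(1) in \<open>auto intro: holomorphic_ball_measurable HinfD\<close>)
qed

lemma integrable_mult_Hinf:
  assumes F: "integrable (nu \<alpha>) F" and f: "Hinf f"
  shows "integrable (nu \<alpha>) (\<lambda>z. F z * f z)"
proof -
  obtain B where B: "B \<ge> 0" "\<And>z. z \<in> ball 0 1 \<Longrightarrow> cmod (f z) \<le> B" using HinfE[OF f] by blast
  have [measurable]: "f \<in> borel_measurable (nu \<alpha>)" "F \<in> borel_measurable (nu \<alpha>)" 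
    using f F by (auto intro: holomorphic_ball_measurable HinfD)
  show ?thesis
  proof (rule Bochner_Integration.integrable_bound[OF integrable_mult_right[OF F, of "of_real B"]])
    show "AE x in nu \<alpha>. norm (F x * f x) \<le> norm (complex_of_real B * F x)"
      using B by (intro AE_I2) (simp add: norm_mult mult.commute[of "cmod (F _)"] mult_right_mono)
  qed measurable
qed

subsection \<open>The radial derivative\<close>

text \<open>Expanding z in the standard basis, complex linearity of the derivative D gives Rf(z) = D
  z. From here on R is handled through total derivatives and partial derivatives no longer
  appear.\<close>

lemma radial_deriv_eq:
  assumes D: "(f has_derivative D) (at z)" "\<And>c v. D (c *s v) = c * D v"
  shows "radial_deriv f z = D z"
proof -
  have lin: "linear D" using D(1) has_derivative_linear by blast
  have "partial_deriv j f z = D (axis j 1)" for j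
  proof -
    let ?p = "\<lambda>w. (\<chi> i. if i = j then w else z $ i)"
    have p: "?p w = (z - (z $ j) *s axis j 1) + w *s axis j 1" for w
      by (auto simp: vec_eq_iff axis_def)
    have "linear (\<lambda>l::complex. l *s (axis j 1 :: complex ^ 'a))"
    proof (rule linearI)
      show "(r *\<^sub>R l) *s b = r *\<^sub>R (l *s b)" for r and l :: complex and b :: "complex ^ 'a"
        unfolding scaleR_conv_of_real[of r l] by (simp add: scaleR_cscale vector_smult_assoc)
    qed (simp add: vec_eq_iff algebra_simps)
    then have l1: "((\<lambda>l::complex. l *s (axis j 1 :: complex ^ 'a)) has_derivative (\<lambda>l. l *s axis j 1)) (at (z $ j))"
      by (intro bounded_linear_imp_has_derivative linear_conv_bounded_linear[THEN iffD1])
    have d: "((\<lambda>l::complex. (z - (z $ j) *s axis j 1) + l *s axis j 1) has_derivative (\<lambda>l. l *s axis j 1)) (at (z $ j))"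
      using has_derivative_add[OF has_derivative_const[of "z - (z $ j) *s axis j 1"] l1] by (simp only: add_0_left)
    have pf: "?p = (\<lambda>w. (z - (z $ j) *s axis j 1) + w *s axis j 1)" by (rule ext) (rule p)
    have "(?p has_derivative (\<lambda>l. l *s axis j 1)) (at (z $ j))"
      by (subst pf) (rule d)
    moreover have "?p (z $ j) = z" by (auto simp: vec_eq_iff)
    ultimately have "((\<lambda>w. f (?p w)) has_derivative (\<lambda>l. D (l *s axis j 1))) (at (z $ j))"
      using D(1) has_derivative_compose[of ?p "\<lambda>l. l *s axis j 1" "z $ j" UNIV f D] by simp
    then have "((\<lambda>w. f (?p w)) has_field_derivative D (axis j 1)) (at (z $ j))"
      unfolding has_field_derivative_def by (simp add: D(2) mult_commute_abs)
    then show ?thesis unfolding partial_deriv_def by (rule DERIV_imp_deriv)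
  qed
  then have "radial_deriv f z = (\<Sum>j\<in>UNIV. D (z $ j *s axis j 1))" by (simp add: radial_deriv_def D(2))
  also have "\<dots> = D (\<Sum>j\<in>UNIV. z $ j *s axis j 1)" by (simp add: linear_sum[OF lin])
  also have "(\<Sum>j\<in>UNIV. z $ j *s axis j 1) = z" by (rule basis_expansion)
  finally show ?thesis .
qed

lemma radial_deriv_cong:
  assumes f: "holomorphic_ball f" and "\<And>z. z \<in> ball 0 1 \<Longrightarrow> f z = g z" and z: "z \<in> ball 0 1"
  shows "radial_deriv f z = radial_deriv g z"
proof -
  obtain D where D: "(f has_derivative D) (at z)" "\<And>c v. D (c *s v) = c * D v" using holomorphic_ballE[OF f z] by blast
  have "(g has_derivative D) (at z)"
    by (rule has_derivative_transform_within_open[OF D(1) open_ball z]) (use assms(2) in auto)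
  then show ?thesis using radial_deriv_eq D by metis
qed

lemma radial_deriv_add:
  assumes "holomorphic_ball f" "holomorphic_ball g" and z: "z \<in> ball 0 1"
  shows "radial_deriv (\<lambda>z. f z + g z) z = radial_deriv f z + radial_deriv g z"
proof -
  obtain D where D: "(f has_derivative D) (at z)" "\<And>c v. D (c *s v) = c * D v" using holomorphic_ballE[OF assms(1) z] by blast
  obtain E where E: "(g has_derivative E) (at z)" "\<And>c v. E (c *s v) = c * E v" using holomorphic_ballE[OF assms(2) z] by blast
  show ?thesis
    using radial_deriv_eq[OF D] radial_deriv_eq[OF E] radial_deriv_eq[OF has_derivative_add[OF D(1) E(1)]] D(2) E(2)
    by (simp add: algebra_simps)
qed

lemma radial_deriv_cmult:
  assumes "holomorphic_ball f" and z: "z \<in> ball 0 1"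
  shows "radial_deriv (\<lambda>z. c * f z) z = c * radial_deriv f z"
proof -
  obtain D where D: "(f has_derivative D) (at z)" "\<And>c v. D (c *s v) = c * D v" using holomorphic_ballE[OF assms(1) z] by blast
  show ?thesis
    using radial_deriv_eq[OF D] radial_deriv_eq[OF has_derivative_mult_right[OF D(1), of c]] D(2)
    by simp
qed

lemma radial_deriv_zero: "radial_deriv (\<lambda>z. 0) z = 0"
  using radial_deriv_eq[of "\<lambda>z. 0" "\<lambda>h. 0" z] by simp

lemma radial_deriv_sum:
  assumes "finite I" "\<And>i. i \<in> I \<Longrightarrow> holomorphic_ball (f i)" and z: "z \<in> ball 0 1"
  shows "radial_deriv (\<lambda>z. \<Sum>i\<in>I. c i * f i z) z = (\<Sum>i\<in>I. c i * radial_deriv (f i) z)"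
  using assms(1,2)
proof (induction I rule: finite_induct)
  case (insert i I)
  then show ?case
    using radial_deriv_add[of "\<lambda>z. c i * f i z" "\<lambda>z. \<Sum>i\<in>I. c i * f i z" z] z
    by (simp add: holomorphic_ball_cmult holomorphic_ball_sum radial_deriv_cmult)
qed (simp add: radial_deriv_zero)

lemma radial_deriv_scale:
  assumes f: "(f has_derivative D) (at (r *\<^sub>R z))" "\<And>c v. D (c *s v) = c * D v"
  shows "radial_deriv (\<lambda>z. f (r *\<^sub>R z)) z = radial_deriv f (r *\<^sub>R z)"
proof -
  have "((\<lambda>z. r *\<^sub>R z) has_derivative (\<lambda>h. r *\<^sub>R h)) (at z)" by (auto intro!: derivative_eq_intros)
  from radial_deriv_eq[OF has_derivative_compose[OF this f(1)]] radial_deriv_eq[OF f]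
  show ?thesis by (simp add: scaleR_cscale f(2))
qed

subsection \<open>Functionals bounded in the supremum norm applied to the kernel\<close>

text \<open>A second order Taylor bound, uniform on a smaller disc. Uniformity is what allows
  differentiating the kernel under a functional that is controlled only by suprema.\<close>

lemma bker_taylor:
  assumes "r < 1"
  obtains C where "C \<ge> 0" "\<And>u v. cmod u \<le> r \<Longrightarrow> cmod v \<le> r \<Longrightarrow>
    cmod (bker s v - bker s u - of_real s * bker (s + 1) u * (v - u)) \<le> C * (cmod (v - u))\<^sup>2"
proof -
  define F :: "nat \<Rightarrow> complex \<Rightarrow> complex" where "F i u = of_real (pochhammer s i) * bker (s + real i) u" for i u
  have sub: "cball 0 r \<subseteq> ball (0::complex) 1" using assms by auto
  have "bounded (F 2 ` cball 0 r)"
    unfolding F_def by (intro compact_imp_bounded compact_continuous_image continuous_intros) (use sub in auto)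
  then obtain B where B: "\<And>u. u \<in> cball 0 r \<Longrightarrow> cmod (F 2 u) \<le> B" unfolding bounded_iff by blast
  have d: "(F i has_field_derivative F (Suc i) u) (at u within cball 0 r)" if "u \<in> cball 0 r" for i u
  proof -
    have "cmod u < 1" using that sub by auto
    from DERIV_cmult[OF has_field_derivative_bker[OF this, of "s + real i"], of "of_real (pochhammer s i)"]
    have "(F i has_field_derivative F (Suc i) u) (at u)"
      by (simp add: F_def[abs_def] pochhammer_Suc algebra_simps)
    then show ?thesis by (rule has_field_derivative_at_within)
  qed
  show ?thesis
  proof (rule that[of "\<bar>B\<bar>"])
    fix u v :: complex assume u: "cmod u \<le> r" and v: "cmod v \<le> r"
    have "cmod (F 0 v - (\<Sum>i\<le>1. F i u * (v - u) ^ i / fact i)) \<le> B * cmod (v - u) ^ Suc 1 / fact 1"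
      by (rule complex_Taylor[of "cball 0 r" 1 F]) (use u v d B in \<open>auto simp: numeral_2_eq_2\<close>)
    then have "cmod (bker s v - bker s u - of_real s * bker (s + 1) u * (v - u)) \<le> B * (cmod (v - u))\<^sup>2"
      by (simp add: F_def numeral_2_eq_2 diff_diff_eq)
    also have "\<dots> \<le> \<bar>B\<bar> * (cmod (v - u))\<^sup>2" by (intro mult_right_mono) auto
    finally show "cmod (bker s v - bker s u - of_real s * bker (s + 1) u * (v - u)) \<le> \<bar>B\<bar> * (cmod (v - u))\<^sup>2" .
  qed simp
qed

text \<open>Covers both integration against an integrable function and abstract bounded functionals
  on the Orlicz space, so that differentiation of kernel transforms is carried out once. The bound
  is phrased with an arbitrary majorant B instead of a supremum.\<close>

definition sup_functional :: "((complex ^ 'n \<Rightarrow> complex) \<Rightarrow> complex) \<Rightarrow> bool" where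
  "sup_functional \<Lambda> \<longleftrightarrow> 
    (\<forall>f g. Hinf f \<longrightarrow> Hinf g \<longrightarrow> \<Lambda> (\<lambda>z. f z + g z) = \<Lambda> f + \<Lambda> g) \<and>
    (\<forall>c f. Hinf f \<longrightarrow> \<Lambda> (\<lambda>z. c * f z) = c * \<Lambda> f) \<and>
    (\<exists>C\<ge>0. \<forall>f B. Hinf f \<longrightarrow> (\<forall>z\<in>ball 0 1. cmod (f z) \<le> B) \<longrightarrow> cmod (\<Lambda> f) \<le> C * B)"

lemma sup_functional_add: "sup_functional \<Lambda> \<Longrightarrow> Hinf f \<Longrightarrow> Hinf g \<Longrightarrow> \<Lambda> (\<lambda>z. f z + g z) = \<Lambda> f + \<Lambda> g"
  by (simp add: sup_functional_def)

lemma sup_functional_cmult: "sup_functional \<Lambda> \<Longrightarrow> Hinf f \<Longrightarrow> \<Lambda> (\<lambda>z. c * f z) = c * \<Lambda> f"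
  by (simp add: sup_functional_def)

lemma sup_functional_diff: 
  assumes "sup_functional \<Lambda>" "Hinf f" "Hinf g" shows "\<Lambda> (\<lambda>z. f z - g z) = \<Lambda> f - \<Lambda> g"
  using sup_functional_add[OF assms(1,2) Hinf_cmult[OF assms(3), of "-1"]] sup_functional_cmult[OF assms(1,3), of "-1"]
  by simp

lemma sup_functional_bound:
  assumes "sup_functional \<Lambda>"
  obtains C where "C \<ge> 0" "\<And>f B. Hinf f \<Longrightarrow> (\<And>z. z \<in> ball 0 1 \<Longrightarrow> cmod (f z) \<le> B) \<Longrightarrow> cmod (\<Lambda> f) \<le> C * B"
  using assms unfolding sup_functional_def by blast

lemma sup_functional_sum:
  assumes "sup_functional \<Lambda>" "finite I" "\<And>i. i \<in> I \<Longrightarrow> Hinf (f i)"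
  shows "\<Lambda> (\<lambda>z. \<Sum>i\<in>I. c i * f i z) = (\<Sum>i\<in>I. c i * \<Lambda> (f i))"
  using assms(2,3)
proof (induction I rule: finite_induct)
  case empty
  show ?case using sup_functional_cmult[OF assms(1) Hinf_const[of 0], of 0] by simp
next
  case (insert i I)
  have "\<Lambda> (\<lambda>z. c i * f i z + (\<Sum>i\<in>I. c i * f i z)) = \<Lambda> (\<lambda>z. c i * f i z) + \<Lambda> (\<lambda>z. \<Sum>i\<in>I. c i * f i z)"
    using insert by (intro sup_functional_add[OF assms(1)] Hinf_cmult Hinf_sum) auto
  then show ?case using insert by (simp add: sup_functional_cmult[OF assms(1)])
qed

lemma sup_functional_integral:
  assumes F: "integrable (nu \<alpha>) F"
  shows "sup_functional (\<lambda>f. LINT z|nu \<alpha>. F z * f z)"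
  unfolding sup_functional_def
proof (intro conjI allI impI)
  fix f g :: "complex ^ 'a \<Rightarrow> complex" and c
  assume f: "Hinf f"
  show "(LINT z|nu \<alpha>. F z * (c * f z)) = c * (LINT z|nu \<alpha>. F z * f z)"
    by (subst integral_mult_right_zero[symmetric]) (simp only: mult.left_commute)
  assume "Hinf g"
  then show "(LINT z|nu \<alpha>. F z * (f z + g z)) = (LINT z|nu \<alpha>. F z * f z) + (LINT z|nu \<alpha>. F z * g z)"
    using f F by (simp add: algebra_simps integrable_mult_Hinf)
next
  show "\<exists>C\<ge>0. \<forall>f B. Hinf f \<longrightarrow> (\<forall>z\<in>ball 0 1. cmod (f z) \<le> B) \<longrightarrow> cmod (LINT z|nu \<alpha>. F z * f z) \<le> C * B"
  proof (intro exI conjI allI impI)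
    show "0 \<le> (LINT z|nu \<alpha>. cmod (F z))" by simp
    fix f :: "complex ^ 'a \<Rightarrow> complex" and B assume f: "Hinf f" and B: "\<forall>z\<in>ball 0 1. cmod (f z) \<le> B"
    have "cmod (LINT z|nu \<alpha>. F z * f z) \<le> (LINT z|nu \<alpha>. cmod (F z * f z))" by (rule integral_norm_bound)
    also have "\<dots> \<le> (LINT z|nu \<alpha>. cmod (F z) * B)"
      by (intro integral_mono integrable_norm integrable_mult_Hinf[OF F f] integrable_mult_left F)
         (use B in \<open>auto simp: norm_mult intro!: mult_left_mono\<close>)
    finally show "cmod (LINT z|nu \<alpha>. F z * f z) \<le> (LINT z|nu \<alpha>. cmod (F z)) * B" by simp
  qed
qed

text \<open>The kernel is antiholomorphic in w; the conjugation makes the transform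
  holomorphic.\<close>

definition ktrans :: "((complex ^ 'n \<Rightarrow> complex) \<Rightarrow> complex) \<Rightarrow> real \<Rightarrow> complex ^ 'n \<Rightarrow> complex" where
  "ktrans \<Lambda> s w = cnj (\<Lambda> (\<lambda>z. bker s (herm z w)))"

text \<open>For w and y in a ball of radius r < 1 the numbers <z,w> and <z,y> stay in the disc of
  radius r for every z. Hence the Taylor remainder is quadratically small uniformly in z, and the
  sup bound of \<Lambda> passes this on to the transform.\<close>

lemma ktrans_derivative:
  fixes s :: real
  assumes \<Lambda>: "sup_functional \<Lambda>" and w: "w \<in> ball 0 1"
  defines "D \<equiv> (\<lambda>h. cnj (\<Lambda> (\<lambda>z. (of_real s * bker (s + 1) (herm z w)) * herm z h)))"
  shows "(ktrans \<Lambda> s has_derivative D) (at w)" "D (c *s v) = c * D v"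
proof -
  obtain K where K: "K \<ge> 0" "\<And>f B. Hinf f \<Longrightarrow> (\<And>z. z \<in> ball 0 1 \<Longrightarrow> cmod (f z) \<le> B) \<Longrightarrow> cmod (\<Lambda> f) \<le> K * B"
    using sup_functional_bound[OF \<Lambda>] by blast
  let ?e = "\<lambda>z. of_real s * bker (s + 1) (herm z w)"
  have e: "Hinf ?e" by (intro Hinf_cmult Hinf_bker w)
  have eh: "Hinf (\<lambda>z. ?e z * herm z h)" for h by (intro Hinf_mult[OF e] Hinf_herm)
  obtain E where E: "E \<ge> 0" "\<And>z. z \<in> ball 0 1 \<Longrightarrow> cmod (?e z) \<le> E" using HinfE[OF e] by blast
  have hh: "cmod (herm z h) \<le> norm h" if "z \<in> ball 0 1" for z h
    using norm_herm_le[of z h] that mult_right_mono[of "norm z" 1 "norm h"] by simp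
  have Dc: "D (c *s v) = c * D v" for c v
  proof -
    have "D (c *s v) = cnj (\<Lambda> (\<lambda>z. cnj c * (?e z * herm z v)))"
      unfolding D_def by (simp add: herm_cscale_right mult_ac)
    then show ?thesis using sup_functional_cmult[OF \<Lambda> eh, of "cnj c" v] by (simp add: D_def)
  qed
  then show "D (c *s v) = c * D v" .
  have bl: "bounded_linear D"
  proof (rule bounded_linear_intro)
    show "D (x + y) = D x + D y" for x y
      unfolding D_def herm_add_right distrib_left using sup_functional_add[OF \<Lambda> eh eh, of x y] by simp
    show "D (r *\<^sub>R x) = r *\<^sub>R D x" for r x by (simp add: scaleR_cscale Dc scaleR_conv_of_real)
    show "norm (D x) \<le> norm x * (K * E)" for x
    proof -
      have "cmod (\<Lambda> (\<lambda>z. ?e z * herm z x)) \<le> K * (E * norm x)"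
        by (rule K(2)[OF eh]) (subst norm_mult, rule mult_mono[OF E(2) hh], auto simp: E(1))
      then show ?thesis by (simp add: D_def mult_ac)
    qed
  qed
  obtain r where r: "norm w < r" "r < 1" using dense[of "norm w" 1] w by auto
  obtain C where C: "C \<ge> 0" "\<And>u v. cmod u \<le> r \<Longrightarrow> cmod v \<le> r \<Longrightarrow>
    cmod (bker s v - bker s u - of_real s * bker (s + 1) u * (v - u)) \<le> C * (cmod (v - u))\<^sup>2" using bker_taylor[OF r(2)] by blast
  have hr: "cmod (herm z y) \<le> r" if "z \<in> ball 0 1" "norm y \<le> r" for z y using hh[OF that(1), of y] that(2) by simp
  show "(ktrans \<Lambda> s has_derivative D) (at w)"
  proof (rule has_derivativeI_sandwich[where e="r - norm w" and H="\<lambda>y. K * C * norm (y - w)"])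
    show "0 < r - norm w" using r by simp
    show "bounded_linear D" by fact
    show "((\<lambda>y. K * C * norm (y - w)) \<longlongrightarrow> 0) (at w)" by (rule tendsto_eq_intros refl | simp)+
    fix y assume y: "y \<noteq> w" "dist y w < r - norm w"
    have yr: "norm y < r" using norm_triangle_ineq[of "y - w" w] y by (simp add: dist_norm)
    then have yb: "y \<in> ball 0 1" using r by simp
    have "ktrans \<Lambda> s y - ktrans \<Lambda> s w - D (y - w) = cnj (\<Lambda> (\<lambda>z. bker s (herm z y) - bker s (herm z w) - ?e z * herm z (y - w)))"
      unfolding ktrans_def D_def
      using sup_functional_diff[OF \<Lambda> Hinf_diff[OF Hinf_bker[OF yb] Hinf_bker[OF w]] eh] sup_functional_diff[OF \<Lambda> Hinf_bker[OF yb] Hinf_bker[OF w]]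
      by simp
    also have "cmod \<dots> \<le> K * (C * (norm (y - w))\<^sup>2)"
    proof (subst complex_mod_cnj, rule K(2))
      show "Hinf (\<lambda>z. bker s (herm z y) - bker s (herm z w) - ?e z * herm z (y - w))"
        by (intro Hinf_diff Hinf_bker yb w eh)
      fix z :: "complex ^ 'a" assume z: "z \<in> ball 0 1"
      have "cmod (bker s (herm z y) - bker s (herm z w) - ?e z * herm z (y - w)) \<le> C * (cmod (herm z (y - w)))\<^sup>2"
        unfolding herm_diff_right by (rule C(2)) (rule hr[OF z less_imp_le[OF r(1)]], rule hr[OF z less_imp_le[OF yr]])
      also have "\<dots> \<le> C * (norm (y - w))\<^sup>2"
        using hh[OF z, of "y - w"] C(1) by (intro mult_left_mono power_mono) auto
      finally show "cmod (bker s (herm z y) - bker s (herm z w) - ?e z * herm z (y - w)) \<le> C * (norm (y - w))\<^sup>2" .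
    qed
    finally show "norm (ktrans \<Lambda> s y - ktrans \<Lambda> s w - D (y - w)) / norm (y - w) \<le> K * C * norm (y - w)"
      using y by (simp add: divide_le_eq power2_eq_square mult_ac)
  qed
qed

lemma holomorphic_ball_ktrans: "sup_functional \<Lambda> \<Longrightarrow> holomorphic_ball (ktrans \<Lambda> s)"
  by (rule holomorphic_ballI[OF ktrans_derivative])

lemma bker_Suc: "cmod u < 1 \<Longrightarrow> bker (s + 1) u * u = bker (s + 1) u - bker s u"
proof -
  assume "cmod u < 1"
  then have "bker (-1) u = 1 - u" using one_minus_nz[of u] by (simp add: bker_def)
  then have "bker s u = bker (s + 1) u * (1 - u)" using bker_add[of "s + 1" "-1" u] by simp
  then show ?thesis by (simp add: algebra_simps)
qed

text \<open>Writing <z,w> = 1 - (1 - <z,w>) in the derivative of the kernel leaves only kernels of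
  orders s and s + 1, without a polynomial factor.\<close>

lemma radial_deriv_ktrans:
  assumes \<Lambda>: "sup_functional \<Lambda>" and w: "w \<in> ball 0 1"
  shows "radial_deriv (ktrans \<Lambda> s) w = of_real s * (ktrans \<Lambda> (s + 1) w - ktrans \<Lambda> s w)"
proof -
  obtain K where K: "K \<ge> 0" "\<And>f B. Hinf f \<Longrightarrow> (\<And>z. z \<in> ball 0 1 \<Longrightarrow> cmod (f z) \<le> B) \<Longrightarrow> cmod (\<Lambda> f) \<le> K * B"
    using sup_functional_bound[OF \<Lambda>] by blast
  let ?g = "\<lambda>z. of_real s * (bker (s + 1) (herm z w) - bker s (herm z w))"
  let ?f = "\<lambda>z. (of_real s * bker (s + 1) (herm z w)) * herm z w"
  have h: "Hinf ?f" "Hinf ?g" by (intro Hinf_mult Hinf_const Hinf_bker w[unfolded mem_ball_0] Hinf_herm Hinf_diff w)+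
  have "?f z = ?g z" if "z \<in> ball 0 1" for z
    using bker_Suc[of "herm z w" s] norm_herm_less_1[of z w] that w by (simp add: mult.assoc)
  \<comment> \<open>\<Lambda> acts on functions defined on the whole space; the sup bound with B = 0
    shows that it depends only on values in the ball.\<close>
  then have "cmod (\<Lambda> (\<lambda>z. ?f z - ?g z)) \<le> K * 0" by (intro K(2) Hinf_diff h) auto
  then have "\<Lambda> ?f = \<Lambda> ?g" using sup_functional_diff[OF \<Lambda> h] by simp
  then have "radial_deriv (ktrans \<Lambda> s) w = cnj (\<Lambda> ?g)"
    using radial_deriv_eq[OF ktrans_derivative[OF \<Lambda> w]] by simp
  then show ?thesis
    unfolding ktrans_def sup_functional_cmult[OF \<Lambda> Hinf_diff[OF Hinf_bker[OF w] Hinf_bker[OF w]]] 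
      sup_functional_diff[OF \<Lambda> Hinf_bker[OF w] Hinf_bker[OF w]] by simp
qed

text \<open>The coefficients are chosen before the functional and the point: the same combination of
  kernels can then be fed to an operator as a test function.\<close>

lemma radial_pow_ktrans:
  "\<exists>c :: nat \<Rightarrow> real. \<forall>\<Lambda> :: (complex ^ 'n \<Rightarrow> complex) \<Rightarrow> complex. sup_functional \<Lambda> \<longrightarrow> 
    holomorphic_ball ((radial_deriv ^^ k) (ktrans \<Lambda> s)) \<and>
    (\<forall>w\<in>ball 0 1. (radial_deriv ^^ k) (ktrans \<Lambda> s) w = (\<Sum>j\<le>k. of_real (c j) * ktrans \<Lambda> (s + real j) w))"
proof (induction k)
  case 0
  show ?case by (rule exI[of _ "\<lambda>_. 1"]) (simp add: holomorphic_ball_ktrans)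
next
  case (Suc k)
  then obtain c :: "nat \<Rightarrow> real" where c: "\<And>\<Lambda> :: (complex ^ 'n \<Rightarrow> complex) \<Rightarrow> complex. sup_functional \<Lambda> \<Longrightarrow> holomorphic_ball ((radial_deriv ^^ k) (ktrans \<Lambda> s))"
    "\<And>\<Lambda> :: (complex ^ 'n \<Rightarrow> complex) \<Rightarrow> complex. \<And>w. sup_functional \<Lambda> \<Longrightarrow> w \<in> ball 0 1 \<Longrightarrow>
      (radial_deriv ^^ k) (ktrans \<Lambda> s) w = (\<Sum>j\<le>k. of_real (c j) * ktrans \<Lambda> (s + real j) w)" by blast
  \<comment> \<open>One more radial derivative sends the kernel of order s + j to (s + j) times the
    difference of the kernels of orders s + j + 1 and s + j; the two summands collect the
    contributions to order s + j from itself and from order s + j - 1.\<close>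
  define c' where "c' j = (if j \<le> k then - c j * (s + real j) else 0) + (if j = 0 then 0 else c (j - 1) * (s + real (j - 1)))" for j
  show ?case
  proof (rule exI[of _ c'], intro allI impI)
    fix \<Lambda> :: "(complex ^ 'n \<Rightarrow> complex) \<Rightarrow> complex" assume \<Lambda>: "sup_functional \<Lambda>"
    note hk = holomorphic_ball_ktrans[OF \<Lambda>]
    have *: "(radial_deriv ^^ Suc k) (ktrans \<Lambda> s) w = (\<Sum>j\<le>Suc k. of_real (c' j) * ktrans \<Lambda> (s + real j) w)" if w: "w \<in> ball 0 1" for w
    proof -
      have "(radial_deriv ^^ Suc k) (ktrans \<Lambda> s) w = radial_deriv (\<lambda>w. \<Sum>j\<le>k. of_real (c j) * ktrans \<Lambda> (s + real j) w) w"
        using radial_deriv_cong[OF c(1)[OF \<Lambda>] c(2)[OF \<Lambda>] w] by simp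
      also have "\<dots> = (\<Sum>j\<le>k. of_real (c j) * radial_deriv (ktrans \<Lambda> (s + real j)) w)"
        by (rule radial_deriv_sum) (use hk w in auto)
      also have "\<dots> = (\<Sum>j\<le>k. of_real (- c j * (s + real j)) * ktrans \<Lambda> (s + real j) w + of_real (c j * (s + real j)) * ktrans \<Lambda> (s + real (Suc j)) w)"
        by (simp add: radial_deriv_ktrans[OF \<Lambda> w] algebra_simps)
      also have "\<dots> = (\<Sum>j\<le>k. of_real (- c j * (s + real j)) * ktrans \<Lambda> (s + real j) w) + (\<Sum>j\<le>k. of_real (c j * (s + real j)) * ktrans \<Lambda> (s + real (Suc j)) w)"
        by (rule sum.distrib)
      also have "(\<Sum>j\<le>k. of_real (- c j * (s + real j)) * ktrans \<Lambda> (s + real j) w) = (\<Sum>j\<le>Suc k. of_real (if j \<le> k then - c j * (s + real j) else 0) * ktrans \<Lambda> (s + real j) w)"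
        by simp
      also have "(\<Sum>j\<le>k. of_real (c j * (s + real j)) * ktrans \<Lambda> (s + real (Suc j)) w) = (\<Sum>j\<le>Suc k. of_real (if j = 0 then 0 else c (j - 1) * (s + real (j - 1))) * ktrans \<Lambda> (s + real j) w)"
        by (subst sum.atMost_Suc_shift) simp
      finally show ?thesis unfolding c'_def by (simp only: of_real_add distrib_right sum.distrib)
    qed
    have "holomorphic_ball (\<lambda>w. \<Sum>j\<le>Suc k. of_real (c' j) * ktrans \<Lambda> (s + real j) w)"
      by (intro holomorphic_ball_sum holomorphic_ball_cmult hk)
    then have "holomorphic_ball ((radial_deriv ^^ Suc k) (ktrans \<Lambda> s))"
      by (rule holomorphic_ball_cong) (simp only: *)
    with * show "holomorphic_ball ((radial_deriv ^^ Suc k) (ktrans \<Lambda> s)) \<and>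
      (\<forall>w\<in>ball 0 1. (radial_deriv ^^ Suc k) (ktrans \<Lambda> s) w = (\<Sum>j\<le>Suc k. of_real (c' j) * ktrans \<Lambda> (s + real j) w))" by blast
  qed
qed

text \<open>For s = n + 1 + \<alpha> this is the Bergman projection. For larger s and holomorphic F
  it acts as a radial differential operator of order s - (n + 1 + \<alpha>).\<close>

definition kint :: "real \<Rightarrow> (complex ^ 'n \<Rightarrow> complex) \<Rightarrow> real \<Rightarrow> complex ^ 'n \<Rightarrow> complex" where
  "kint \<alpha> F s z = (LINT \<xi>|nu \<alpha>. F \<xi> * bker s (herm z \<xi>))"

lemma kint_ktrans:
  assumes "w \<in> ball 0 1"
  shows "kint \<alpha> F s w = ktrans (\<lambda>\<phi>. LINT \<xi>|nu \<alpha>. cnj (F \<xi>) * \<phi> \<xi>) s w"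
proof -
  have "kint \<alpha> F s w = (LINT \<xi>|nu \<alpha>. cnj (cnj (F \<xi>) * bker s (herm \<xi> w)))"
    unfolding kint_def
  proof (rule Bochner_Integration.integral_cong[OF refl])
    fix \<xi> :: "complex ^ 'a" assume "\<xi> \<in> space (nu \<alpha>)"
    then have "cmod (herm \<xi> w) < 1" using assms norm_herm_less_1[of \<xi> w] by simp
    then show "F \<xi> * bker s (herm w \<xi>) = cnj (cnj (F \<xi>) * bker s (herm \<xi> w))"
      by (simp add: cnj_bker cnj_herm)
  qed
  then show ?thesis unfolding ktrans_def by (simp only: Bochner_Integration.integral_cnj)
qed

lemma sup_functional_cnj: "integrable (nu \<alpha>) F \<Longrightarrow> sup_functional (\<lambda>\<phi>. LINT \<xi>|nu \<alpha>. cnj (F \<xi>) * \<phi> \<xi>)"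
  by (rule sup_functional_integral) simp

lemma holomorphic_ball_kint:
  assumes "integrable (nu \<alpha>) F" shows "holomorphic_ball (kint \<alpha> F s)"
  by (rule holomorphic_ball_cong[OF holomorphic_ball_ktrans[OF sup_functional_cnj[OF assms]]]) (simp add: kint_ktrans)

lemma radial_deriv_kint:
  assumes "integrable (nu \<alpha>) F" and w: "w \<in> ball 0 1"
  shows "radial_deriv (kint \<alpha> F s) w = of_real s * (kint \<alpha> F (s + 1) w - kint \<alpha> F s w)"
  using radial_deriv_cong[OF holomorphic_ball_ktrans[OF sup_functional_cnj[OF assms(1)]] _ w, of s "kint \<alpha> F s"]
    radial_deriv_ktrans[OF sup_functional_cnj[OF assms(1)] w] w
  by (simp add: kint_ktrans)

lemma kint_reproducing:
  fixes f :: "complex ^ 'n \<Rightarrow> complex"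
  assumes "holomorphic_ball f" "\<alpha> > -1" "integrable (nu \<alpha>) f" "w \<in> ball 0 1"
  shows "kint \<alpha> f (real CARD('n) + 1 + \<alpha>) w = f w"
  unfolding kint_def by (rule reproducing_formula[OF assms])

text \<open>A dilate of f is bounded, hence equals its kernel integral, whose radial derivative is a
  difference of kernel integrals and so holomorphic. R commutes with dilations, and r can be taken
  close enough to 1 to reach any given point. The weight 0 is an arbitrary choice.\<close>

lemma holomorphic_radial_deriv:
  fixes f :: "complex ^ 'n \<Rightarrow> complex"
  assumes f: "holomorphic_ball f"
  shows "holomorphic_ball (radial_deriv f)"
  unfolding holomorphic_ball_def
proof
  fix z0 :: "complex ^ 'n" assume z0: "z0 \<in> ball 0 1"
  obtain r where r: "norm z0 < r" "r < 1" using dense[of "norm z0" 1] z0 by auto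
  have r0: "r > 0" using r(1) norm_ge_zero[of z0] by linarith
  let ?N = "real CARD('n) + 1 + 0"
  let ?F = "\<lambda>z. f (r *\<^sub>R z)"
  have F: "Hinf ?F" using Hinf_dilate[OF f] r0 r by simp
  have iF: "integrable (nu 0) ?F" by (rule Hinf_integrable[OF F]) simp
  define T where "T = kint 0 ?F ?N"
  define U where "U = (\<lambda>z. of_real ?N * (kint 0 ?F (?N + 1) z - T z))"
  have T: "T z = f (r *\<^sub>R z)" if "z \<in> ball 0 1" for z
    unfolding T_def by (rule kint_reproducing[OF HinfD[OF F] _ iF that]) simp
  have hU: "holomorphic_ball U"
    unfolding U_def T_def by (intro holomorphic_ball_cmult holomorphic_ball_diff holomorphic_ball_kint iF)
  have U: "radial_deriv T z = U z" if "z \<in> ball 0 1" for z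
    unfolding T_def U_def by (rule radial_deriv_kint[OF iF that])
  have hT: "holomorphic_ball T" unfolding T_def by (rule holomorphic_ball_kint[OF iF])
  have eq: "U (inverse r *\<^sub>R z) = radial_deriv f z" if z: "z \<in> ball 0 r" for z
  proof -
    have zr: "inverse r *\<^sub>R z \<in> ball 0 1" using z r0 by (simp add: field_simps)
    have z1: "z \<in> ball 0 1" using z r by simp
    obtain D where D: "(f has_derivative D) (at z)" "\<And>c v. D (c *s v) = c * D v" using holomorphic_ballE[OF f z1] by blast
    have "radial_deriv f z = radial_deriv ?F (inverse r *\<^sub>R z)"
      using radial_deriv_scale[of f D r "inverse r *\<^sub>R z"] D r0 by simp
    also have "\<dots> = radial_deriv T (inverse r *\<^sub>R z)"
      using radial_deriv_cong[OF hT T zr] by simp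
    also have "\<dots> = U (inverse r *\<^sub>R z)" by (rule U[OF zr])
    finally show ?thesis by simp
  qed
  have "inverse r *\<^sub>R z0 \<in> ball 0 1" using r r0 by (simp add: field_simps)
  then obtain E where E: "(U has_derivative E) (at (inverse r *\<^sub>R z0))" "\<And>c v. E (c *s v) = c * E v" using holomorphic_ballE[OF hU] by blast
  have "((\<lambda>z. inverse r *\<^sub>R z) has_derivative (\<lambda>h. inverse r *\<^sub>R h)) (at z0)" by (auto intro!: derivative_eq_intros)
  from has_derivative_compose[OF this E(1)]
  have "((\<lambda>z. U (inverse r *\<^sub>R z)) has_derivative (\<lambda>h. E (inverse r *\<^sub>R h))) (at z0)" .
  then have "(radial_deriv f has_derivative (\<lambda>h. E (inverse r *\<^sub>R h))) (at z0)"
    by (rule has_derivative_transform_within_open[OF _ open_ball, of _ _ _ _ 0 r]) (use r eq in auto)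
  moreover have "E (inverse r *\<^sub>R (c *s v)) = c * E (inverse r *\<^sub>R v)" for c v
    by (simp add: scaleR_cscale E(2))
  ultimately show "\<exists>D. (radial_deriv f has_derivative D) (at z0) \<and> (\<forall>c v. D (c *s v) = c * D v)" by blast
qed

lemma holomorphic_radial_pow: "holomorphic_ball f \<Longrightarrow> holomorphic_ball ((radial_deriv ^^ k) f)"
  by (induction k) (auto intro: holomorphic_radial_deriv)

text \<open>Raising the order of the kernel from s to s + 1 amounts to applying 1 + R/s. Starting
  from the reproducing order, k steps give a polynomial of degree at most k in R, with coefficients
  that do not depend on b.\<close>

lemma kint_radial_polynomial:
  assumes \<alpha>: "\<alpha> > -1"
  shows "\<exists>q :: nat \<Rightarrow> real. \<forall>b :: complex ^ 'n \<Rightarrow> complex. holomorphic_ball b \<longrightarrow> integrable (nu \<alpha>) b \<longrightarrow>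
    (\<forall>z\<in>ball 0 1. kint \<alpha> b (real CARD('n) + 1 + \<alpha> + real k) z = (\<Sum>i\<le>k. of_real (q i) * (radial_deriv ^^ i) b z))"
proof (induction k)
  case 0
  show ?case by (rule exI[of _ "\<lambda>_. 1"]) (simp add: kint_reproducing[OF _ \<alpha>])
next
  case (Suc k)
  let ?s = "real CARD('n) + 1 + \<alpha> + real k"
  have s: "?s > 0" using \<alpha> by simp
  from Suc obtain q where q: "\<And>b :: complex ^ 'n \<Rightarrow> complex. \<And>z. holomorphic_ball b \<Longrightarrow> integrable (nu \<alpha>) b \<Longrightarrow> z \<in> ball 0 1 \<Longrightarrow>
    kint \<alpha> b ?s z = (\<Sum>i\<le>k. of_real (q i) * (radial_deriv ^^ i) b z)" by blast
  define q' where "q' i = (if i \<le> k then q i else 0) + (if i = 0 then 0 else q (i - 1) / ?s)" for i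
  show ?case
  proof (rule exI[of _ q'], intro allI impI ballI)
    fix b :: "complex ^ 'n \<Rightarrow> complex" and z :: "complex ^ 'n" assume b: "holomorphic_ball b" "integrable (nu \<alpha>) b" and z: "z \<in> ball 0 1"
    have "kint \<alpha> b (?s + 1) z = kint \<alpha> b ?s z + radial_deriv (kint \<alpha> b ?s) z / of_real ?s"
      using radial_deriv_kint[OF b(2) z, of ?s] s by (simp only: of_real_eq_0_iff) (simp add: field_simps del: of_real_add)
    also have "radial_deriv (kint \<alpha> b ?s) z = radial_deriv (\<lambda>z. \<Sum>i\<le>k. of_real (q i) * (radial_deriv ^^ i) b z) z"
      by (rule radial_deriv_cong[OF holomorphic_ball_kint[OF b(2)] q[OF b] z])
    also have "\<dots> = (\<Sum>i\<le>k. of_real (q i) * (radial_deriv ^^ Suc i) b z)"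
      by (subst radial_deriv_sum) (use holomorphic_radial_pow[OF b(1)] z in auto)
    also have "kint \<alpha> b ?s z + (\<Sum>i\<le>k. of_real (q i) * (radial_deriv ^^ Suc i) b z) / of_real ?s =
      (\<Sum>i\<le>k. of_real (q i) * (radial_deriv ^^ i) b z) + (\<Sum>i\<le>k. of_real (q i / ?s) * (radial_deriv ^^ Suc i) b z)"
      by (simp only: q[OF b z] sum_divide_distrib of_real_divide times_divide_eq_left)
    also have "(\<Sum>i\<le>k. of_real (q i) * (radial_deriv ^^ i) b z) = (\<Sum>i\<le>Suc k. of_real (if i \<le> k then q i else 0) * (radial_deriv ^^ i) b z)"
      by simp
    also have "(\<Sum>i\<le>k. of_real (q i / ?s) * (radial_deriv ^^ Suc i) b z) = (\<Sum>i\<le>Suc k. of_real (if i = 0 then 0 else q (i - 1) / ?s) * (radial_deriv ^^ i) b z)"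
      by (subst sum.atMost_Suc_shift) simp
    finally have "kint \<alpha> b (?s + 1) z = (\<Sum>i\<le>Suc k. of_real (q' i) * (radial_deriv ^^ i) b z)"
      unfolding q'_def by (simp only: of_real_add distrib_right sum.distrib)
    then show "kint \<alpha> b (real CARD('n) + 1 + \<alpha> + real (Suc k)) z = (\<Sum>i\<le>Suc k. of_real (q' i) * (radial_deriv ^^ i) b z)"
      by (simp only: of_nat_Suc) (simp only: add_ac)
  qed
qed

section \<open>Kernel estimates\<close>

lemma bker_of_real: "x < 1 \<Longrightarrow> bker s (of_real x) = of_real ((1 - x) powr (- s))"
proof -
  assume "x < 1"
  then have "of_real (1 - x) powr of_real (- s) = complex_of_real ((1 - x) powr (- s))"
    by (intro powr_of_real) auto
  then show ?thesis by (simp add: bker_def)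
qed

text \<open>The reproducing formula is applied to the kernel at w itself and evaluated at w.\<close>

lemma nn_kernel_square:
  assumes \<alpha>: "\<alpha> > -1" and w: "(w :: complex ^ 'n) \<in> ball 0 1"
  shows "(\<integral>\<^sup>+z. ennreal (cmod (1 - herm z w) powr (- 2 * (real CARD('n) + 1 + \<alpha>))) \<partial>nu \<alpha>) = ennreal (bdef w powr (- (real CARD('n) + 1 + \<alpha>)))"
proof -
  let ?N = "real CARD('n) + 1 + \<alpha>"
  let ?f = "\<lambda>z. bker ?N (herm z w)"
  have f: "Hinf ?f" by (rule Hinf_bker[OF w])
  have i: "integrable (nu \<alpha>) ?f" by (rule Hinf_integrable[OF f \<alpha>])
  have d: "bdef w > 0" by (rule bdef_pos[OF w])
  have sq: "?f z * bker ?N (herm w z) = of_real (cmod (1 - herm z w) powr (- 2 * ?N))" if "z \<in> ball 0 1" for z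
  proof -
    have "cmod (herm z w) < 1" using that w norm_herm_less_1[of z w] by simp
    then have "bker ?N (herm w z) = cnj (?f z)" by (simp add: cnj_bker cnj_herm)
    then have "?f z * bker ?N (herm w z) = of_real ((cmod (?f z))\<^sup>2)" by (simp only: complex_norm_square)
    also have "(cmod (?f z))\<^sup>2 = cmod (1 - herm z w) powr (- 2 * ?N)"
      unfolding norm_bker power2_eq_square powr_add[symmetric] by (simp add: algebra_simps)
    finally show ?thesis .
  qed
  have r: "(LINT z|nu \<alpha>. ?f z * bker ?N (herm w z)) = ?f w"
    by (rule reproducing_formula[OF HinfD[OF f] \<alpha> i w])
  have "?f w = of_real (bdef w powr (- ?N))"
    unfolding herm_self by (rule bker_of_real) (use d in simp)
  then have "(LINT z|nu \<alpha>. complex_of_real (cmod (1 - herm z w) powr (- 2 * ?N))) = of_real (bdef w powr (- ?N))"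
    using r sq by (subst (asm) Bochner_Integration.integral_cong[OF refl]) auto
  then have L: "(LINT z|nu \<alpha>. cmod (1 - herm z w) powr (- 2 * ?N)) = bdef w powr (- ?N)"
    by (simp only: integral_complex_of_real of_real_eq_iff)
  have "integrable (nu \<alpha>) (\<lambda>z. complex_of_real (cmod (1 - herm z w) powr (- 2 * ?N)))"
  proof -
    have "integrable (nu \<alpha>) (\<lambda>z. cmod (?f z * ?f z))" by (intro integrable_norm integrable_mult_Hinf[OF i f])
    also have "(\<lambda>z. cmod (?f z * ?f z)) = (\<lambda>z. cmod (1 - herm z w) powr (- 2 * ?N))"
      unfolding norm_mult norm_bker powr_add[symmetric] by (simp add: algebra_simps)
    finally show ?thesis by (rule integrable_of_real)
  qed
  then have "integrable (nu \<alpha>) (\<lambda>z. cmod (1 - herm z w) powr (- 2 * ?N))"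
    by (simp only: complex_of_real_integrable_eq)
  from nn_integral_eq_integral[OF this] show ?thesis unfolding L by simp
qed

lemma kernel_lower:
  assumes "z \<in> ball 0 1" "w \<in> ball 0 1"
  shows "bdef w / 2 \<le> cmod (1 - herm z w)" "bdef z / 2 \<le> cmod (1 - herm z w)" "cmod (1 - herm z w) \<le> 2" "0 < cmod (1 - herm z w)"
proof -
  have 1: "1 - cmod (herm z w) \<le> cmod (1 - herm z w)" using norm_triangle_ineq2[of 1 "herm z w"] by simp
  have 2: "cmod (herm z w) \<le> norm w" "cmod (herm z w) \<le> norm z"
    using norm_herm_le[of z w] mult_right_mono[of "norm z" 1 "norm w"] mult_left_mono[of "norm w" 1 "norm z"] assms by auto
  have 3: "bdef x / 2 \<le> 1 - norm x" for x :: "complex ^ 'a"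
  proof -
    have "2 * norm x \<le> 1 + norm x * norm x"
      using zero_le_power2[of "1 - norm x"] by (simp add: power2_eq_square algebra_simps)
    then show ?thesis by (simp add: power2_eq_square)
  qed
  show "bdef w / 2 \<le> cmod (1 - herm z w)" "bdef z / 2 \<le> cmod (1 - herm z w)" using 1 2 3[of w] 3[of z] by linarith+
  show "cmod (1 - herm z w) \<le> 2" using norm_triangle_ineq4[of 1 "herm z w"] 2 assms by simp
  show "0 < cmod (1 - herm z w)" using 1 2 assms by auto
qed

lemma nn_integral_powr_tail:
  assumes "\<delta> > 0" "a > 0" "a \<le> 1"
  shows "(\<integral>\<^sup>+r. ennreal (r powr (- \<delta> - 1)) * indicator {a..1} r \<partial>lborel) \<le> ennreal (a powr (- \<delta>) / \<delta>)"
proof -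
  have "(\<integral>\<^sup>+r. ennreal (r powr (- \<delta> - 1)) * indicator {a..1} r \<partial>lborel) = ennreal ((- (1 powr (-\<delta>) / \<delta>)) - (- (a powr (- \<delta>) / \<delta>)))"
  proof (rule nn_integral_FTC_Icc[where F="\<lambda>r. - (r powr (- \<delta>) / \<delta>)"])
    fix r assume "r \<in> {a..1}"
    then have "r > 0" using assms by simp
    then show "((\<lambda>r. - (r powr (- \<delta>) / \<delta>)) has_real_derivative r powr (- \<delta> - 1)) (at r)"
      using assms by (auto intro!: derivative_eq_intros)

  qed (use assms in auto)
  also have "\<dots> \<le> ennreal (a powr (- \<delta>) / \<delta>)" using assms by (intro ennreal_leI) auto
  finally show ?thesis .
qed

text \<open>A one-parameter family of the exactly computable integrals dominates the kernel: for
  \<open>r\<close> comparable to \<open>\<bar>1 - u\<bar>\<close> one has \<open>\<bar>1 - (1 - r) u\<bar> \<le> 2 \<bar>1 - u\<bar>\<close>.\<close>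

lemma forelli_rudin:
  assumes \<alpha>: "\<alpha> > -1" and \<delta>: "\<delta> > 0"
  shows "\<exists>C>0. \<forall>w\<in>ball (0::complex ^ 'n) 1. (\<integral>\<^sup>+z. ennreal (cmod (1 - herm z w) powr (- (real CARD('n) + 1 + \<alpha> + \<delta>))) \<partial>nu \<alpha>) \<le> ennreal (C * bdef w powr (- \<delta>))"
proof -
  let ?N = "real CARD('n) + 1 + \<alpha>"
  let ?e = "?N - \<delta> - 1"
  have N: "?N > 0" using \<alpha> by simp
  \<comment> \<open>The minimum of x^e over [1/4, 1/2], where e = N - \<delta> - 1 may have either
    sign.\<close>
  define c0 where "c0 = min ((1/4) powr ?e) ((1/2) powr ?e)"
  have c0: "c0 > 0" by (simp add: c0_def)
  define c where "c = c0 * 2 powr (- 2 * ?N) / 4"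
  have c: "c > 0" using c0 by (simp add: c_def)
  define C where "C = (1/8) powr (- \<delta>) / \<delta> / c"
  have C: "C > 0" using c \<delta> by (simp add: C_def)
  show ?thesis
  proof (rule exI[of _ C], intro conjI C ballI)
    fix w :: "complex ^ 'n" assume w: "w \<in> ball 0 1"
    define d where "d = bdef w"
    have d: "0 < d" "d \<le> 1" using bdef_pos[OF w] by (simp_all add: d_def)
    \<comment> \<open>With y = |1 - <z,w>| \<ge> d/2 and y \<le> 2, the interval [y/4, y/2] that
      matters for z lies in [d/8, 1], whatever z is. The exponent e of r makes the r-integral below
      diverge exactly like d^(-\<delta>).\<close>
    let ?k = "\<lambda>z r. ennreal (r powr ?e * cmod (1 - herm z ((1 - r) *\<^sub>R w)) powr (- 2 * ?N)) * indicator {d/8..1} r"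
    have low: "ennreal (c * cmod (1 - herm z w) powr (- (?N + \<delta>))) \<le> (\<integral>\<^sup>+r. ?k z r \<partial>lborel)" if z: "z \<in> ball 0 1" for z
    proof -
      define y where "y = cmod (1 - herm z w)"
      have y: "d / 2 \<le> y" "y \<le> 2" "y > 0" using kernel_lower[OF z w] by (auto simp: y_def d_def)
      have "ennreal (c * y powr (- (?N + \<delta>))) = ennreal (c0 * y powr ?e * (2 * y) powr (- 2 * ?N)) * ennreal (y / 4)"
      proof -
        have "y powr (- (?N + \<delta>)) = y powr ?e * y powr (- 2 * ?N) * y" 
        proof -
          have "y powr ?e * y powr (- 2 * ?N) * y powr 1 = y powr (?e + (- 2 * ?N) + 1)" by (simp only: powr_add)
          also have "?e + (- 2 * ?N) + 1 = - (?N + \<delta>)" by simp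
          finally show ?thesis using y by simp
        qed
        then show ?thesis using y c0 by (simp add: c_def powr_mult flip: ennreal_mult)
      qed
      also have "\<dots> = (\<integral>\<^sup>+r. ennreal (c0 * y powr ?e * (2 * y) powr (- 2 * ?N)) * indicator {y/4..y/2} r \<partial>lborel)"
        using y by (subst nn_integral_cmult_indicator) auto
      also have "\<dots> \<le> (\<integral>\<^sup>+r. ?k z r \<partial>lborel)"
      proof (rule nn_integral_mono)
        fix r :: real
        show "ennreal (c0 * y powr ?e * (2 * y) powr (- 2 * ?N)) * indicator {y/4..y/2} r \<le> ?k z r"
        proof (cases "r \<in> {y/4..y/2}")
          case True
          then have r: "y/4 \<le> r" "r \<le> y/2" "d/8 \<le> r" "r \<le> 1" "0 < r" using y by auto
          have 1: "c0 * y powr ?e \<le> r powr ?e"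
          proof -
            define x where "x = r / y"
            have x: "1/4 \<le> x" "x \<le> 1/2" "r = x * y" using r y by (auto simp: x_def field_simps)
            have "c0 \<le> x powr ?e"
            proof (cases "?e \<ge> 0")
              case True
              then have "(1/4) powr ?e \<le> x powr ?e" using x by (intro powr_mono2) auto
              then show ?thesis by (simp add: c0_def)
            next
              case False
              then have "(1/2) powr ?e \<le> x powr ?e" using x by (intro powr_mono2') auto
              then show ?thesis by (simp add: c0_def)
            qed
            then show ?thesis using x y by (simp add: powr_mult mult_right_mono)
          qed
          have 2: "(2 * y) powr (- 2 * ?N) \<le> cmod (1 - herm z ((1 - r) *\<^sub>R w)) powr (- 2 * ?N)"
          proof (rule powr_mono2')
            have "herm z ((1 - r) *\<^sub>R w) = of_real (1 - r) * herm z w"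
              by (simp only: scaleR_cscale herm_cscale_right complex_cnj_complex_of_real)
            then have eq: "1 - herm z ((1 - r) *\<^sub>R w) = (1 - herm z w) + of_real r * herm z w"
              by (simp add: algebra_simps)
            have "cmod (herm z w) \<le> 1" using norm_herm_less_1[of z w] z w by simp
            then have "cmod (of_real r * herm z w) \<le> r" using r mult_left_mono[of "cmod (herm z w)" 1 r] by (simp add: norm_mult)
            then have "cmod (1 - herm z ((1 - r) *\<^sub>R w)) \<le> y + r"
              unfolding eq using norm_triangle_ineq[of "1 - herm z w" "of_real r * herm z w"] by (simp add: y_def)
            then show "cmod (1 - herm z ((1 - r) *\<^sub>R w)) \<le> 2 * y" using r y by simp
            have "(1 - r) *\<^sub>R w \<in> ball 0 1" using scaleR_in_ball[of "1 - r" w] r w by simp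
            then show "0 < cmod (1 - herm z ((1 - r) *\<^sub>R w))" using kernel_lower(4)[OF z] by blast
          qed (use N in auto)
          have "c0 * y powr ?e * (2 * y) powr (- 2 * ?N) \<le> r powr ?e * cmod (1 - herm z ((1 - r) *\<^sub>R w)) powr (- 2 * ?N)"
            using 1 2 c0 by (intro mult_mono) auto
          then show ?thesis using True r by (simp add: ennreal_leI)
        qed simp
      qed
      finally show ?thesis by (simp add: y_def)
    qed
    interpret nu: finite_measure "nu \<alpha> :: (complex ^ 'n) measure" by (rule finite_measure_nu[OF \<alpha>])
    interpret P: pair_sigma_finite "nu \<alpha> :: (complex ^ 'n) measure" "lborel :: real measure" ..
    have "ennreal c * (\<integral>\<^sup>+z. ennreal (cmod (1 - herm z w) powr (- (?N + \<delta>))) \<partial>nu \<alpha>) = (\<integral>\<^sup>+z. ennreal (c * cmod (1 - herm z w) powr (- (?N + \<delta>))) \<partial>nu \<alpha>)"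
      using c by (subst nn_integral_cmult[symmetric]) (auto simp: ennreal_mult)
    also have "\<dots> \<le> (\<integral>\<^sup>+z. \<integral>\<^sup>+r. ?k z r \<partial>lborel \<partial>nu \<alpha>)"
      by (rule nn_integral_mono) (use low in auto)
    also have "\<dots> = (\<integral>\<^sup>+r. \<integral>\<^sup>+z. ?k z r \<partial>nu \<alpha> \<partial>lborel)"
      by (rule P.Fubini'[symmetric]) measurable
    also have "\<dots> \<le> (\<integral>\<^sup>+r. ennreal (r powr (- \<delta> - 1)) * indicator {d/8..1} r \<partial>lborel)"
    proof (rule nn_integral_mono)
      fix r :: real
      show "(\<integral>\<^sup>+z. ?k z r \<partial>nu \<alpha>) \<le> ennreal (r powr (- \<delta> - 1)) * indicator {d/8..1} r"
      proof (cases "r \<in> {d/8..1}")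
        case True
        then have r: "0 < r" "r \<le> 1" using d by auto
        then have wr: "(1 - r) *\<^sub>R w \<in> ball 0 1" using scaleR_in_ball[of "1 - r" w] w by simp
        \<comment> \<open>The dilated point has distance of order at least r from the sphere, so its
          exact kernel integral is at most r^(-N), for every w.\<close>
        have "r \<le> bdef ((1 - r) *\<^sub>R w)"
        proof -
          have "(norm w)\<^sup>2 \<le> 1" using w by (simp add: power_le_one)
          then have "(1 - r)\<^sup>2 * (norm w)\<^sup>2 \<le> (1 - r)\<^sup>2" by (simp add: mult_left_le)
          also have "\<dots> \<le> 1 - r" using r by (simp add: power2_eq_square mult_left_le)
          finally show ?thesis by (simp add: power_mult_distrib)
        qed
        then have p: "bdef ((1 - r) *\<^sub>R w) powr (- ?N) \<le> r powr (- ?N)" using r N by (intro powr_mono2') auto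
        have "(\<integral>\<^sup>+z. ?k z r \<partial>nu \<alpha>) = (\<integral>\<^sup>+z. ennreal (r powr ?e) * ennreal (cmod (1 - herm z ((1 - r) *\<^sub>R w)) powr (- 2 * ?N)) \<partial>nu \<alpha>)"
          using True by (intro nn_integral_cong) (simp add: ennreal_mult)
        also have "\<dots> = ennreal (r powr ?e) * ennreal (bdef ((1 - r) *\<^sub>R w) powr (- ?N))"
          by (subst nn_integral_cmult, measurable, subst nn_kernel_square[OF \<alpha> wr]) simp
        also have "\<dots> = ennreal (r powr ?e * bdef ((1 - r) *\<^sub>R w) powr (- ?N))" by (simp add: ennreal_mult)
        also have "\<dots> \<le> ennreal (r powr ?e * r powr (- ?N))" using p by (intro ennreal_leI mult_left_mono) auto
        also have "r powr ?e * r powr (- ?N) = r powr (- \<delta> - 1)" unfolding powr_add[symmetric] by (rule arg_cong[of _ _ "(powr) r"]) simp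
        finally show ?thesis using True by simp
      qed simp
    qed
    also have "\<dots> \<le> ennreal ((d/8) powr (- \<delta>) / \<delta>)"
      by (rule nn_integral_powr_tail) (use \<delta> d in auto)
    also have "(d/8) powr (- \<delta>) / \<delta> = c * (C * d powr (- \<delta>))"
      using d c \<delta> by (simp add: C_def powr_divide divide_simps)
    also have "ennreal \<dots> = ennreal c * ennreal (C * d powr (- \<delta>))" using c by (simp add: ennreal_mult')
    finally show "(\<integral>\<^sup>+z. ennreal (cmod (1 - herm z w) powr (- (?N + \<delta>))) \<partial>nu \<alpha>) \<le> ennreal (C * bdef w powr (- \<delta>))"
      using c by (subst (asm) ennreal_mult_le_mult_iff) (auto simp: d_def)
  qed
qed

section \<open>Changing the weight, and Fubini for two weights\<close>

lemma nu_density: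
  assumes \<alpha>: "\<alpha> > -1" and \<beta>: "\<alpha> + \<beta> > -1"
  shows "nu (\<alpha> + \<beta>) = density (nu \<alpha>) (\<lambda>z :: complex ^ 'n. ennreal (nu_mass TYPE('n) \<alpha> / nu_mass TYPE('n) (\<alpha> + \<beta>) * bdef z powr \<beta>))"
proof -
  let ?R = "restrict_space lborel (ball 0 1 :: (complex ^ 'n) set)"
  note p = nu_mass_pos[OF \<alpha>, where 'n='n] nu_mass_pos[OF \<beta>, where 'n='n]
  have m: "(\<lambda>z::complex ^ 'n. ennreal (k * bdef z powr a)) \<in> borel_measurable ?R" for k a
  proof (rule measurable_restrict_space1)
    have "(\<lambda>z::complex ^ 'n. k * bdef z powr a) \<in> borel_measurable borel"
      by (rule borel_measurable_times[OF borel_measurable_const borel_measurable_weight])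
    then show "(\<lambda>z::complex ^ 'n. ennreal (k * bdef z powr a)) \<in> borel_measurable lborel" by simp
  qed
  have m': "(\<lambda>z::complex ^ 'n. ennreal (bdef z powr a / k)) \<in> borel_measurable ?R" for k a
    using m[of "1/k" a] by simp
  have "density (nu \<alpha>) (\<lambda>z. ennreal (nu_mass TYPE('n) \<alpha> / nu_mass TYPE('n) (\<alpha> + \<beta>) * bdef z powr \<beta>))
    = density ?R (\<lambda>z. ennreal (bdef z powr \<alpha> / nu_mass TYPE('n) \<alpha>) * ennreal (nu_mass TYPE('n) \<alpha> / nu_mass TYPE('n) (\<alpha> + \<beta>) * bdef z powr \<beta>))"
    unfolding nu_def[of \<alpha>] nu_mass[OF \<alpha>] by (rule density_density_eq[OF m' m])
  also have "\<dots> = density ?R (\<lambda>z. ennreal (bdef z powr (\<alpha> + \<beta>) / nu_mass TYPE('n) (\<alpha> + \<beta>)))"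
    by (rule density_cong, use m' m in measurable, intro AE_I2) (use p in \<open>auto simp: powr_add simp flip: ennreal_mult\<close>)
  also have "\<dots> = nu (\<alpha> + \<beta>)" unfolding nu_def nu_mass[OF \<beta>] ..
  finally show ?thesis by simp
qed

lemma borel_measurable_nu_cong: "f \<in> borel_measurable (nu \<alpha>) \<longleftrightarrow> f \<in> borel_measurable (nu \<beta>)"
  by (simp add: measurable_cong_sets[OF sets_nu refl])

lemma nn_integral_nu_shift:
  fixes g :: "complex ^ 'n \<Rightarrow> ennreal"
  assumes \<alpha>: "\<alpha> > -1" and \<beta>: "\<alpha> + \<beta> > -1" and g: "g \<in> borel_measurable (nu \<alpha>)"
  shows "(\<integral>\<^sup>+z. g z \<partial>nu (\<alpha> + \<beta>)) = ennreal (nu_mass TYPE('n) \<alpha> / nu_mass TYPE('n) (\<alpha> + \<beta>)) * (\<integral>\<^sup>+z. ennreal (bdef z powr \<beta>) * g z \<partial>nu \<alpha>)"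
proof -
  note p = nu_mass_pos[OF \<alpha>, where 'n='n] nu_mass_pos[OF \<beta>, where 'n='n]
  note [measurable] = g
  let ?c = "nu_mass TYPE('n) \<alpha> / nu_mass TYPE('n) (\<alpha> + \<beta>)"
  have "(\<integral>\<^sup>+z. g z \<partial>nu (\<alpha> + \<beta>)) = (\<integral>\<^sup>+z. ennreal (?c * bdef z powr \<beta>) * g z \<partial>nu \<alpha>)"
    unfolding nu_density[OF \<alpha> \<beta>] by (rule nn_integral_density) measurable
  also have "\<dots> = (\<integral>\<^sup>+z. ennreal ?c * (ennreal (bdef z powr \<beta>) * g z) \<partial>nu \<alpha>)"
    using p by (intro nn_integral_cong) (simp only: ennreal_mult[OF divide_nonneg_nonneg[OF less_imp_le less_imp_le] powr_ge_zero] mult.assoc)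
  also have "\<dots> = ennreal ?c * (\<integral>\<^sup>+z. ennreal (bdef z powr \<beta>) * g z \<partial>nu \<alpha>)"
    by (rule nn_integral_cmult) measurable
  finally show ?thesis .
qed

lemma nn_bdef_finite:
  assumes "\<alpha> > -1" "\<alpha> + \<beta> > -1"
  shows "(\<integral>\<^sup>+z. ennreal (bdef z powr \<beta>) \<partial>(nu \<alpha> :: (complex ^ 'n) measure)) < \<infinity>"
proof -
  note p = nu_mass_pos[OF assms(1), where 'n='n] nu_mass_pos[OF assms(2), where 'n='n]
  have "(\<integral>\<^sup>+z. 1 \<partial>(nu (\<alpha> + \<beta>) :: (complex ^ 'n) measure)) = ennreal (nu_mass TYPE('n) \<alpha> / nu_mass TYPE('n) (\<alpha> + \<beta>)) * (\<integral>\<^sup>+z. ennreal (bdef z powr \<beta>) * 1 \<partial>(nu \<alpha> :: (complex ^ 'n) measure))"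
    using nn_integral_nu_shift[OF assms, of "\<lambda>z :: complex ^ 'n. 1"] by simp
  moreover have "(\<integral>\<^sup>+z. 1 \<partial>(nu (\<alpha> + \<beta>) :: (complex ^ 'n) measure)) = 1" by (simp add: emeasure_nu[OF assms(2)])
  ultimately have "1 = ennreal (nu_mass TYPE('n) \<alpha> / nu_mass TYPE('n) (\<alpha> + \<beta>)) * (\<integral>\<^sup>+z. ennreal (bdef z powr \<beta>) \<partial>(nu \<alpha> :: (complex ^ 'n) measure))" by simp
  then show ?thesis using p by (auto simp: less_top[symmetric] ennreal_mult_top)
qed

lemma integral_nu_shift:
  fixes f :: "complex ^ 'n \<Rightarrow> 'b :: {banach, second_countable_topology}"
  assumes \<alpha>: "\<alpha> > -1" and \<beta>: "\<alpha> + \<beta> > -1" and f: "f \<in> borel_measurable (nu \<alpha>)"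
  shows "(LINT z|nu (\<alpha> + \<beta>). f z) = (nu_mass TYPE('n) \<alpha> / nu_mass TYPE('n) (\<alpha> + \<beta>)) *\<^sub>R (LINT z|nu \<alpha>. bdef z powr \<beta> *\<^sub>R f z)"
    and "integrable (nu (\<alpha> + \<beta>)) f \<longleftrightarrow> integrable (nu \<alpha>) (\<lambda>z. bdef z powr \<beta> *\<^sub>R f z)"
proof -
  note p = nu_mass_pos[OF \<alpha>, where 'n='n] nu_mass_pos[OF \<beta>, where 'n='n]
  let ?c = "nu_mass TYPE('n) \<alpha> / nu_mass TYPE('n) (\<alpha> + \<beta>)"
  have c: "?c \<noteq> 0" using p by auto
  have m: "(\<lambda>z::complex ^ 'n. ?c * bdef z powr \<beta>) \<in> borel_measurable (nu \<alpha>)" by measurable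
  have nn: "AE z in nu \<alpha>. 0 \<le> ?c * bdef (z::complex ^ 'n) powr \<beta>" using p by simp
  show "(LINT z|nu (\<alpha> + \<beta>). f z) = ?c *\<^sub>R (LINT z|nu \<alpha>. bdef z powr \<beta> *\<^sub>R f z)"
    unfolding nu_density[OF \<alpha> \<beta>] integral_density[OF f m nn] scaleR_scaleR[symmetric] by (rule integral_scaleR_right)
  show "integrable (nu (\<alpha> + \<beta>)) f \<longleftrightarrow> integrable (nu \<alpha>) (\<lambda>z. bdef z powr \<beta> *\<^sub>R f z)"
    unfolding nu_density[OF \<alpha> \<beta>] integrable_density[OF f m nn] scaleR_scaleR[symmetric]
  proof
    assume "integrable (nu \<alpha>) (\<lambda>z. ?c *\<^sub>R bdef z powr \<beta> *\<^sub>R f z)"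
    then have "integrable (nu \<alpha>) (\<lambda>z. inverse ?c *\<^sub>R ?c *\<^sub>R bdef z powr \<beta> *\<^sub>R f z)" by (rule integrable_scaleR_right)
    then show "integrable (nu \<alpha>) (\<lambda>z. bdef z powr \<beta> *\<^sub>R f z)" using c by simp
  qed (rule integrable_scaleR_right)
qed

declare sets_nu[measurable_cong del]

lemma borel_measurable_bker[measurable]: "bker s \<in> borel_measurable borel"
proof -
  have "bker s = (\<lambda>u. if 1 - u = 0 then 0 else exp (- of_real s * Ln (1 - u)))"
    by (auto simp: bker_def powr_def fun_eq_iff)
  also have "\<dots> \<in> borel_measurable borel" by measurable
  finally show ?thesis .
qed

lemma measurable_fst_nu[measurable]: "fst \<in> borel_measurable (nu \<alpha> \<Otimes>\<^sub>M M)"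
  by (rule measurable_compose[OF measurable_fst measurable_ident_nu])

lemma measurable_snd_nu[measurable]: "snd \<in> borel_measurable (M \<Otimes>\<^sub>M nu \<alpha>)"
  by (rule measurable_compose[OF measurable_snd measurable_ident_nu])

lemma measurable_pair_kernel:
  fixes F G :: "complex ^ 'n \<Rightarrow> complex"
  assumes F: "F \<in> borel_measurable (nu \<alpha>)" and G: "G \<in> borel_measurable (nu \<beta>)" and T: "T \<in> borel_measurable borel"
  shows "(\<lambda>p. F (fst p) * bker s (herm (T (snd p)) (fst p)) * cnj (G (snd p))) \<in> borel_measurable (nu \<alpha> \<Otimes>\<^sub>M nu \<beta>)"
proof -
  have cnj: "cnj \<in> borel_measurable borel" by (intro borel_measurable_continuous_onI continuous_intros)
  show ?thesis
    by (intro borel_measurable_times measurable_compose[OF measurable_fst F] 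
      measurable_compose[OF measurable_compose[OF measurable_snd G] cnj]
      measurable_compose[OF borel_measurable_herm borel_measurable_bker]
      measurable_fst_nu measurable_compose[OF measurable_snd_nu T])
qed

lemma integrable_pair_nu:
  fixes f :: "(complex ^ 'n) \<times> (complex ^ 'n) \<Rightarrow> complex"
  assumes \<alpha>: "\<alpha> > -1" "\<beta> > -1" and [measurable]: "f \<in> borel_measurable (nu \<alpha> \<Otimes>\<^sub>M nu \<beta>)"
    and fin: "(\<integral>\<^sup>+x. \<integral>\<^sup>+y. ennreal (cmod (f (x, y))) \<partial>nu \<beta> \<partial>nu \<alpha>) < \<infinity>"
  shows "integrable (nu \<alpha> \<Otimes>\<^sub>M nu \<beta>) f"
proof -
  interpret A: finite_measure "nu \<alpha> :: (complex ^ 'n) measure" by (rule finite_measure_nu[OF \<alpha>(1)])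
  interpret B: finite_measure "nu \<beta> :: (complex ^ 'n) measure" by (rule finite_measure_nu[OF \<alpha>(2)])
  show ?thesis
    unfolding integrable_iff_bounded using fin by (subst B.nn_integral_fst[symmetric]) auto
qed

lemma Fubini_nu:
  fixes f :: "complex ^ 'n \<Rightarrow> complex ^ 'n \<Rightarrow> complex"
  assumes \<alpha>: "\<alpha> > -1" "\<beta> > -1" and m: "(\<lambda>p. f (fst p) (snd p)) \<in> borel_measurable (nu \<alpha> \<Otimes>\<^sub>M nu \<beta>)"
    and fin: "(\<integral>\<^sup>+x. \<integral>\<^sup>+y. ennreal (cmod (f x y)) \<partial>nu \<beta> \<partial>nu \<alpha>) < \<infinity>"
  shows "(LINT y|nu \<beta>. (LINT x|nu \<alpha>. f x y)) = (LINT x|nu \<alpha>. (LINT y|nu \<beta>. f x y))"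
proof -
  interpret A: finite_measure "nu \<alpha> :: (complex ^ 'n) measure" by (rule finite_measure_nu[OF \<alpha>(1)])
  interpret B: finite_measure "nu \<beta> :: (complex ^ 'n) measure" by (rule finite_measure_nu[OF \<alpha>(2)])
  interpret P: pair_sigma_finite "nu \<alpha> :: (complex ^ 'n) measure" "nu \<beta> :: (complex ^ 'n) measure" ..
  have "integrable (nu \<alpha> \<Otimes>\<^sub>M nu \<beta>) (case_prod f)"
    unfolding case_prod_beta' by (rule integrable_pair_nu[OF \<alpha> m]) (use fin in simp)
  from P.Fubini_integral[OF this] show ?thesis .
qed

lemma cnj_kint:
  fixes g :: "complex ^ 'n \<Rightarrow> complex"
  assumes "w \<in> ball 0 1"
  shows "(LINT z|nu \<alpha>. cnj (g z) * bker s (herm z w)) = cnj (kint \<alpha> g s w)"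
proof -
  have "cnj (kint \<alpha> g s w) = (LINT z|nu \<alpha>. cnj (g z * bker s (herm w z)))"
    unfolding kint_def by (simp only: Bochner_Integration.integral_cnj)
  also have "\<dots> = (LINT z|nu \<alpha>. cnj (g z) * bker s (herm z w))"
  proof (rule Bochner_Integration.integral_cong[OF refl])
    fix z :: "complex ^ 'n" assume "z \<in> space (nu \<alpha>)"
    then have "cmod (herm w z) < 1" using assms norm_herm_less_1[of w z] by simp
    then show "cnj (g z * bker s (herm w z)) = cnj (g z) * bker s (herm z w)"
      by (simp add: cnj_bker cnj_herm)
  qed
  finally show ?thesis by simp
qed

text \<open>Integration by parts in the guise of Fubini: \<open>b\<close> is replaced by its
  fractional radial derivative \<open>kint \<alpha> b (n + 1 + \<alpha> + k)\<close> and the weight gains \<open>k\<close>.\<close>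

lemma radial_integration_by_parts:
  fixes b g :: "complex ^ 'n \<Rightarrow> complex"
  assumes \<alpha>: "\<alpha> > -1" and k: "k \<ge> 0" and b: "holomorphic_ball b" and g: "Hinf g"
    and \<epsilon>: "0 < \<epsilon>" "2 * \<epsilon> < 1 + \<alpha>" and bd: "\<And>z. z \<in> ball 0 1 \<Longrightarrow> cmod (b z) \<le> B * bdef z powr (- \<epsilon>)"
  shows "(LINT z|nu \<alpha>. b z * cnj (g z)) = (LINT z|nu (\<alpha> + k). kint \<alpha> b (real CARD('n) + 1 + \<alpha> + k) z * cnj (g z))"
proof -
  let ?N = "real CARD('n) + 1 + \<alpha> + k"
  have \<alpha>k: "\<alpha> + k > -1" using \<alpha> k by simp
  have [measurable]: "b \<in> borel_measurable (nu \<alpha>)" "g \<in> borel_measurable (nu (\<alpha> + k))"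
    using b g by (auto intro: holomorphic_ball_measurable HinfD)
  obtain G where G: "G \<ge> 0" "\<And>z. z \<in> ball 0 1 \<Longrightarrow> cmod (g z) \<le> G" using HinfE[OF g] by blast
  have B: "B \<ge> 0" using order.trans[OF norm_ge_zero bd[of 0]] by simp
  obtain C where C: "C > 0" "\<And>w. w \<in> ball (0::complex ^ 'n) 1 \<Longrightarrow> (\<integral>\<^sup>+z. ennreal (cmod (1 - herm z w) powr (- (real CARD('n) + 1 + (\<alpha> + k) + \<epsilon>))) \<partial>nu (\<alpha> + k)) \<le> ennreal (C * bdef w powr (- \<epsilon>))"
    using forelli_rudin[OF \<alpha>k \<epsilon>(1), where 'n='n] by blast
  \<comment> \<open>The kernel has the critical exponent for the weight \<alpha> + k, while
    \<open>forelli_rudin\<close> needs a positive excess. Since |1 - <z,w>| \<le> 2, raising the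
    exponent by \<epsilon> costs only a constant.\<close>
  have bk: "cmod (bker ?N (herm z w)) \<le> 2 powr \<epsilon> * cmod (1 - herm z w) powr (- (real CARD('n) + 1 + (\<alpha> + k) + \<epsilon>))" 
    if "z \<in> ball 0 1" "w \<in> ball 0 1" for z w
  proof -
    have "cmod (1 - herm z w) powr (- ?N) = cmod (1 - herm z w) powr \<epsilon> * cmod (1 - herm z w) powr (- (real CARD('n) + 1 + (\<alpha> + k) + \<epsilon>))"
      unfolding powr_add[symmetric] by (rule arg_cong[of _ _ "(powr) _"]) simp
    also have "\<dots> \<le> 2 powr \<epsilon> * cmod (1 - herm z w) powr (- (real CARD('n) + 1 + (\<alpha> + k) + \<epsilon>))"
      using kernel_lower(3,4)[OF that] \<epsilon> by (intro mult_right_mono powr_mono2) auto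
    finally show ?thesis by (simp only: norm_bker)
  qed
  \<comment> \<open>Absolute convergence: one factor bdef^(-\<epsilon>) comes from b and one from
    the kernel integral, and 2 \<epsilon> < 1 + \<alpha> makes their product integrable.\<close>
  have "(\<integral>\<^sup>+w. \<integral>\<^sup>+z. ennreal (cmod (b w * bker ?N (herm z w) * cnj (g z))) \<partial>nu (\<alpha> + k) \<partial>nu \<alpha>)
    \<le> (\<integral>\<^sup>+w. ennreal (B * G * 2 powr \<epsilon> * C * bdef w powr (- 2 * \<epsilon>)) \<partial>(nu \<alpha> :: (complex ^ 'n) measure))"
  proof (rule nn_integral_mono)
    fix w :: "complex ^ 'n" assume "w \<in> space (nu \<alpha>)"
    then have w: "w \<in> ball 0 1" by simp
    have "(\<integral>\<^sup>+z. ennreal (cmod (b w * bker ?N (herm z w) * cnj (g z))) \<partial>nu (\<alpha> + k)) \<le> 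
      (\<integral>\<^sup>+z. ennreal (B * bdef w powr (- \<epsilon>) * 2 powr \<epsilon> * G) * ennreal (cmod (1 - herm z w) powr (- (real CARD('n) + 1 + (\<alpha> + k) + \<epsilon>))) \<partial>nu (\<alpha> + k))"
    proof (rule nn_integral_mono)
      fix z :: "complex ^ 'n" assume "z \<in> space (nu (\<alpha> + k))"
      then have z: "z \<in> ball 0 1" by simp
      have "cmod (b w * bker ?N (herm z w) * cnj (g z)) \<le> (B * bdef w powr (- \<epsilon>)) * (2 powr \<epsilon> * cmod (1 - herm z w) powr (- (real CARD('n) + 1 + (\<alpha> + k) + \<epsilon>))) * G"
        unfolding norm_mult complex_mod_cnj using B by (intro mult_mono bd w z bk G mult_nonneg_nonneg) auto
      then show "ennreal (cmod (b w * bker ?N (herm z w) * cnj (g z))) \<le> ennreal (B * bdef w powr (- \<epsilon>) * 2 powr \<epsilon> * G) * ennreal (cmod (1 - herm z w) powr (- (real CARD('n) + 1 + (\<alpha> + k) + \<epsilon>)))"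
        using B G(1) by (subst ennreal_mult[symmetric]) (auto intro!: ennreal_leI simp: mult_ac)
    qed
    also have "\<dots> = ennreal (B * bdef w powr (- \<epsilon>) * 2 powr \<epsilon> * G) * (\<integral>\<^sup>+z. ennreal (cmod (1 - herm z w) powr (- (real CARD('n) + 1 + (\<alpha> + k) + \<epsilon>))) \<partial>nu (\<alpha> + k))"
      by (rule nn_integral_cmult) measurable
    also have "\<dots> \<le> ennreal (B * bdef w powr (- \<epsilon>) * 2 powr \<epsilon> * G) * ennreal (C * bdef w powr (- \<epsilon>))"
      by (intro mult_left_mono C(2) w) auto
    also have "\<dots> = ennreal (B * G * 2 powr \<epsilon> * C * (bdef w powr (- \<epsilon>) * bdef w powr (- \<epsilon>)))"
      using B G C by (subst ennreal_mult[symmetric]) (auto simp: mult_ac)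
    also have "bdef w powr (- \<epsilon>) * bdef w powr (- \<epsilon>) = bdef w powr (- 2 * \<epsilon>)"
      unfolding powr_add[symmetric] by simp
    finally show "(\<integral>\<^sup>+z. ennreal (cmod (b w * bker ?N (herm z w) * cnj (g z))) \<partial>nu (\<alpha> + k)) \<le> ennreal (B * G * 2 powr \<epsilon> * C * bdef w powr (- 2 * \<epsilon>))" .
  qed
  also have "\<dots> = ennreal (B * G * 2 powr \<epsilon> * C) * (\<integral>\<^sup>+w. ennreal (bdef w powr (- 2 * \<epsilon>)) \<partial>(nu \<alpha> :: (complex ^ 'n) measure))"
    using B G C by (subst nn_integral_cmult[symmetric]) (auto simp: ennreal_mult)
  also have "\<dots> < \<infinity>"
    using nn_bdef_finite[OF \<alpha>, of "- 2 * \<epsilon>", where 'n='n] \<epsilon> by (simp add: ennreal_mult_less_top)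
  finally have fin: "(\<integral>\<^sup>+w. \<integral>\<^sup>+z. ennreal (cmod (b w * bker ?N (herm z w) * cnj (g z))) \<partial>nu (\<alpha> + k) \<partial>nu \<alpha>) < \<infinity>" .
  have "(LINT z|nu (\<alpha> + k). kint \<alpha> b ?N z * cnj (g z)) = (LINT z|nu (\<alpha> + k). (LINT w|nu \<alpha>. b w * bker ?N (herm z w) * cnj (g z)))"
    unfolding kint_def by simp
  also have "\<dots> = (LINT w|nu \<alpha>. (LINT z|nu (\<alpha> + k). b w * bker ?N (herm z w) * cnj (g z)))"
    by (rule Fubini_nu[OF \<alpha> \<alpha>k _ fin]) (rule measurable_pair_kernel, measurable)
  also have "\<dots> = (LINT w|nu \<alpha>. b w * cnj (g w))"
  proof (rule Bochner_Integration.integral_cong[OF refl])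
    fix w :: "complex ^ 'n" assume "w \<in> space (nu \<alpha>)"
    then have w: "w \<in> ball 0 1" by simp
    have "(LINT z|nu (\<alpha> + k). b w * bker ?N (herm z w) * cnj (g z)) = b w * (LINT z|nu (\<alpha> + k). cnj (g z) * bker ?N (herm z w))"
      by (subst integral_mult_right_zero[symmetric]) (simp only: mult_ac)
    also have "\<dots> = b w * cnj (g w)"
      unfolding cnj_kint[OF w] using kint_reproducing[OF HinfD[OF g] \<alpha>k Hinf_integrable[OF g \<alpha>k] w] by (simp add: add.assoc)
    finally show "(LINT z|nu (\<alpha> + k). b w * bker ?N (herm z w) * cnj (g z)) = b w * cnj (g w)" .
  qed
  finally show ?thesis by simp
qed

text \<open>Absorbing the power of \<open>bdef\<close> into the measure lowers the weight to
  \<alpha> - \<delta>; relative to that weight the exponent N exceeds the critical one by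
  \<delta>.\<close>

lemma weighted_kernel_bound:
  assumes \<alpha>: "\<alpha> > -1" and \<delta>: "0 < \<delta>" "\<delta> < 1 + \<alpha>"
  shows "\<exists>C>0. \<forall>w\<in>ball (0::complex ^ 'n) 1. (\<integral>\<^sup>+z. ennreal (bdef z powr (- \<delta>) * cmod (1 - herm z w) powr (- (real CARD('n) + 1 + \<alpha>))) \<partial>nu \<alpha>) \<le> ennreal (C * bdef w powr (- \<delta>))"
proof -
  have \<alpha>': "\<alpha> + - \<delta> > -1" using \<delta> by simp
  note p = nu_mass_pos[OF \<alpha>, where 'n='n] nu_mass_pos[OF \<alpha>', where 'n='n]
  let ?c = "nu_mass TYPE('n) \<alpha> / nu_mass TYPE('n) (\<alpha> + - \<delta>)"
  have c: "?c > 0" using p by simp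
  obtain C where C: "C > 0" "\<And>w. w \<in> ball (0::complex ^ 'n) 1 \<Longrightarrow> (\<integral>\<^sup>+z. ennreal (cmod (1 - herm z w) powr (- (real CARD('n) + 1 + (\<alpha> + - \<delta>) + \<delta>))) \<partial>nu (\<alpha> + - \<delta>)) \<le> ennreal (C * bdef w powr (- \<delta>))"
    using forelli_rudin[OF \<alpha>' \<delta>(1), where 'n='n] by blast
  show ?thesis
  proof (intro exI[of _ "C / ?c"] conjI ballI)
    show "C / ?c > 0" by (rule divide_pos_pos[OF C(1) c])
    fix w :: "complex ^ 'n" assume w: "w \<in> ball 0 1"
    let ?I = "\<integral>\<^sup>+z. ennreal (bdef z powr (- \<delta>) * cmod (1 - herm z w) powr (- (real CARD('n) + 1 + \<alpha>))) \<partial>nu \<alpha>"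
    have "ennreal ?c * ?I = (\<integral>\<^sup>+z. ennreal (cmod (1 - herm z w) powr (- (real CARD('n) + 1 + \<alpha>))) \<partial>nu (\<alpha> + - \<delta>))"
      by (subst nn_integral_nu_shift[OF \<alpha> \<alpha>'], measurable) (simp add: ennreal_mult)
    also have "\<dots> \<le> ennreal (C * bdef w powr (- \<delta>))"
    proof -
      have "real CARD('n) + 1 + (\<alpha> + - \<delta>) + \<delta> = real CARD('n) + 1 + \<alpha>" by simp
      then show ?thesis using C(2)[OF w] by (simp only:)
    qed
    also have "\<dots> = ennreal ?c * ennreal (C / ?c * bdef w powr (- \<delta>))"
    proof (subst ennreal_mult[symmetric])
      show "0 \<le> C / ?c * bdef w powr (- \<delta>)"
        by (rule mult_nonneg_nonneg[OF less_imp_le[OF divide_pos_pos[OF C(1) c]]]) simp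
    qed (use c in auto)
    finally show "?I \<le> ennreal (C / ?c * bdef w powr (- \<delta>))"
      using c by (subst (asm) ennreal_mult_le_mult_iff) auto
  qed
qed

section \<open>Pointwise estimates\<close>

text \<open>Let S be the supremum of sqrt|f| bdef^N and I the integral of sqrt|f|. The reproducing
  formula of the weight \<alpha> + N, whose kernel has exponent 2N, bounds |f(z)| bdef(z)^(2N) by a
  constant times the integral of |f| bdef^N, and there |f| bdef^N \<le> S sqrt|f|. So S^2 \<le> K S
  I. The exponent 1/2 is reached without any subharmonicity.\<close>

lemma sqrt_bound_Hinf:
  fixes f :: "complex ^ 'n \<Rightarrow> complex"
  assumes \<alpha>: "\<alpha> > -1"
  defines "N \<equiv> real CARD('n) + 1 + \<alpha>"
  shows "\<exists>K>0. \<forall>f :: complex ^ 'n \<Rightarrow> complex. Hinf f \<longrightarrow> (\<forall>z\<in>ball 0 1. sqrt (cmod (f z)) * bdef z powr N \<le> K * (LINT \<xi>|nu \<alpha>. sqrt (cmod (f \<xi>))))"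
proof -
  have N: "N > 0" using \<alpha> by (simp add: N_def)
  have \<alpha>': "\<alpha> + N > -1" using \<alpha> N by simp
  note p = nu_mass_pos[OF \<alpha>, where 'n='n] nu_mass_pos[OF \<alpha>', where 'n='n]
  let ?c = "nu_mass TYPE('n) \<alpha> / nu_mass TYPE('n) (\<alpha> + N)"
  define K where "K = 2 powr (2 * N) * ?c"
  have K: "K > 0" using p by (simp add: K_def)
  show ?thesis
  proof (intro exI[of _ K] conjI K allI impI ballI)
    fix f :: "complex ^ 'n \<Rightarrow> complex" and z :: "complex ^ 'n" assume f: "Hinf f" and z: "z \<in> ball 0 1"
    obtain B where B: "B \<ge> 0" "\<And>z. z \<in> ball 0 1 \<Longrightarrow> cmod (f z) \<le> B" using HinfE[OF f] by blast
    have [measurable]: "f \<in> borel_measurable (nu \<alpha>)" "f \<in> borel_measurable (nu (\<alpha> + N))" using f by (auto intro: holomorphic_ball_measurable HinfD)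
    interpret finite_measure "nu \<alpha> :: (complex ^ 'n) measure" by (rule finite_measure_nu[OF \<alpha>])
    let ?u = "\<lambda>z. sqrt (cmod (f z)) * bdef z powr N"
    define S where "S = (SUP z\<in>ball 0 1. ?u z)"
    define I where "I = (LINT \<xi>|nu \<alpha>. sqrt (cmod (f \<xi>)))"
    have ub: "?u z \<le> sqrt B" if "z \<in> ball 0 1" for z
    proof -
      have "bdef z powr N \<le> 1" using bdef_pos[OF that] N by (intro powr_le1) auto
      then have "?u z \<le> sqrt B * 1" using B that by (intro mult_mono) auto
      then show ?thesis by simp
    qed
    then have bdd: "bdd_above (?u ` ball 0 1)" by (auto intro!: bdd_aboveI)
    have uS: "?u z \<le> S" if "z \<in> ball 0 1" for z unfolding S_def by (rule cSUP_upper[OF that bdd])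
    have S0: "S \<ge> 0" using uS[of 0] order.trans[of 0 "?u 0" S] by simp
    have iI: "integrable (nu \<alpha>) (\<lambda>\<xi>. sqrt (cmod (f \<xi>)))"
      by (rule integrable_const_bound[of _ "sqrt B"]) (use B in auto)
    have I0: "I \<ge> 0" unfolding I_def by simp
    have main: "?u z * ?u z \<le> K * S * I" if z: "z \<in> ball 0 1" for z
    proof -
      have if': "integrable (nu (\<alpha> + N)) f" by (rule Hinf_integrable[OF f \<alpha>'])
      have d: "bdef z > 0" by (rule bdef_pos[OF z])
      have "f z = kint (\<alpha> + N) f (2 * N) z"
        using kint_reproducing[OF HinfD[OF f] \<alpha>' if' z] by (simp add: N_def algebra_simps)
      then have "cmod (f z) \<le> (LINT \<xi>|nu (\<alpha> + N). cmod (f \<xi> * bker (2 * N) (herm z \<xi>)))"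
        unfolding kint_def by simp
      also have "\<dots> \<le> (LINT \<xi>|nu (\<alpha> + N). (bdef z / 2) powr (- (2 * N)) * cmod (f \<xi>))"
      proof (rule integral_mono)
        show "integrable (nu (\<alpha> + N)) (\<lambda>\<xi>. (bdef z / 2) powr (- (2 * N)) * cmod (f \<xi>))" using if' by simp
        show le: "cmod (f \<xi> * bker (2 * N) (herm z \<xi>)) \<le> (bdef z / 2) powr (- (2 * N)) * cmod (f \<xi>)" if "\<xi> \<in> space (nu (\<alpha> + N))" for \<xi>
        proof -
          have "\<xi> \<in> ball 0 1" using that by simp
          then have "cmod (bker (2 * N) (herm z \<xi>)) \<le> (bdef z / 2) powr (- (2 * N))"
            unfolding norm_bker using kernel_lower(2)[OF z] d N by (intro powr_mono2') auto
          then show ?thesis by (simp add: norm_mult mult.commute mult_left_mono)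
        qed
        show "integrable (nu (\<alpha> + N)) (\<lambda>\<xi>. cmod (f \<xi> * bker (2 * N) (herm z \<xi>)))"
          by (rule Bochner_Integration.integrable_bound[OF \<open>integrable (nu (\<alpha> + N)) (\<lambda>\<xi>. (bdef z / 2) powr (- (2 * N)) * cmod (f \<xi>))\<close>], measurable, rule AE_I2)
             (use le in simp)
      qed
      also have "\<dots> = (bdef z / 2) powr (- (2 * N)) * (?c * (LINT \<xi>|nu \<alpha>. bdef \<xi> powr N * cmod (f \<xi>)))"
        by (simp add: integral_nu_shift(1)[OF \<alpha> \<alpha>'])
      also have "\<dots> \<le> (bdef z / 2) powr (- (2 * N)) * (?c * (LINT \<xi>|nu \<alpha>. S * sqrt (cmod (f \<xi>))))"
      proof (intro mult_left_mono integral_mono)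
        show "bdef \<xi> powr N * cmod (f \<xi>) \<le> S * sqrt (cmod (f \<xi>))" if "\<xi> \<in> space (nu \<alpha>)" for \<xi>
        proof -
          have "bdef \<xi> powr N * cmod (f \<xi>) = ?u \<xi> * sqrt (cmod (f \<xi>))" by simp
          also have "\<dots> \<le> S * sqrt (cmod (f \<xi>))" using that by (intro mult_right_mono uS) auto
          finally show ?thesis .
        qed
        have "integrable (nu (\<alpha> + N)) (\<lambda>\<xi>. cmod (f \<xi>))" using if' by simp
        then show "integrable (nu \<alpha>) (\<lambda>\<xi>. bdef \<xi> powr N * cmod (f \<xi>))"
          by (subst (asm) integral_nu_shift(2)[OF \<alpha> \<alpha>']) auto
      qed (use p iI in auto)
      also have "\<dots> = bdef z powr (- (2 * N)) * (K * S * I)"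
        using d by (simp add: I_def K_def powr_divide powr_minus field_simps)
      finally have "cmod (f z) * bdef z powr (2 * N) \<le> bdef z powr (- (2 * N)) * (K * S * I) * bdef z powr (2 * N)"
        by (rule mult_right_mono) simp
      also have "\<dots> = K * S * I * (bdef z powr (- (2 * N)) * bdef z powr (2 * N))" by (simp only: mult_ac)
      also have "bdef z powr (- (2 * N)) * bdef z powr (2 * N) = 1" using d by (simp flip: powr_add)
      finally have "cmod (f z) * bdef z powr (2 * N) \<le> K * S * I" by simp
      moreover have "?u z * ?u z = cmod (f z) * bdef z powr (2 * N)"
      proof -
        have "bdef z powr N * bdef z powr N = bdef z powr (2 * N)" by (simp flip: powr_add)
        moreover have "?u z * ?u z = (sqrt (cmod (f z)) * sqrt (cmod (f z))) * (bdef z powr N * bdef z powr N)" by (simp only: mult_ac)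
        ultimately show ?thesis by simp
      qed
      ultimately show ?thesis by simp
    qed
    \<comment> \<open>Division by S is legitimate because S is finite, f being bounded; this is why
      unbounded f are treated separately through dilates.\<close>
    have "S \<le> K * I"
    proof (cases "S = 0")
      case True then show ?thesis using K I0 by simp
    next
      case False
      then have Sp: "S > 0" using S0 by simp
      have "S \<le> sqrt (K * S * I)" unfolding S_def
      proof (rule cSUP_least)
        show "?u z \<le> sqrt (K * (SUP z\<in>ball 0 1. ?u z) * I)" if "z \<in> ball 0 1" for z
          using main[OF that] unfolding S_def[symmetric] by (intro real_le_rsqrt) (simp add: power2_eq_square)
      qed simp
      then have "S\<^sup>2 \<le> K * S * I" using S0 K I0 by (metis real_sqrt_le_iff real_sqrt_unique power2_eq_square abs_of_nonneg real_sqrt_abs)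
      then have "S * S \<le> S * (K * I)" by (simp add: power2_eq_square mult_ac)
      then show ?thesis using Sp by simp
    qed
    then show "?u z \<le> K * (LINT \<xi>|nu \<alpha>. sqrt (cmod (f \<xi>)))" using uS[OF z] by (simp add: I_def)
  qed
qed

text \<open>For \<alpha> \<ge> 0 the weight decreases along rays, so the image of the measure under
  a dilation is dominated by the measure itself up to the Jacobian. Weights below 0 are reached
  later by passing to \<alpha> + 1.\<close>

lemma nn_integral_dilation:
  fixes g :: "complex ^ 'n \<Rightarrow> ennreal"
  assumes \<alpha>: "\<alpha> \<ge> 0" and R: "0 < R" "R < 1" and g: "g \<in> borel_measurable (nu \<alpha>)"
  shows "ennreal (R ^ (2 * CARD('n))) * (\<integral>\<^sup>+z. g (R *\<^sub>R z) \<partial>nu \<alpha>) \<le> (\<integral>\<^sup>+z. g z \<partial>nu \<alpha>)"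
proof -
  have \<alpha>1: "\<alpha> > -1" using \<alpha> by simp
  let ?m = "nu_mass TYPE('n) \<alpha>"
  have m: "?m > 0" by (rule nu_mass_pos[OF \<alpha>1])
  define w where "w z = indicator (ball 0 1) z * bdef z powr \<alpha> / ?m" for z :: "complex ^ 'n"
  have [measurable]: "w \<in> borel_measurable borel"
    unfolding w_def by measurable
  define g0 where "g0 z = g z * indicator (ball 0 1) z" for z
  have g0[measurable]: "g0 \<in> borel_measurable borel"
  proof -
    have "g \<in> borel_measurable (restrict_space borel (ball 0 1))"
      using g by (simp add: measurable_cong_sets[OF sets_nu refl])
    then show ?thesis unfolding g0_def
      by (subst (asm) borel_measurable_restrict_space_iff_ennreal) auto
  qed
  have gR[measurable]: "(\<lambda>z. g (R *\<^sub>R z)) \<in> borel_measurable (nu \<alpha>)"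
  proof -
    have "(\<lambda>z. g0 (R *\<^sub>R z)) \<in> borel_measurable (nu \<alpha>)"
      by (rule measurable_compose[OF measurable_ident_nu]) measurable
    also have "(\<lambda>z. g0 (R *\<^sub>R z)) \<in> borel_measurable (nu \<alpha>) \<longleftrightarrow> ?thesis"
    proof (rule measurable_cong)
      fix z :: "complex ^ 'n" assume "z \<in> space (nu \<alpha>)"
      then have "R *\<^sub>R z \<in> ball 0 1" using scaleR_in_ball[of R z] R by simp
      then show "g0 (R *\<^sub>R z) = g (R *\<^sub>R z)" by (simp only: g0_def indicator_simps mult_1_right)
    qed
    finally show ?thesis .
  qed
  define F where "F y = g0 y * ennreal (w (inverse R *\<^sub>R y))" for y
  have [measurable]: "F \<in> borel_measurable borel" unfolding F_def by measurable
  have "(\<integral>\<^sup>+y. F y \<partial>lborel) = ennreal (R ^ DIM(complex ^ 'n)) * (\<integral>\<^sup>+z. F (R *\<^sub>R z) \<partial>lborel)"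
    by (rule nn_integral_lborel_scaling) (use R in auto)
  also have "(\<integral>\<^sup>+z. F (R *\<^sub>R z) \<partial>lborel) = (\<integral>\<^sup>+z. g (R *\<^sub>R z) \<partial>nu \<alpha>)"
    unfolding nn_integral_nu[OF gR \<alpha>1]
    using R scaleR_in_ball[of R] by (intro nn_integral_cong) (auto simp: F_def g0_def w_def indicator_def)
  also have "DIM(complex ^ 'n) = 2 * CARD('n)" by (simp add: DIM_cart)
  finally have "ennreal (R ^ (2 * CARD('n))) * (\<integral>\<^sup>+z. g (R *\<^sub>R z) \<partial>nu \<alpha>) = (\<integral>\<^sup>+y. F y \<partial>lborel)" by simp
  also have "\<dots> \<le> (\<integral>\<^sup>+y. g y * ennreal (w y) \<partial>lborel)"
  proof (rule nn_integral_mono)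
    fix y :: "complex ^ 'n"
    show "F y \<le> g y * ennreal (w y)"
    proof (cases "y \<in> ball 0 1 \<and> norm (inverse R *\<^sub>R y) < 1")
      case True
      have "(norm y)\<^sup>2 \<le> (norm (inverse R *\<^sub>R y))\<^sup>2"
        using R by (intro power_mono) (auto simp: field_simps mult_left_le_one_le)
      moreover have "bdef (inverse R *\<^sub>R y) > 0" using True by (intro bdef_pos) simp
      ultimately have "bdef (inverse R *\<^sub>R y) powr \<alpha> \<le> bdef y powr \<alpha>" using \<alpha> by (intro powr_mono2) auto
      then have "w (inverse R *\<^sub>R y) \<le> w y" using True m by (simp add: w_def divide_right_mono)
      then show ?thesis using True by (simp add: F_def g0_def mult_left_mono ennreal_leI)
    next
      case False
      then show ?thesis by (auto simp: F_def g0_def w_def indicator_def)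
    qed
  qed
  also have "\<dots> = (\<integral>\<^sup>+z. g z \<partial>nu \<alpha>)"
    unfolding nn_integral_nu[OF g \<alpha>1] w_def ..
  finally show ?thesis .
qed

text \<open>The bounded case is applied to the dilates, whose integrals are controlled by that of f;
  the limit R -> 1 is taken only in the value at z, where f is continuous.\<close>

lemma sqrt_bound:
  assumes \<alpha>: "\<alpha> \<ge> 0"
  defines "N \<equiv> real CARD('n) + 1 + \<alpha>"
  shows "\<exists>K\<ge>1. \<forall>f :: complex ^ 'n \<Rightarrow> complex. holomorphic_ball f \<longrightarrow> (\<forall>z\<in>ball 0 1. 
    ennreal (sqrt (cmod (f z)) * bdef z powr N) \<le> ennreal K * (\<integral>\<^sup>+\<xi>. ennreal (sqrt (cmod (f \<xi>))) \<partial>nu \<alpha>))"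
proof -
  have \<alpha>1: "\<alpha> > -1" using \<alpha> by simp
  obtain K where K: "K > 0" "\<And>f z. Hinf f \<Longrightarrow> z \<in> ball (0::complex ^ 'n) 1 \<Longrightarrow> sqrt (cmod (f z)) * bdef z powr N \<le> K * (LINT \<xi>|nu \<alpha>. sqrt (cmod (f \<xi>)))"
    using sqrt_bound_Hinf[OF \<alpha>1, where 'n='n] unfolding N_def by blast
  interpret finite_measure "nu \<alpha> :: (complex ^ 'n) measure" by (rule finite_measure_nu[OF \<alpha>1])
  show ?thesis
  proof (intro exI[of _ "max 1 K"] conjI allI impI ballI)
    fix f :: "complex ^ 'n \<Rightarrow> complex" and z :: "complex ^ 'n" assume f: "holomorphic_ball f" and z: "z \<in> ball 0 1"
    have [measurable]: "f \<in> borel_measurable (nu \<alpha>)" by (rule holomorphic_ball_measurable[OF f])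
    let ?I = "\<integral>\<^sup>+\<xi>. ennreal (sqrt (cmod (f \<xi>))) \<partial>nu \<alpha>"
    show "ennreal (sqrt (cmod (f z)) * bdef z powr N) \<le> ennreal (max 1 K) * ?I"
    proof (cases "?I = \<infinity>")
      case True
      then show ?thesis by (simp add: ennreal_mult_top)
    next
      case False
      then obtain i where i: "?I = ennreal i" "i \<ge> 0" by (cases ?I) auto
      have R: "R ^ (2 * CARD('n)) * (sqrt (cmod (f (R *\<^sub>R z))) * bdef z powr N) \<le> K * i" if R: "0 < R" "R < 1" for R
      proof -
        let ?f = "\<lambda>z. f (R *\<^sub>R z)"
        have h: "Hinf ?f" using Hinf_dilate[OF f] R by simp
        obtain B where B: "B \<ge> 0" "\<And>z. z \<in> ball 0 1 \<Longrightarrow> cmod (?f z) \<le> B" using HinfE[OF h] by blast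
        have [measurable]: "?f \<in> borel_measurable (nu \<alpha>)" by (rule holomorphic_ball_measurable[OF HinfD[OF h]])
        have int: "integrable (nu \<alpha>) (\<lambda>\<xi>. sqrt (cmod (?f \<xi>)))"
          by (rule integrable_const_bound[of _ "sqrt B"]) (use B in auto)
        let ?J = "LINT \<xi>|nu \<alpha>. sqrt (cmod (?f \<xi>))"
        have "ennreal (R ^ (2 * CARD('n)) * ?J) = ennreal (R ^ (2 * CARD('n))) * (\<integral>\<^sup>+\<xi>. ennreal (sqrt (cmod (?f \<xi>))) \<partial>nu \<alpha>)"
          using R by (simp add: ennreal_mult' nn_integral_eq_integral[OF int])
        also have "\<dots> \<le> ?I" using nn_integral_dilation[OF \<alpha> R, of "\<lambda>\<xi>. ennreal (sqrt (cmod (f \<xi>)))"] by simp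
        finally have "R ^ (2 * CARD('n)) * ?J \<le> i" unfolding i(1) using i(2) by (simp add: ennreal_le_iff)
        then have "K * (R ^ (2 * CARD('n)) * ?J) \<le> K * i" using K by simp
        moreover have "R ^ (2 * CARD('n)) * (sqrt (cmod (?f z)) * bdef z powr N) \<le> R ^ (2 * CARD('n)) * (K * ?J)"
          using K(2)[OF h z] R by (intro mult_left_mono) auto
        ultimately show ?thesis by (simp add: mult_ac)
      qed
      have "1 ^ (2 * CARD('n)) * (sqrt (cmod (f (1 *\<^sub>R z))) * bdef z powr N) \<le> K * i"
      proof (rule tendsto_upperbound)
        have "isCont f (1 *\<^sub>R z)" using continuous_on_interior[OF holomorphic_ball_continuous[OF f]] z by simp
        then have "((\<lambda>R. f (R *\<^sub>R z)) \<longlongrightarrow> f (1 *\<^sub>R z)) (at_left 1)"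
          by (rule isCont_tendsto_compose) (intro tendsto_intros)
        then show "((\<lambda>R. R ^ (2 * CARD('n)) * (sqrt (cmod (f (R *\<^sub>R z))) * bdef z powr N)) \<longlongrightarrow> 1 ^ (2 * CARD('n)) * (sqrt (cmod (f (1 *\<^sub>R z))) * bdef z powr N)) (at_left 1)"
          by (intro tendsto_intros)
        show "\<forall>\<^sub>F R in at_left 1. R ^ (2 * CARD('n)) * (sqrt (cmod (f (R *\<^sub>R z))) * bdef z powr N) \<le> K * i"
          using R unfolding eventually_at_left_field by (intro exI[of _ 0]) auto
      qed auto
      also have "K * i \<le> max 1 K * i" using i by (intro mult_right_mono) auto
      finally have "ennreal (sqrt (cmod (f z)) * bdef z powr N) \<le> ennreal (max 1 K * i)" by (simp add: ennreal_leI)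
      then show ?thesis unfolding i(1) by (simp add: ennreal_mult')
    qed
  qed simp
qed

lemma sqrt_powr: "x \<ge> 0 \<Longrightarrow> sqrt (x powr a) = x powr (a / 2)"
  by (simp add: powr_half_sqrt[symmetric] powr_powr)

text \<open>Multiplying f by the kernel of order 4N at w replaces a change of variables by an
  automorphism. The square root turns it into |1 - <\<xi>,w>|^(-2N), its value at w cancels the
  weights, and the resulting density has total mass 1 by \<open>nn_kernel_square\<close>.\<close>

lemma sqrt_submean:
  assumes \<alpha>: "\<alpha> \<ge> 0"
  defines "N \<equiv> real CARD('n) + 1 + \<alpha>"
  shows "\<exists>K\<ge>1. \<forall>f :: complex ^ 'n \<Rightarrow> complex. holomorphic_ball f \<longrightarrow> (\<forall>w\<in>ball 0 1. 
    ennreal (sqrt (cmod (f w))) \<le> ennreal K * (\<integral>\<^sup>+\<xi>. ennreal (sqrt (cmod (f \<xi>)) * (bdef w powr N * cmod (1 - herm \<xi> w) powr (- 2 * N))) \<partial>nu \<alpha>))"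
proof -
  obtain K where K: "K \<ge> 1" "\<And>f z. holomorphic_ball f \<Longrightarrow> z \<in> ball (0::complex ^ 'n) 1 \<Longrightarrow> 
    ennreal (sqrt (cmod (f z)) * bdef z powr N) \<le> ennreal K * (\<integral>\<^sup>+\<xi>. ennreal (sqrt (cmod (f \<xi>))) \<partial>nu \<alpha>)"
    using sqrt_bound[OF \<alpha>, where 'n='n] unfolding N_def by blast
  show ?thesis
  proof (intro exI[of _ K] conjI allI impI ballI K(1))
    fix f :: "complex ^ 'n \<Rightarrow> complex" and w :: "complex ^ 'n" assume f: "holomorphic_ball f" and w: "w \<in> ball 0 1"
    have [measurable]: "f \<in> borel_measurable (nu \<alpha>)" by (rule holomorphic_ball_measurable[OF f])
    let ?F = "\<lambda>\<xi>. f \<xi> * bker (4 * N) (herm \<xi> w)"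
    have F: "holomorphic_ball ?F" by (intro holomorphic_ball_mult f HinfD Hinf_bker w)
    have d: "bdef w > 0" by (rule bdef_pos[OF w])
    have sF: "sqrt (cmod (?F \<xi>)) = sqrt (cmod (f \<xi>)) * cmod (1 - herm \<xi> w) powr (- 2 * N)" for \<xi>
      unfolding norm_mult norm_bker real_sqrt_mult by (subst sqrt_powr) auto
    have cw: "cmod (1 - herm w w) = bdef w"
    proof -
      have "1 - herm w w = of_real (bdef w)" unfolding herm_self by simp
      then show ?thesis using d by (simp only: norm_of_real abs_of_pos)
    qed
    have "sqrt (cmod (f w)) = bdef w powr N * (sqrt (cmod (?F w)) * bdef w powr N)"
    proof -
      have "bdef w powr N * bdef w powr (- 2 * N) * bdef w powr N = 1"
        using d by (simp flip: powr_add)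
      moreover have "bdef w powr N * (sqrt (cmod (?F w)) * bdef w powr N) = sqrt (cmod (f w)) * (bdef w powr N * bdef w powr (- 2 * N) * bdef w powr N)"
        unfolding sF cw by (simp only: mult_ac)
      ultimately show ?thesis by simp
    qed
    then have "ennreal (sqrt (cmod (f w))) = ennreal (bdef w powr N) * ennreal (sqrt (cmod (?F w)) * bdef w powr N)"
      by (simp add: ennreal_mult)
    also have "\<dots> \<le> ennreal (bdef w powr N) * (ennreal K * (\<integral>\<^sup>+\<xi>. ennreal (sqrt (cmod (?F \<xi>))) \<partial>nu \<alpha>))"
      by (intro mult_left_mono K(2) F w) simp
    also have "\<dots> = ennreal K * (ennreal (bdef w powr N) * (\<integral>\<^sup>+\<xi>. ennreal (sqrt (cmod (?F \<xi>))) \<partial>nu \<alpha>))"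
      by (rule mult.left_commute)
    also have "ennreal (bdef w powr N) * (\<integral>\<^sup>+\<xi>. ennreal (sqrt (cmod (?F \<xi>))) \<partial>nu \<alpha>) = 
      (\<integral>\<^sup>+\<xi>. ennreal (sqrt (cmod (f \<xi>)) * (bdef w powr N * cmod (1 - herm \<xi> w) powr (- 2 * N))) \<partial>nu \<alpha>)"
      unfolding sF by (subst nn_integral_cmult[symmetric], measurable) (simp add: ennreal_mult mult_ac)
    finally show "ennreal (sqrt (cmod (f w))) \<le> ennreal K * (\<integral>\<^sup>+\<xi>. ennreal (sqrt (cmod (f \<xi>)) * (bdef w powr N * cmod (1 - herm \<xi> w) powr (- 2 * N))) \<partial>nu \<alpha>)" .
  qed
qed

text \<open>At least half of the mean \<open>m\<close> comes from the set where \<open>u \<ge> m / 2\<close>, which replaces convexity.\<close>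

lemma jensen_half:
  fixes u p :: "'a \<Rightarrow> real" and \<Psi> :: "real \<Rightarrow> real"
  assumes [measurable]: "u \<in> borel_measurable M" "p \<in> borel_measurable M" "(\<lambda>x. \<Psi> (u x)) \<in> borel_measurable M"
    and u: "\<And>x. x \<in> space M \<Longrightarrow> u x \<ge> 0" and p: "\<And>x. x \<in> space M \<Longrightarrow> p x \<ge> 0" and p1: "(\<integral>\<^sup>+x. ennreal (p x) \<partial>M) \<le> 1"
    and \<Psi>0: "\<And>x. x \<ge> 0 \<Longrightarrow> \<Psi> x \<ge> 0" and \<Psi>: "\<And>x y. 0 < x \<Longrightarrow> x \<le> y \<Longrightarrow> \<Psi> x * y \<le> \<Psi> y * x"
    and m: "m > 0" "ennreal m \<le> (\<integral>\<^sup>+x. ennreal (u x * p x) \<partial>M)"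
  shows "ennreal (\<Psi> (m / 2)) \<le> (\<integral>\<^sup>+x. ennreal (\<Psi> (u x) * p x) \<partial>M)"
proof -
  define X where "X = (\<integral>\<^sup>+x. ennreal (u x * p x) * indicator {x. m / 2 \<le> u x} x \<partial>M)"
  have "ennreal (m / 2) + ennreal (m / 2) = ennreal m" using m by (simp flip: ennreal_plus)
  also have "\<dots> \<le> (\<integral>\<^sup>+x. ennreal (u x * p x) \<partial>M)" by fact
  also have "\<dots> \<le> (\<integral>\<^sup>+x. ennreal (m / 2) * ennreal (p x) + ennreal (u x * p x) * indicator {x. m / 2 \<le> u x} x \<partial>M)"
  proof (rule nn_integral_mono)
    fix x assume x: "x \<in> space M"
    show "ennreal (u x * p x) \<le> ennreal (m / 2) * ennreal (p x) + ennreal (u x * p x) * indicator {x. m / 2 \<le> u x} x"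
    proof (cases "m / 2 \<le> u x")
      case False
      then have "u x * p x \<le> m / 2 * p x" using p[OF x] by (intro mult_right_mono) auto
      then have "ennreal (u x * p x) \<le> ennreal (m / 2) * ennreal (p x)" using m p[OF x] by (simp add: ennreal_leI flip: ennreal_mult)
      then show ?thesis using False by simp
    qed simp
  qed
  also have "\<dots> = ennreal (m / 2) * (\<integral>\<^sup>+x. ennreal (p x) \<partial>M) + X"
    unfolding X_def by (subst nn_integral_add, measurable, subst nn_integral_cmult) auto
  also have "\<dots> \<le> ennreal (m / 2) * 1 + X" by (intro add_right_mono mult_left_mono p1) auto
  finally have X: "ennreal (m / 2) \<le> X" by (simp add: ennreal_add_left_cancel_le)
  have "ennreal (m / 2) * ennreal (\<Psi> (m / 2)) \<le> ennreal (\<Psi> (m / 2)) * X"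
    using X by (subst mult.commute) (intro mult_left_mono, auto)
  also have "\<dots> = (\<integral>\<^sup>+x. ennreal (\<Psi> (m / 2)) * (ennreal (u x * p x) * indicator {x. m / 2 \<le> u x} x) \<partial>M)"
    unfolding X_def by (subst nn_integral_cmult) auto
  also have "\<dots> \<le> (\<integral>\<^sup>+x. ennreal (m / 2) * ennreal (\<Psi> (u x) * p x) \<partial>M)"
  proof (rule nn_integral_mono)
    fix x assume x: "x \<in> space M"
    show "ennreal (\<Psi> (m / 2)) * (ennreal (u x * p x) * indicator {x. m / 2 \<le> u x} x) \<le> ennreal (m / 2) * ennreal (\<Psi> (u x) * p x)"
    proof (cases "m / 2 \<le> u x")
      case True
      then have "\<Psi> (m / 2) * u x * p x \<le> \<Psi> (u x) * (m / 2) * p x" using m p[OF x] by (intro mult_right_mono \<Psi>) auto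
      then show ?thesis using True m p[OF x] u[OF x] \<Psi>0[of "m / 2"] \<Psi>0[of "u x"]
        by (simp add: ennreal_leI mult_ac flip: ennreal_mult)
    qed simp
  qed
  also have "\<dots> = ennreal (m / 2) * (\<integral>\<^sup>+x. ennreal (\<Psi> (u x) * p x) \<partial>M)"
    by (rule nn_integral_cmult) measurable
  finally show ?thesis using m by (subst (asm) ennreal_mult_le_mult_iff) auto
qed

text \<open>The only properties of a growth function that enter the pointwise theory; all three
  functions of the theorem satisfy them.\<close>

definition moderate :: "(real \<Rightarrow> real) \<Rightarrow> bool" where
  "moderate \<Phi> \<longleftrightarrow> continuous_on {0..} \<Phi> \<and> mono_on {0..} \<Phi> \<and> \<Phi> 0 = 0 \<and> (\<forall>t>0. \<Phi> t > 0) \<and>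
    (\<forall>x M. 0 \<le> x \<longrightarrow> x \<le> 1 \<longrightarrow> 0 \<le> M \<longrightarrow> \<Phi> (x * M) \<le> sqrt x * \<Phi> M) \<and>
    (\<exists>C\<ge>1. \<exists>q\<ge>0. \<forall>x M. 1 \<le> x \<longrightarrow> 0 \<le> M \<longrightarrow> \<Phi> (x * M) \<le> C * x powr q * \<Phi> M)"

lemma moderateD:
  assumes "moderate \<Phi>"
  shows "continuous_on {0..} \<Phi>" "\<Phi> 0 = 0" "\<And>t. t > 0 \<Longrightarrow> \<Phi> t > 0" "\<And>t. t \<ge> 0 \<Longrightarrow> \<Phi> t \<ge> 0"
    "\<And>s t. 0 \<le> s \<Longrightarrow> s \<le> t \<Longrightarrow> \<Phi> s \<le> \<Phi> t"
    "\<And>x M. 0 \<le> x \<Longrightarrow> x \<le> 1 \<Longrightarrow> 0 \<le> M \<Longrightarrow> \<Phi> (x * M) \<le> sqrt x * \<Phi> M"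
proof -
  show 1: "continuous_on {0..} \<Phi>" "\<Phi> 0 = 0" "\<And>t. t > 0 \<Longrightarrow> \<Phi> t > 0" "\<And>s t. 0 \<le> s \<Longrightarrow> s \<le> t \<Longrightarrow> \<Phi> s \<le> \<Phi> t"
    "\<And>x M. 0 \<le> x \<Longrightarrow> x \<le> 1 \<Longrightarrow> 0 \<le> M \<Longrightarrow> \<Phi> (x * M) \<le> sqrt x * \<Phi> M"
    using assms by (auto simp: moderate_def mono_on_def)
  show "\<And>t. t \<ge> 0 \<Longrightarrow> \<Phi> t \<ge> 0" using 1(2,4) by force
qed

lemma moderate_upper:
  assumes "moderate \<Phi>"
  obtains C q where "C \<ge> 1" "q \<ge> 0" "\<And>x M. 1 \<le> x \<Longrightarrow> 0 \<le> M \<Longrightarrow> \<Phi> (x * M) \<le> C * x powr q * \<Phi> M"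
  using assms unfolding moderate_def by blast

lemma moderate_measurable:
  assumes \<Phi>: "moderate \<Phi>" and u: "u \<in> borel_measurable M" "\<And>x. x \<in> space M \<Longrightarrow> (0::real) \<le> u x"
  shows "(\<lambda>x. \<Phi> (u x)) \<in> borel_measurable M"
proof -
  have "(\<lambda>t. \<Phi> (max 0 t)) \<in> borel_measurable borel"
    by (intro borel_measurable_continuous_onI continuous_on_compose2[OF moderateD(1)[OF \<Phi>]] continuous_intros) auto
  from measurable_compose[OF u(1) this] have "(\<lambda>x. \<Phi> (max 0 (u x))) \<in> borel_measurable M" .
  also have "?this \<longleftrightarrow> ?thesis" using u(2) by (intro measurable_cong) (simp add: max_absorb2)
  finally show ?thesis .
qed

lemma moderate_cmod_measurable:
  assumes \<Phi>: "moderate \<Phi>" and f: "f \<in> borel_measurable M" and c: "c \<ge> 0"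
  shows "(\<lambda>x. \<Phi> (cmod (f x) / c)) \<in> borel_measurable M"
  by (rule moderate_measurable[OF \<Phi>]) (use f c in auto)

text \<open>\<open>jensen_half\<close> is applied to sqrt|f| and x -> \<Phi>(x^2): the lower type
  1/2 of \<Phi> is precisely the required monotonicity of \<Phi>(x^2)/x. Working in the weight
  \<alpha> + 1 secures a nonnegative weight and leaves a factor \<open>bdef\<close> in the
  integration variable, which pays for a singular integral when dilates are compared.\<close>

lemma moderate_submean:
  assumes \<Phi>: "moderate \<Phi>" and \<alpha>: "\<alpha> > -1"
  defines "N \<equiv> real CARD('n) + 1 + \<alpha>"
  shows "\<exists>K>0. \<forall>f :: complex ^ 'n \<Rightarrow> complex. holomorphic_ball f \<longrightarrow> (\<forall>w\<in>ball 0 1. 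
    ennreal (\<Phi> (cmod (f w))) \<le> ennreal K * (\<integral>\<^sup>+\<xi>. ennreal (\<Phi> (cmod (f \<xi>)) * (bdef w powr (N + 1) * bdef \<xi> * cmod (1 - herm \<xi> w) powr (- 2 * (N + 1)))) \<partial>nu \<alpha>))"
proof -
  have a1: "\<alpha> + 1 \<ge> 0" "\<alpha> + 1 > -1" using \<alpha> by auto
  note p = nu_mass_pos[OF \<alpha>, where 'n='n] nu_mass_pos[OF a1(2), where 'n='n]
  let ?c = "nu_mass TYPE('n) \<alpha> / nu_mass TYPE('n) (\<alpha> + 1)"
  note \<Phi>D = moderateD[OF \<Phi>]
  obtain C q where Cq: "C \<ge> 1" "q \<ge> 0" "\<And>x M. 1 \<le> x \<Longrightarrow> 0 \<le> M \<Longrightarrow> \<Phi> (x * M) \<le> C * x powr q * \<Phi> M"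
    using moderate_upper[OF \<Phi>] by blast
  have NN: "real CARD('n) + 1 + (\<alpha> + 1) = N + 1" by (simp add: N_def)
  obtain K where K: "K \<ge> 1" "\<And>f w. holomorphic_ball f \<Longrightarrow> w \<in> ball (0::complex ^ 'n) 1 \<Longrightarrow> 
    ennreal (sqrt (cmod (f w))) \<le> ennreal K * (\<integral>\<^sup>+\<xi>. ennreal (sqrt (cmod (f \<xi>)) * (bdef w powr (N + 1) * cmod (1 - herm \<xi> w) powr (- 2 * (N + 1)))) \<partial>nu (\<alpha> + 1))"
    using sqrt_submean[OF a1(1), where 'n='n] unfolding NN by blast
  \<comment> \<open>Halving the mean and the constant K of \<open>sqrt_submean\<close> give \<Phi>
    at |f(w)| / (4 K^2); the upper type removes this factor. The quotient of masses comes from the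
    change of weight.\<close>
  define K' where "K' = C * (4 * K\<^sup>2) powr q * ?c"
  have K': "K' > 0" using Cq K p by (simp add: K'_def)
  show ?thesis
  proof (intro exI[of _ K'] conjI allI impI ballI K')
    fix f :: "complex ^ 'n \<Rightarrow> complex" and w :: "complex ^ 'n" assume f: "holomorphic_ball f" and w: "w \<in> ball 0 1"
    have [measurable]: "f \<in> borel_measurable (nu \<alpha>)" "f \<in> borel_measurable (nu (\<alpha> + 1))" by (rule holomorphic_ball_measurable[OF f])+
    have d: "bdef w > 0" by (rule bdef_pos[OF w])
    let ?p = "\<lambda>\<xi>. bdef w powr (N + 1) * cmod (1 - herm \<xi> w) powr (- 2 * (N + 1))"
    have \<Phi>m: "(\<lambda>\<xi>. \<Phi> (cmod (f \<xi>))) \<in> borel_measurable (nu \<beta>)" if "f \<in> borel_measurable (nu \<beta>)" for \<beta>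
      using moderate_cmod_measurable[OF \<Phi> that, of 1] by simp
    note [measurable] = \<Phi>m[of \<alpha>] \<Phi>m[of "\<alpha> + 1"]
    have 1: "ennreal (\<Phi> (cmod (f w))) \<le> ennreal (C * (4 * K\<^sup>2) powr q) * (\<integral>\<^sup>+\<xi>. ennreal (\<Phi> (cmod (f \<xi>)) * ?p \<xi>) \<partial>nu (\<alpha> + 1))"
    proof (cases "f w = 0")
      case True then show ?thesis by (simp add: \<Phi>D)
    next
      case False
      define m where "m = sqrt (cmod (f w)) / K"
      have m: "m > 0" using False K by (simp add: m_def)
      have mint: "ennreal m \<le> (\<integral>\<^sup>+\<xi>. ennreal (sqrt (cmod (f \<xi>)) * ?p \<xi>) \<partial>nu (\<alpha> + 1))"
      proof -
        have "ennreal K * ennreal m = ennreal (sqrt (cmod (f w)))" using K m by (simp add: m_def flip: ennreal_mult)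
        also have "\<dots> \<le> ennreal K * (\<integral>\<^sup>+\<xi>. ennreal (sqrt (cmod (f \<xi>)) * ?p \<xi>) \<partial>nu (\<alpha> + 1))" by (rule K(2)[OF f w])
        finally show ?thesis using K by (subst (asm) ennreal_mult_le_mult_iff) auto
      qed
      have "ennreal ((\<lambda>x. \<Phi> (x\<^sup>2)) (m / 2)) \<le> (\<integral>\<^sup>+\<xi>. ennreal ((\<lambda>x. \<Phi> (x\<^sup>2)) (sqrt (cmod (f \<xi>))) * ?p \<xi>) \<partial>nu (\<alpha> + 1))"
      proof (rule jensen_half[OF _ _ _ _ _ _ _ _ m mint])
        show "(\<lambda>\<xi>. \<Phi> ((sqrt (cmod (f \<xi>)))\<^sup>2)) \<in> borel_measurable (nu (\<alpha> + 1))" by simp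
        have "(\<integral>\<^sup>+\<xi>. ennreal (?p \<xi>) \<partial>nu (\<alpha> + 1)) = ennreal (bdef w powr (N + 1)) * (\<integral>\<^sup>+\<xi>. ennreal (cmod (1 - herm \<xi> w) powr (- 2 * (N + 1))) \<partial>nu (\<alpha> + 1))"
          by (subst nn_integral_cmult[symmetric], measurable) (simp add: ennreal_mult)
        also have "\<dots> = ennreal (bdef w powr (N + 1)) * ennreal (bdef w powr (- (N + 1)))"
          using nn_kernel_square[OF a1(2) w] unfolding NN by simp
        also have "\<dots> = 1" using d by (simp flip: ennreal_mult powr_add)
        finally show "(\<integral>\<^sup>+\<xi>. ennreal (?p \<xi>) \<partial>nu (\<alpha> + 1)) \<le> 1" by simp
        show "\<Phi> (x\<^sup>2) * y \<le> \<Phi> (y\<^sup>2) * x" if xy: "0 < x" "x \<le> y" for x y :: real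
        proof -
          have "\<Phi> ((x / y)\<^sup>2 * y\<^sup>2) \<le> sqrt ((x / y)\<^sup>2) * \<Phi> (y\<^sup>2)"
            using xy by (intro \<Phi>D(6)) (auto simp: power_le_one)
          then have "\<Phi> (x\<^sup>2) \<le> x / y * \<Phi> (y\<^sup>2)" using xy by (simp add: power_divide real_sqrt_divide)
          then show ?thesis using xy by (simp add: field_simps)
        qed
      qed (use \<Phi>D in auto)
      then have 2: "ennreal (\<Phi> ((m / 2)\<^sup>2)) \<le> (\<integral>\<^sup>+\<xi>. ennreal (\<Phi> (cmod (f \<xi>)) * ?p \<xi>) \<partial>nu (\<alpha> + 1))" by simp
      have "cmod (f w) = (4 * K\<^sup>2) * (m / 2)\<^sup>2" using K by (simp add: m_def power_divide)
      then have "\<Phi> (cmod (f w)) \<le> C * (4 * K\<^sup>2) powr q * \<Phi> ((m / 2)\<^sup>2)"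
        using Cq(3)[of "4 * K\<^sup>2" "(m / 2)\<^sup>2"] one_le_power[OF K(1), of 2] by simp
      then have "ennreal (\<Phi> (cmod (f w))) \<le> ennreal (C * (4 * K\<^sup>2) powr q) * ennreal (\<Phi> ((m / 2)\<^sup>2))"
        using Cq \<Phi>D by (subst ennreal_mult[symmetric]) (auto intro: ennreal_leI)
      also have "\<dots> \<le> ennreal (C * (4 * K\<^sup>2) powr q) * (\<integral>\<^sup>+\<xi>. ennreal (\<Phi> (cmod (f \<xi>)) * ?p \<xi>) \<partial>nu (\<alpha> + 1))"
        by (intro mult_left_mono 2) simp
      finally show ?thesis .
    qed
    also have "(\<integral>\<^sup>+\<xi>. ennreal (\<Phi> (cmod (f \<xi>)) * ?p \<xi>) \<partial>nu (\<alpha> + 1)) = ennreal ?c * (\<integral>\<^sup>+\<xi>. ennreal (bdef \<xi> powr 1) * ennreal (\<Phi> (cmod (f \<xi>)) * ?p \<xi>) \<partial>nu \<alpha>)"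
      by (rule nn_integral_nu_shift[OF \<alpha> a1(2)]) measurable
    also have "(\<integral>\<^sup>+\<xi>. ennreal (bdef \<xi> powr 1) * ennreal (\<Phi> (cmod (f \<xi>)) * ?p \<xi>) \<partial>nu \<alpha>)
      = (\<integral>\<^sup>+\<xi>. ennreal (\<Phi> (cmod (f \<xi>)) * (bdef w powr (N + 1) * bdef \<xi> * cmod (1 - herm \<xi> w) powr (- 2 * (N + 1)))) \<partial>nu \<alpha>)"
    proof (rule nn_integral_cong)
      fix \<xi> :: "complex ^ 'n" assume "\<xi> \<in> space (nu \<alpha>)"
      then have "bdef \<xi> > 0" by (intro bdef_pos) simp
      then show "ennreal (bdef \<xi> powr 1) * ennreal (\<Phi> (cmod (f \<xi>)) * ?p \<xi>) = ennreal (\<Phi> (cmod (f \<xi>)) * (bdef w powr (N + 1) * bdef \<xi> * cmod (1 - herm \<xi> w) powr (- 2 * (N + 1))))"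
        using \<Phi>D by (simp add: mult_ac flip: ennreal_mult)
    qed
    finally show "ennreal (\<Phi> (cmod (f w))) \<le> ennreal K' * (\<integral>\<^sup>+\<xi>. ennreal (\<Phi> (cmod (f \<xi>)) * (bdef w powr (N + 1) * bdef \<xi> * cmod (1 - herm \<xi> w) powr (- 2 * (N + 1)))) \<partial>nu \<alpha>)"
      using p Cq unfolding K'_def by (subst ennreal_mult) (auto simp: mult.assoc)
  qed
qed

text \<open>Of the 2N + 2 powers of |1 - <\<xi>,w>| in the sub-mean-value kernel, one absorbs
  \<open>bdef\<close> at \<xi> and the others are bounded below by \<open>bdef\<close> at w, which
  leaves bdef(w)^(-N).\<close>

lemma moderate_pointwise:
  assumes \<Phi>: "moderate \<Phi>" and \<alpha>: "\<alpha> > -1"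
  defines "N \<equiv> real CARD('n) + 1 + \<alpha>"
  shows "\<exists>K\<ge>1. \<forall>f :: complex ^ 'n \<Rightarrow> complex. holomorphic_ball f \<longrightarrow> (\<forall>w\<in>ball 0 1. 
    ennreal (\<Phi> (cmod (f w))) \<le> ennreal (K * bdef w powr (- N)) * (\<integral>\<^sup>+\<xi>. ennreal (\<Phi> (cmod (f \<xi>))) \<partial>nu \<alpha>))"
proof -
  have N: "N > 0" using \<alpha> by (simp add: N_def)
  note \<Phi>D = moderateD[OF \<Phi>]
  obtain K where K: "K > 0" "\<And>f w. holomorphic_ball f \<Longrightarrow> w \<in> ball (0::complex ^ 'n) 1 \<Longrightarrow> 
    ennreal (\<Phi> (cmod (f w))) \<le> ennreal K * (\<integral>\<^sup>+\<xi>. ennreal (\<Phi> (cmod (f \<xi>)) * (bdef w powr (N + 1) * bdef \<xi> * cmod (1 - herm \<xi> w) powr (- 2 * (N + 1)))) \<partial>nu \<alpha>)"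
    using moderate_submean[OF \<Phi> \<alpha>, where 'n='n] unfolding N_def by blast
  define K' where "K' = max 1 (K * (2 * 2 powr (2 * N + 1)))"
  have K': "K' \<ge> 1" by (simp add: K'_def)
  show ?thesis
  proof (intro exI[of _ K'] conjI allI impI ballI K')
    fix f :: "complex ^ 'n \<Rightarrow> complex" and w :: "complex ^ 'n" assume f: "holomorphic_ball f" and w: "w \<in> ball 0 1"
    have [measurable]: "f \<in> borel_measurable (nu \<alpha>)" by (rule holomorphic_ball_measurable[OF f])
    have d: "bdef w > 0" by (rule bdef_pos[OF w])
    note [measurable] = moderate_cmod_measurable[OF \<Phi> \<open>f \<in> borel_measurable (nu \<alpha>)\<close>, of 1, simplified]
    have le: "bdef w powr (N + 1) * bdef \<xi> * cmod (1 - herm \<xi> w) powr (- 2 * (N + 1)) \<le> 2 * 2 powr (2 * N + 1) * bdef w powr (- N)" if \<xi>: "\<xi> \<in> ball 0 1" for \<xi>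
    proof -
      let ?y = "cmod (1 - herm \<xi> w)"
      have y: "bdef w / 2 \<le> ?y" "bdef \<xi> \<le> 2 * ?y" "?y > 0" using kernel_lower[OF \<xi> w] by auto
      have "?y powr (- 2 * (N + 1)) = ?y powr (- (2 * N + 1)) * ?y powr (-1)" unfolding powr_add[symmetric] by (rule arg_cong[of _ _ "(powr) _"]) simp
      then have "bdef w powr (N + 1) * bdef \<xi> * ?y powr (- 2 * (N + 1)) = bdef w powr (N + 1) * (bdef \<xi> * ?y powr (-1)) * ?y powr (- (2 * N + 1))"
        by (simp only: mult_ac)
      also have "\<dots> \<le> bdef w powr (N + 1) * 2 * (bdef w / 2) powr (- (2 * N + 1))"
      proof (intro mult_mono mult_left_mono)
        show "bdef \<xi> * ?y powr (-1) \<le> 2" using y by (simp add: powr_minus_divide field_simps)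
        show "?y powr (- (2 * N + 1)) \<le> (bdef w / 2) powr (- (2 * N + 1))" using y d N by (intro powr_mono2') auto
      qed (use bdef_pos[OF \<xi>] in auto)
      also have "(bdef w / 2) powr (- (2 * N + 1)) = 2 powr (2 * N + 1) * bdef w powr (- (2 * N + 1))"
        using d by (simp only: powr_divide powr_minus) (simp add: field_simps)
      also have "bdef w powr (N + 1) * 2 * (2 powr (2 * N + 1) * bdef w powr (- (2 * N + 1))) = 2 * 2 powr (2 * N + 1) * (bdef w powr (N + 1) * bdef w powr (- (2 * N + 1)))"
        by (simp only: mult_ac)
      also have "bdef w powr (N + 1) * bdef w powr (- (2 * N + 1)) = bdef w powr (- N)" unfolding powr_add[symmetric] by simp
      finally show ?thesis .
    qed
    have "ennreal (\<Phi> (cmod (f w))) \<le> ennreal K * (\<integral>\<^sup>+\<xi>. ennreal (\<Phi> (cmod (f \<xi>)) * (bdef w powr (N + 1) * bdef \<xi> * cmod (1 - herm \<xi> w) powr (- 2 * (N + 1)))) \<partial>nu \<alpha>)"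
      by (rule K(2)[OF f w])
    also have "\<dots> \<le> ennreal K * (\<integral>\<^sup>+\<xi>. ennreal (2 * 2 powr (2 * N + 1) * bdef w powr (- N)) * ennreal (\<Phi> (cmod (f \<xi>))) \<partial>nu \<alpha>)"
    proof (intro mult_left_mono nn_integral_mono)
      fix \<xi> :: "complex ^ 'n" assume "\<xi> \<in> space (nu \<alpha>)"
      then have "\<Phi> (cmod (f \<xi>)) * (bdef w powr (N + 1) * bdef \<xi> * cmod (1 - herm \<xi> w) powr (- 2 * (N + 1))) \<le> \<Phi> (cmod (f \<xi>)) * (2 * 2 powr (2 * N + 1) * bdef w powr (- N))"
        using \<Phi>D by (intro mult_left_mono le) auto
      then show "ennreal (\<Phi> (cmod (f \<xi>)) * (bdef w powr (N + 1) * bdef \<xi> * cmod (1 - herm \<xi> w) powr (- 2 * (N + 1)))) \<le> ennreal (2 * 2 powr (2 * N + 1) * bdef w powr (- N)) * ennreal (\<Phi> (cmod (f \<xi>)))"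
        using \<Phi>D by (subst ennreal_mult[symmetric]) (auto intro!: ennreal_leI simp: mult.commute)
    qed simp
    also have "\<dots> = ennreal (K * (2 * 2 powr (2 * N + 1)) * bdef w powr (- N)) * (\<integral>\<^sup>+\<xi>. ennreal (\<Phi> (cmod (f \<xi>))) \<partial>nu \<alpha>)"
      using K by (subst nn_integral_cmult, measurable) (simp add: ennreal_mult mult.assoc)
    also have "\<dots> \<le> ennreal (K' * bdef w powr (- N)) * (\<integral>\<^sup>+\<xi>. ennreal (\<Phi> (cmod (f \<xi>))) \<partial>nu \<alpha>)"
      by (intro mult_right_mono ennreal_leI) (auto simp: K'_def)
    finally show "ennreal (\<Phi> (cmod (f w))) \<le> ennreal (K' * bdef w powr (- N)) * (\<integral>\<^sup>+\<xi>. ennreal (\<Phi> (cmod (f \<xi>))) \<partial>nu \<alpha>)" .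
  qed
qed

section \<open>Growth functions\<close>

lemma growth_inv_props:
  assumes "growth_function \<Phi>" "y \<ge> 0"
  shows "growth_inv \<Phi> y \<ge> 0" "\<Phi> (growth_inv \<Phi> y) = y"
proof -
  have y: "y \<in> \<Phi> ` {0..}" using assms by (simp add: growth_function_def)
  show "growth_inv \<Phi> y \<ge> 0" using inv_into_into[OF y] by simp
  show "\<Phi> (growth_inv \<Phi> y) = y" by (rule f_inv_into_f[OF y])
qed

lemma growth_function_mono: "growth_function \<Phi> \<Longrightarrow> 0 \<le> s \<Longrightarrow> s \<le> t \<Longrightarrow> \<Phi> s \<le> \<Phi> t"
  by (auto simp: growth_function_def mono_on_def)

lemma growth_function_nonneg: "growth_function \<Phi> \<Longrightarrow> 0 \<le> t \<Longrightarrow> 0 \<le> \<Phi> t"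
  by (auto simp: growth_function_def)

lemma growth_function_0: assumes "growth_function \<Phi>" shows "\<Phi> 0 = 0"
  using growth_function_mono[OF assms order.refl growth_inv_props(1)[OF assms order.refl]]
    growth_inv_props(2)[OF assms order.refl] growth_function_nonneg[OF assms order.refl] by simp

lemma growth_inv_pos:
  assumes "growth_function \<Phi>" "y > 0" shows "growth_inv \<Phi> y > 0"
  using growth_inv_props[OF assms(1), of y] growth_function_0[OF assms(1)] assms(2) by (cases "growth_inv \<Phi> y = 0") auto

text \<open>\<open>growth_inv\<close> selects some preimage, and a growth function may have flat
  pieces. Comparison with a given point is therefore stated for strict inequalities of values; later
  arguments approach values of \<Phi> strictly from one side.\<close>

lemma growth_inv_less:
  assumes "growth_function \<Phi>" "0 \<le> y" "0 \<le> x" "y < \<Phi> x" shows "growth_inv \<Phi> y < x"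
  using growth_function_mono[OF assms(1,3), of "growth_inv \<Phi> y"] growth_inv_props[OF assms(1,2)] assms(4) by linarith

lemma growth_inv_greater:
  assumes "growth_function \<Phi>" "0 \<le> x" "\<Phi> x < y" shows "x < growth_inv \<Phi> y"
proof -
  have "0 \<le> y" using growth_function_nonneg[OF assms(1,2)] assms(3) by simp
  note growth_inv_props[OF assms(1) this]
  then show ?thesis using growth_function_mono[OF assms(1), of "growth_inv \<Phi> y" x] assms(3) by linarith
qed

lemma growth_inv_mono:
  assumes "growth_function \<Phi>" "0 \<le> y" "y \<le> y'" shows "growth_inv \<Phi> y \<le> growth_inv \<Phi> y'"
proof (cases "y = y'")
  case False
  then show ?thesis
    using growth_inv_greater[OF assms(1) growth_inv_props(1)[OF assms(1,2)], of y'] growth_inv_props(2)[OF assms(1,2)] assms(3) by simp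
qed simp

lemma growth_U_D:
  assumes "\<Phi> \<in> growth_U q"
  shows "growth_function \<Phi>" "growth_upper_type q \<Phi>" "\<And>s t. 0 < s \<Longrightarrow> s \<le> t \<Longrightarrow> \<Phi> s / s \<le> \<Phi> t / t"
  using assms by (auto simp: growth_U_def mono_on_def)

text \<open>By the upper type a zero at t > 0 would force zeros at all larger arguments, against
  surjectivity.\<close>

lemma growth_U_pos:
  assumes \<Phi>: "\<Phi> \<in> growth_U q" and t: "t > 0" shows "\<Phi> t > 0"
proof (rule ccontr)
  note g = growth_U_D(1)[OF \<Phi>]
  assume "\<not> \<Phi> t > 0"
  then have z: "\<Phi> t = 0" using growth_function_nonneg[OF g, of t] t by simp
  obtain C where C: "C > 0" "\<And>s x. s > 0 \<Longrightarrow> x \<ge> 1 \<Longrightarrow> \<Phi> (s * x) \<le> C * x powr q * \<Phi> s"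
    using growth_U_D(2)[OF \<Phi>] unfolding growth_upper_type_def by blast
  define y where "y = growth_inv \<Phi> 1"
  have y: "y \<ge> 0" "\<Phi> y = 1" using growth_inv_props[OF g, of 1] by (auto simp: y_def)
  have "t < y" using growth_function_mono[OF g y(1), of t] y z by (cases "t < y") auto
  then have "\<Phi> (t * (y / t)) \<le> C * (y / t) powr q * \<Phi> t" using t by (intro C(2)) auto
  then show False using z y t by simp
qed

lemma growth_U_scale_down:
  assumes \<Phi>: "\<Phi> \<in> growth_U q" and x: "0 \<le> x" "x \<le> 1" and M: "0 \<le> M"
  shows "\<Phi> (x * M) \<le> x * \<Phi> M"
proof (cases "x = 0 \<or> M = 0")
  case True
  then show ?thesis using growth_function_0[OF growth_U_D(1)[OF \<Phi>]] x growth_function_nonneg[OF growth_U_D(1)[OF \<Phi>] M] by auto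
next
  case False
  then have "\<Phi> (x * M) / (x * M) \<le> \<Phi> M / M" using x M by (intro growth_U_D(3)[OF \<Phi>]) (auto simp: mult_left_le_one_le)
  then show ?thesis using False x M by (simp add: field_simps)
qed

lemma le_sqrt_unit: "0 \<le> x \<Longrightarrow> x \<le> 1 \<Longrightarrow> x \<le> sqrt x"
  by (intro real_le_rsqrt) (simp add: power2_eq_square mult_left_le)

lemma growth_U_moderate:
  assumes \<Phi>: "\<Phi> \<in> growth_U q" and q: "q \<ge> 0" shows "moderate \<Phi>"
  unfolding moderate_def
proof (intro conjI allI impI)
  note g = growth_U_D(1)[OF \<Phi>]
  show "continuous_on {0..} \<Phi>" "mono_on {0..} \<Phi>" using g by (auto simp: growth_function_def)
  show "\<Phi> 0 = 0" by (rule growth_function_0[OF g])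
  show "\<Phi> t > 0" if "t > 0" for t by (rule growth_U_pos[OF \<Phi> that])
  show "\<Phi> (x * M) \<le> sqrt x * \<Phi> M" if "0 \<le> x" "x \<le> 1" "0 \<le> M" for x M
    using growth_U_scale_down[OF \<Phi> that] mult_right_mono[OF le_sqrt_unit[OF that(1,2)] growth_function_nonneg[OF g that(3)]] by linarith
  obtain C where C: "C > 0" "\<And>s x. s > 0 \<Longrightarrow> x \<ge> 1 \<Longrightarrow> \<Phi> (s * x) \<le> C * x powr q * \<Phi> s"
    using growth_U_D(2)[OF \<Phi>] unfolding growth_upper_type_def by blast
  show "\<exists>C\<ge>1. \<exists>q\<ge>0. \<forall>x M. 1 \<le> x \<longrightarrow> 0 \<le> M \<longrightarrow> \<Phi> (x * M) \<le> C * x powr q * \<Phi> M"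
  proof (rule exI[of _ "max 1 C"], rule conjI, simp, rule exI[of _ q], intro conjI q allI impI)
    fix x M :: real assume x: "1 \<le> x" and M: "0 \<le> M"
    show "\<Phi> (x * M) \<le> max 1 C * x powr q * \<Phi> M"
    proof (cases "M = 0")
      case False
      then have "\<Phi> (x * M) \<le> C * x powr q * \<Phi> M" using C(2)[of M x] x M by (simp add: mult.commute)
      also have "\<dots> \<le> max 1 C * x powr q * \<Phi> M"
        using growth_function_nonneg[OF g M] by (intro mult_right_mono) auto
      finally show ?thesis .
    qed (simp add: growth_function_0[OF g])
  qed
qed

text \<open>Let \<psi>(t) = \<Phi>(t)/t, which is non-decreasing. Bounding \<psi> below by \<psi>(a)
  on [a, t], the Dini integral gives \<psi>(a) ln(t/a) \<le> C \<psi>(t). So \<psi> at least halves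
  whenever its argument is divided by a fixed large K, and iteration yields a power.\<close>

lemma dini_lower_type:
  assumes \<Phi>: "\<Phi> \<in> growth_U q" and dini: "dini_condition \<Phi>"
  shows "\<exists>\<epsilon>>0. \<epsilon> \<le> 1 \<and> (\<exists>C\<ge>1. \<forall>x M. 0 < x \<longrightarrow> x \<le> 1 \<longrightarrow> 0 \<le> M \<longrightarrow> \<Phi> (x * M) \<le> C * x powr (1 + \<epsilon>) * \<Phi> M)"
proof -
  note g = growth_U_D(1)[OF \<Phi>]
  obtain C where C: "C > 0" "\<And>t. t > 0 \<Longrightarrow> (\<integral>\<^sup>+s\<in>{0<..<t}. ennreal (\<Phi> s / s\<^sup>2) \<partial>lborel) \<le> ennreal (C * (\<Phi> t / t))"
    using dini unfolding dini_condition_def by blast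
  define \<psi> where "\<psi> t = \<Phi> t / t" for t
  have \<psi>0: "\<psi> t \<ge> 0" if "t > 0" for t using growth_function_nonneg[OF g, of t] that by (simp add: \<psi>_def)
  have \<psi>m: "\<psi> s \<le> \<psi> t" if "0 < s" "s \<le> t" for s t using growth_U_D(3)[OF \<Phi> that] by (simp add: \<psi>_def)
  have ineq: "\<psi> a * ln (t / a) \<le> C * \<psi> t" if "0 < a" "a < t" for a t
  proof -
    have "ennreal (\<psi> a * ln (t / a)) = ennreal (\<psi> a) * ennreal (ln t - ln a)"
      using that \<psi>0[of a] by (subst ennreal_mult[symmetric]) (auto simp: ln_div)
    also have "ennreal (ln t - ln a) = (\<integral>\<^sup>+s. ennreal (1 / s) * indicator {a..t} s \<partial>lborel)"
      by (rule nn_integral_FTC_Icc[symmetric]) (use that in \<open>auto intro!: derivative_eq_intros\<close>)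
    also have "ennreal (\<psi> a) * \<dots> = (\<integral>\<^sup>+s. ennreal (\<psi> a) * (ennreal (1 / s) * indicator {a..t} s) \<partial>lborel)"
      by (rule nn_integral_cmult[symmetric]) measurable
    also have "\<dots> \<le> (\<integral>\<^sup>+s\<in>{0<..<t}. ennreal (\<Phi> s / s\<^sup>2) \<partial>lborel)"
    proof (rule nn_integral_mono_AE)
      have "AE s in lborel. s \<noteq> t" by (rule AE_lborel_singleton)
      then show "AE s in lborel. ennreal (\<psi> a) * (ennreal (1 / s) * indicator {a..t} s) \<le> ennreal (\<Phi> s / s\<^sup>2) * indicator {0<..<t} s"
      proof eventually_elim
        fix s assume "s \<noteq> t"
        show "ennreal (\<psi> a) * (ennreal (1 / s) * indicator {a..t} s) \<le> ennreal (\<Phi> s / s\<^sup>2) * indicator {0<..<t} s"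
        proof (cases "s \<in> {a..t}")
          case True
          then have s: "0 < s" "a \<le> s" "s < t" using that \<open>s \<noteq> t\<close> by auto
          have "\<psi> a * (1 / s) \<le> \<psi> s * (1 / s)" using \<psi>m[OF that(1) s(2)] s by (intro mult_right_mono) auto
          also have "\<dots> = \<Phi> s / s\<^sup>2" by (simp add: \<psi>_def power2_eq_square)
          finally show ?thesis using True s \<psi>0[OF that(1)] by (simp add: ennreal_leI flip: ennreal_mult)
        qed simp
      qed
    qed
    also have "\<dots> \<le> ennreal (C * \<psi> t)" using C(2)[of t] that by (simp add: \<psi>_def)
    finally show ?thesis using C(1) \<psi>0[of t] that by (simp add: ennreal_le_iff)
  qed
  \<comment> \<open>ln K \<ge> 2C gives the halving; the extra 1 keeps \<epsilon> = ln 2 / ln K at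
    most 1.\<close>
  define K where "K = exp (2 * C + 1)"
  have K: "K > 1" "K > 0" using C(1) by (simp_all add: K_def)
  have lnK: "ln K = 2 * C + 1" by (simp add: K_def)
  have half: "\<psi> (t / K) \<le> \<psi> t / 2" if "t > 0" for t
  proof -
    have "\<psi> (t / K) * ln (t / (t / K)) \<le> C * \<psi> t" using K that by (intro ineq) (auto simp: field_simps)
    then have "\<psi> (t / K) * (2 * C + 1) \<le> C * \<psi> t" using K that by (simp add: lnK)
    moreover have "0 \<le> \<psi> (t / K)" using \<psi>0[of "t / K"] K that by simp
    ultimately have "\<psi> (t / K) * (2 * C) \<le> C * \<psi> t" by (simp add: distrib_left)
    then have "C * (2 * \<psi> (t / K)) \<le> C * \<psi> t" by (simp add: mult_ac)
    then show ?thesis using C(1) by simp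
  qed
  have it: "\<psi> (t / K ^ m) \<le> \<psi> t / 2 ^ m" if "t > 0" for t m
  proof (induction m)
    case (Suc m)
    have "\<psi> (t / K ^ m / K) \<le> \<psi> (t / K ^ m) / 2" using half[of "t / K ^ m"] that K by simp
    also have "\<dots> \<le> (\<psi> t / 2 ^ m) / 2" using Suc by (rule divide_right_mono) simp
    finally show ?case by (simp add: field_simps)
  qed simp
  define \<epsilon> where "\<epsilon> = ln 2 / ln K"
  have \<epsilon>: "\<epsilon> > 0" using C(1) by (simp add: \<epsilon>_def lnK)
  have \<epsilon>1: "\<epsilon> \<le> 1" using C(1) ln2_le_25_over_36 by (simp add: \<epsilon>_def lnK divide_le_eq)
  have Ke: "K powr \<epsilon> = 2" using K by (simp add: powr_def \<epsilon>_def lnK) (use C(1) in simp)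
  show ?thesis
  proof (rule exI[of _ \<epsilon>], intro conjI \<epsilon> \<epsilon>1, rule exI[of _ 2], intro conjI allI impI)
    fix x M :: real assume x: "0 < x" "x \<le> 1" and M: "0 \<le> M"
    show "\<Phi> (x * M) \<le> 2 * x powr (1 + \<epsilon>) * \<Phi> M"
    proof (cases "M = 0")
      case True then show ?thesis by (simp add: growth_function_0[OF g])
    next
      case False
      then have Mp: "M > 0" using M by simp
      \<comment> \<open>The number of whole factors K contained in 1/x. The incomplete last step
        costs one more factor K^\<epsilon> = 2, the constant of the conclusion.\<close>
      define m where "m = nat \<lfloor>ln (1 / x) / ln K\<rfloor>"
      have l0: "0 \<le> ln (1 / x) / ln K" using x C(1) by (simp add: lnK)
      have m1: "real m \<le> ln (1 / x) / ln K" and m2: "ln (1 / x) / ln K < real m + 1"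
        using l0 unfolding m_def by (auto simp: of_nat_nat)
      have "real m * ln K \<le> ln (1 / x)" using m1 C(1) by (simp add: lnK field_simps)
      then have "exp (real m * ln K) \<le> 1 / x" using x by (metis exp_le_cancel_iff exp_ln zero_less_divide_1_iff)
      then have "K ^ m \<le> 1 / x" using K by (simp add: exp_of_nat_mult)
      then have "x * M \<le> M / K ^ m" using K x Mp by (simp add: field_simps)
      then have "\<psi> (x * M) \<le> \<psi> (M / K ^ m)" using x Mp by (intro \<psi>m) auto
      also have "\<dots> \<le> \<psi> M / 2 ^ m" by (rule it[OF Mp])
      also have "1 / 2 ^ m \<le> 2 * x powr \<epsilon>"
      proof -
        have "ln (1 / x) \<le> (real m + 1) * ln K" using m2 C(1) by (simp add: lnK field_simps)
        then have "\<epsilon> * ln (1 / x) \<le> (real m + 1) * ln 2" 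
          using \<epsilon> mult_left_mono[of "ln (1 / x)" "(real m + 1) * ln K" \<epsilon>] C(1) by (simp add: \<epsilon>_def lnK mult.commute[of "ln 2"])
        then have "exp (\<epsilon> * ln (1 / x)) \<le> exp (real (Suc m) * ln 2)" by (simp add: add.commute)
        also have "\<dots> = 2 ^ Suc m" by (simp only: exp_of_nat_mult) simp
        finally have "exp (- (\<epsilon> * ln x)) \<le> 2 ^ Suc m" using x by (simp add: ln_div)
        moreover have "x powr \<epsilon> = exp (\<epsilon> * ln x)" using x by (simp add: powr_def)
        ultimately have "1 / x powr \<epsilon> \<le> 2 * 2 ^ m" by (simp add: exp_minus divide_inverse)
        then show ?thesis using x by (simp add: field_simps)
      qed
      then have "\<psi> M / 2 ^ m \<le> \<psi> M * (2 * x powr \<epsilon>)" using \<psi>0[OF Mp] mult_left_mono[of "1 / 2 ^ m" "2 * x powr \<epsilon>" "\<psi> M"] by simp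
      finally have "\<Phi> (x * M) / (x * M) \<le> \<Phi> M / M * (2 * x powr \<epsilon>)" by (simp add: \<psi>_def)
      then have "\<Phi> (x * M) \<le> \<Phi> M * 2 * (x * x powr \<epsilon>)" using x Mp by (simp add: field_simps)
      also have "x * x powr \<epsilon> = x powr (1 + \<epsilon>)" using x by (simp add: powr_add)
      finally show ?thesis by (simp add: mult_ac)
    qed
  qed simp
qed

section \<open>The growth function determined by the quotient of \<rho>_1 and \<rho>_2\<close>

locale growth_triple =
  fixes q :: real and \<Phi>1 \<Phi>2 \<Phi> :: "real \<Rightarrow> real"
  assumes q: "q \<ge> 1"
    and \<Phi>1: "\<Phi>1 \<in> growth_U q" and \<Phi>2: "\<Phi>2 \<in> growth_U q"
    and anti: "antimono_on {0<..} (\<lambda>t. growth_inv \<Phi>2 (\<Phi>1 t) / t)"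
    and \<Phi>: "growth_function \<Phi>"
    and rho: "\<forall>t>0. rho \<Phi> t = rho \<Phi>1 t / rho \<Phi>2 t"
begin

lemmas g1 = growth_U_D(1)[OF \<Phi>1] and g2 = growth_U_D(1)[OF \<Phi>2]

lemma rho_eq: "t > 0 \<Longrightarrow> rho \<Phi> t = growth_inv \<Phi>2 (1 / t) / growth_inv \<Phi>1 (1 / t)"
  using rho growth_inv_pos[OF g1, of "1 / t"] growth_inv_pos[OF g2, of "1 / t"] by (simp add: rho_def)

lemma inv_eq: assumes s: "s > 0" shows "growth_inv \<Phi> s = s * growth_inv \<Phi>1 s / growth_inv \<Phi>2 s"
proof -
  have p: "growth_inv \<Phi>1 s > 0" "growth_inv \<Phi>2 s > 0" "growth_inv \<Phi> s > 0"
    using growth_inv_pos[OF g1 s] growth_inv_pos[OF g2 s] growth_inv_pos[OF \<Phi> s] by auto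
  have "s / growth_inv \<Phi> s = growth_inv \<Phi>2 s / growth_inv \<Phi>1 s"
    using rho_eq[of "1 / s"] s by (simp add: rho_def)
  then show ?thesis using p s by (simp add: field_simps)
qed

text \<open>The numerator of \<Phi>^{-1}(t) = t \<Phi>_1^{-1}(t) / \<Phi>_2^{-1}(t) contributes one
  factor t explicitly and at most one through \<Phi>_1^{-1}, as \<Phi>_1(t)/t is non-decreasing; the
  denominator does not decrease. The square here is the origin of the square root in
  \<open>moderate\<close>.\<close>

lemma inv_doubling: assumes s: "s > 0" and t: "t \<ge> 1" shows "growth_inv \<Phi> (s * t) \<le> t\<^sup>2 * growth_inv \<Phi> s"
proof -
  have st: "s * t > 0" "s \<le> s * t" using s t by auto
  have p: "growth_inv \<Phi>1 s > 0" "growth_inv \<Phi>2 s > 0" using growth_inv_pos[OF g1 s] growth_inv_pos[OF g2 s] by auto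
  have 1: "growth_inv \<Phi>1 (s * t) \<le> t * growth_inv \<Phi>1 s"
  proof (rule ccontr)
    assume n: "\<not> ?thesis"
    let ?y = "growth_inv \<Phi>1 (s * t)"
    have y: "?y > 0" by (rule growth_inv_pos[OF g1 st(1)])
    have "s / t * t * t = s * t" using t by simp
    have "growth_inv \<Phi>1 s * t < ?y" using n by (simp add: mult.commute)
    then have "growth_inv \<Phi>1 s < ?y / t" using t by (simp add: field_simps)
    moreover have "\<Phi>1 (1 / t * ?y) \<le> 1 / t * \<Phi>1 ?y" using t y by (intro growth_U_scale_down[OF \<Phi>1]) auto
    then have le: "\<Phi>1 (?y / t) \<le> s" using growth_inv_props(2)[OF g1, of "s * t"] st t by simp
    \<comment> \<open>Since x < 1, scaling by x lowers \<Phi>_1 strictly; this strictness is what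
      contradicts the choice of preimages.\<close>
    define x where "x = growth_inv \<Phi>1 s / (?y / t)"
    have x: "0 < x" "x < 1" using calculation p y t by (auto simp: x_def field_simps)
    have xe: "x * (?y / t) = growth_inv \<Phi>1 s" using y t by (simp add: x_def)
    have "\<Phi>1 (x * (?y / t)) \<le> x * \<Phi>1 (?y / t)" using x y t by (intro growth_U_scale_down[OF \<Phi>1]) auto
    moreover have "x * \<Phi>1 (?y / t) < \<Phi>1 (?y / t)" using x growth_U_pos[OF \<Phi>1, of "?y / t"] y t by simp
    ultimately have "s < \<Phi>1 (?y / t)" unfolding xe using growth_inv_props(2)[OF g1, of s] s by linarith
    then show False using le by simp
  qed
  have 2: "growth_inv \<Phi>2 s \<le> growth_inv \<Phi>2 (s * t)" by (rule growth_inv_mono[OF g2]) (use s st in auto)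
  have "growth_inv \<Phi> (s * t) = s * t * growth_inv \<Phi>1 (s * t) / growth_inv \<Phi>2 (s * t)" by (rule inv_eq[OF st(1)])
  also have "\<dots> \<le> s * t * (t * growth_inv \<Phi>1 s) / growth_inv \<Phi>2 s"
    using 1 2 p s t by (intro frac_le mult_left_mono) auto
  also have "\<dots> = t\<^sup>2 * growth_inv \<Phi> s" by (simp add: inv_eq[OF s] power2_eq_square)
  finally show ?thesis .
qed

text \<open>The quotient t / \<Phi>^{-1}(t) equals \<Phi>_2^{-1}(t) / \<Phi>_1^{-1}(t), which is the
  function of hypothesis (ii) at the point \<Phi>_1^{-1}(t).\<close>

lemma inv_ratio: assumes s: "0 < s" "s \<le> t" shows "t / growth_inv \<Phi> t \<le> s / growth_inv \<Phi> s"
proof -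
  have t: "t > 0" using s by simp
  note p = growth_inv_pos[OF g1 s(1)] growth_inv_pos[OF g1 t] growth_inv_pos[OF g2 s(1)] growth_inv_pos[OF g2 t]
  have "growth_inv \<Phi>2 (\<Phi>1 (growth_inv \<Phi>1 t)) / growth_inv \<Phi>1 t \<le> growth_inv \<Phi>2 (\<Phi>1 (growth_inv \<Phi>1 s)) / growth_inv \<Phi>1 s"
    using monotone_onD[OF anti, of "growth_inv \<Phi>1 s" "growth_inv \<Phi>1 t"] p growth_inv_mono[OF g1, of s t] s by simp
  then have "growth_inv \<Phi>2 t / growth_inv \<Phi>1 t \<le> growth_inv \<Phi>2 s / growth_inv \<Phi>1 s"
    using growth_inv_props(2)[OF g1] s t by simp
  then show ?thesis using p s t by (simp add: inv_eq)
qed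

text \<open>Near 0 the quotient s / \<Phi>_2^{-1}(s) stays bounded while \<Phi>_1^{-1}(s) becomes
  small, so the preimage of some s > 0 lies below t, and \<Phi>(t) \<ge> s.\<close>

lemma \<Phi>_pos: assumes t: "t > 0" shows "\<Phi> t > 0"
proof (rule ccontr)
  assume "\<not> \<Phi> t > 0"
  then have z: "\<Phi> t = 0" using growth_function_nonneg[OF \<Phi>, of t] t by simp
  let ?b = "growth_inv \<Phi>2 1"
  have b: "?b > 0" by (rule growth_inv_pos[OF g2]) simp
  define s where "s = min 1 (\<Phi>1 (t * ?b / 2))"
  have s: "0 < s" "s \<le> 1" using growth_U_pos[OF \<Phi>1, of "t * ?b / 2"] t b by (auto simp: s_def)
  have p: "growth_inv \<Phi>2 s > 0" by (rule growth_inv_pos[OF g2 s(1)])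
  have "\<Phi>2 (growth_inv \<Phi>2 s) / growth_inv \<Phi>2 s \<le> \<Phi>2 ?b / ?b"
    by (rule growth_U_D(3)[OF \<Phi>2 p]) (rule growth_inv_mono[OF g2 less_imp_le[OF s(1)] s(2)])
  then have 1: "s / growth_inv \<Phi>2 s \<le> 1 / ?b" using growth_inv_props(2)[OF g2] s by simp
  have 2: "growth_inv \<Phi>1 s < t * ?b"
  proof (rule growth_inv_less[OF g1])
    have "\<Phi>1 (1/2 * (t * ?b)) \<le> 1/2 * \<Phi>1 (t * ?b)" by (rule growth_U_scale_down[OF \<Phi>1]) (use t b in auto)
    moreover have "\<Phi>1 (t * ?b) > 0" by (rule growth_U_pos[OF \<Phi>1]) (use t b in auto)
    ultimately show "s < \<Phi>1 (t * ?b)" by (simp add: s_def)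
  qed (use s t b in auto)
  have "growth_inv \<Phi> s = s / growth_inv \<Phi>2 s * growth_inv \<Phi>1 s" by (simp add: inv_eq[OF s(1)])
  also have "\<dots> \<le> 1 / ?b * growth_inv \<Phi>1 s" using 1 growth_inv_pos[OF g1 s(1)] by (intro mult_right_mono) auto
  also have "\<dots> < 1 / ?b * (t * ?b)" using 2 b by (intro mult_strict_left_mono) auto
  also have "\<dots> = t" using b by simp
  finally have "\<Phi> (growth_inv \<Phi> s) \<le> \<Phi> t" using growth_inv_props(1)[OF \<Phi>, of s] s by (intro growth_function_mono[OF \<Phi>]) auto
  then show False using z growth_inv_props(2)[OF \<Phi>, of s] s by simp
qed

text \<open>Transfers \<open>inv_doubling\<close> from the inverse to \<Phi>. For s below \<Phi>(xM)
  and T above \<Phi>(M) the preimages are strictly comparable with xM and M, which yields s \<le>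
  sqrt(x) T; then s and T tend to the two values.\<close>

lemma \<Phi>_scale_down: assumes x: "0 \<le> x" "x \<le> 1" and M: "0 \<le> M" shows "\<Phi> (x * M) \<le> sqrt x * \<Phi> M"
proof (cases "x = 0 \<or> M = 0")
  case True
  then show ?thesis using growth_function_0[OF \<Phi>] x growth_function_nonneg[OF \<Phi> M] by auto
next
  case False
  then have xM: "0 < x" "0 < M" "0 < x * M" using x M by auto
  have *: "s \<le> sqrt x * T" if s: "0 < s" "s < \<Phi> (x * M)" and T: "\<Phi> M < T" for s T
  proof -
    have "\<Phi> (x * M) \<le> \<Phi> M" using xM x by (intro growth_function_mono[OF \<Phi>]) auto
    then have sT: "s < T" using s T by simp
    have "growth_inv \<Phi> s < x * M" by (rule growth_inv_less[OF \<Phi>]) (use s xM in auto)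
    moreover have "M < growth_inv \<Phi> T" by (rule growth_inv_greater[OF \<Phi> M T])
    moreover have "growth_inv \<Phi> (s * (T / s)) \<le> (T / s)\<^sup>2 * growth_inv \<Phi> s" by (rule inv_doubling[OF s(1)]) (use s sT in auto)
    ultimately have "M < (T / s)\<^sup>2 * growth_inv \<Phi> s" using s by simp
    also have "\<dots> \<le> (T / s)\<^sup>2 * (x * M)" using \<open>growth_inv \<Phi> s < x * M\<close> by (intro mult_left_mono) auto
    finally have "1 < (T / s)\<^sup>2 * x" using xM by (simp add: mult.assoc[symmetric])
    then have "s\<^sup>2 \<le> T\<^sup>2 * x" using s by (simp add: power_divide field_simps)
    then have "s \<le> sqrt (T\<^sup>2 * x)" by (rule real_le_rsqrt)
    also have "\<dots> = sqrt x * T" using s sT by (simp add: real_sqrt_mult)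
    finally show ?thesis .
  qed
  have "\<Phi> (x * M) \<le> sqrt x * T" if T: "\<Phi> M < T" for T
  proof (rule dense_le_bounded[of 0])
    show "0 < \<Phi> (x * M)" by (rule \<Phi>_pos[OF xM(3)])
  qed (use *[OF _ _ T] in auto)
  then have "\<Phi> (x * M) / sqrt x \<le> T" if "\<Phi> M < T" for T using that xM by (simp add: field_simps)
  then have "\<Phi> (x * M) / sqrt x \<le> \<Phi> M" by (rule dense_ge)
  then show ?thesis using xM by (simp add: field_simps)
qed

text \<open>The same passage through strict inequalities, now with \<open>inv_ratio\<close>:
  hypothesis (ii) is what bounds the growth of \<Phi> by that of a linear function.\<close>

lemma \<Phi>_scale_up: assumes x: "1 \<le> x" and M: "0 \<le> M" shows "\<Phi> (x * M) \<le> x * \<Phi> M"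
proof (cases "M = 0")
  case True
  then show ?thesis using growth_function_0[OF \<Phi>] by auto
next
  case False
  then have xM: "0 < M" "0 < x * M" using x M by auto
  have *: "t \<le> x * s" if s: "\<Phi> M < s" and t: "0 < t" "t < \<Phi> (x * M)" for s t
  proof (cases "s \<le> t")
    case True
    have s0: "s > 0" using \<Phi>_pos[OF xM(1)] s by simp
    have "M < growth_inv \<Phi> s" by (rule growth_inv_greater[OF \<Phi> M s])
    moreover have "growth_inv \<Phi> t < x * M" by (rule growth_inv_less[OF \<Phi>]) (use t xM in auto)
    moreover have "t / growth_inv \<Phi> t \<le> s / growth_inv \<Phi> s" by (rule inv_ratio[OF s0 True])
    moreover have p: "growth_inv \<Phi> t > 0" "growth_inv \<Phi> s > 0" using growth_inv_pos[OF \<Phi>] s0 t by auto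
    ultimately have "t * growth_inv \<Phi> s \<le> s * growth_inv \<Phi> t" by (simp add: field_simps)
    also have "\<dots> \<le> s * (x * growth_inv \<Phi> s)"
    proof -
      have "x * M \<le> x * growth_inv \<Phi> s" using \<open>M < growth_inv \<Phi> s\<close> x by (intro mult_left_mono) auto
      then show ?thesis using \<open>growth_inv \<Phi> t < x * M\<close> s0 by (intro mult_left_mono) auto
    qed
    finally have "t * growth_inv \<Phi> s \<le> (x * s) * growth_inv \<Phi> s" by (simp add: mult_ac)
    then show ?thesis using p by simp
  next
    case False
    have s0: "s > 0" using \<Phi>_pos[OF xM(1)] s by simp
    then show ?thesis using False x mult_right_mono[of 1 x s] by linarith
  qed
  have "\<Phi> (x * M) \<le> x * s" if s: "\<Phi> M < s" for s
  proof (rule dense_le_bounded[of 0])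
    show "0 < \<Phi> (x * M)" by (rule \<Phi>_pos[OF xM(2)])
  qed (use *[OF s] in auto)
  then have "\<Phi> (x * M) / x \<le> s" if "\<Phi> M < s" for s using that x by (simp add: field_simps)
  then have "\<Phi> (x * M) / x \<le> \<Phi> M" by (rule dense_ge)
  then show ?thesis using x by (simp add: field_simps)
qed

lemma moderate_\<Phi>: "moderate \<Phi>"
  unfolding moderate_def
proof (intro conjI allI impI)
  show "continuous_on {0..} \<Phi>" "mono_on {0..} \<Phi>" using \<Phi> by (auto simp: growth_function_def)
  show "\<exists>C\<ge>1. \<exists>q\<ge>0. \<forall>x M. 1 \<le> x \<longrightarrow> 0 \<le> M \<longrightarrow> \<Phi> (x * M) \<le> C * x powr q * \<Phi> M"
    by (intro exI[of _ 1] conjI) (auto simp: \<Phi>_scale_up)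
qed (auto simp: growth_function_0[OF \<Phi>] \<Phi>_pos \<Phi>_scale_down)

lemma moderate_\<Phi>1: "moderate \<Phi>1" and moderate_\<Phi>2: "moderate \<Phi>2"
  using growth_U_moderate[OF \<Phi>1] growth_U_moderate[OF \<Phi>2] q by auto

lemma rho_pos: "t > 0 \<Longrightarrow> rho \<Phi> t > 0"
  using growth_inv_pos[OF \<Phi>, of "1 / t"] by (simp add: rho_def)

lemma rho_inv: "t > 0 \<Longrightarrow> rho \<Phi> t = (1 / t) / growth_inv \<Phi> (1 / t)"
  by (simp add: rho_def)

lemma rho_mono: assumes "0 < s" "s \<le> t" shows "rho \<Phi> s \<le> rho \<Phi> t"
  using inv_ratio[of "1 / t" "1 / s"] assms by (simp add: rho_inv frac_le)

text \<open>Since \<rho>(1/T) = T / \<Phi>^{-1}(T), dividing T by s divides the numerator by s,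
  while by \<open>inv_doubling\<close> the denominator falls by at most s^2.\<close>

lemma rho_upper: assumes t: "t > 0" and s: "s \<ge> 1" shows "rho \<Phi> (s * t) \<le> s * rho \<Phi> t"
proof -
  let ?S = "1 / (s * t)"
  have S: "?S > 0" "?S * s = 1 / t" using s t by auto
  note p = growth_inv_pos[OF \<Phi> S(1)] growth_inv_pos[OF \<Phi>, of "1 / t"]
  have "growth_inv \<Phi> (?S * s) \<le> s\<^sup>2 * growth_inv \<Phi> ?S" by (rule inv_doubling[OF S(1) s])
  then have d: "growth_inv \<Phi> (1 / t) \<le> s\<^sup>2 * growth_inv \<Phi> ?S" unfolding S(2) .
  have "rho \<Phi> (s * t) = ?S / growth_inv \<Phi> ?S" using s t by (simp add: rho_inv)
  also have "\<dots> = ?S * s\<^sup>2 / (s\<^sup>2 * growth_inv \<Phi> ?S)" using s by simp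
  also have "\<dots> \<le> ?S * s\<^sup>2 / growth_inv \<Phi> (1 / t)" using d p t S s by (intro divide_left_mono mult_pos_pos) auto
  also have "\<dots> = s * rho \<Phi> t" using s t by (simp add: rho_inv power2_eq_square)
  finally show ?thesis .
qed

lemma rho_upper_type: "upper_type_unit 1 (rho \<Phi>)"
  unfolding upper_type_unit_def by (rule exI[of _ 1]) (auto intro: rho_upper)

text \<open>With M = \<Phi>^{-1}(s) one has \<rho>(1/s) = s/M, so the claim is \<Phi>(M)/M \<le>
  \<Phi>(y)/y for y \<le> M, that is, upper type 1. The restriction on y is what the pointwise
  estimate supplies with s = bdef^(-N).\<close>

lemma pairing_domination:
  assumes s: "s > 0" and y: "0 \<le> y" "y \<le> growth_inv \<Phi> s"
  shows "y * rho \<Phi> (1 / s) \<le> \<Phi> y"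
proof (cases "y = 0")
  case True then show ?thesis using growth_function_0[OF \<Phi>] by simp
next
  case False
  let ?M = "growth_inv \<Phi> s"
  have M: "?M > 0" by (rule growth_inv_pos[OF \<Phi> s])
  have "\<Phi> (?M / y * y) \<le> ?M / y * \<Phi> y" using False y by (intro \<Phi>_scale_up) auto
  then have "s \<le> ?M / y * \<Phi> y" using False growth_inv_props(2)[OF \<Phi>, of s] s by simp
  then show ?thesis using False y M s by (simp add: rho_inv field_simps)
qed

text \<open>Here \<rho>(1/s) = \<Phi>_2^{-1}(s) / \<Phi>_1^{-1}(s) is the value of the
  non-increasing function of hypothesis (ii) at M = \<Phi>_1^{-1}(s). For y \<le> M it is at most
  the value at y, so y \<rho>(1/s) \<le> \<Phi>_2^{-1}(\<Phi>_1(y)).\<close>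

lemma hankel_domination:
  assumes s: "s > 0" and y: "0 \<le> y" "y \<le> growth_inv \<Phi>1 s"
  shows "\<Phi>2 (y * rho \<Phi> (1 / s)) \<le> \<Phi>1 y"
proof (cases "y = 0")
  case True then show ?thesis using growth_function_0[OF g1] growth_function_0[OF g2] by simp
next
  case False
  then have y0: "y > 0" using y by simp
  let ?M = "growth_inv \<Phi>1 s"
  have M: "?M > 0" by (rule growth_inv_pos[OF g1 s])
  have "growth_inv \<Phi>2 (\<Phi>1 ?M) / ?M \<le> growth_inv \<Phi>2 (\<Phi>1 y) / y"
    using monotone_onD[OF anti, of y ?M] y y0 M by simp
  then have "growth_inv \<Phi>2 s / ?M \<le> growth_inv \<Phi>2 (\<Phi>1 y) / y" using growth_inv_props(2)[OF g1, of s] s by simp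
  then have "y * rho \<Phi> (1 / s) \<le> growth_inv \<Phi>2 (\<Phi>1 y)" using s y0 by (simp add: rho_eq field_simps)
  moreover have "0 \<le> y * rho \<Phi> (1 / s)" using rho_pos[of "1 / s"] s y by simp
  ultimately have "\<Phi>2 (y * rho \<Phi> (1 / s)) \<le> \<Phi>2 (growth_inv \<Phi>2 (\<Phi>1 y))" by (intro growth_function_mono[OF g2])
  also have "\<dots> = \<Phi>1 y" by (rule growth_inv_props(2)[OF g2 growth_function_nonneg[OF g1 y(1)]])
  finally show ?thesis .
qed

end

text \<open>Dividing y by 4K^2 gains a factor 1/(2K) by the lower type 1/2. The value of \<Phi> is
  then at most s/2, strictly below s, as the arbitrary choice of preimage requires.\<close>

lemma moderate_inv_bound:
  assumes \<Phi>: "moderate \<Phi>" "growth_function \<Phi>" and s: "s > 0" and K: "K \<ge> 1" and y: "y \<ge> 0" "\<Phi> y \<le> K * s"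
  shows "y / (4 * K\<^sup>2) \<le> growth_inv \<Phi> s"
proof (rule ccontr)
  assume n: "\<not> ?thesis"
  let ?x = "1 / (4 * K\<^sup>2)"
  have "1 \<le> K\<^sup>2" using K by (simp add: one_le_power)
  then have x: "0 \<le> ?x" "?x \<le> 1" by (auto simp: divide_le_eq)
  have sx: "sqrt ?x = 1 / (2 * K)" using K by (simp add: real_sqrt_divide real_sqrt_mult)
  have "s = \<Phi> (growth_inv \<Phi> s)" using growth_inv_props(2)[OF \<Phi>(2), of s] s by simp
  also have "\<dots> \<le> \<Phi> (?x * y)" using n growth_inv_props(1)[OF \<Phi>(2), of s] s by (intro moderateD(5)[OF \<Phi>(1)]) auto
  also have "\<dots> \<le> sqrt ?x * \<Phi> y" by (rule moderateD(6)[OF \<Phi>(1) x y(1)])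
  also have "\<dots> \<le> sqrt ?x * (K * s)" using y(2) by (intro mult_left_mono) auto
  also have "\<dots> = s / 2" unfolding sx using K by simp
  finally show False using s by simp
qed

section \<open>Luxemburg norms\<close>

lemma lux_norm_le:
  assumes "\<mu> > 0" "(\<integral>\<^sup>+z. ennreal (\<Phi> (cmod (f z) / \<mu>)) \<partial>nu \<alpha>) \<le> 1"
  shows "lux_norm \<alpha> \<Phi> f \<le> ennreal \<mu>"
  unfolding lux_norm_def using assms by (intro Inf_lower) blast

lemma lux_norm_less:
  assumes "lux_norm \<alpha> \<Phi> f < c"
  obtains \<mu> where "\<mu> > 0" "ennreal \<mu> < c" "(\<integral>\<^sup>+z. ennreal (\<Phi> (cmod (f z) / \<mu>)) \<partial>nu \<alpha>) \<le> 1"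
  using assms unfolding lux_norm_def Inf_less_iff by blast

text \<open>Reduces a bound by the Luxemburg norm to the admissible \<mu>; if there are none, the
  right-hand side is infinite.\<close>

lemma le_lux_normI:
  assumes "C > 0" "\<And>\<mu>. \<mu> > 0 \<Longrightarrow> (\<integral>\<^sup>+z. ennreal (\<Phi> (cmod (f z) / \<mu>)) \<partial>nu \<alpha>) \<le> 1 \<Longrightarrow> x \<le> ennreal (C * \<mu>)"
  shows "x \<le> ennreal C * lux_norm \<alpha> \<Phi> f"
proof -
  have "x / ennreal C \<le> lux_norm \<alpha> \<Phi> f"
    unfolding lux_norm_def
  proof (rule Inf_greatest)
    fix y assume "y \<in> {ennreal \<mu> |\<mu>. \<mu> > 0 \<and> (\<integral>\<^sup>+z. ennreal (\<Phi> (cmod (f z) / \<mu>)) \<partial>nu \<alpha>) \<le> 1}"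
    then obtain \<mu> where \<mu>: "y = ennreal \<mu>" "\<mu> > 0" "(\<integral>\<^sup>+z. ennreal (\<Phi> (cmod (f z) / \<mu>)) \<partial>nu \<alpha>) \<le> 1" by blast
    have "x / ennreal C \<le> ennreal (\<mu> * C) / ennreal C"
      using assms(2)[OF \<mu>(2,3)] by (intro divide_right_mono_ennreal) (simp add: mult.commute)
    also have "\<dots> = y" using assms(1) \<mu> by (simp add: divide_ennreal)
    finally show "x / ennreal C \<le> y" .
  qed
  then have "ennreal C * (x / ennreal C) \<le> ennreal C * lux_norm \<alpha> \<Phi> f" by (rule mult_left_mono) simp
  moreover have "ennreal C * (x / ennreal C) = x"
    using assms(1) by (simp add: ennreal_times_divide ennreal_mult_divide_eq mult.commute)
  ultimately show ?thesis by simp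
qed

text \<open>After normalisation the modulus is at most b^s times the preimage of bdef(w)^(-N), with
  b \<le> 1. The lower type 1/2 spends half of s, and s/2 \<ge> 2N leaves room for the exponent 2N
  whose integral is known exactly; hence s \<ge> 4N.\<close>

lemma kernel_lux_norm:
  fixes g :: "complex ^ 'n \<Rightarrow> complex"
  assumes \<Phi>: "moderate \<Phi>" "growth_function \<Phi>" and \<alpha>: "\<alpha> > -1" and w: "w \<in> ball 0 1"
    and s: "s \<ge> 4 * (real CARD('n) + 1 + \<alpha>)" and A: "A > 0"
    and g: "\<And>z. z \<in> ball 0 1 \<Longrightarrow> cmod (g z) \<le> A * cmod (1 - herm z w) powr (- s)"
  shows "lux_norm \<alpha> \<Phi> g \<le> ennreal (A * 2 powr s * bdef w powr (- s) / growth_inv \<Phi> (bdef w powr (- (real CARD('n) + 1 + \<alpha>))))"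
proof (rule lux_norm_le)
  define N where "N = real CARD('n) + 1 + \<alpha>"
  have N: "N > 0" using \<alpha> by (simp add: N_def)
  have d: "bdef w > 0" by (rule bdef_pos[OF w])
  let ?M = "growth_inv \<Phi> (bdef w powr (- N))"
  have M: "?M > 0" using d by (intro growth_inv_pos[OF \<Phi>(2)]) auto
  let ?l = "A * 2 powr s * bdef w powr (- s) / ?M"
  show l: "0 < A * 2 powr s * bdef w powr (- s) / growth_inv \<Phi> (bdef w powr (- (real CARD('n) + 1 + \<alpha>)))"
    using A d M by (auto simp: N_def[symmetric])
  have "(\<integral>\<^sup>+z. ennreal (\<Phi> (cmod (g z) / ?l)) \<partial>nu \<alpha>) \<le> (\<integral>\<^sup>+z. ennreal (bdef w powr N) * ennreal (cmod (1 - herm z w) powr (- 2 * N)) \<partial>nu \<alpha>)"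
  proof (rule nn_integral_mono)
    fix z :: "complex ^ 'n" assume "z \<in> space (nu \<alpha>)"
    then have z: "z \<in> ball 0 1" by simp
    let ?y = "cmod (1 - herm z w)"
    have y: "bdef w / 2 \<le> ?y" "?y > 0" using kernel_lower[OF z w] by auto
    \<comment> \<open>The 2 in the denominator makes b \<le> 1, so that the lower type applies; it
      is the source of 2^s in the norm bound.\<close>
    define b where "b = bdef w / (2 * ?y)"
    have b: "0 < b" "b \<le> 1" using y d by (auto simp: b_def field_simps)
    have "cmod (g z) / ?l \<le> (A * ?y powr (- s)) / ?l"
      using g[OF z] l by (intro divide_right_mono) (auto simp: N_def)
    also have "\<dots> = b powr s * ?M"
      using A d y M by (simp add: b_def powr_divide powr_mult powr_minus field_simps)
    finally have "\<Phi> (cmod (g z) / ?l) \<le> \<Phi> (b powr s * ?M)"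
      by (rule moderateD(5)[OF \<Phi>(1) divide_nonneg_pos[OF norm_ge_zero l[folded N_def]]])
    also have "\<dots> \<le> sqrt (b powr s) * \<Phi> ?M"
      using b s N M by (intro moderateD(6)[OF \<Phi>(1)]) (auto intro: powr_le1 simp: N_def)
    also have "sqrt (b powr s) = b powr (s / 2)" by (rule sqrt_powr) (use b in simp)
    also have "\<Phi> ?M = bdef w powr (- N)" by (rule growth_inv_props(2)[OF \<Phi>(2)]) simp
    also have "b powr (s / 2) * bdef w powr (- N) \<le> (bdef w / ?y) powr (2 * N) * bdef w powr (- N)"
    proof (rule mult_right_mono)
      have "b powr (s / 2) \<le> b powr (2 * N)" using b s by (intro powr_mono') (auto simp: N_def)
      also have "\<dots> \<le> (bdef w / ?y) powr (2 * N)"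
        using b y d N by (intro powr_mono2) (auto simp: b_def field_simps)
      finally show "b powr (s / 2) \<le> (bdef w / ?y) powr (2 * N)" .
    qed simp
    also have "(bdef w / ?y) powr (2 * N) * bdef w powr (- N) = bdef w powr N * ?y powr (- 2 * N)"
    proof -
      have "bdef w powr (2 * N) * bdef w powr (- N) = bdef w powr N" unfolding powr_add[symmetric] by simp
      then show ?thesis using d y by (simp add: powr_divide powr_minus field_simps)
    qed
    finally have "\<Phi> (cmod (g z) / ?l) \<le> bdef w powr N * ?y powr (- 2 * N)" by simp
    then show "ennreal (\<Phi> (cmod (g z) / ?l)) \<le> ennreal (bdef w powr N) * ennreal (?y powr (- 2 * N))"
      by (simp add: ennreal_leI flip: ennreal_mult)
  qed
  also have "\<dots> = ennreal (bdef w powr N) * ennreal (bdef w powr (- N))"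
    unfolding N_def using nn_kernel_square[OF \<alpha> w] by (subst nn_integral_cmult) auto
  also have "\<dots> = 1" using d by (simp flip: ennreal_mult powr_add)
  finally show "(\<integral>\<^sup>+z. ennreal (\<Phi> (cmod (g z) / (A * 2 powr s * bdef w powr (- s) / growth_inv \<Phi> (bdef w powr (- (real CARD('n) + 1 + \<alpha>)))))) \<partial>nu \<alpha>) \<le> 1"
    unfolding N_def .
qed

section \<open>The positive Bergman operator on an Orlicz space\<close>

lemma cmod_one_minus_herm_sym: "cmod (1 - herm z w) = cmod (1 - herm w z)"
  using complex_mod_cnj[of "1 - herm z w"] by (simp add: cnj_herm del: complex_mod_cnj)

text \<open>Schur's test with the weight \<open>h = bdef powr (- \<eta>)\<close>. For fixed \<open>z\<close>, Jensen is applied to the measure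
  proportional to \<open>h \<xi> \<bar>1 - \<langle>z, \<xi>\<rangle>\<bar> powr (- N)\<close> and the function \<open>u \<xi> * x\<close> with \<open>x = h z / h \<xi>\<close>; the lower type
  above \<open>1\<close> leaves a positive power of \<open>x\<close> after division by \<open>x\<close>.\<close>

lemma bergman_positive_bound:
  assumes \<Phi>: "moderate \<Phi>" and \<alpha>: "\<alpha> > -1"
    and ratio: "\<And>x y. 0 < x \<Longrightarrow> x \<le> y \<Longrightarrow> \<Phi> x * y \<le> \<Phi> y * x"
    and \<epsilon>: "0 < \<epsilon>" "\<epsilon> \<le> 1" and C: "C \<ge> 1" "\<And>x M. 0 < x \<Longrightarrow> x \<le> 1 \<Longrightarrow> 0 \<le> M \<Longrightarrow> \<Phi> (x * M) \<le> C * x powr (1 + \<epsilon>) * \<Phi> M"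
  shows "\<exists>K\<ge>1. \<forall>u v :: complex ^ 'n \<Rightarrow> real. u \<in> borel_measurable (nu \<alpha>) \<longrightarrow> (\<forall>z\<in>ball 0 1. u z \<ge> 0 \<and> v z \<ge> 0) \<longrightarrow>
    (\<forall>z\<in>ball 0 1. ennreal (v z) \<le> (\<integral>\<^sup>+\<xi>. ennreal (u \<xi> * cmod (1 - herm z \<xi>) powr (- (real CARD('n) + 1 + \<alpha>))) \<partial>nu \<alpha>)) \<longrightarrow>
    (\<integral>\<^sup>+z. ennreal (\<Phi> (v z / K)) \<partial>nu \<alpha>) \<le> ennreal K * (\<integral>\<^sup>+\<xi>. ennreal (\<Phi> (u \<xi>)) \<partial>nu \<alpha>)"
proof -
  define N where "N = real CARD('n) + 1 + \<alpha>"
  have N: "N > 0" using \<alpha> by (simp add: N_def)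
  note \<Phi>D = moderateD[OF \<Phi>]
  obtain C' q' where C': "C' \<ge> 1" "q' \<ge> 0" "\<And>x M. 1 \<le> x \<Longrightarrow> 0 \<le> M \<Longrightarrow> \<Phi> (x * M) \<le> C' * x powr q' * \<Phi> M"
    using moderate_upper[OF \<Phi>] by blast
  \<comment> \<open>Q \<ge> 2 keeps Q - 1 positive, since the power x^(Q-1) left after division by x
    also has to be integrated with a weight.\<close>
  define Q where "Q = max 2 q'"
  have Q: "Q \<ge> 2" "Q \<ge> q'" by (auto simp: Q_def)
  define D where "D = max C C'"
  have D: "D \<ge> 1" using C by (auto simp: D_def)
  \<comment> \<open>The factor x = h(z)/h(\<xi>) may be small or large, so both scaling regimes are
    put into a single bound, each with an exponent above 1.\<close>
  have \<Phi>x: "\<Phi> (x * M) \<le> D * (x powr (1 + \<epsilon>) + x powr Q) * \<Phi> M" if x: "x > 0" and M: "M \<ge> 0" for x M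
  proof (cases "x \<le> 1")
    case True
    then have "\<Phi> (x * M) \<le> C * x powr (1 + \<epsilon>) * \<Phi> M" using C(2) x M by blast
    also have "\<dots> \<le> D * (x powr (1 + \<epsilon>) + x powr Q) * \<Phi> M"
      using \<Phi>D(4)[OF M] C by (intro mult_right_mono mult_mono) (auto simp: D_def)
    finally show ?thesis .
  next
    case False
    then have "\<Phi> (x * M) \<le> C' * x powr q' * \<Phi> M" using C'(3) M by simp
    also have "\<dots> \<le> D * (x powr (1 + \<epsilon>) + x powr Q) * \<Phi> M"
    proof (intro mult_right_mono mult_mono)
      have "x powr q' \<le> x powr Q" using False Q by (intro powr_mono) auto
      then show "x powr q' \<le> x powr (1 + \<epsilon>) + x powr Q" using powr_ge_zero[of x "1 + \<epsilon>"] by linarith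
    qed (use \<Phi>D(4)[OF M] C' in \<open>auto simp: D_def\<close>)
    finally show ?thesis .
  qed
  \<comment> \<open>Chosen so that \<eta>Q = (1 + \<alpha>)/2: then \<eta>, \<eta>\<epsilon> and
    \<eta>(Q - 1) all lie in the range (0, 1 + \<alpha>) of
    \<open>weighted_kernel_bound\<close>.\<close>
  define \<eta> where "\<eta> = (1 + \<alpha>) / (2 * Q)"
  have \<eta>: "0 < \<eta>" using \<alpha> Q by (simp add: \<eta>_def)
  have \<eta>Q: "\<eta> * Q < 1 + \<alpha>" using \<alpha> Q by (simp add: \<eta>_def)
  have "\<eta> * 1 \<le> \<eta> * Q" using Q \<eta> by (intro mult_left_mono) auto
  then have \<eta>1: "\<eta> < 1 + \<alpha>" using \<eta>Q by simp
  have W: "\<exists>A>0. \<forall>w\<in>ball (0::complex ^ 'n) 1. (\<integral>\<^sup>+z. ennreal (bdef z powr (- \<delta>) * cmod (1 - herm z w) powr (- N)) \<partial>nu \<alpha>) \<le> ennreal (A * bdef w powr (- \<delta>))"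
    if "0 < \<delta>" "\<delta> < 1 + \<alpha>" for \<delta>
    using weighted_kernel_bound[OF \<alpha> that, where 'n='n] unfolding N_def .
  have "\<eta> * \<epsilon> \<le> \<eta>" using \<epsilon> \<eta> by (intro mult_left_le) auto
  then have "\<eta> * \<epsilon> < 1 + \<alpha>" using \<eta>1 by (rule le_less_trans)
  moreover have "0 < \<eta> * \<epsilon>" using \<eta> \<epsilon> by simp
  ultimately have "0 < \<eta> * \<epsilon>" "\<eta> * \<epsilon> < 1 + \<alpha>" by auto
  from W[OF this] obtain A1 where A1: "A1 > 0" "\<And>w. w \<in> ball (0::complex ^ 'n) 1 \<Longrightarrow> 
    (\<integral>\<^sup>+z. ennreal (bdef z powr (- (\<eta> * \<epsilon>)) * cmod (1 - herm z w) powr (- N)) \<partial>nu \<alpha>) \<le> ennreal (A1 * bdef w powr (- (\<eta> * \<epsilon>)))" by blast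
  have "0 < \<eta> * (Q - 1)" "\<eta> * (Q - 1) < 1 + \<alpha>" using \<eta> Q \<eta>Q by (auto simp: algebra_simps)
  from W[OF this] obtain A2 where A2: "A2 > 0" "\<And>w. w \<in> ball (0::complex ^ 'n) 1 \<Longrightarrow> 
    (\<integral>\<^sup>+z. ennreal (bdef z powr (- (\<eta> * (Q - 1))) * cmod (1 - herm z w) powr (- N)) \<partial>nu \<alpha>) \<le> ennreal (A2 * bdef w powr (- (\<eta> * (Q - 1))))" by blast
  from W[OF \<eta> \<eta>1] obtain A0 where A0: "A0 > 0" "\<And>w. w \<in> ball (0::complex ^ 'n) 1 \<Longrightarrow> 
    (\<integral>\<^sup>+z. ennreal (bdef z powr (- \<eta>) * cmod (1 - herm z w) powr (- N)) \<partial>nu \<alpha>) \<le> ennreal (A0 * bdef w powr (- \<eta>))" by blast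
  \<comment> \<open>2 A0 undoes the normalisation of the density together with the halving in
    \<open>jensen_half\<close>; the last entry is the constant produced by the two weighted
    integrals in z.\<close>
  define K where "K = max 1 (max (2 * A0) (D / A0 * (A1 + A2)))"
  have K: "K \<ge> 1" "K \<ge> 2 * A0" "K \<ge> D / A0 * (A1 + A2)" by (auto simp: K_def)
  show ?thesis
  proof (intro exI[of _ K] conjI K(1) allI impI)
    fix u v :: "complex ^ 'n \<Rightarrow> real"
    assume um[measurable]: "u \<in> borel_measurable (nu \<alpha>)" and uv: "\<forall>z\<in>ball 0 1. u z \<ge> 0 \<and> v z \<ge> 0"
      and v: "\<forall>z\<in>ball 0 1. ennreal (v z) \<le> (\<integral>\<^sup>+\<xi>. ennreal (u \<xi> * cmod (1 - herm z \<xi>) powr (- (real CARD('n) + 1 + \<alpha>))) \<partial>nu \<alpha>)"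
    have \<Phi>u: "(\<lambda>\<xi>. \<Phi> (u \<xi>)) \<in> borel_measurable (nu \<alpha>)"
      by (rule moderate_measurable[OF \<Phi> um]) (use uv in simp)
    let ?x = "\<lambda>z \<xi> :: complex ^ 'n. bdef \<xi> powr \<eta> * bdef z powr (- \<eta>)"
    have xpow: "?x z \<xi> powr a = bdef \<xi> powr (\<eta> * a) * bdef z powr (- (\<eta> * a))" if "z \<in> ball 0 1" "\<xi> \<in> ball 0 1" for z \<xi> a
      using bdef_pos[OF that(1)] bdef_pos[OF that(2)] by (simp add: powr_mult powr_powr)
    note sym = cmod_one_minus_herm_sym
    let ?k = "\<lambda>z \<xi>. cmod (1 - herm z \<xi>) powr (- N)"
    let ?g1 = "\<lambda>z \<xi>. bdef \<xi> powr (\<eta> * \<epsilon>) * (bdef z powr (- (\<eta> * \<epsilon>)) * ?k z \<xi>)"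
    let ?g2 = "\<lambda>z \<xi>. bdef \<xi> powr (\<eta> * (Q - 1)) * (bdef z powr (- (\<eta> * (Q - 1))) * ?k z \<xi>)"
    have pt: "ennreal (\<Phi> (v z / K)) \<le> (\<integral>\<^sup>+\<xi>. ennreal (D / A0 * \<Phi> (u \<xi>) * (?g1 z \<xi> + ?g2 z \<xi>)) \<partial>nu \<alpha>)" if z: "z \<in> ball 0 1" for z
    proof (cases "v z = 0")
      case True then show ?thesis by (simp add: \<Phi>D)
    next
      case False
      then have vz: "v z > 0" using uv z by force
      have dz: "bdef z > 0" by (rule bdef_pos[OF z])
      \<comment> \<open>Normalised to mass at most 1 by the weighted kernel bound at z. The product
        of p with the factor x is the unweighted kernel divided by A0, so the mean of u x against p
        dominates v(z)/A0.\<close>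
      define p where "p \<xi> = bdef \<xi> powr (- \<eta>) * ?k z \<xi> / (A0 * bdef z powr (- \<eta>))" for \<xi>
      have p0: "p \<xi> \<ge> 0" for \<xi> using A0(1) by (simp add: p_def)
      have [measurable]: "p \<in> borel_measurable (nu \<alpha>)" unfolding p_def by measurable
      have up: "u \<xi> * ?x z \<xi> * p \<xi> = u \<xi> * ?k z \<xi> / A0" if "\<xi> \<in> ball 0 1" for \<xi>
        using bdef_pos[OF that] dz A0(1) by (simp add: p_def powr_minus field_simps)
      have xp: "?x z \<xi> * p \<xi> = ?k z \<xi> / A0" if "\<xi> \<in> ball 0 1" for \<xi>
        using bdef_pos[OF that] dz A0(1) by (simp add: p_def powr_minus field_simps)
      have "ennreal (v z / A0 / 2 * 2) \<le> (\<integral>\<^sup>+\<xi>. ennreal (u \<xi> * ?x z \<xi> * p \<xi>) \<partial>nu \<alpha>)"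
      proof -
        have "ennreal A0 * ennreal (v z / A0) = ennreal (v z)" using A0(1) vz by (simp flip: ennreal_mult)
        also have "\<dots> \<le> (\<integral>\<^sup>+\<xi>. ennreal (u \<xi> * ?k z \<xi>) \<partial>nu \<alpha>)" using v z by (simp add: N_def)
        also have "\<dots> = (\<integral>\<^sup>+\<xi>. ennreal A0 * ennreal (u \<xi> * ?x z \<xi> * p \<xi>) \<partial>nu \<alpha>)"
        proof (rule nn_integral_cong)
          fix \<xi> :: "complex ^ 'n" assume "\<xi> \<in> space (nu \<alpha>)"
          then have "\<xi> \<in> ball 0 1" by simp
          from up[OF this] show "ennreal (u \<xi> * ?k z \<xi>) = ennreal A0 * ennreal (u \<xi> * ?x z \<xi> * p \<xi>)"
            using A0(1) by (simp only: ennreal_mult'[symmetric] less_imp_le) simp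
        qed
        also have "\<dots> = ennreal A0 * (\<integral>\<^sup>+\<xi>. ennreal (u \<xi> * ?x z \<xi> * p \<xi>) \<partial>nu \<alpha>)" by (rule nn_integral_cmult) measurable
        finally show ?thesis using A0(1) by (subst (asm) ennreal_mult_le_mult_iff) auto
      qed
      then have mint: "ennreal (v z / A0) \<le> (\<integral>\<^sup>+\<xi>. ennreal (u \<xi> * ?x z \<xi> * p \<xi>) \<partial>nu \<alpha>)" by simp
      have "ennreal (\<Phi> (v z / A0 / 2)) \<le> (\<integral>\<^sup>+\<xi>. ennreal (\<Phi> (u \<xi> * ?x z \<xi>) * p \<xi>) \<partial>nu \<alpha>)"
      proof (rule jensen_half[OF _ _ _ _ _ _ _ ratio _ mint])
        show "(\<lambda>\<xi>. \<Phi> (u \<xi> * ?x z \<xi>)) \<in> borel_measurable (nu \<alpha>)"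
          by (rule moderate_measurable[OF \<Phi>]) (use uv in auto)
        have "ennreal (A0 * bdef z powr (- \<eta>)) * (\<integral>\<^sup>+\<xi>. ennreal (p \<xi>) \<partial>nu \<alpha>) = (\<integral>\<^sup>+\<xi>. ennreal (bdef \<xi> powr (- \<eta>) * cmod (1 - herm \<xi> z) powr (- N)) \<partial>nu \<alpha>)"
          using A0(1) dz p0 by (subst nn_integral_cmult[symmetric], measurable) (simp add: p_def sym[of z] flip: ennreal_mult)
        also have "\<dots> \<le> ennreal (A0 * bdef z powr (- \<eta>))" by (rule A0(2)[OF z])
        finally have "ennreal (A0 * bdef z powr (- \<eta>)) * (\<integral>\<^sup>+\<xi>. ennreal (p \<xi>) \<partial>nu \<alpha>) \<le> ennreal (A0 * bdef z powr (- \<eta>)) * 1" by simp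
        then show "(\<integral>\<^sup>+\<xi>. ennreal (p \<xi>) \<partial>nu \<alpha>) \<le> 1"
          using A0(1) dz by (subst (asm) ennreal_mult_le_mult_iff) auto
      qed (use \<Phi>D(4) uv p0 vz A0(1) in auto)
      also have "\<dots> \<le> (\<integral>\<^sup>+\<xi>. ennreal (D / A0 * \<Phi> (u \<xi>) * (?g1 z \<xi> + ?g2 z \<xi>)) \<partial>nu \<alpha>)"
      proof (rule nn_integral_mono, rule ennreal_leI)
        fix \<xi> :: "complex ^ 'n" assume "\<xi> \<in> space (nu \<alpha>)"
        then have \<xi>: "\<xi> \<in> ball 0 1" by simp
        have x: "?x z \<xi> > 0" using dz bdef_pos[OF \<xi>] by simp
        have "\<Phi> (?x z \<xi> * u \<xi>) \<le> D * (?x z \<xi> powr (1 + \<epsilon>) + ?x z \<xi> powr Q) * \<Phi> (u \<xi>)"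
          by (rule \<Phi>x[OF x]) (use uv \<xi> in auto)
        also have "?x z \<xi> powr (1 + \<epsilon>) = ?x z \<xi> * ?x z \<xi> powr \<epsilon>" using x by (simp add: powr_add)
        also have "?x z \<xi> powr Q = ?x z \<xi> * ?x z \<xi> powr (Q - 1)" using x powr_add[of "?x z \<xi>" 1 "Q - 1"] by simp
        finally have "\<Phi> (u \<xi> * ?x z \<xi>) * p \<xi> \<le> (D * (?x z \<xi> * ?x z \<xi> powr \<epsilon> + ?x z \<xi> * ?x z \<xi> powr (Q - 1)) * \<Phi> (u \<xi>)) * p \<xi>"
          using p0 by (intro mult_right_mono) (simp_all add: mult.commute)
        also have "\<dots> = D * (?x z \<xi> powr \<epsilon> + ?x z \<xi> powr (Q - 1)) * \<Phi> (u \<xi>) * (?x z \<xi> * p \<xi>)"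
          by (simp only: distrib_left distrib_right mult_ac)
        also have "\<dots> = D / A0 * \<Phi> (u \<xi>) * (?g1 z \<xi> + ?g2 z \<xi>)"
          unfolding xp[OF \<xi>] xpow[OF z \<xi>] by (simp add: algebra_simps)
        finally show "\<Phi> (u \<xi> * ?x z \<xi>) * p \<xi> \<le> D / A0 * \<Phi> (u \<xi>) * (?g1 z \<xi> + ?g2 z \<xi>)" .
      qed
      finally have "ennreal (\<Phi> (v z / A0 / 2)) \<le> (\<integral>\<^sup>+\<xi>. ennreal (D / A0 * \<Phi> (u \<xi>) * (?g1 z \<xi> + ?g2 z \<xi>)) \<partial>nu \<alpha>)" .
      moreover have "\<Phi> (v z / K) \<le> \<Phi> (v z / A0 / 2)"
        using vz K A0(1) by (intro \<Phi>D(5)) (auto simp: mult.commute intro!: divide_left_mono)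
      ultimately show ?thesis by (meson ennreal_leI order_trans)
    qed
    interpret finite_measure "nu \<alpha> :: (complex ^ 'n) measure" by (rule finite_measure_nu[OF \<alpha>])
    interpret P: pair_sigma_finite "nu \<alpha> :: (complex ^ 'n) measure" "nu \<alpha> :: (complex ^ 'n) measure" ..
    have km: "(\<lambda>p. ?k (fst p) (snd p)) \<in> borel_measurable (nu \<alpha> \<Otimes>\<^sub>M nu \<alpha>)"
    proof -
      have "(\<lambda>p. herm (fst p) (snd p)) \<in> borel_measurable (nu \<alpha> \<Otimes>\<^sub>M nu \<alpha>)"
        by (rule borel_measurable_herm[OF measurable_fst_nu measurable_snd_nu])
      then show ?thesis by measurable
    qed
    have bm: "(\<lambda>p. bdef (fst p :: complex ^ 'n) powr a) \<in> borel_measurable (nu \<alpha> \<Otimes>\<^sub>M nu \<alpha>)" "(\<lambda>p. bdef (snd p :: complex ^ 'n) powr a) \<in> borel_measurable (nu \<alpha> \<Otimes>\<^sub>M nu \<alpha>)" for a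
      using measurable_compose[OF measurable_fst_nu borel_measurable_weight] measurable_compose[OF measurable_snd_nu borel_measurable_weight] by auto
    have Gm: "(\<lambda>(z, \<xi>). ennreal (D / A0 * \<Phi> (u \<xi>) * (?g1 z \<xi> + ?g2 z \<xi>))) \<in> borel_measurable (nu \<alpha> \<Otimes>\<^sub>M nu \<alpha>)"
      unfolding split_beta
      by (intro measurable_compose[OF _ measurable_ennreal] borel_measurable_times borel_measurable_add borel_measurable_const km bm 
          measurable_compose[OF measurable_snd \<Phi>u])
    have "(\<integral>\<^sup>+z. ennreal (\<Phi> (v z / K)) \<partial>nu \<alpha>) \<le> (\<integral>\<^sup>+z. \<integral>\<^sup>+\<xi>. ennreal (D / A0 * \<Phi> (u \<xi>) * (?g1 z \<xi> + ?g2 z \<xi>)) \<partial>nu \<alpha> \<partial>nu \<alpha>)"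
      by (rule nn_integral_mono) (use pt in simp)
    also have "\<dots> = (\<integral>\<^sup>+\<xi>. \<integral>\<^sup>+z. ennreal (D / A0 * \<Phi> (u \<xi>) * (?g1 z \<xi> + ?g2 z \<xi>)) \<partial>nu \<alpha> \<partial>nu \<alpha>)"
      by (rule P.Fubini'[OF Gm, symmetric])
    also have "\<dots> \<le> (\<integral>\<^sup>+\<xi>. ennreal K * ennreal (\<Phi> (u \<xi>)) \<partial>nu \<alpha>)"
    proof (rule nn_integral_mono)
      fix \<xi> :: "complex ^ 'n" assume "\<xi> \<in> space (nu \<alpha>)"
      then have \<xi>: "\<xi> \<in> ball 0 1" by simp
      have d: "bdef \<xi> > 0" by (rule bdef_pos[OF \<xi>])
      have \<Phi>0: "\<Phi> (u \<xi>) \<ge> 0" using uv \<xi> by (intro \<Phi>D(4)) simp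
      have c: "bdef \<xi> powr a * (A * bdef \<xi> powr (- a)) = A" for a A using d by (simp add: powr_minus)
      have "(\<integral>\<^sup>+z. ennreal (D / A0 * \<Phi> (u \<xi>) * (?g1 z \<xi> + ?g2 z \<xi>)) \<partial>nu \<alpha>)
        = (\<integral>\<^sup>+z. ennreal (D / A0 * \<Phi> (u \<xi>)) * (ennreal (bdef \<xi> powr (\<eta> * \<epsilon>)) * ennreal (bdef z powr (- (\<eta> * \<epsilon>)) * ?k z \<xi>)
            + ennreal (bdef \<xi> powr (\<eta> * (Q - 1))) * ennreal (bdef z powr (- (\<eta> * (Q - 1))) * ?k z \<xi>)) \<partial>nu \<alpha>)"
        using \<Phi>0 D A0(1) by (intro nn_integral_cong) (simp flip: ennreal_mult ennreal_plus)
      also have "\<dots> = ennreal (D / A0 * \<Phi> (u \<xi>)) * (ennreal (bdef \<xi> powr (\<eta> * \<epsilon>)) * (\<integral>\<^sup>+z. ennreal (bdef z powr (- (\<eta> * \<epsilon>)) * ?k z \<xi>) \<partial>nu \<alpha>)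
            + ennreal (bdef \<xi> powr (\<eta> * (Q - 1))) * (\<integral>\<^sup>+z. ennreal (bdef z powr (- (\<eta> * (Q - 1))) * ?k z \<xi>) \<partial>nu \<alpha>))"
        by (subst nn_integral_cmult, measurable, subst nn_integral_add, measurable, subst (1 2) nn_integral_cmult) auto
      also have "\<dots> \<le> ennreal (D / A0 * \<Phi> (u \<xi>)) * (ennreal (bdef \<xi> powr (\<eta> * \<epsilon>)) * ennreal (A1 * bdef \<xi> powr (- (\<eta> * \<epsilon>)))
            + ennreal (bdef \<xi> powr (\<eta> * (Q - 1))) * ennreal (A2 * bdef \<xi> powr (- (\<eta> * (Q - 1)))))"
        by (intro mult_left_mono add_mono A1(2) A2(2) \<xi>) auto
      also have "\<dots> = ennreal (D / A0 * \<Phi> (u \<xi>)) * (ennreal A1 + ennreal A2)"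
        by (simp only: ennreal_mult'[symmetric] powr_ge_zero c)
      also have "\<dots> = ennreal (D / A0 * (A1 + A2) * \<Phi> (u \<xi>))"
        using \<Phi>0 D A0(1) A1(1) A2(1) by (simp add: mult_ac flip: ennreal_mult ennreal_plus)
      also have "\<dots> \<le> ennreal (K * \<Phi> (u \<xi>))" using K(3) \<Phi>0 by (intro ennreal_leI mult_right_mono) auto
      also have "\<dots> = ennreal K * ennreal (\<Phi> (u \<xi>))" using K(1) by (intro ennreal_mult') simp
      finally show "(\<integral>\<^sup>+z. ennreal (D / A0 * \<Phi> (u \<xi>) * (?g1 z \<xi> + ?g2 z \<xi>)) \<partial>nu \<alpha>) \<le> ennreal K * ennreal (\<Phi> (u \<xi>))" .
    qed
    also have "\<dots> = ennreal K * (\<integral>\<^sup>+\<xi>. ennreal (\<Phi> (u \<xi>)) \<partial>nu \<alpha>)"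
      using \<Phi>u by (intro nn_integral_cmult) measurable
    finally show "(\<integral>\<^sup>+z. ennreal (\<Phi> (v z / K)) \<partial>nu \<alpha>) \<le> ennreal K * (\<integral>\<^sup>+\<xi>. ennreal (\<Phi> (u \<xi>)) \<partial>nu \<alpha>)" .
  qed
qed

section \<open>Dilations\<close>

lemma herm_scaleR_swap: "herm (r *\<^sub>R z) w = herm z (r *\<^sub>R w)"
  by (simp add: scaleR_cscale herm_cscale_left herm_cscale_right)

lemma bdef_dilate: "0 \<le> r \<Longrightarrow> r \<le> 1 \<Longrightarrow> bdef z \<le> bdef (r *\<^sub>R z)"
  by (simp add: power_mult_distrib mult_left_le_one_le power_le_one)

lemma shell_measure_tendsto_0:
  assumes \<alpha>: "\<alpha> > -1"
  shows "(\<lambda>m. measure (nu \<alpha>) {z \<in> ball 0 1. norm (z :: complex ^ 'n) > 1 - inverse (real (Suc m))}) \<longlonglongrightarrow> 0"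
proof -
  interpret finite_measure "nu \<alpha> :: (complex ^ 'n) measure" by (rule finite_measure_nu[OF \<alpha>])
  let ?A = "\<lambda>m. {z \<in> ball 0 1. norm (z :: complex ^ 'n) > 1 - inverse (real (Suc m))}"
  have "{z \<in> space (nu \<alpha>). norm (z :: complex ^ 'n) > 1 - inverse (real (Suc m))} \<in> sets (nu \<alpha>)" for m
    by measurable
  then have sets: "range ?A \<subseteq> sets (nu \<alpha>)" by auto
  have dec: "decseq ?A"
  proof (rule decseq_SucI)
    fix m
    have "inverse (real (Suc (Suc m))) \<le> inverse (real (Suc m))" by (intro le_imp_inverse_le) auto
    then have "1 - inverse (real (Suc (Suc m))) < x \<Longrightarrow> 1 - inverse (real (Suc m)) < x" for x by linarith
    then show "?A (Suc m) \<subseteq> ?A m" by blast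
  qed
  have "(\<Inter>m. ?A m) = {}"
  proof (rule ccontr)
    assume "(\<Inter>m. ?A m) \<noteq> {}"
    then obtain z where z: "\<And>m. z \<in> ?A m" by auto
    have "0 < 1 - norm z" using z[of 0] by simp
    then obtain m where "inverse (real (Suc m)) < 1 - norm z" using reals_Archimedean by blast
    then show False using z[of m] by simp
  qed
  then show ?thesis using finite_Lim_measure_decseq[OF sets dec] by simp
qed

text \<open>Near the sphere the dilates are controlled uniformly by integrating the sub-mean-value
  property in the dilated variable; elsewhere the convergence is uniform.\<close>

lemma dilation_converges:
  fixes f :: "complex ^ 'n \<Rightarrow> complex"
  assumes \<Phi>: "moderate \<Phi>" and \<alpha>: "\<alpha> > -1" and f: "holomorphic_ball f"
    and fin: "(\<integral>\<^sup>+z. ennreal (\<Phi> (cmod (f z))) \<partial>nu \<alpha>) < \<infinity>" and \<epsilon>: "\<epsilon> > 0"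
  shows "\<forall>\<^sub>F r in at_left 1. (\<integral>\<^sup>+z. ennreal (\<Phi> (cmod (f (r *\<^sub>R z) - f z) / \<epsilon>)) \<partial>nu \<alpha>) \<le> 1"
proof -
  define N where "N = real CARD('n) + 1 + \<alpha>"
  have N: "N > 0" using \<alpha> by (simp add: N_def)
  note \<Phi>D = moderateD[OF \<Phi>]
  interpret finite_measure "nu \<alpha> :: (complex ^ 'n) measure" by (rule finite_measure_nu[OF \<alpha>])
  interpret P: pair_sigma_finite "nu \<alpha> :: (complex ^ 'n) measure" "nu \<alpha> :: (complex ^ 'n) measure" ..
  have fm[measurable]: "f \<in> borel_measurable (nu \<alpha>)" by (rule holomorphic_ball_measurable[OF f])
  have \<Phi>f[measurable]: "(\<lambda>z. \<Phi> (cmod (f z))) \<in> borel_measurable (nu \<alpha>)"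
    by (rule moderate_measurable[OF \<Phi>]) auto
  obtain C q where Cq: "C \<ge> 1" "q \<ge> 0" "\<And>x M. 1 \<le> x \<Longrightarrow> 0 \<le> M \<Longrightarrow> \<Phi> (x * M) \<le> C * x powr q * \<Phi> M"
    using moderate_upper[OF \<Phi>] by blast
  \<comment> \<open>The factor 2/\<epsilon> comes from |a - b| \<le> 2 max(|a|, |b|); the added 1
    makes the scaling factor at least 1, as the upper type requires.\<close>
  define C0 where "C0 = C * (2 / \<epsilon> + 1) powr q"
  have "2 / \<epsilon> + 1 > 0" using \<epsilon> by (simp add: add_pos_pos)
  then have C0: "C0 > 0" using Cq(1) by (simp add: C0_def)
  have diff: "\<Phi> (cmod (a - b) / \<epsilon>) \<le> C0 * (\<Phi> (cmod a) + \<Phi> (cmod b))" for a b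
  proof -
    define M where "M = max (cmod a) (cmod b)"
    have M0: "0 \<le> M" unfolding M_def by (rule max.coboundedI1) simp
    have "cmod (a - b) \<le> 2 * M" using norm_triangle_ineq4[of a b] by (simp add: M_def)
    then have "cmod (a - b) / \<epsilon> \<le> 2 / \<epsilon> * M" using \<epsilon> by (simp add: field_simps)
    also have "\<dots> \<le> (2 / \<epsilon> + 1) * M" using M0 by (intro mult_right_mono) auto
    finally have "\<Phi> (cmod (a - b) / \<epsilon>) \<le> \<Phi> ((2 / \<epsilon> + 1) * M)" using \<epsilon> by (intro \<Phi>D(5)) auto
    also have "\<dots> \<le> C0 * \<Phi> M" unfolding C0_def using \<epsilon> M0 by (intro Cq(3)) auto
    also have "\<Phi> M \<le> \<Phi> (cmod a) + \<Phi> (cmod b)" using \<Phi>D(4)[of "cmod a"] \<Phi>D(4)[of "cmod b"] by (auto simp: M_def max_def)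
    finally show ?thesis using C0 by simp
  qed
  obtain K where K: "K > 0" "\<And>f w. holomorphic_ball f \<Longrightarrow> w \<in> ball (0::complex ^ 'n) 1 \<Longrightarrow> 
    ennreal (\<Phi> (cmod (f w))) \<le> ennreal K * (\<integral>\<^sup>+\<xi>. ennreal (\<Phi> (cmod (f \<xi>)) * (bdef w powr (N + 1) * bdef \<xi> * cmod (1 - herm \<xi> w) powr (- 2 * (N + 1)))) \<partial>nu \<alpha>)"
    using moderate_submean[OF \<Phi> \<alpha>, where 'n='n] unfolding N_def by blast
  let ?k = "\<lambda>w \<xi>. bdef w powr (N + 1) * bdef \<xi> * cmod (1 - herm \<xi> w) powr (- 2 * (N + 1))"
  obtain F1 where F1: "F1 > 0" "\<And>w. w \<in> ball (0::complex ^ 'n) 1 \<Longrightarrow> (\<integral>\<^sup>+z. ennreal (cmod (1 - herm z w) powr (- (N + 1))) \<partial>nu \<alpha>) \<le> ennreal (F1 * bdef w powr (- 1))"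
    using forelli_rudin[OF \<alpha>, of 1, where 'n='n] unfolding N_def by auto
  define C1 where "C1 = 2 powr (N + 1) * F1"
  have C1: "C1 > 0" using F1 by (simp add: C1_def)
  define c where "c \<xi> = 2 powr (N + 1) * bdef \<xi> * (bdef \<xi> / 2) powr (- (N + 1))" for \<xi> :: "complex ^ 'n"
  have rb: "r *\<^sub>R z \<in> ball 0 1" if "z \<in> ball 0 1" "0 < r" "r < 1" for z :: "complex ^ 'n" and r
    using scaleR_in_ball[of r z] that by simp
  \<comment> \<open>Half of the kernel exponent is spent against the power of \<open>bdef\<close> at
    w. The exponent N + 1 that remains exceeds the critical one by 1, and the factor
    \<open>bdef\<close> at \<xi> compensates the resulting bdef^(-1).\<close>
  have kle: "?k w \<xi> \<le> 2 powr (N + 1) * bdef \<xi> * cmod (1 - herm \<xi> w) powr (- (N + 1))" if "w \<in> ball 0 1" "\<xi> \<in> ball 0 1" for w \<xi>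
  proof -
    let ?y = "cmod (1 - herm \<xi> w)"
    have y: "bdef w \<le> 2 * ?y" "?y > 0" using kernel_lower[OF that(2,1)] by auto
    have "?y powr (- 2 * (N + 1)) = ?y powr (- (N + 1)) * ?y powr (- (N + 1))" unfolding powr_add[symmetric] by simp
    then have "?k w \<xi> = bdef w powr (N + 1) * ?y powr (- (N + 1)) * (bdef \<xi> * ?y powr (- (N + 1)))" by (simp only: mult_ac)
    also have "\<dots> \<le> 2 powr (N + 1) * (bdef \<xi> * ?y powr (- (N + 1)))"
    proof (rule mult_right_mono)
      have "bdef w powr (N + 1) \<le> (2 * ?y) powr (N + 1)" using y bdef_pos[OF that(1)] N by (intro powr_mono2) auto
      then have "bdef w powr (N + 1) * ?y powr (- (N + 1)) \<le> (2 * ?y) powr (N + 1) * ?y powr (- (N + 1))" by (intro mult_right_mono) auto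
      also have "\<dots> = 2 powr (N + 1) * (?y powr (N + 1) * ?y powr (- (N + 1)))" using y by (simp only: powr_mult mult.assoc)
      also have "?y powr (N + 1) * ?y powr (- (N + 1)) = 1" using y(2) unfolding powr_add[symmetric] by simp
      finally have "bdef w powr (N + 1) * ?y powr (- (N + 1)) \<le> 2 powr (N + 1) * 1" .
      then show "bdef w powr (N + 1) * ?y powr (- (N + 1)) \<le> 2 powr (N + 1)" by simp
    qed (use bdef_pos[OF that(2)] in auto)
    finally show ?thesis by (simp only: mult_ac)
  qed
  define T where "T m = {z \<in> ball 0 1. norm (z :: complex ^ 'n) > 1 - inverse (real (Suc m))}" for m
  have T[measurable]: "T m \<in> sets (nu \<alpha>)" for m
  proof -
    have "{z \<in> space (nu \<alpha>). norm (z :: complex ^ 'n) > 1 - inverse (real (Suc m))} \<in> sets (nu \<alpha>)" by measurable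
    then show ?thesis by (simp add: T_def)
  qed
  define \<tau> where "\<tau> m = measure (nu \<alpha>) (T m)" for m
  have \<tau>: "\<tau> \<longlonglongrightarrow> 0" unfolding \<tau>_def T_def by (rule shell_measure_tendsto_0[OF \<alpha>])
  \<comment> \<open>Two bounds for one integral over the shell: C1 is uniform in \<xi> and serves as
    dominating constant, whereas c(\<xi>) \<tau>(m) tends to 0 for each fixed \<xi>. Both are
    independent of r.\<close>
  have J: "(\<integral>\<^sup>+z. ennreal (?k (r *\<^sub>R z) \<xi>) * indicator (T m) z \<partial>nu \<alpha>) \<le> ennreal (min C1 (c \<xi> * \<tau> m))"
    if r: "0 < r" "r < 1" and \<xi>: "\<xi> \<in> ball 0 1" for r \<xi> m
  proof -
    have d: "bdef \<xi> > 0" by (rule bdef_pos[OF \<xi>])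
    have r\<xi>: "r *\<^sub>R \<xi> \<in> ball 0 1" by (rule rb[OF \<xi> r])
    \<comment> \<open>The dilation is moved from the variable of integration z to the parameter
      \<xi>, whose dilate is no closer to the sphere than \<xi> itself.\<close>
    have sw: "cmod (1 - herm \<xi> (r *\<^sub>R z)) = cmod (1 - herm z (r *\<^sub>R \<xi>))" for z
      using cmod_one_minus_herm_sym[of \<xi> "r *\<^sub>R z"] by (simp add: herm_scaleR_swap)
    have "(\<integral>\<^sup>+z. ennreal (?k (r *\<^sub>R z) \<xi>) * indicator (T m) z \<partial>nu \<alpha>) \<le> 
      (\<integral>\<^sup>+z. ennreal (2 powr (N + 1) * bdef \<xi>) * ennreal (cmod (1 - herm z (r *\<^sub>R \<xi>)) powr (- (N + 1))) \<partial>nu \<alpha>)"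
    proof (rule nn_integral_mono)
      fix z :: "complex ^ 'n" assume "z \<in> space (nu \<alpha>)"
      then have "r *\<^sub>R z \<in> ball 0 1" using rb[OF _ r] by simp
      from kle[OF this \<xi>] have "ennreal (?k (r *\<^sub>R z) \<xi>) \<le> ennreal (2 powr (N + 1) * bdef \<xi>) * ennreal (cmod (1 - herm z (r *\<^sub>R \<xi>)) powr (- (N + 1)))"
        unfolding sw using d by (subst ennreal_mult[symmetric]) (auto intro: ennreal_leI)
      then show "ennreal (?k (r *\<^sub>R z) \<xi>) * indicator (T m) z \<le> ennreal (2 powr (N + 1) * bdef \<xi>) * ennreal (cmod (1 - herm z (r *\<^sub>R \<xi>)) powr (- (N + 1)))"
        by (simp add: indicator_def)
    qed
    also have "\<dots> = ennreal (2 powr (N + 1) * bdef \<xi>) * (\<integral>\<^sup>+z. ennreal (cmod (1 - herm z (r *\<^sub>R \<xi>)) powr (- (N + 1))) \<partial>nu \<alpha>)"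
      by (rule nn_integral_cmult) measurable
    also have "\<dots> \<le> ennreal (2 powr (N + 1) * bdef \<xi>) * ennreal (F1 * bdef (r *\<^sub>R \<xi>) powr (- 1))"
      by (intro mult_left_mono F1(2) r\<xi>) auto
    also have "\<dots> = ennreal (2 powr (N + 1) * bdef \<xi> * (F1 * bdef (r *\<^sub>R \<xi>) powr (- 1)))"
      by (rule ennreal_mult[symmetric]) (use d F1 in auto)
    also have "\<dots> \<le> ennreal C1"
    proof (rule ennreal_leI)
      have "bdef \<xi> \<le> bdef (r *\<^sub>R \<xi>)" using r by (intro bdef_dilate) auto
      moreover have "x * y powr (- 1) \<le> 1" if "x \<le> y" "0 < x" for x y :: real
        using that by (simp add: powr_minus_divide)
      ultimately have "bdef \<xi> * bdef (r *\<^sub>R \<xi>) powr (- 1) \<le> 1" using d by blast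
      then have "2 powr (N + 1) * F1 * (bdef \<xi> * bdef (r *\<^sub>R \<xi>) powr (- 1)) \<le> 2 powr (N + 1) * F1 * 1" using F1 by (intro mult_left_mono) auto
      then show "2 powr (N + 1) * bdef \<xi> * (F1 * bdef (r *\<^sub>R \<xi>) powr (- 1)) \<le> C1" by (simp only: C1_def mult_ac mult_1_right)
    qed
    finally have 1: "(\<integral>\<^sup>+z. ennreal (?k (r *\<^sub>R z) \<xi>) * indicator (T m) z \<partial>nu \<alpha>) \<le> ennreal C1" .
    have "(\<integral>\<^sup>+z. ennreal (?k (r *\<^sub>R z) \<xi>) * indicator (T m) z \<partial>nu \<alpha>) \<le> (\<integral>\<^sup>+z. ennreal (c \<xi>) * indicator (T m) z \<partial>nu \<alpha>)"
    proof (intro nn_integral_mono mult_right_mono ennreal_leI)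
      fix z :: "complex ^ 'n" assume "z \<in> space (nu \<alpha>)"
      then have rz: "r *\<^sub>R z \<in> ball 0 1" using rb[OF _ r] by simp
      have "?k (r *\<^sub>R z) \<xi> \<le> 2 powr (N + 1) * bdef \<xi> * cmod (1 - herm \<xi> (r *\<^sub>R z)) powr (- (N + 1))" by (rule kle[OF rz \<xi>])
      also have "\<dots> \<le> c \<xi>" unfolding c_def
        using kernel_lower(2)[OF \<xi> rz] d N by (intro mult_left_mono powr_mono2') auto
      finally show "?k (r *\<^sub>R z) \<xi> \<le> c \<xi>" .
    qed auto
    also have "\<dots> = ennreal (c \<xi>) * emeasure (nu \<alpha>) (T m)" by (rule nn_integral_cmult_indicator) simp
    also have "\<dots> = ennreal (c \<xi> * \<tau> m)" using d by (simp add: \<tau>_def emeasure_eq_measure c_def ennreal_mult)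
    finally show ?thesis using 1 by (simp add: min_def)
  qed
  have cm[measurable]: "c \<in> borel_measurable (nu \<alpha>)" unfolding c_def by measurable
  have c0: "c \<xi> \<ge> 0" if "\<xi> \<in> ball 0 1" for \<xi> using bdef_pos[OF that] by (simp add: c_def)
  define E where "E m = (\<integral>\<^sup>+\<xi>. ennreal (\<Phi> (cmod (f \<xi>)) * min C1 (c \<xi> * \<tau> m)) \<partial>nu \<alpha>)" for m
  define F where "F m = (\<integral>\<^sup>+\<xi>. ennreal (\<Phi> (cmod (f \<xi>))) * indicator (T m) \<xi> \<partial>nu \<alpha>)" for m
  have E: "E \<longlonglongrightarrow> 0"
  proof -
    have "E \<longlonglongrightarrow> (\<integral>\<^sup>+\<xi>. 0 \<partial>(nu \<alpha> :: (complex ^ 'n) measure))" unfolding E_def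
    proof (rule nn_integral_dominated_convergence[where w="\<lambda>\<xi>. ennreal C1 * ennreal (\<Phi> (cmod (f \<xi>)))"])
      show "(\<integral>\<^sup>+\<xi>. ennreal C1 * ennreal (\<Phi> (cmod (f \<xi>))) \<partial>nu \<alpha>) < \<infinity>"
        using fin by (simp add: nn_integral_cmult ennreal_mult_less_top)
      show "AE \<xi> in nu \<alpha>. ennreal (\<Phi> (cmod (f \<xi>)) * min C1 (c \<xi> * \<tau> m)) \<le> ennreal C1 * ennreal (\<Phi> (cmod (f \<xi>)))" for m
        using \<Phi>D(4) C1 by (intro AE_I2) (subst ennreal_mult[symmetric], auto intro!: ennreal_leI simp: mult.commute[of C1] mult_left_mono)
      show "AE \<xi> in nu \<alpha>. (\<lambda>m. ennreal (\<Phi> (cmod (f \<xi>)) * min C1 (c \<xi> * \<tau> m))) \<longlonglongrightarrow> 0"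
      proof (rule AE_I2)
        fix \<xi> :: "complex ^ 'n"
        have "(\<lambda>m. \<Phi> (cmod (f \<xi>)) * min C1 (c \<xi> * \<tau> m)) \<longlonglongrightarrow> \<Phi> (cmod (f \<xi>)) * min C1 (c \<xi> * 0)"
          by (intro tendsto_intros tendsto_min \<tau>)
        then show "(\<lambda>m. ennreal (\<Phi> (cmod (f \<xi>)) * min C1 (c \<xi> * \<tau> m))) \<longlonglongrightarrow> 0"
          using C1 tendsto_ennrealI by fastforce
      qed
    qed measurable
    then show ?thesis by simp
  qed
  have F: "F \<longlonglongrightarrow> 0"
  proof -
    have "F \<longlonglongrightarrow> (\<integral>\<^sup>+\<xi>. 0 \<partial>(nu \<alpha> :: (complex ^ 'n) measure))" unfolding F_def
    proof (rule nn_integral_dominated_convergence[where w="\<lambda>\<xi>. ennreal (\<Phi> (cmod (f \<xi>)))"])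
      show "AE \<xi> in nu \<alpha>. (\<lambda>m. ennreal (\<Phi> (cmod (f \<xi>))) * indicator (T m) \<xi>) \<longlonglongrightarrow> 0"
      proof (rule AE_I2)
        fix \<xi> :: "complex ^ 'n" assume "\<xi> \<in> space (nu \<alpha>)"
        then have "0 < 1 - norm \<xi>" by simp
        then obtain m where m: "inverse (real (Suc m)) < 1 - norm \<xi>" using reals_Archimedean by blast
        have "\<forall>\<^sub>F k in sequentially. ennreal (\<Phi> (cmod (f \<xi>))) * indicator (T k) \<xi> = 0"
        proof (rule eventually_sequentiallyI[of m])
          fix k assume "m \<le> k"
          then have "inverse (real (Suc k)) \<le> inverse (real (Suc m))" by (intro le_imp_inverse_le) auto
          then have "\<not> 1 - inverse (real (Suc k)) < norm \<xi>" using m by linarith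
          then have "\<xi> \<notin> T k" unfolding T_def by blast
          then show "ennreal (\<Phi> (cmod (f \<xi>))) * indicator (T k) \<xi> = 0" by simp
        qed
        then show "(\<lambda>m. ennreal (\<Phi> (cmod (f \<xi>))) * indicator (T m) \<xi>) \<longlonglongrightarrow> 0" by (rule tendsto_eventually)
      qed
      show "AE \<xi> in nu \<alpha>. ennreal (\<Phi> (cmod (f \<xi>))) * indicator (T m) \<xi> \<le> ennreal (\<Phi> (cmod (f \<xi>)))" for m
        by (intro AE_I2) (simp add: indicator_def)
    qed (use fin in measurable)
    then show ?thesis by simp
  qed
  \<comment> \<open>The thresholds give 1/4 for each of the two shell terms after multiplication by
    C0 (and by K for E); the remaining 1/2 is reserved for the inner ball.\<close>
  have "\<forall>\<^sub>F m in sequentially. E m < ennreal (1 / (4 * C0 * K)) \<and> F m < ennreal (1 / (4 * C0))"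
    using C0 K(1) by (intro eventually_conj order_tendstoD(2)[OF E] order_tendstoD(2)[OF F]) auto
  then obtain m where m: "E m < ennreal (1 / (4 * C0 * K))" "F m < ennreal (1 / (4 * C0))"
    by (auto simp: eventually_sequentially)
  \<comment> \<open>The lower type 1/2 turns this value into \<Phi>(t0) \<le> 1/2.\<close>
  define t0 where "t0 = min 1 (1 / (4 * (\<Phi> 1)\<^sup>2))"
  have \<Phi>1: "\<Phi> 1 > 0" by (rule \<Phi>D(3)) simp
  have t0: "t0 > 0" "t0 \<le> 1" using \<Phi>1 by (auto simp: t0_def)
  have \<Phi>t0: "\<Phi> t0 \<le> 1 / 2"
  proof -
    have "\<Phi> t0 \<le> sqrt t0 * \<Phi> 1" using \<Phi>D(6)[of t0 1] t0 by simp
    also have "sqrt t0 \<le> sqrt (1 / (4 * (\<Phi> 1)\<^sup>2))" by (simp add: t0_def)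
    also have "sqrt (1 / (4 * (\<Phi> 1)\<^sup>2)) = 1 / (2 * \<Phi> 1)" using \<Phi>1 by (simp add: real_sqrt_divide real_sqrt_mult)
    finally show ?thesis using \<Phi>1 by simp
  qed
  define R where "R = 1 - inverse (real (Suc m))"
  have R: "0 \<le> R" "R < 1" by (auto simp: R_def inverse_le_1_iff)
  have cR: "cball (0 :: complex ^ 'n) R \<subseteq> ball 0 1" using R by auto
  have "uniformly_continuous_on (cball 0 R) f"
    by (intro compact_uniformly_continuous continuous_on_subset[OF holomorphic_ball_continuous[OF f] cR]) simp
  moreover have "\<epsilon> * t0 > 0" using \<epsilon> t0 by simp
  ultimately obtain \<delta> where \<delta>: "\<delta> > 0" "\<And>x y. x \<in> cball 0 R \<Longrightarrow> y \<in> cball 0 R \<Longrightarrow> dist y x < \<delta> \<Longrightarrow> dist (f y) (f x) < \<epsilon> * t0"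
    unfolding uniformly_continuous_on_def by metis
  have main: "(\<integral>\<^sup>+z. ennreal (\<Phi> (cmod (f (r *\<^sub>R z) - f z) / \<epsilon>)) \<partial>nu \<alpha>) \<le> 1" if r: "max 0 (1 - \<delta>) < r" "r < 1" for r
  proof -
    have r0: "0 < r" using r by simp
    have "Hinf (\<lambda>z. f (r *\<^sub>R z))" using Hinf_dilate[OF f] r by simp
    then have frm[measurable]: "(\<lambda>z. f (r *\<^sub>R z)) \<in> borel_measurable (nu \<alpha>)" by (intro holomorphic_ball_measurable HinfD)
    have [measurable]: "(\<lambda>z. \<Phi> (cmod (f (r *\<^sub>R z)))) \<in> borel_measurable (nu \<alpha>)"
      by (rule moderate_measurable[OF \<Phi>]) auto
    have km: "(\<lambda>(\<xi>, z). ennreal (\<Phi> (cmod (f \<xi>)) * ?k (r *\<^sub>R z) \<xi>) * indicator (T m) z) \<in> borel_measurable (nu \<alpha> \<Otimes>\<^sub>M nu \<alpha>)"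
    proof -
      have rm: "(\<lambda>p :: (complex ^ 'n) \<times> (complex ^ 'n). r *\<^sub>R snd p) \<in> borel_measurable (nu \<alpha> \<Otimes>\<^sub>M nu \<alpha>)"
        by (intro borel_measurable_scaleR borel_measurable_const measurable_snd_nu)
      have h: "(\<lambda>p :: (complex ^ 'n) \<times> (complex ^ 'n). herm (fst p) (r *\<^sub>R snd p)) \<in> borel_measurable (nu \<alpha> \<Otimes>\<^sub>M nu \<alpha>)"
        by (rule borel_measurable_herm[OF measurable_fst_nu rm])
      have h': "(\<lambda>p :: (complex ^ 'n) \<times> (complex ^ 'n). cmod (1 - herm (fst p) (r *\<^sub>R snd p)) powr a) \<in> borel_measurable (nu \<alpha> \<Otimes>\<^sub>M nu \<alpha>)" for a
        using h by measurable
      have d1: "(\<lambda>p :: (complex ^ 'n) \<times> (complex ^ 'n). bdef (r *\<^sub>R snd p) powr a) \<in> borel_measurable (nu \<alpha> \<Otimes>\<^sub>M nu \<alpha>)" for a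
        by (rule measurable_compose[OF rm borel_measurable_weight])
      have d2: "(\<lambda>p :: (complex ^ 'n) \<times> (complex ^ 'n). bdef (fst p)) \<in> borel_measurable (nu \<alpha> \<Otimes>\<^sub>M nu \<alpha>)"
        by (rule measurable_compose[OF measurable_fst_nu]) measurable
      have i: "(\<lambda>p :: (complex ^ 'n) \<times> (complex ^ 'n). indicator (T m) (snd p) :: ennreal) \<in> borel_measurable (nu \<alpha> \<Otimes>\<^sub>M nu \<alpha>)"
        by (rule measurable_compose[OF measurable_snd]) measurable
      show ?thesis unfolding split_beta
        by (intro borel_measurable_times_ennreal i measurable_compose[OF _ measurable_ennreal] borel_measurable_times h' d1 d2 measurable_compose[OF measurable_fst \<Phi>f])
    qed
    have "(\<integral>\<^sup>+z. ennreal (\<Phi> (cmod (f (r *\<^sub>R z)))) * indicator (T m) z \<partial>nu \<alpha>)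
      \<le> (\<integral>\<^sup>+z. ennreal K * (\<integral>\<^sup>+\<xi>. ennreal (\<Phi> (cmod (f \<xi>)) * ?k (r *\<^sub>R z) \<xi>) * indicator (T m) z \<partial>nu \<alpha>) \<partial>nu \<alpha>)"
    proof (rule nn_integral_mono)
      fix z :: "complex ^ 'n" assume "z \<in> space (nu \<alpha>)"
      then have rz: "r *\<^sub>R z \<in> ball 0 1" using rb[OF _ r0 r(2)] by simp
      show "ennreal (\<Phi> (cmod (f (r *\<^sub>R z)))) * indicator (T m) z \<le> ennreal K * (\<integral>\<^sup>+\<xi>. ennreal (\<Phi> (cmod (f \<xi>)) * ?k (r *\<^sub>R z) \<xi>) * indicator (T m) z \<partial>nu \<alpha>)"
        using K(2)[OF f rz] by (cases "z \<in> T m") auto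
    qed
    also have "\<dots> = ennreal K * (\<integral>\<^sup>+z. \<integral>\<^sup>+\<xi>. ennreal (\<Phi> (cmod (f \<xi>)) * ?k (r *\<^sub>R z) \<xi>) * indicator (T m) z \<partial>nu \<alpha> \<partial>nu \<alpha>)"
    proof (rule nn_integral_cmult)
      have "(\<lambda>(z, \<xi>). ennreal (\<Phi> (cmod (f \<xi>)) * ?k (r *\<^sub>R z) \<xi>) * indicator (T m) z) \<in> borel_measurable (nu \<alpha> \<Otimes>\<^sub>M nu \<alpha>)"
        using measurable_compose[OF measurable_pair_swap'[of "nu \<alpha>" "nu \<alpha>"] km] by (simp add: split_beta')
      then show "(\<lambda>z. \<integral>\<^sup>+\<xi>. ennreal (\<Phi> (cmod (f \<xi>)) * ?k (r *\<^sub>R z) \<xi>) * indicator (T m) z \<partial>nu \<alpha>) \<in> borel_measurable (nu \<alpha>)"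
        by (rule borel_measurable_nn_integral)
    qed
    also have "(\<integral>\<^sup>+z. \<integral>\<^sup>+\<xi>. ennreal (\<Phi> (cmod (f \<xi>)) * ?k (r *\<^sub>R z) \<xi>) * indicator (T m) z \<partial>nu \<alpha> \<partial>nu \<alpha>)
      = (\<integral>\<^sup>+\<xi>. \<integral>\<^sup>+z. ennreal (\<Phi> (cmod (f \<xi>)) * ?k (r *\<^sub>R z) \<xi>) * indicator (T m) z \<partial>nu \<alpha> \<partial>nu \<alpha>)"
      by (rule P.Fubini'[OF km])
    also have "\<dots> \<le> E m" unfolding E_def
    proof (rule nn_integral_mono)
      fix \<xi> :: "complex ^ 'n" assume "\<xi> \<in> space (nu \<alpha>)"
      then have \<xi>: "\<xi> \<in> ball 0 1" by simp
      have k0: "0 \<le> ?k (r *\<^sub>R z) \<xi>" for z using bdef_pos[OF \<xi>] by (intro mult_nonneg_nonneg) auto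
      have "(\<integral>\<^sup>+z. ennreal (\<Phi> (cmod (f \<xi>)) * ?k (r *\<^sub>R z) \<xi>) * indicator (T m) z \<partial>nu \<alpha>) = 
        (\<integral>\<^sup>+z. ennreal (\<Phi> (cmod (f \<xi>))) * (ennreal (?k (r *\<^sub>R z) \<xi>) * indicator (T m) z) \<partial>nu \<alpha>)"
        using k0 \<Phi>D(4) by (intro nn_integral_cong) (simp add: ennreal_mult' mult.assoc)
      also have "\<dots> = ennreal (\<Phi> (cmod (f \<xi>))) * (\<integral>\<^sup>+z. ennreal (?k (r *\<^sub>R z) \<xi>) * indicator (T m) z \<partial>nu \<alpha>)"
        by (rule nn_integral_cmult) measurable
      also have "\<dots> \<le> ennreal (\<Phi> (cmod (f \<xi>))) * ennreal (min C1 (c \<xi> * \<tau> m))"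
        by (intro mult_left_mono J r0 r \<xi>) simp
      also have "\<dots> = ennreal (\<Phi> (cmod (f \<xi>)) * min C1 (c \<xi> * \<tau> m))"
        using \<Phi>D(4) by (simp add: ennreal_mult')
      finally show "(\<integral>\<^sup>+z. ennreal (\<Phi> (cmod (f \<xi>)) * ?k (r *\<^sub>R z) \<xi>) * indicator (T m) z \<partial>nu \<alpha>) \<le> ennreal (\<Phi> (cmod (f \<xi>)) * min C1 (c \<xi> * \<tau> m))" .
    qed
    finally have t1: "(\<integral>\<^sup>+z. ennreal (\<Phi> (cmod (f (r *\<^sub>R z)))) * indicator (T m) z \<partial>nu \<alpha>) \<le> ennreal K * E m" by (simp add: mult_left_mono)
    also have "\<dots> \<le> ennreal K * ennreal (1 / (4 * C0 * K))" using m(1) by (intro mult_left_mono) auto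
    also have "\<dots> = ennreal (1 / (4 * C0))" using K(1) C0 by (simp flip: ennreal_mult)
    finally have t1: "(\<integral>\<^sup>+z. ennreal (\<Phi> (cmod (f (r *\<^sub>R z)))) * indicator (T m) z \<partial>nu \<alpha>) \<le> ennreal (1 / (4 * C0))" .
    have "(\<integral>\<^sup>+z. ennreal (\<Phi> (cmod (f (r *\<^sub>R z) - f z) / \<epsilon>)) \<partial>nu \<alpha>) \<le> 
      (\<integral>\<^sup>+z. ennreal C0 * (ennreal (\<Phi> (cmod (f (r *\<^sub>R z)))) * indicator (T m) z + ennreal (\<Phi> (cmod (f z))) * indicator (T m) z) + ennreal (1/2) \<partial>nu \<alpha>)"
    proof (rule nn_integral_mono)
      fix z :: "complex ^ 'n" assume z: "z \<in> space (nu \<alpha>)"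
      show "ennreal (\<Phi> (cmod (f (r *\<^sub>R z) - f z) / \<epsilon>)) \<le> ennreal C0 * (ennreal (\<Phi> (cmod (f (r *\<^sub>R z)))) * indicator (T m) z + ennreal (\<Phi> (cmod (f z))) * indicator (T m) z) + ennreal (1/2)"
      proof (cases "z \<in> T m")
        case True
        have "ennreal (\<Phi> (cmod (f (r *\<^sub>R z) - f z) / \<epsilon>)) \<le> ennreal (C0 * (\<Phi> (cmod (f (r *\<^sub>R z))) + \<Phi> (cmod (f z))))" by (intro ennreal_leI diff)
        also have "\<dots> = ennreal C0 * (ennreal (\<Phi> (cmod (f (r *\<^sub>R z)))) + ennreal (\<Phi> (cmod (f z))))"
          using C0 \<Phi>D(4) by (simp add: ennreal_mult)
        finally show ?thesis using True by (simp add: add_increasing2)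
      next
        case False
        then have zR: "norm z \<le> R" using z by (auto simp: T_def R_def)
        have "norm (r *\<^sub>R z) \<le> norm z" using r0 r by (simp add: mult_left_le_one_le)
        moreover have "dist (r *\<^sub>R z) z < \<delta>"
        proof -
          have "dist (r *\<^sub>R z) z = norm ((r - 1) *\<^sub>R z)" unfolding dist_norm by (simp add: algebra_simps)
          also have "\<dots> = (1 - r) * norm z" using r by simp
          also have "\<dots> \<le> 1 - r" using r zR R by (intro mult_left_le) auto
          finally show ?thesis using r by simp
        qed
        ultimately have "dist (f (r *\<^sub>R z)) (f z) < \<epsilon> * t0" using zR by (intro \<delta>(2)) auto
        then have "cmod (f (r *\<^sub>R z) - f z) / \<epsilon> \<le> t0" using \<epsilon> by (simp add: dist_norm field_simps)
        then have "\<Phi> (cmod (f (r *\<^sub>R z) - f z) / \<epsilon>) \<le> \<Phi> t0" using \<epsilon> by (intro \<Phi>D(5)) auto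
        then have "ennreal (\<Phi> (cmod (f (r *\<^sub>R z) - f z) / \<epsilon>)) \<le> ennreal (1/2)" using \<Phi>t0 by (intro ennreal_leI) linarith
        then show ?thesis using False by simp
      qed
    qed
    also have "\<dots> = ennreal C0 * ((\<integral>\<^sup>+z. ennreal (\<Phi> (cmod (f (r *\<^sub>R z)))) * indicator (T m) z \<partial>nu \<alpha>) + F m) + ennreal (1/2) * emeasure (nu \<alpha>) (space (nu \<alpha> :: (complex ^ 'n) measure))"
      unfolding F_def by (subst nn_integral_add, measurable, subst nn_integral_cmult, measurable, subst nn_integral_add) auto
    also have "\<dots> \<le> ennreal C0 * (ennreal (1 / (4 * C0)) + ennreal (1 / (4 * C0))) + ennreal (1/2) * 1"
      using m(2) by (intro add_mono mult_left_mono t1) (auto simp: emeasure_nu[OF \<alpha>])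
    also have "\<dots> = ennreal (C0 * (1 / (4 * C0) + 1 / (4 * C0)) + 1/2)"
    proof -
      have "ennreal (1 / (4 * C0)) + ennreal (1 / (4 * C0)) = ennreal (1 / (4 * C0) + 1 / (4 * C0))" using C0 by (subst ennreal_plus) auto
      moreover have "ennreal C0 * ennreal (1 / (4 * C0) + 1 / (4 * C0)) = ennreal (C0 * (1 / (4 * C0) + 1 / (4 * C0)))" using C0 by (subst ennreal_mult) auto
      moreover have "ennreal (C0 * (1 / (4 * C0) + 1 / (4 * C0))) + ennreal (1/2) = ennreal (C0 * (1 / (4 * C0) + 1 / (4 * C0)) + 1/2)"
        using C0 by (subst ennreal_plus) auto
      ultimately show ?thesis by simp
    qed
    also have "\<dots> = 1" using C0 by (simp add: field_simps)
    finally show ?thesis .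
  qed
  have "max 0 (1 - \<delta>) < 1" using \<delta>(1) by simp
  then show ?thesis unfolding eventually_at_left_field using main by blast
qed

section \<open>Functionals determined by kernels\<close>

lemma bker_lipschitz:
  assumes "r < 1"
  obtains L where "L \<ge> 0" "\<And>u v. cmod u \<le> r \<Longrightarrow> cmod v \<le> r \<Longrightarrow> cmod (bker s v - bker s u) \<le> L * cmod (v - u)"
proof -
  have sub: "cball 0 r \<subseteq> ball (0::complex) 1" using assms by auto
  let ?F = "\<lambda>u. of_real s * bker (s + 1) u"
  have "bounded (?F ` cball 0 r)"
    by (intro compact_imp_bounded compact_continuous_image continuous_intros) (use sub in auto)
  then obtain B where B: "\<And>u. u \<in> cball 0 r \<Longrightarrow> cmod (?F u) \<le> B" unfolding bounded_iff by blast
  show ?thesis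
  proof (rule that[of "\<bar>B\<bar>"])
    fix u v :: complex assume "cmod u \<le> r" "cmod v \<le> r"
    then have uv: "u \<in> cball 0 r" "v \<in> cball 0 r" by auto
    show "cmod (bker s v - bker s u) \<le> \<bar>B\<bar> * cmod (v - u)"
    proof (rule field_differentiable_bound[OF convex_cball _ _ uv(2,1)])
      fix z assume z: "z \<in> cball (0::complex) r"
      then have "cmod z < 1" using sub by auto
      from has_field_derivative_bker[OF this] show "(bker s has_field_derivative ?F z) (at z within cball 0 r)"
        by (rule has_field_derivative_at_within)
      show "cmod (?F z) \<le> \<bar>B\<bar>" using B[OF z] by linarith
    qed
  qed simp
qed

text \<open>A dilate is a superposition of kernels by the reproducing formula; approximating the identity of
  the ball by simple functions turns the superposition into finite sums.\<close>

lemma functional_vanishes_dilate: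
  fixes f :: "complex ^ 'n \<Rightarrow> complex"
  assumes \<alpha>: "\<alpha> > -1" and \<Lambda>: "sup_functional \<Lambda>" and f: "holomorphic_ball f" and r: "0 \<le> r" "r < 1"
    and ker: "\<And>a. a \<in> ball 0 1 \<Longrightarrow> \<Lambda> (\<lambda>z. bker (real CARD('n) + 1 + \<alpha>) (herm z a)) = 0"
  shows "\<Lambda> (\<lambda>z. f (r *\<^sub>R z)) = 0"
proof -
  define N where "N = real CARD('n) + 1 + \<alpha>"
  \<comment> \<open>The dilation is split into two equal ones: one makes F bounded, the other keeps
    the arguments of the kernel in a disc of radius s < 1.\<close>
  define s where "s = sqrt r"
  have s: "0 \<le> s" "s < 1" "s * s = r" using r by (auto simp: s_def real_sqrt_lt_1_iff)
  interpret finite_measure "nu \<alpha> :: (complex ^ 'n) measure" by (rule finite_measure_nu[OF \<alpha>])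
  define F where "F z = f (s *\<^sub>R z)" for z
  have F: "Hinf F" unfolding F_def by (rule Hinf_dilate[OF f s(1,2)])
  have Fm[measurable]: "F \<in> borel_measurable (nu \<alpha>)" using F by (intro holomorphic_ball_measurable HinfD)
  have iF: "integrable (nu \<alpha>) F" by (rule Hinf_integrable[OF F \<alpha>])
  obtain Q where Q: "\<And>i. simple_function (nu \<alpha>) (Q i)" "\<And>w. w \<in> space (nu \<alpha>) \<Longrightarrow> (\<lambda>i. Q i w) \<longlonglongrightarrow> (w :: complex ^ 'n)"
    using borel_measurable_implies_sequence_metric[OF measurable_ident_nu[of \<alpha>], of 0] by metis
  \<comment> \<open>Values outside the closed ball are replaced by 0, so that the dilated points s P
    stay in the open ball. At each interior w the replacement is eventually invisible.\<close>
  define P where "P i w = (if norm (Q i w) \<le> 1 then Q i w else 0)" for i w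
  have P: "simple_function (nu \<alpha>) (P i)" for i
    using simple_function_compose1[OF Q(1), of "\<lambda>x. if norm x \<le> 1 then x else 0" i] by (simp add: P_def[abs_def])
  have Pb: "P i w \<in> cball 0 1" for i w by (simp add: P_def)
  have Plim: "(\<lambda>i. P i w) \<longlonglongrightarrow> w" if "w \<in> ball 0 1" for w
  proof (rule Lim_transform_eventually)
    show "(\<lambda>i. Q i w) \<longlonglongrightarrow> w" using Q(2) that by simp
    from topological_tendstoD[OF this open_ball that] show "\<forall>\<^sub>F i in sequentially. Q i w = P i w"
      by eventually_elim (simp add: P_def)
  qed
  have Pm[measurable]: "P i \<in> borel_measurable (nu \<alpha>)" for i by (rule borel_measurable_simple_function[OF P])
  obtain L where L: "L \<ge> 0" "\<And>u v. cmod u \<le> s \<Longrightarrow> cmod v \<le> s \<Longrightarrow> cmod (bker N v - bker N u) \<le> L * cmod (v - u)"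
    using bker_lipschitz[OF s(2)] by blast
  obtain K where K: "K \<ge> 0" "\<And>f B. Hinf f \<Longrightarrow> (\<And>z. z \<in> ball 0 1 \<Longrightarrow> cmod (f z) \<le> B) \<Longrightarrow> cmod (\<Lambda> f) \<le> K * B"
    using sup_functional_bound[OF \<Lambda>] by blast
  have sb: "s *\<^sub>R x \<in> ball 0 1" if "x \<in> cball 0 1" for x :: "complex ^ 'n"
    using that s mult_left_mono[of "norm x" 1 s] by auto
  have hs: "cmod (herm z (s *\<^sub>R x)) \<le> s" if "z \<in> ball 0 1" "x \<in> cball 0 1" for z x :: "complex ^ 'n"
  proof -
    have "cmod (herm z (s *\<^sub>R x)) \<le> norm z * (s * norm x)" using norm_herm_le[of z "s *\<^sub>R x"] s by simp
    also have "\<dots> \<le> 1 * (s * 1)" using that s by (intro mult_mono) auto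
    finally show ?thesis by simp
  qed
  have Fz: "f (r *\<^sub>R z) = (LINT w|nu \<alpha>. F w * bker N (herm z (s *\<^sub>R w)))" if z: "z \<in> ball 0 1" for z
  proof -
    have "s *\<^sub>R z \<in> ball 0 1" using z s by (intro scaleR_in_ball) auto
    then have "kint \<alpha> F N (s *\<^sub>R z) = F (s *\<^sub>R z)" unfolding N_def by (intro kint_reproducing HinfD[OF F] \<alpha> iF)
    then show ?thesis by (simp add: kint_def F_def s(3) herm_scaleR_swap)
  qed
  define m where "m i p = (LINT w|nu \<alpha>. indicator (P i -` {p} \<inter> space (nu \<alpha>)) w *\<^sub>R F w)" for i p
  define S where "S i z = (\<Sum>p\<in>P i ` space (nu \<alpha>). m i p * bker N (herm z (s *\<^sub>R p)))" for i z
  have fin: "finite (P i ` space (nu \<alpha>))" for i using P by (simp add: simple_function_def)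
  have kH: "Hinf (\<lambda>z. bker N (herm z (s *\<^sub>R p)))" if "p \<in> P i ` space (nu \<alpha>)" for i p
    using that Pb sb by (intro Hinf_bker) blast
  have SH: "Hinf (S i)" for i unfolding S_def by (intro Hinf_sum Hinf_cmult kH)
  have S0: "\<Lambda> (S i) = 0" for i
  proof -
    have "\<Lambda> (S i) = (\<Sum>p\<in>P i ` space (nu \<alpha>). m i p * \<Lambda> (\<lambda>z. bker N (herm z (s *\<^sub>R p))))"
      unfolding S_def by (rule sup_functional_sum[OF \<Lambda> fin kH])
    also have "\<dots> = 0"
    proof (rule sum.neutral, rule ballI)
      fix p assume "p \<in> P i ` space (nu \<alpha>)"
      then have "s *\<^sub>R p \<in> ball 0 1" using Pb sb by blast
      then show "m i p * \<Lambda> (\<lambda>z. bker N (herm z (s *\<^sub>R p))) = 0" using ker by (simp add: N_def)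
    qed
    finally show ?thesis .
  qed
  have Sint: "S i z = (LINT w|nu \<alpha>. F w * bker N (herm z (s *\<^sub>R P i w)))" for i z
  proof -
    have sets: "P i -` {p} \<inter> space (nu \<alpha>) \<in> sets (nu \<alpha>)" for p by (rule simple_functionD(2)[OF P])
    have ii: "integrable (nu \<alpha>) (\<lambda>w. indicator (P i -` {p} \<inter> space (nu \<alpha>)) w *\<^sub>R F w)" for p
      using iF sets by (rule integrable_mult_indicator[rotated])
    have "S i z = (LINT w|nu \<alpha>. (\<Sum>p\<in>P i ` space (nu \<alpha>). (indicator (P i -` {p} \<inter> space (nu \<alpha>)) w *\<^sub>R F w) * bker N (herm z (s *\<^sub>R p))))"
    proof -
      have i2: "integrable (nu \<alpha>) (\<lambda>w. (indicator (P i -` {p} \<inter> space (nu \<alpha>)) w *\<^sub>R F w) * bker N (herm z (s *\<^sub>R p)))" for p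
        by (rule integrable_mult_left[OF ii])
      show ?thesis unfolding S_def m_def by (simp only: Bochner_Integration.integral_sum[OF i2] Bochner_Integration.integral_mult_left[OF ii])
    qed
    also have "\<dots> = (LINT w|nu \<alpha>. F w * bker N (herm z (s *\<^sub>R P i w)))"
    proof (rule Bochner_Integration.integral_cong[OF refl])
      fix w :: "complex ^ 'n" assume w: "w \<in> space (nu \<alpha>)"
      have "(\<Sum>p\<in>P i ` space (nu \<alpha>). (indicator (P i -` {p} \<inter> space (nu \<alpha>)) w *\<^sub>R F w) * bker N (herm z (s *\<^sub>R p)))
        = (\<Sum>p\<in>{P i w}. (indicator (P i -` {p} \<inter> space (nu \<alpha>)) w *\<^sub>R F w) * bker N (herm z (s *\<^sub>R p)))"
        using w fin by (intro sum.mono_neutral_right) auto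
      also have "\<dots> = F w * bker N (herm z (s *\<^sub>R P i w))" using w by (simp only: sum.insert sum.empty finite.emptyI empty_iff not_False_eq_True) simp
      finally show "(\<Sum>p\<in>P i ` space (nu \<alpha>). (indicator (P i -` {p} \<inter> space (nu \<alpha>)) w *\<^sub>R F w) * bker N (herm z (s *\<^sub>R p))) = F w * bker N (herm z (s *\<^sub>R P i w))" .
    qed
    finally show ?thesis .
  qed
  obtain B where B: "B \<ge> 0" "\<And>z. z \<in> ball 0 1 \<Longrightarrow> cmod (F z) \<le> B" using HinfE[OF F] by blast
  \<comment> \<open>Bounds the distance between the dilate and its i-th finite sum uniformly over
    the ball, as is needed for a functional controlled by suprema.\<close>
  define e where "e i = (LINT w|nu \<alpha>. B * (L * norm (P i w - w)))" for i
  have norm2: "norm (P i w - w) \<le> 2" if "w \<in> space (nu \<alpha>)" for i w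
    using norm_triangle_ineq4[of "P i w" w] Pb[of i w] that by simp
  have ie: "integrable (nu \<alpha>) (\<lambda>w. B * (L * norm (P i w - w)))" for i
    using norm2 by (intro integrable_mult_right integrable_const_bound[of _ 2]) auto
  have e: "e \<longlonglongrightarrow> 0"
  proof -
    have "e \<longlonglongrightarrow> (LINT w|(nu \<alpha> :: (complex ^ 'n) measure). 0)" unfolding e_def
    proof (rule integral_dominated_convergence[where w="\<lambda>_. B * (L * 2)"])
      show "AE w in nu \<alpha>. (\<lambda>i. B * (L * norm (P i w - w))) \<longlonglongrightarrow> 0"
      proof (rule AE_I2)
        fix w :: "complex ^ 'n" assume "w \<in> space (nu \<alpha>)"
        then have "(\<lambda>i. B * (L * norm (P i w - w))) \<longlonglongrightarrow> B * (L * norm (w - w))" by (intro tendsto_intros Plim) simp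
        then show "(\<lambda>i. B * (L * norm (P i w - w))) \<longlonglongrightarrow> 0" by simp
      qed
      show "AE w in nu \<alpha>. norm (B * (L * norm (P i w - w))) \<le> B * (L * 2)" for i
        using norm2 B(1) L(1) by (intro AE_I2) (auto simp: abs_mult intro!: mult_left_mono)
    qed auto
    then show ?thesis by simp
  qed
  have fH: "Hinf (\<lambda>z. f (r *\<^sub>R z))" by (rule Hinf_dilate[OF f r])
  have dz: "cmod (f (r *\<^sub>R z) - S i z) \<le> e i" if z: "z \<in> ball 0 1" for z i
  proof -
    have i1: "integrable (nu \<alpha>) (\<lambda>w. F w * bker N (herm z (s *\<^sub>R w)))" and i2: "integrable (nu \<alpha>) (\<lambda>w. F w * bker N (herm z (s *\<^sub>R P i w)))"
    proof -
      have "bounded (bker N ` cball 0 s)"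
        by (intro compact_imp_bounded compact_continuous_image continuous_intros) (use s in auto)
      then obtain D where D: "\<And>u. cmod u \<le> s \<Longrightarrow> cmod (bker N u) \<le> D" unfolding bounded_iff by force
      have le: "norm (F w * bker N (herm z (s *\<^sub>R x))) \<le> B * D" if "w \<in> space (nu \<alpha>)" "x \<in> cball 0 1" for w x
        using that B unfolding norm_mult by (intro mult_mono D hs z B(2)) auto
      show "integrable (nu \<alpha>) (\<lambda>w. F w * bker N (herm z (s *\<^sub>R w)))"
        by (rule integrable_const_bound[of _ "B * D"], rule AE_I2, rule le) auto
      show "integrable (nu \<alpha>) (\<lambda>w. F w * bker N (herm z (s *\<^sub>R P i w)))"
        by (rule integrable_const_bound[of _ "B * D"], rule AE_I2, rule le[OF _ Pb]) auto
    qed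
    have "f (r *\<^sub>R z) - S i z = (LINT w|nu \<alpha>. F w * bker N (herm z (s *\<^sub>R w)) - F w * bker N (herm z (s *\<^sub>R P i w)))"
      unfolding Fz[OF z] Sint using i1 i2 by simp
    also have "cmod \<dots> \<le> (LINT w|nu \<alpha>. cmod (F w * bker N (herm z (s *\<^sub>R w)) - F w * bker N (herm z (s *\<^sub>R P i w))))"
      by (rule integral_norm_bound)
    also have "\<dots> \<le> e i" unfolding e_def
    proof (rule integral_mono)
      show "integrable (nu \<alpha>) (\<lambda>w. cmod (F w * bker N (herm z (s *\<^sub>R w)) - F w * bker N (herm z (s *\<^sub>R P i w))))"
        using i1 i2 by (intro integrable_norm Bochner_Integration.integrable_diff)
      fix w :: "complex ^ 'n" assume w: "w \<in> space (nu \<alpha>)"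
      have w1: "w \<in> cball 0 1" using w by simp
      have "cmod (bker N (herm z (s *\<^sub>R P i w)) - bker N (herm z (s *\<^sub>R w))) \<le> L * cmod (herm z (s *\<^sub>R P i w) - herm z (s *\<^sub>R w))"
        by (rule L(2)[OF hs[OF z w1] hs[OF z Pb]])
      also have "herm z (s *\<^sub>R P i w) - herm z (s *\<^sub>R w) = herm z (s *\<^sub>R (P i w - w))" by (simp add: herm_diff_right scaleR_diff_right)
      also have "cmod (herm z (s *\<^sub>R (P i w - w))) \<le> norm (P i w - w)"
      proof -
        have "cmod (herm z (s *\<^sub>R (P i w - w))) \<le> norm z * (s * norm (P i w - w))" using norm_herm_le[of z "s *\<^sub>R (P i w - w)"] s by simp
        also have "\<dots> \<le> 1 * (1 * norm (P i w - w))" using z s by (intro mult_mono) auto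
        finally show ?thesis by simp
      qed
      finally have b: "cmod (bker N (herm z (s *\<^sub>R P i w)) - bker N (herm z (s *\<^sub>R w))) \<le> L * norm (P i w - w)" using L(1) by (simp add: mult_left_mono)
      have "cmod (F w * bker N (herm z (s *\<^sub>R w)) - F w * bker N (herm z (s *\<^sub>R P i w))) = cmod (F w) * cmod (bker N (herm z (s *\<^sub>R P i w)) - bker N (herm z (s *\<^sub>R w)))"
        by (simp add: norm_minus_commute flip: norm_mult right_diff_distrib)
      also have "\<dots> \<le> B * (L * norm (P i w - w))" using B w L(1) by (intro mult_mono b) auto
      finally show "cmod (F w * bker N (herm z (s *\<^sub>R w)) - F w * bker N (herm z (s *\<^sub>R P i w))) \<le> B * (L * norm (P i w - w))" .
    qed (rule ie)
    finally show ?thesis .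
  qed
  have "cmod (\<Lambda> (\<lambda>z. f (r *\<^sub>R z))) \<le> K * e i" for i
  proof -
    have "\<Lambda> (\<lambda>z. f (r *\<^sub>R z)) = \<Lambda> (\<lambda>z. f (r *\<^sub>R z) - S i z)" using sup_functional_diff[OF \<Lambda> fH SH] S0 by simp
    then show ?thesis using K(2)[OF Hinf_diff[OF fH SH[of i]] dz] by simp
  qed
  moreover have "(\<lambda>i. K * e i) \<longlonglongrightarrow> K * 0" by (intro tendsto_intros e)
  ultimately have "cmod (\<Lambda> (\<lambda>z. f (r *\<^sub>R z))) \<le> K * 0" by (intro LIMSEQ_le_const) auto
  then show ?thesis by simp
qed

section \<open>The spaces \<open>\<Gamma>\<close>\<close>

lemma radial_line_derivative:
  fixes h :: "complex ^ 'n \<Rightarrow> complex"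
  assumes h: "holomorphic_ball h" and t: "t > 0" "t *\<^sub>R z \<in> ball 0 1"
  shows "((\<lambda>t. h (t *\<^sub>R z)) has_vector_derivative (inverse t *\<^sub>R radial_deriv h (t *\<^sub>R z))) (at t within A)"
proof -
  obtain D where D: "(h has_derivative D) (at (t *\<^sub>R z))" "\<And>c v. D (c *s v) = c * D v" using holomorphic_ballE[OF h t(2)] by blast
  have "((\<lambda>t. t *\<^sub>R z) has_derivative (\<lambda>x. x *\<^sub>R z)) (at t within A)" by (auto intro!: derivative_eq_intros)
  from has_derivative_compose[OF this D(1)]
  have "((\<lambda>t. h (t *\<^sub>R z)) has_derivative (\<lambda>x. D (x *\<^sub>R z))) (at t within A)" .
  moreover have "D (x *\<^sub>R z) = x *\<^sub>R (inverse t *\<^sub>R radial_deriv h (t *\<^sub>R z))" for x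
    using t radial_deriv_eq[OF D] by (simp add: scaleR_cscale D(2) scaleR_conv_of_real)
  ultimately show ?thesis unfolding has_vector_derivative_def by simp
qed

lemma holomorphic_half_bound:
  fixes h :: "complex ^ 'n \<Rightarrow> complex"
  assumes h: "holomorphic_ball h"
  obtains M where "M \<ge> 0" "\<And>z. norm z \<le> 1/2 \<Longrightarrow> cmod (h z) \<le> M"
proof -
  have "bounded (h ` cball 0 (1/2))"
    by (intro compact_imp_bounded compact_continuous_image continuous_on_subset[OF holomorphic_ball_continuous[OF h]]) auto
  then obtain M where M: "\<And>z. z \<in> cball 0 (1/2) \<Longrightarrow> cmod (h z) \<le> M" unfolding bounded_iff by blast
  have "0 \<le> M" using order.trans[OF norm_ge_zero M[of 0]] by simp
  then show ?thesis using that[of M] M by simp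
qed

text \<open>Rh is integrated along the ray from z/2 to z, starting at 1/2 because d/dt h(tz) =
  Rh(tz)/t. The value at z/2 is bounded by a constant, which V(0) \<le> c V(z) absorbs.\<close>

lemma radial_majorant:
  fixes h :: "complex ^ 'n \<Rightarrow> complex"
  assumes h: "holomorphic_ball h" and A: "A \<ge> 0" "\<And>z. z \<in> ball 0 1 \<Longrightarrow> cmod (radial_deriv h z) \<le> A * V z"
    and V: "V 0 > 0" "\<And>z. z \<in> ball 0 1 \<Longrightarrow> V z \<ge> 0" and c: "c \<ge> 0" "\<And>t z. 0 \<le> t \<Longrightarrow> t \<le> 1 \<Longrightarrow> z \<in> ball 0 1 \<Longrightarrow> V (t *\<^sub>R z) \<le> c * V z"
  shows "\<exists>B\<ge>0. \<forall>z\<in>ball 0 1. cmod (h z) \<le> B * V z"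
proof -
  obtain M where M: "M \<ge> 0" "\<And>z. norm z \<le> 1/2 \<Longrightarrow> cmod (h z) \<le> M" using holomorphic_half_bound[OF h] by blast
  show ?thesis
  proof (intro exI[of _ "M * c / V 0 + A * c"] conjI ballI)
    show "0 \<le> M * c / V 0 + A * c" using M A c V by simp
    fix z :: "complex ^ 'n" assume z: "z \<in> ball 0 1"
    have tz: "t *\<^sub>R z \<in> ball 0 1" if "t \<in> {1/2..1}" for t using that z by (intro scaleR_in_ball) auto
    have "cmod (h (1 *\<^sub>R z) - h ((1/2) *\<^sub>R z)) \<le> (2 * (A * (c * V z))) * norm (1 - 1/2 :: real)"
    proof (rule differentiable_bound[of "{1/2..1}" "\<lambda>t. h (t *\<^sub>R z)" "\<lambda>t x. x *\<^sub>R (inverse t *\<^sub>R radial_deriv h (t *\<^sub>R z))"])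
      fix t :: real assume t: "t \<in> {1/2..1}"
      show "((\<lambda>t. h (t *\<^sub>R z)) has_derivative (\<lambda>x. x *\<^sub>R (inverse t *\<^sub>R radial_deriv h (t *\<^sub>R z)))) (at t within {1/2..1})"
        using radial_line_derivative[OF h _ tz[OF t]] t unfolding has_vector_derivative_def by simp
      have "cmod (radial_deriv h (t *\<^sub>R z)) \<le> A * V (t *\<^sub>R z)" by (rule A(2)[OF tz[OF t]])
      also have "\<dots> \<le> A * (c * V z)" using t z by (intro mult_left_mono c(2) A(1)) auto
      finally have "cmod (radial_deriv h (t *\<^sub>R z)) \<le> A * (c * V z)" .
      moreover have "inverse t \<le> 2" using t by (simp add: field_simps)
      ultimately have "cmod (inverse t *\<^sub>R radial_deriv h (t *\<^sub>R z)) \<le> 2 * (A * (c * V z))" 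
        using t unfolding norm_scaleR by (intro mult_mono) auto
      then have "cmod (x *\<^sub>R (inverse t *\<^sub>R radial_deriv h (t *\<^sub>R z))) \<le> 2 * (A * (c * V z)) * norm x" for x
        by (subst norm_scaleR) (metis abs_ge_zero mult.commute mult_left_mono real_norm_def)
      then show "onorm (\<lambda>x. x *\<^sub>R (inverse t *\<^sub>R radial_deriv h (t *\<^sub>R z))) \<le> 2 * (A * (c * V z))"
        by (intro onorm_bound) (use A c V(2)[OF z] in auto)
    qed auto
    then have "cmod (h z - h ((1/2) *\<^sub>R z)) \<le> A * (c * V z)" by simp
    moreover have "cmod (h ((1/2) *\<^sub>R z)) \<le> M" using z by (intro M(2)) simp
    moreover have "M \<le> M * c / V 0 * V z"
    proof -
      have "V 0 \<le> c * V z" using c(2)[of 0 z] z by simp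
      then have "M * V 0 \<le> M * (c * V z)" using M by (intro mult_left_mono) auto
      then show ?thesis using V(1) by (simp add: field_simps)
    qed
    ultimately show "cmod (h z) \<le> (M * c / V 0 + A * c) * V z"
      using norm_triangle_ineq[of "h z - h ((1/2) *\<^sub>R z)" "h ((1/2) *\<^sub>R z)"] by (simp add: algebra_simps)
  qed
qed

text \<open>The same integration along the ray, but now the integral of the majorant is evaluated,
  which gains one power of \<open>bdef\<close>. On the ray the majorant is written in 1 - t|z| and
  has an explicit primitive.\<close>

lemma radial_power_growth:
  fixes h :: "complex ^ 'n \<Rightarrow> complex"
  assumes h: "holomorphic_ball h" and a: "a > 0" and A: "A \<ge> 0" "\<And>z. z \<in> ball 0 1 \<Longrightarrow> cmod (radial_deriv h z) \<le> A * bdef z powr (- (a + 1))"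
  shows "\<exists>B\<ge>0. \<forall>z\<in>ball 0 1. cmod (h z) \<le> B * bdef z powr (- a)"
proof -
  obtain M where M: "M \<ge> 0" "\<And>z. norm z \<le> 1/2 \<Longrightarrow> cmod (h z) \<le> M" using holomorphic_half_bound[OF h] by blast
  \<comment> \<open>The factor 1/t is at most 2, and 2 \<le> 4|z| supplies the inner derivative |z|;
    the division by a comes from the primitive.\<close>
  define B where "B = 4 * A / a"
  have B: "B \<ge> 0" using A a by (simp add: B_def)
  show ?thesis
  proof (intro exI[of _ "M + B * 2 powr a"] conjI ballI)
    show "0 \<le> M + B * 2 powr a" using M B by simp
    fix z :: "complex ^ 'n" assume z: "z \<in> ball 0 1"
    have d: "0 < bdef z" "bdef z \<le> 1" using bdef_pos[OF z] by auto
    have d1: "1 \<le> bdef z powr (- a)" using d a powr_mono2'[of "-a" "bdef z" 1] by simp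
    then have Md: "M \<le> M * bdef z powr (- a)" using M(1) mult_left_mono[of 1 "bdef z powr (- a)" M] by simp
    show "cmod (h z) \<le> (M + B * 2 powr a) * bdef z powr (- a)"
    proof (cases "norm z \<le> 1/2")
      case True
      then have "cmod (h z) \<le> M * bdef z powr (- a)" using M(2) Md by force
      then show ?thesis using B by (simp add: distrib_right add_increasing2)
    next
      case False
      define x where "x = norm z"
      have x: "1/2 < x" "x < 1" using False z by (auto simp: x_def)
      have tx: "0 < 1 - t * x" if "t \<le> 1" for t using that x mult_right_mono[of t 1 x] by linarith
      have tz: "t *\<^sub>R z \<in> ball 0 1" if "t \<in> {1/2..1}" for t using that z by (intro scaleR_in_ball) auto
      have "cmod (h (1 *\<^sub>R z) - h ((1/2) *\<^sub>R z)) \<le> B * (1 - 1 * x) powr (- a) - B * (1 - 1/2 * x) powr (- a)"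
      proof (rule differentiable_bound_general[of "1/2" 1 "\<lambda>t. h (t *\<^sub>R z)" "\<lambda>t. B * (1 - t * x) powr (- a)" 
          "\<lambda>t. inverse t *\<^sub>R radial_deriv h (t *\<^sub>R z)" "\<lambda>t. B * (a * x * (1 - t * x) powr (- a - 1))"])
        show "continuous_on {1/2..1} (\<lambda>t. h (t *\<^sub>R z))"
          by (intro continuous_on_compose2[OF holomorphic_ball_continuous[OF h]] continuous_intros) (use tz in auto)
        show "continuous_on {1/2..1} (\<lambda>t. B * (1 - t * x) powr (- a))"
          by (intro continuous_intros) (use tx in force)
        fix t :: real assume t: "1/2 < t" "t < 1"
        show "((\<lambda>t. h (t *\<^sub>R z)) has_vector_derivative inverse t *\<^sub>R radial_deriv h (t *\<^sub>R z)) (at t)"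
          using t tz[of t] by (intro radial_line_derivative[OF h]) auto
        have "((\<lambda>t. B * (1 - t * x) powr (- a)) has_real_derivative B * (a * x * (1 - t * x) powr (- a - 1))) (at t)"
          using tx[of t] t by (auto intro!: derivative_eq_intros)
        then show "((\<lambda>t. B * (1 - t * x) powr (- a)) has_vector_derivative B * (a * x * (1 - t * x) powr (- a - 1))) (at t)"
          by (simp add: has_real_derivative_iff_has_vector_derivative)
        have t1: "t *\<^sub>R z \<in> ball 0 1" using tz[of t] t by simp
        have "cmod (radial_deriv h (t *\<^sub>R z)) \<le> A * bdef (t *\<^sub>R z) powr (- (a + 1))" by (rule A(2)[OF t1])
        also have "\<dots> \<le> A * (1 - t * x) powr (- (a + 1))"
        proof (intro mult_left_mono powr_mono2' A(1))
          have "(t * x)\<^sup>2 \<le> t * x" using tx[of t] t x by (simp add: power2_eq_square mult_left_le)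
          then show "1 - t * x \<le> bdef (t *\<^sub>R z)" using t by (simp add: x_def)
        qed (use tx[of t] t a in auto)
        finally have r: "cmod (radial_deriv h (t *\<^sub>R z)) \<le> A * (1 - t * x) powr (- (a + 1))" .
        have "cmod (inverse t *\<^sub>R radial_deriv h (t *\<^sub>R z)) \<le> 2 * (A * (1 - t * x) powr (- (a + 1)))"
          unfolding norm_scaleR using t r by (intro mult_mono) (auto simp: field_simps)
        also have "\<dots> \<le> (4 * x) * (A * (1 - t * x) powr (- (a + 1)))" using x A(1) by (intro mult_right_mono) auto
        also have "\<dots> = B * (a * x * (1 - t * x) powr (- a - 1))" using a by (simp add: B_def)
        finally show "norm (inverse t *\<^sub>R radial_deriv h (t *\<^sub>R z)) \<le> B * (a * x * (1 - t * x) powr (- a - 1))" .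
      qed simp
      then have 1: "cmod (h z - h ((1/2) *\<^sub>R z)) \<le> B * (1 - x) powr (- a)"
        using mult_nonneg_nonneg[OF B powr_ge_zero[of "1 - 1/2 * x" "- a"]] unfolding mult_1 scaleR_one by linarith
      have "(1 - x) powr (- a) \<le> (bdef z / 2) powr (- a)"
      proof (rule powr_mono2')
        show "bdef z / 2 \<le> 1 - x" using zero_le_power2[of "1 - x"] unfolding x_def[symmetric] by (simp add: power2_diff)
      qed (use a d in auto)
      also have "\<dots> = 2 powr a * bdef z powr (- a)" using d by (simp add: powr_divide powr_minus field_simps)
      finally have "B * (1 - x) powr (- a) \<le> B * (2 powr a * bdef z powr (- a))" using B by (intro mult_left_mono)
      moreover have "cmod (h ((1/2) *\<^sub>R z)) \<le> M" using z by (intro M(2)) simp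
      ultimately show ?thesis
        using 1 Md norm_triangle_ineq[of "h z - h ((1/2) *\<^sub>R z)" "h ((1/2) *\<^sub>R z)"] by (simp add: algebra_simps)
    qed
  qed
qed

text \<open>A positive \<epsilon> keeps all intermediate exponents positive, so no integration meets
  the logarithmic case.\<close>

lemma radial_tower_growth:
  fixes g :: "complex ^ 'n \<Rightarrow> complex"
  assumes g: "holomorphic_ball g" and \<epsilon>: "\<epsilon> > 0"
  shows "A \<ge> 0 \<Longrightarrow> (\<And>z. z \<in> ball 0 1 \<Longrightarrow> cmod ((radial_deriv ^^ k) g z) \<le> A * bdef z powr (- (real k + \<epsilon>))) \<Longrightarrow>
    \<exists>B\<ge>0. \<forall>z\<in>ball 0 1. cmod (g z) \<le> B * bdef z powr (- \<epsilon>)"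
proof (induction k arbitrary: A)
  case 0 then show ?case by auto
next
  case (Suc k)
  have "\<exists>B\<ge>0. \<forall>z\<in>ball 0 1. cmod ((radial_deriv ^^ k) g z) \<le> B * bdef z powr (- (real k + \<epsilon>))"
    by (rule radial_power_growth[OF holomorphic_radial_pow[OF g] _ Suc.prems(1)]) (use Suc.prems(2) \<epsilon> in \<open>auto simp: algebra_simps\<close>)
  then show ?case using Suc.IH by blast
qed

text \<open>Here no power is gained: derivatives of lower order satisfy the same bound as the top
  one, which is what a polynomial in R needs.\<close>

lemma radial_tower_majorant:
  fixes g :: "complex ^ 'n \<Rightarrow> complex"
  assumes g: "holomorphic_ball g" and A: "A \<ge> 0" "\<And>z. z \<in> ball 0 1 \<Longrightarrow> cmod ((radial_deriv ^^ k) g z) \<le> A * V z"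
    and V: "V 0 > 0" "\<And>z. z \<in> ball 0 1 \<Longrightarrow> V z \<ge> 0" and c: "c \<ge> 0" "\<And>t z. 0 \<le> t \<Longrightarrow> t \<le> 1 \<Longrightarrow> z \<in> ball 0 1 \<Longrightarrow> V (t *\<^sub>R z) \<le> c * V z"
  shows "i \<le> k \<Longrightarrow> \<exists>B\<ge>0. \<forall>z\<in>ball 0 1. cmod ((radial_deriv ^^ i) g z) \<le> B * V z"
proof (induction i rule: inc_induct)
  case base then show ?case using A by blast
next
  case (step i)
  then obtain B where B: "B \<ge> 0" "\<And>z. z \<in> ball 0 1 \<Longrightarrow> cmod (radial_deriv ((radial_deriv ^^ i) g) z) \<le> B * V z" by auto
  show ?case by (rule radial_majorant[OF holomorphic_radial_pow[OF g] B V c])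
qed

text \<open>If f is not integrable, its integral is 0 by convention and the inequality still holds;
  this spares integrability proofs later.\<close>

lemma norm_integral_le_nn: "ennreal (norm (integral\<^sup>L M f)) \<le> (\<integral>\<^sup>+x. ennreal (norm (f x)) \<partial>M)"
proof (cases "integrable M f")
  case True then show ?thesis by (rule integral_norm_bound_ennreal)
next
  case False then show ?thesis by (simp add: not_integrable_integral_eq)
qed

lemma borel_measurable_cnj: "cnj \<in> borel_measurable borel"
  by (intro borel_measurable_continuous_onI continuous_intros)

lemma integrable_mult_cnj_Hinf:
  assumes F: "integrable (nu \<alpha>) F" and f: "Hinf f"
  shows "integrable (nu \<alpha>) (\<lambda>\<xi>. F \<xi> * cnj (f \<xi>))"
proof -
  have "(\<lambda>\<xi>. F \<xi> * cnj (f \<xi>)) \<in> borel_measurable (nu \<alpha>)"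
    by (intro borel_measurable_times borel_measurable_integrable[OF F]
      measurable_compose[OF holomorphic_ball_measurable[OF HinfD[OF f]] borel_measurable_cnj])
  from Bochner_Integration.integrable_bound[OF integrable_mult_Hinf[OF F f] this] show ?thesis by (simp add: norm_mult)
qed

lemma radial_pow_cong:
  assumes "holomorphic_ball f" "\<And>z. z \<in> ball 0 1 \<Longrightarrow> f z = g z" "z \<in> ball 0 1"
  shows "(radial_deriv ^^ k) f z = (radial_deriv ^^ k) g z"
  using assms(3)
proof (induction k arbitrary: z)
  case 0 then show ?case using assms(2) by simp
next
  case (Suc k)
  then show ?case using radial_deriv_cong[OF holomorphic_radial_pow[OF assms(1), of k] Suc.IH] by simp
qed

text \<open>Since |1 - <z,w>| \<le> 2, each lower order is dominated by the top order up to a power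
  of 2.\<close>

lemma kernel_sum_bound:
  fixes c :: "nat \<Rightarrow> real"
  shows "\<exists>A>0. \<forall>z\<in>ball (0 :: complex ^ 'n) 1. \<forall>w\<in>ball 0 1. 
    cmod (\<Sum>j\<le>k. of_real (c j) * bker (s + real j) (herm z w)) \<le> A * cmod (1 - herm z w) powr (- (s + real k))"
proof -
  define A where "A = (\<Sum>j\<le>k. \<bar>c j\<bar>) * 2 ^ k + 1"
  have A: "A > 0" unfolding A_def by (intro add_nonneg_pos mult_nonneg_nonneg sum_nonneg) auto
  show ?thesis
  proof (intro exI[of _ A] conjI A ballI)
    fix z w :: "complex ^ 'n" assume z: "z \<in> ball 0 1" and w: "w \<in> ball 0 1"
    let ?x = "cmod (1 - herm z w)"
    have x: "0 < ?x" "?x \<le> 2" using kernel_lower[OF z w] by auto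
    have term_le: "cmod (of_real (c j) * bker (s + real j) (herm z w)) \<le> \<bar>c j\<bar> * (2 ^ k * ?x powr (- (s + real k)))" if j: "j \<le> k" for j
    proof -
      have "?x powr (real k - real j) \<le> 2 powr (real k - real j)" using x j by (intro powr_mono2) auto
      also have "\<dots> \<le> 2 powr real k" by (intro powr_mono) auto
      finally have "?x powr (real k - real j) \<le> 2 ^ k" by (simp add: powr_realpow)
      moreover have "?x powr (- (s + real j)) = ?x powr (real k - real j) * ?x powr (- (s + real k))" by (simp flip: powr_add add: algebra_simps)
      ultimately have "?x powr (- (s + real j)) \<le> 2 ^ k * ?x powr (- (s + real k))" by (simp add: mult_right_mono)
      then show ?thesis unfolding norm_mult norm_bker by (simp add: mult_left_mono)
    qed
    have "cmod (\<Sum>j\<le>k. of_real (c j) * bker (s + real j) (herm z w)) \<le> (\<Sum>j\<le>k. \<bar>c j\<bar> * (2 ^ k * ?x powr (- (s + real k))))"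
      by (rule sum_norm_le) (use term_le in auto)
    also have "\<dots> = (A - 1) * ?x powr (- (s + real k))" by (simp add: A_def sum_distrib_right mult.assoc)
    also have "\<dots> \<le> A * ?x powr (- (s + real k))" by (intro mult_right_mono) auto
    finally show "cmod (\<Sum>j\<le>k. of_real (c j) * bker (s + real j) (herm z w)) \<le> A * ?x powr (- (s + real k))" .
  qed
qed

lemma Hinf_kernel_sum:
  "w \<in> ball 0 1 \<Longrightarrow> Hinf (\<lambda>z. \<Sum>j\<le>k. of_real (c j) * bker (s + real j) (herm z w))"
  by (intro Hinf_sum Hinf_cmult Hinf_bker)

lemma moderate_growth_pointwise:
  assumes \<Phi>: "moderate \<Phi>" "growth_function \<Phi>" and \<alpha>: "\<alpha> > -1"
  shows "\<exists>K\<ge>1. \<forall>f :: complex ^ 'n \<Rightarrow> complex. \<forall>\<mu>>0. holomorphic_ball f \<longrightarrow> (\<integral>\<^sup>+z. ennreal (\<Phi> (cmod (f z) / \<mu>)) \<partial>nu \<alpha>) \<le> 1 \<longrightarrow>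
    (\<forall>w\<in>ball 0 1. cmod (f w) / (K * \<mu>) \<le> growth_inv \<Phi> (bdef w powr (- (real CARD('n) + 1 + \<alpha>))))"
proof -
  define N where "N = real CARD('n) + 1 + \<alpha>"
  obtain K where K: "K \<ge> 1" "\<And>f w. holomorphic_ball f \<Longrightarrow> w \<in> ball (0::complex ^ 'n) 1 \<Longrightarrow>
    ennreal (\<Phi> (cmod (f w))) \<le> ennreal (K * bdef w powr (- N)) * (\<integral>\<^sup>+\<xi>. ennreal (\<Phi> (cmod (f \<xi>))) \<partial>nu \<alpha>)"
    using moderate_pointwise[OF \<Phi>(1) \<alpha>, where 'n='n] unfolding N_def by blast
  show ?thesis unfolding N_def[symmetric]
  proof (intro exI[of _ "4 * K\<^sup>2"] conjI allI impI ballI)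
    show "1 \<le> 4 * K\<^sup>2" using one_le_power[OF K(1), of 2] by linarith
    fix f :: "complex ^ 'n \<Rightarrow> complex" and \<mu> :: real and w :: "complex ^ 'n"
    assume \<mu>: "\<mu> > 0" and f: "holomorphic_ball f" and I: "(\<integral>\<^sup>+z. ennreal (\<Phi> (cmod (f z) / \<mu>)) \<partial>nu \<alpha>) \<le> 1" and w: "w \<in> ball 0 1"
    have c: "cmod (of_real (1 / \<mu>) * f z) = cmod (f z) / \<mu>" for z using \<mu> by (simp add: norm_mult norm_divide)
    have "ennreal (\<Phi> (cmod (f w) / \<mu>)) \<le> ennreal (K * bdef w powr (- N)) * (\<integral>\<^sup>+\<xi>. ennreal (\<Phi> (cmod (f \<xi>) / \<mu>)) \<partial>nu \<alpha>)"
      using K(2)[OF holomorphic_ball_cmult[OF f, of "of_real (1 / \<mu>)"] w] unfolding c .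
    also have "\<dots> \<le> ennreal (K * bdef w powr (- N)) * 1" by (intro mult_left_mono I) simp
    finally have "\<Phi> (cmod (f w) / \<mu>) \<le> K * bdef w powr (- N)" using K(1) by (simp add: ennreal_le_iff)
    from moderate_inv_bound[OF \<Phi> _ K(1) _ this] bdef_pos[OF w] \<mu>
    show "cmod (f w) / (4 * K\<^sup>2 * \<mu>) \<le> growth_inv \<Phi> (bdef w powr (- N))" by (simp add: mult.commute)
  qed
qed

context growth_triple
begin

text \<open>Along a ray towards 0 the quantity \<open>bdef\<close> grows by a factor x; the upper
  type lets \<rho> grow by at most a constant times x^(\<gamma>N), and the factor x^(-k) compensates
  because k \<ge> \<gamma>N. This is the use of the condition on k in the definition of
  \<Gamma>.\<close>

lemma gamma_weight_dilate:
  assumes N: "N > 0" and \<gamma>: "\<gamma> \<ge> 0" "upper_type_unit \<gamma> (rho \<Phi>)" and k: "k \<ge> \<gamma> * N"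
  defines "W \<equiv> (\<lambda>z :: complex ^ 'n. bdef z powr (- k) * rho \<Phi> (bdef z powr N))"
  shows "\<exists>c\<ge>0. \<forall>t z. 0 \<le> t \<longrightarrow> t \<le> 1 \<longrightarrow> z \<in> ball 0 1 \<longrightarrow> W (t *\<^sub>R z) \<le> c * W z"
proof -
  obtain C where C: "C > 0" "\<And>s t. s > 1 \<Longrightarrow> t > 0 \<Longrightarrow> s * t \<le> 1 \<Longrightarrow> rho \<Phi> (s * t) \<le> C * s powr \<gamma> * rho \<Phi> t"
    using \<gamma>(2) unfolding upper_type_unit_def by blast
  show ?thesis
  proof (intro exI[of _ "max 1 C"] conjI allI impI)
    show "0 \<le> max 1 C" by simp
    fix t :: real and z :: "complex ^ 'n" assume t: "0 \<le> t" "t \<le> 1" and z: "z \<in> ball 0 1"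
    let ?a = "bdef z" and ?b = "bdef (t *\<^sub>R z)"
    have ab: "0 < ?a" "?a \<le> ?b" "?b \<le> 1" using bdef_pos[OF z] bdef_dilate[OF t] by auto
    have W0: "W z \<ge> 0" using rho_pos[of "?a powr N"] ab by (simp add: W_def)
    show "W (t *\<^sub>R z) \<le> max 1 C * W z"
    proof (cases "?a = ?b")
      case True
      then have "W (t *\<^sub>R z) = 1 * W z" unfolding W_def by (simp only: mult_1)
      also have "\<dots> \<le> max 1 C * W z" by (intro mult_right_mono W0) simp
      finally show ?thesis .
    next
      case False
      then have ab': "?a < ?b" using ab(2) by linarith
      define x where "x = ?b / ?a"
      have x: "x > 1" using ab' ab by (simp add: x_def)
      have bx: "?b = x * ?a" using ab by (simp add: x_def)
      have xN: "x powr N > 1" using x N by simp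
      have e: "x powr N * ?a powr N = ?b powr N" using ab x unfolding bx by (simp add: powr_mult)
      have bN: "?b powr N \<le> 1" by (rule powr_le1) (use ab N in linarith)+
      have "rho \<Phi> (?b powr N) \<le> C * (x powr N) powr \<gamma> * rho \<Phi> (?a powr N)"
        using C(2)[OF xN, of "?a powr N"] ab bN unfolding e by simp
      also have "(x powr N) powr \<gamma> \<le> x powr k" using x k by (simp add: powr_powr mult.commute)
      finally have r: "rho \<Phi> (?b powr N) \<le> C * x powr k * rho \<Phi> (?a powr N)"
        using C(1) rho_pos[of "?a powr N"] ab by (simp add: mult_left_mono mult_right_mono)
      have "W (t *\<^sub>R z) \<le> ?b powr (- k) * (C * x powr k * rho \<Phi> (?a powr N))"
        unfolding W_def by (intro mult_left_mono r) simp
      also have "?b powr (- k) = x powr (- k) * ?a powr (- k)" using x ab unfolding bx by (simp add: powr_mult)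
      also have "x powr (- k) * ?a powr (- k) * (C * x powr k * rho \<Phi> (?a powr N)) = C * W z"
        using x by (simp add: W_def powr_minus field_simps)
      also have "\<dots> \<le> max 1 C * W z" by (intro mult_right_mono W0) simp
      finally show ?thesis .
    qed
  qed
qed

text \<open>Turns a membership given by some \<gamma> and k into the facts used afterwards. The
  growth exponent (1 + \<alpha>)/4 is a convenient one whose double stays below 1 + \<alpha>, as
  \<open>radial_integration_by_parts\<close> demands.\<close>

lemma gamma_regularity:
  fixes g :: "complex ^ 'n \<Rightarrow> complex"
  assumes \<alpha>: "\<alpha> > -1" and g: "g \<in> Gamma_space \<alpha> (rho \<Phi>)"
  defines "N \<equiv> real CARD('n) + 1 + \<alpha>"
  obtains k :: nat and B C where "holomorphic_ball g" "integrable (nu \<alpha>) g" "C > 0"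
    "\<And>z. z \<in> ball 0 1 \<Longrightarrow> cmod (g z) \<le> B * bdef z powr (- ((1 + \<alpha>) / 4))"
    "\<And>z. z \<in> ball 0 1 \<Longrightarrow> cmod (kint \<alpha> g (N + real k) z) \<le> C * (bdef z powr (- real k) * rho \<Phi> (bdef z powr N))"
proof -
  have N: "N > 0" using \<alpha> by (simp add: N_def)
  obtain \<gamma> k C where h: "holomorphic_ball g" and \<gamma>: "\<gamma> \<ge> 0" "upper_type_unit \<gamma> (rho \<Phi>)" and k: "real k > \<gamma> * N" and C: "C > 0"
    and bd: "\<And>z. z \<in> ball 0 1 \<Longrightarrow> cmod ((radial_deriv ^^ k) g z) \<le> C * bdef z powr (- real k) * rho \<Phi> (bdef z powr N)"
    using g unfolding Gamma_space_def N_def by blast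
  define \<epsilon> where "\<epsilon> = (1 + \<alpha>) / 4"
  have \<epsilon>: "\<epsilon> > 0" "\<alpha> + (- \<epsilon>) > -1" using \<alpha> by (auto simp: \<epsilon>_def field_simps)
  define W where "W z = bdef z powr (- real k) * rho \<Phi> (bdef z powr N)" for z :: "complex ^ 'n"
  have bW: "cmod ((radial_deriv ^^ k) g z) \<le> C * W z" if "z \<in> ball 0 1" for z using bd[OF that] by (simp add: W_def mult.assoc)
  have rhopos: "rho \<Phi> (bdef z powr N) > 0" if "z \<in> ball 0 1" for z :: "complex ^ 'n" using bdef_pos[OF that] by (intro rho_pos) simp
  have W0: "W 0 > 0" "\<And>z. z \<in> ball 0 1 \<Longrightarrow> W z \<ge> 0" 
    using rhopos[of 0] by (simp add: W_def) (simp add: W_def less_imp_le[OF rhopos])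
  obtain c where c: "c \<ge> 0" "\<And>t z. 0 \<le> t \<Longrightarrow> t \<le> 1 \<Longrightarrow> z \<in> ball 0 1 \<Longrightarrow> W (t *\<^sub>R z) \<le> c * W z"
    using gamma_weight_dilate[OF N \<gamma>, of "real k", where 'n='n] k unfolding W_def by force
  have "cmod ((radial_deriv ^^ k) g z) \<le> (C * rho \<Phi> 1) * bdef z powr (- (real k + \<epsilon>))" if z: "z \<in> ball 0 1" for z
  proof -
    have d: "0 < bdef z" "bdef z \<le> 1" using bdef_pos[OF z] by auto
    have "cmod ((radial_deriv ^^ k) g z) \<le> C * (bdef z powr (- real k) * rho \<Phi> (bdef z powr N))" using bW[OF z] by (simp add: W_def)
    also have "\<dots> \<le> C * (bdef z powr (- (real k + \<epsilon>)) * rho \<Phi> 1)"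
    proof (intro mult_left_mono mult_mono)
      show "bdef z powr (- real k) \<le> bdef z powr (- (real k + \<epsilon>))" using d \<epsilon> by (intro powr_mono') auto
      have "bdef z powr N \<le> 1" using d N by (intro powr_le1) auto
      then show "rho \<Phi> (bdef z powr N) \<le> rho \<Phi> 1" using d by (intro rho_mono) auto
    qed (use C rhopos[OF z] in auto)
    finally show ?thesis by (simp add: mult_ac)
  qed
  moreover have "0 \<le> C * rho \<Phi> 1" using C rho_pos[of 1] by simp
  ultimately obtain B where B: "B \<ge> 0" "\<And>z. z \<in> ball 0 1 \<Longrightarrow> cmod (g z) \<le> B * bdef z powr (- \<epsilon>)"
    using radial_tower_growth[OF h \<epsilon>(1), of "C * rho \<Phi> 1" k] by blast
  have int: "integrable (nu \<alpha>) g"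
  proof (rule integrableI_bounded)
    show "g \<in> borel_measurable (nu \<alpha>)" by (rule holomorphic_ball_measurable[OF h])
    have "(\<integral>\<^sup>+z. ennreal (cmod (g z)) \<partial>nu \<alpha>) \<le> (\<integral>\<^sup>+z. ennreal B * ennreal (bdef z powr (- \<epsilon>)) \<partial>(nu \<alpha> :: (complex ^ 'n) measure))"
      using B by (intro nn_integral_mono) (auto simp flip: ennreal_mult intro!: ennreal_leI)
    also have "\<dots> = ennreal B * (\<integral>\<^sup>+z. ennreal (bdef z powr (- \<epsilon>)) \<partial>(nu \<alpha> :: (complex ^ 'n) measure))"
      by (rule nn_integral_cmult) measurable
    also have "\<dots> < \<infinity>" using nn_bdef_finite[OF \<alpha> \<epsilon>(2), where 'n='n] by (simp add: ennreal_mult_less_top)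
    finally show "(\<integral>\<^sup>+z. ennreal (norm (g z)) \<partial>nu \<alpha>) < \<infinity>" .
  qed
  obtain q :: "nat \<Rightarrow> real" where "\<forall>b :: complex ^ 'n \<Rightarrow> complex. holomorphic_ball b \<longrightarrow> integrable (nu \<alpha>) b \<longrightarrow>
    (\<forall>z\<in>ball 0 1. kint \<alpha> b (N + real k) z = (\<Sum>i\<le>k. of_real (q i) * (radial_deriv ^^ i) b z))"
    using kint_radial_polynomial[OF \<alpha>, of k, where 'n='n] unfolding N_def ..
  with h int have q: "kint \<alpha> g (N + real k) z = (\<Sum>i\<le>k. of_real (q i) * (radial_deriv ^^ i) g z)" if "z \<in> ball 0 1" for z
    using that by simp
  \<comment> \<open>The kernel integral is a polynomial in R applied to g; every derivative of order
    at most k inherits the majorant W of the top one.\<close>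
  have "\<forall>i\<in>{..k}. \<exists>A\<ge>0. \<forall>z\<in>ball 0 1. cmod ((radial_deriv ^^ i) g z) \<le> A * W z"
  proof
    fix i assume "i \<in> {..k}"
    then have i: "i \<le> k" by simp
    show "\<exists>A\<ge>0. \<forall>z\<in>ball 0 1. cmod ((radial_deriv ^^ i) g z) \<le> A * W z"
      by (rule radial_tower_majorant[where V=W and A=C and c=c and k=k, OF h less_imp_le[OF C] bW W0 c i])
  qed
  from bchoice[OF this] obtain A where A': "\<forall>i\<in>{..k}. A i \<ge> 0 \<and> (\<forall>z\<in>ball 0 1. cmod ((radial_deriv ^^ i) g z) \<le> A i * W z)" ..
  then have A: "\<And>i. i \<le> k \<Longrightarrow> A i \<ge> 0" "\<And>i z. i \<le> k \<Longrightarrow> z \<in> ball 0 1 \<Longrightarrow> cmod ((radial_deriv ^^ i) g z) \<le> A i * W z"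
    by simp_all
  define D where "D = (\<Sum>i\<le>k. \<bar>q i\<bar> * A i) + 1"
  have "0 \<le> (\<Sum>i\<le>k. \<bar>q i\<bar> * A i)" using A(1) by (intro sum_nonneg) auto
  then have D: "D > 0" by (simp add: D_def)
  have "cmod (kint \<alpha> g (N + real k) z) \<le> D * W z" if z: "z \<in> ball 0 1" for z
  proof -
    have "cmod (kint \<alpha> g (N + real k) z) \<le> (\<Sum>i\<le>k. \<bar>q i\<bar> * (A i * W z))" unfolding q[OF z]
      by (rule sum_norm_le) (use A(2)[OF _ z] in \<open>auto simp: norm_mult intro!: mult_left_mono\<close>)
    also have "\<dots> = (D - 1) * W z" by (simp add: D_def sum_distrib_right mult.assoc)
    also have "\<dots> \<le> D * W z" using W0(2)[OF z] by (intro mult_right_mono) auto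
    finally show ?thesis .
  qed
  then show ?thesis using that[OF h int D] B(2) unfolding \<epsilon>_def W_def by blast
qed

text \<open>Entry into \<Gamma> uses the type \<gamma> = 1. The bound 4N on k is dictated by the
  norm estimate for kernels and exceeds what \<Gamma> itself asks for.\<close>

lemma gammaI:
  fixes g :: "complex ^ 'n \<Rightarrow> complex"
  assumes \<alpha>: "\<alpha> > -1" and g: "holomorphic_ball g"
  defines "N \<equiv> real CARD('n) + 1 + \<alpha>"
  assumes k: "real k \<ge> 4 * N" and C: "C > 0"
    and bd: "\<And>z. z \<in> ball 0 1 \<Longrightarrow> cmod ((radial_deriv ^^ k) g z) \<le> C * bdef z powr (- real k) * rho \<Phi> (bdef z powr N)"
  shows "g \<in> Gamma_space \<alpha> (rho \<Phi>)"
proof -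
  have "N > 0" using \<alpha> by (simp add: N_def)
  then have "real k > 1 * N" using k by linarith
  then show ?thesis unfolding Gamma_space_def mem_Collect_eq N_def[symmetric]
    using g rho_upper_type C bd zero_le_one by blast
qed

text \<open>Measurability comes from monotonicity, the inverse of \<Phi> being an arbitrary
  selection; \<rho> is cut off at 0 to make it monotone on the whole line.\<close>

lemma rho_measurable: "(\<lambda>z :: complex ^ 'n. rho \<Phi> (bdef z powr a)) \<in> borel_measurable (nu \<alpha>)"
proof -
  define r where "r t = (if t > 0 then rho \<Phi> t else 0)" for t
  have "mono r"
  proof (rule monoI)
    fix x y :: real assume "x \<le> y"
    then show "r x \<le> r y" using rho_mono[of x y] rho_pos[of y] by (auto simp: r_def)
  qed
  then have [measurable]: "r \<in> borel_measurable borel" by (rule borel_measurable_mono)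
  have "(\<lambda>z :: complex ^ 'n. r (bdef z powr a)) \<in> borel_measurable (nu \<alpha>)" by measurable
  moreover have "r (bdef z powr a) = rho \<Phi> (bdef z powr a)" if "z \<in> space (nu \<alpha>)" for z :: "complex ^ 'n"
    using bdef_pos[of z] that by (simp add: r_def)
  ultimately show ?thesis by (subst measurable_cong[of _ _ "\<lambda>z. r (bdef z powr a)"]) simp_all
qed

end

section \<open>Hankel operators\<close>

lemma hankel_kint:
  fixes b :: "complex ^ 'n \<Rightarrow> complex"
  shows "hankel \<alpha> b f = kint \<alpha> (\<lambda>\<xi>. b \<xi> * cnj (f \<xi>)) (real CARD('n) + 1 + \<alpha>)"
  by (intro ext) (simp only: hankel_def bergman_proj_def kint_def bker_def powr_minus divide_inverse)

text \<open>The extra weight bdef^k of the measure cancels the singular factor in the bound on D,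
  which leaves the plain weight w in \<nu>_\<alpha>.\<close>

lemma nn_integral_kernel_shift:
  fixes D f :: "complex ^ 'n \<Rightarrow> complex"
  assumes \<alpha>: "\<alpha> > -1" and k: "k \<ge> 0" and D: "D \<in> borel_measurable (nu \<alpha>)" and f: "f \<in> borel_measurable (nu \<alpha>)"
    and C: "C > 0" and w: "\<And>z. z \<in> ball 0 1 \<Longrightarrow> cmod (D z) \<le> C * (bdef z powr (- k) * w z)"
  defines "M \<equiv> nu_mass TYPE('n) \<alpha> / nu_mass TYPE('n) (\<alpha> + k) * C"
  shows "(\<integral>\<^sup>+z. ennreal (cmod (D z * f z)) \<partial>nu (\<alpha> + k)) \<le> (\<integral>\<^sup>+z. ennreal (M * (w z * cmod (f z))) \<partial>nu \<alpha>)" and "M > 0"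
proof -
  have \<alpha>k: "\<alpha> + k > -1" using \<alpha> k by simp
  note p = nu_mass_pos[OF \<alpha>, where 'n='n] nu_mass_pos[OF \<alpha>k, where 'n='n]
  let ?c = "nu_mass TYPE('n) \<alpha> / nu_mass TYPE('n) (\<alpha> + k)"
  show "M > 0" using p C by (simp add: M_def)
  note [measurable] = D f
  have "(\<integral>\<^sup>+z. ennreal (cmod (D z * f z)) \<partial>nu (\<alpha> + k)) = ennreal ?c * (\<integral>\<^sup>+z. ennreal (bdef z powr k) * ennreal (cmod (D z * f z)) \<partial>nu \<alpha>)"
    by (rule nn_integral_nu_shift[OF \<alpha> \<alpha>k]) measurable
  also have "\<dots> = (\<integral>\<^sup>+z. ennreal ?c * (ennreal (bdef z powr k) * ennreal (cmod (D z * f z))) \<partial>nu \<alpha>)"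
    by (rule nn_integral_cmult[symmetric]) measurable
  also have "\<dots> \<le> (\<integral>\<^sup>+z. ennreal (M * (w z * cmod (f z))) \<partial>nu \<alpha>)"
  proof (rule nn_integral_mono)
    fix z :: "complex ^ 'n" assume "z \<in> space (nu \<alpha>)"
    then have z: "z \<in> ball 0 1" by simp
    have d: "0 < bdef z" by (rule bdef_pos[OF z])
    have "bdef z powr k * cmod (D z) \<le> bdef z powr k * (C * (bdef z powr (- k) * w z))" by (intro mult_left_mono w z) simp
    also have "\<dots> = C * w z" using d by (simp add: powr_minus)
    finally have "?c * (bdef z powr k * cmod (D z) * cmod (f z)) \<le> ?c * (C * w z * cmod (f z))"
      using p by (intro mult_left_mono mult_right_mono) auto
    moreover have "ennreal ?c * (ennreal (bdef z powr k) * ennreal (cmod (D z * f z))) = ennreal (?c * (bdef z powr k * cmod (D z) * cmod (f z)))"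
      using p by (simp add: norm_mult mult.assoc flip: ennreal_mult)
    ultimately show "ennreal ?c * (ennreal (bdef z powr k) * ennreal (cmod (D z * f z))) \<le> ennreal (M * (w z * cmod (f z)))"
      by (simp add: M_def ennreal_leI mult.assoc)
  qed
  finally show "(\<integral>\<^sup>+z. ennreal (cmod (D z * f z)) \<partial>nu (\<alpha> + k)) \<le> (\<integral>\<^sup>+z. ennreal (M * (w z * cmod (f z))) \<partial>nu \<alpha>)" .
qed

context growth_triple
begin

lemma gamma_imp_hankel_bounded:
  fixes b :: "complex ^ 'n \<Rightarrow> complex"
  assumes \<alpha>: "\<alpha> > -1" and dini: "dini_condition \<Phi>2" and b: "b \<in> Gamma_space \<alpha> (rho \<Phi>)"
  shows "hankel_bounded \<alpha> \<Phi>1 \<Phi>2 b"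
proof -
  define N where "N = real CARD('n) + 1 + \<alpha>"
  obtain k B C where bh: "holomorphic_ball b" "integrable (nu \<alpha>) b" and C: "C > 0"
    and bB: "\<And>z. z \<in> ball 0 1 \<Longrightarrow> cmod (b z) \<le> B * bdef z powr (- ((1 + \<alpha>) / 4))"
    and bD: "\<And>z. z \<in> ball 0 1 \<Longrightarrow> cmod (kint \<alpha> b (N + real k) z) \<le> C * (bdef z powr (- real k) * rho \<Phi> (bdef z powr N))"
    by (rule gamma_regularity[OF \<alpha> b, folded N_def]) (rule that)
  define D where "D = kint \<alpha> b (N + real k)"
  have Dm: "D \<in> borel_measurable (nu \<alpha>)" unfolding D_def by (intro holomorphic_ball_measurable holomorphic_ball_kint bh)
  define M where "M = nu_mass TYPE('n) \<alpha> / nu_mass TYPE('n) (\<alpha> + real k) * C"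
  have M: "M > 0" unfolding M_def by (rule nn_integral_kernel_shift(2)[OF \<alpha> _ Dm Dm C bD[folded D_def]]) simp
  obtain \<epsilon> C2 where \<epsilon>: "0 < \<epsilon>" "\<epsilon> \<le> 1" and C2: "C2 \<ge> 1" "\<And>x M. 0 < x \<Longrightarrow> x \<le> 1 \<Longrightarrow> 0 \<le> M \<Longrightarrow> \<Phi>2 (x * M) \<le> C2 * x powr (1 + \<epsilon>) * \<Phi>2 M"
    using dini_lower_type[OF \<Phi>2 dini] by blast
  have ratio: "\<Phi>2 x * y \<le> \<Phi>2 y * x" if "0 < x" "x \<le> y" for x y
    using growth_U_D(3)[OF \<Phi>2 that] that by (simp add: field_simps)
  obtain K where K: "K \<ge> 1" "\<And>u v :: complex ^ 'n \<Rightarrow> real. u \<in> borel_measurable (nu \<alpha>) \<Longrightarrow> (\<And>z. z \<in> ball 0 1 \<Longrightarrow> u z \<ge> 0 \<and> v z \<ge> 0) \<Longrightarrow>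
    (\<And>z. z \<in> ball 0 1 \<Longrightarrow> ennreal (v z) \<le> (\<integral>\<^sup>+\<xi>. ennreal (u \<xi> * cmod (1 - herm z \<xi>) powr (- N)) \<partial>nu \<alpha>)) \<Longrightarrow>
    (\<integral>\<^sup>+z. ennreal (\<Phi>2 (v z / K)) \<partial>nu \<alpha>) \<le> ennreal K * (\<integral>\<^sup>+\<xi>. ennreal (\<Phi>2 (u \<xi>)) \<partial>nu \<alpha>)"
    using bergman_positive_bound[OF moderate_\<Phi>2 \<alpha> ratio \<epsilon> C2, where 'n='n] unfolding N_def by blast
  obtain K1 where K1: "K1 \<ge> 1" "\<And>f \<mu> w. \<mu> > 0 \<Longrightarrow> holomorphic_ball f \<Longrightarrow> (\<integral>\<^sup>+z. ennreal (\<Phi>1 (cmod (f z) / \<mu>)) \<partial>nu \<alpha>) \<le> 1 \<Longrightarrow>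
    w \<in> ball (0 :: complex ^ 'n) 1 \<Longrightarrow> cmod (f w) / (K1 * \<mu>) \<le> growth_inv \<Phi>1 (bdef w powr (- N))"
    using moderate_growth_pointwise[OF moderate_\<Phi>1 g1 \<alpha>, where 'n='n] unfolding N_def by blast
  \<comment> \<open>M stems from the change of weight and K1 from the pointwise estimate of f. K
    enters twice: once inside \<Phi>_2 and once to remove the factor in front of the
    integral.\<close>
  let ?C = "K * K * M * K1"
  have Cpos: "?C > 0" using K(1) M K1(1) by simp
  show ?thesis unfolding hankel_bounded_def
  proof (intro exI[of _ ?C] conjI Cpos allI impI)
    fix f :: "complex ^ 'n \<Rightarrow> complex" assume "holomorphic_ball f \<and> bounded (f ` ball 0 1)"
    then have f: "Hinf f" by (simp add: Hinf_def)
    note fh = HinfD[OF f]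
    have fm[measurable]: "f \<in> borel_measurable (nu \<alpha>)" by (rule holomorphic_ball_measurable[OF fh])
    have rm[measurable]: "(\<lambda>z :: complex ^ 'n. rho \<Phi> (bdef z powr N)) \<in> borel_measurable (nu \<alpha>)" by (rule rho_measurable)
    show "lux_norm \<alpha> \<Phi>2 (hankel \<alpha> b f) \<le> ennreal ?C * lux_norm \<alpha> \<Phi>1 f"
    proof (rule le_lux_normI[OF Cpos])
      fix \<mu> :: real assume \<mu>: "\<mu> > 0" and I: "(\<integral>\<^sup>+z. ennreal (\<Phi>1 (cmod (f z) / \<mu>)) \<partial>nu \<alpha>) \<le> 1"
      \<comment> \<open>K1 makes |f|/(K1 \<mu>) at most \<Phi>_1^{-1}(bdef^(-N)), the range in which
        \<open>hankel_domination\<close> compares \<Phi>_2(u) with \<Phi>_1.\<close>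
      define u where "u \<xi> = cmod (f \<xi>) / (K1 * \<mu>) * rho \<Phi> (bdef \<xi> powr N)" for \<xi>
      define v where "v z = cmod (hankel \<alpha> b f z) / (M * K1 * \<mu>)" for z
      have rhopos: "rho \<Phi> (bdef z powr N) > 0" if "z \<in> ball 0 1" for z :: "complex ^ 'n" using bdef_pos[OF that] by (intro rho_pos) simp
      have u0: "u z \<ge> 0" if "z \<in> ball 0 1" for z using rhopos[OF that] K1(1) \<mu> by (simp add: u_def)
      have v0: "v z \<ge> 0" for z using M K1(1) \<mu> by (simp add: v_def)
      have um: "u \<in> borel_measurable (nu \<alpha>)" unfolding u_def by measurable
      have uv: "ennreal (v z) \<le> (\<integral>\<^sup>+\<xi>. ennreal (u \<xi> * cmod (1 - herm z \<xi>) powr (- N)) \<partial>nu \<alpha>)" if z: "z \<in> ball 0 1" for z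
      proof -
        \<comment> \<open>For fixed z the kernel of the projection is absorbed into the test
          function, so the value of h_b f at z becomes a pairing of b with a bounded holomorphic
          function, to which integration by parts applies.\<close>
        define \<phi> where "\<phi> \<xi> = f \<xi> * bker N (herm \<xi> z)" for \<xi>
        have \<phi>: "Hinf \<phi>" unfolding \<phi>_def by (intro Hinf_mult f Hinf_bker z)
        have \<phi>m: "(\<lambda>\<xi>. cnj (\<phi> \<xi>)) \<in> borel_measurable (nu \<alpha>)" by (rule measurable_compose[OF holomorphic_ball_measurable[OF HinfD[OF \<phi>]] borel_measurable_cnj])
        have "hankel \<alpha> b f z = (LINT \<xi>|nu \<alpha>. b \<xi> * cnj (\<phi> \<xi>))" unfolding hankel_kint kint_def N_def[symmetric]
        proof (rule Bochner_Integration.integral_cong[OF refl])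
          fix \<xi> :: "complex ^ 'n" assume "\<xi> \<in> space (nu \<alpha>)"
          then have "cmod (herm \<xi> z) < 1" using z by (intro norm_herm_less_1) auto
          then show "b \<xi> * cnj (f \<xi>) * bker N (herm z \<xi>) = b \<xi> * cnj (\<phi> \<xi>)" by (simp add: \<phi>_def cnj_bker cnj_herm)
        qed
        also have "\<dots> = (LINT \<xi>|nu (\<alpha> + real k). D \<xi> * cnj (\<phi> \<xi>))" unfolding D_def N_def
          by (rule radial_integration_by_parts[OF \<alpha> _ bh(1) \<phi> _ _ bB]) (use \<alpha> in auto)
        finally have "ennreal (cmod (hankel \<alpha> b f z)) \<le> (\<integral>\<^sup>+\<xi>. ennreal (cmod (D \<xi> * cnj (\<phi> \<xi>))) \<partial>nu (\<alpha> + real k))"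
          by (simp only: norm_integral_le_nn)
        also have "\<dots> \<le> (\<integral>\<^sup>+\<xi>. ennreal (M * (rho \<Phi> (bdef \<xi> powr N) * cmod (cnj (\<phi> \<xi>)))) \<partial>nu \<alpha>)"
          unfolding M_def by (rule nn_integral_kernel_shift(1)[OF \<alpha> _ Dm \<phi>m C bD[folded D_def]]) simp
        also have "\<dots> = (\<integral>\<^sup>+\<xi>. ennreal (M * K1 * \<mu>) * ennreal (u \<xi> * cmod (1 - herm z \<xi>) powr (- N)) \<partial>nu \<alpha>)"
        proof (rule nn_integral_cong)
          fix \<xi> :: "complex ^ 'n" assume \<xi>: "\<xi> \<in> space (nu \<alpha>)"
          have "M * (rho \<Phi> (bdef \<xi> powr N) * cmod (cnj (\<phi> \<xi>))) = (M * K1 * \<mu>) * (u \<xi> * cmod (1 - herm z \<xi>) powr (- N))"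
            using K1(1) \<mu> by (simp add: \<phi>_def u_def norm_mult norm_bker cmod_one_minus_herm_sym[of \<xi> z])
          then show "ennreal (M * (rho \<Phi> (bdef \<xi> powr N) * cmod (cnj (\<phi> \<xi>)))) = ennreal (M * K1 * \<mu>) * ennreal (u \<xi> * cmod (1 - herm z \<xi>) powr (- N))"
            using M K1(1) \<mu> u0[of \<xi>] \<xi> by (subst ennreal_mult[symmetric]) auto
        qed
        also have "\<dots> = ennreal (M * K1 * \<mu>) * (\<integral>\<^sup>+\<xi>. ennreal (u \<xi> * cmod (1 - herm z \<xi>) powr (- N)) \<partial>nu \<alpha>)"
        proof (rule nn_integral_cmult)
          have "(\<lambda>\<xi>. herm z \<xi>) \<in> borel_measurable (nu \<alpha>)" by (intro borel_measurable_herm borel_measurable_const measurable_ident_nu)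
          then have "(\<lambda>\<xi>. cmod (1 - herm z \<xi>) powr (- N)) \<in> borel_measurable (nu \<alpha>)" by measurable
          then show "(\<lambda>\<xi>. ennreal (u \<xi> * cmod (1 - herm z \<xi>) powr (- N))) \<in> borel_measurable (nu \<alpha>)" using um by measurable
        qed
        finally have le: "ennreal (cmod (hankel \<alpha> b f z)) \<le> ennreal (M * K1 * \<mu>) * (\<integral>\<^sup>+\<xi>. ennreal (u \<xi> * cmod (1 - herm z \<xi>) powr (- N)) \<partial>nu \<alpha>)" .
        have pos: "M * K1 * \<mu> > 0" using M K1(1) \<mu> by simp
        have "ennreal (v z) = ennreal (1 / (M * K1 * \<mu>)) * ennreal (cmod (hankel \<alpha> b f z))" using pos by (simp add: v_def flip: ennreal_mult)
        also have "\<dots> \<le> ennreal (1 / (M * K1 * \<mu>)) * (ennreal (M * K1 * \<mu>) * (\<integral>\<^sup>+\<xi>. ennreal (u \<xi> * cmod (1 - herm z \<xi>) powr (- N)) \<partial>nu \<alpha>))"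
          by (intro mult_left_mono le) simp
        also have "\<dots> = (\<integral>\<^sup>+\<xi>. ennreal (u \<xi> * cmod (1 - herm z \<xi>) powr (- N)) \<partial>nu \<alpha>)"
        proof -
          have "ennreal (1 / (M * K1 * \<mu>)) * ennreal (M * K1 * \<mu>) = 1" using pos by (subst ennreal_mult[symmetric]) auto
          then show ?thesis by (simp only: mult.assoc[symmetric] mult_1)
        qed
        finally show ?thesis .
      qed
      have "(\<integral>\<^sup>+\<xi>. ennreal (\<Phi>2 (u \<xi>)) \<partial>nu \<alpha>) \<le> (\<integral>\<^sup>+\<xi>. ennreal (\<Phi>1 (cmod (f \<xi>) / \<mu>)) \<partial>nu \<alpha>)"
      proof (rule nn_integral_mono)
        fix \<xi> :: "complex ^ 'n" assume "\<xi> \<in> space (nu \<alpha>)"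
        then have \<xi>: "\<xi> \<in> ball 0 1" by simp
        let ?s = "bdef \<xi> powr (- N)"
        have s: "?s > 0" "1 / ?s = bdef \<xi> powr N" using bdef_pos[OF \<xi>] by (simp, simp only: powr_minus inverse_eq_divide divide_divide_eq_right mult_1 div_by_1)
        have "\<Phi>2 (u \<xi>) \<le> \<Phi>1 (cmod (f \<xi>) / (K1 * \<mu>))"
          unfolding u_def s(2)[symmetric] using K1(1) \<mu> by (intro hankel_domination s(1) K1(2)[OF \<mu> fh I \<xi>]) auto
        also have "\<dots> \<le> \<Phi>1 (cmod (f \<xi>) / \<mu>)"
          using K1(1) \<mu> by (intro growth_function_mono[OF g1] divide_left_mono) auto
        finally show "ennreal (\<Phi>2 (u \<xi>)) \<le> ennreal (\<Phi>1 (cmod (f \<xi>) / \<mu>))" by (rule ennreal_leI)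
      qed
      then have U: "(\<integral>\<^sup>+\<xi>. ennreal (\<Phi>2 (u \<xi>)) \<partial>nu \<alpha>) \<le> 1" using I by (rule order.trans)
      have "(\<integral>\<^sup>+z. ennreal (\<Phi>2 (v z / K)) \<partial>nu \<alpha>) \<le> ennreal K * (\<integral>\<^sup>+\<xi>. ennreal (\<Phi>2 (u \<xi>)) \<partial>nu \<alpha>)"
        using u0 v0 uv by (intro K(2) um) auto
      also have "\<dots> \<le> ennreal K * 1" by (intro mult_left_mono U) simp
      finally have V: "(\<integral>\<^sup>+z. ennreal (\<Phi>2 (v z / K)) \<partial>nu \<alpha>) \<le> ennreal K" by simp
      have "hankel \<alpha> b f \<in> borel_measurable (nu \<alpha>)"
        unfolding hankel_kint by (intro holomorphic_ball_measurable holomorphic_ball_kint integrable_mult_cnj_Hinf bh f)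
      then have "v \<in> borel_measurable (nu \<alpha>)" unfolding v_def by measurable
      then have vm: "(\<lambda>z. \<Phi>2 (v z / K)) \<in> borel_measurable (nu \<alpha>)"
        using v0 K(1) by (intro moderate_measurable[OF moderate_\<Phi>2] borel_measurable_divide borel_measurable_const divide_nonneg_nonneg) auto
      \<comment> \<open>A further division by K inside \<Phi>_2 lowers its value by the factor 1/K,
        since \<Phi>_2(t)/t is non-decreasing; this brings the integral down to 1.\<close>
      have "(\<integral>\<^sup>+z. ennreal (\<Phi>2 (cmod (hankel \<alpha> b f z) / (?C * \<mu>))) \<partial>nu \<alpha>) \<le> (\<integral>\<^sup>+z. ennreal (1 / K) * ennreal (\<Phi>2 (v z / K)) \<partial>nu \<alpha>)"
      proof (rule nn_integral_mono)
        fix z :: "complex ^ 'n"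
        have "cmod (hankel \<alpha> b f z) / (?C * \<mu>) = 1 / K * (v z / K)" using K(1) by (simp add: v_def field_simps)
        moreover have "\<Phi>2 (1 / K * (v z / K)) \<le> 1 / K * \<Phi>2 (v z / K)" using K(1) v0 by (intro growth_U_scale_down[OF \<Phi>2]) auto
        moreover have "\<Phi>2 (v z / K) \<ge> 0" using v0 K(1) by (intro growth_function_nonneg[OF g2]) auto
        ultimately show "ennreal (\<Phi>2 (cmod (hankel \<alpha> b f z) / (?C * \<mu>))) \<le> ennreal (1 / K) * ennreal (\<Phi>2 (v z / K))"
          using K(1) by (simp flip: ennreal_mult)
      qed
      also have "\<dots> = ennreal (1 / K) * (\<integral>\<^sup>+z. ennreal (\<Phi>2 (v z / K)) \<partial>nu \<alpha>)"
        using vm by (intro nn_integral_cmult) measurable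
      also have "\<dots> \<le> ennreal (1 / K) * ennreal K" by (intro mult_left_mono V) simp
      also have "\<dots> = 1" using K(1) by (simp flip: ennreal_mult)
      finally show "lux_norm \<alpha> \<Phi>2 (hankel \<alpha> b f) \<le> ennreal (?C * \<mu>)"
        using Cpos \<mu> by (intro lux_norm_le) auto
    qed
  qed
qed

lemma hankel_bounded_imp_gamma:
  fixes b :: "complex ^ 'n \<Rightarrow> complex"
  assumes \<alpha>: "\<alpha> > -1" and b: "holomorphic_ball b" "integrable (nu \<alpha>) b" and bdd: "hankel_bounded \<alpha> \<Phi>1 \<Phi>2 b"
  shows "b \<in> Gamma_space \<alpha> (rho \<Phi>)"
proof -
  define N where "N = real CARD('n) + 1 + \<alpha>"
  define k where "k = nat \<lceil>4 * N\<rceil>"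
  have k: "real k \<ge> 4 * N" unfolding k_def by (rule real_nat_ceiling_ge)
  obtain C where C: "C > 0" "\<And>f. Hinf f \<Longrightarrow> lux_norm \<alpha> \<Phi>2 (hankel \<alpha> b f) \<le> ennreal C * lux_norm \<alpha> \<Phi>1 f"
    using bdd unfolding hankel_bounded_def Hinf_def by blast
  define \<Lambda> where "\<Lambda> = (\<lambda>\<phi>. LINT \<xi>|nu \<alpha>. cnj (b \<xi>) * \<phi> \<xi>)"
  have \<Lambda>: "sup_functional \<Lambda>" unfolding \<Lambda>_def by (rule sup_functional_cnj[OF b(2)])
  obtain c :: "nat \<Rightarrow> real" where c: "\<And>w. w \<in> ball 0 1 \<Longrightarrow> (radial_deriv ^^ k) (ktrans \<Lambda> N) w = (\<Sum>j\<le>k. of_real (c j) * ktrans \<Lambda> (N + real j) w)"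
    using radial_pow_ktrans[of k N, where 'n='n] \<Lambda> by blast
  obtain A where A: "A > 0" "\<And>z w. z \<in> ball (0 :: complex ^ 'n) 1 \<Longrightarrow> w \<in> ball 0 1 \<Longrightarrow>
    cmod (\<Sum>j\<le>k. of_real (c j) * bker (0 + real j) (herm z w)) \<le> A * cmod (1 - herm z w) powr (- (0 + real k))"
    using kernel_sum_bound[where k=k and c=c and s=0 and 'n='n] by blast
  obtain K where K: "K \<ge> 1" "\<And>f \<mu> w. \<mu> > 0 \<Longrightarrow> holomorphic_ball f \<Longrightarrow> (\<integral>\<^sup>+z. ennreal (\<Phi>2 (cmod (f z) / \<mu>)) \<partial>nu \<alpha>) \<le> 1 \<Longrightarrow>
    w \<in> ball (0 :: complex ^ 'n) 1 \<Longrightarrow> cmod (f w) / (K * \<mu>) \<le> growth_inv \<Phi>2 (bdef w powr (- N))"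
    using moderate_growth_pointwise[OF moderate_\<Phi>2 g2 \<alpha>, where 'n='n] unfolding N_def by blast
  let ?M = "K * (2 * (C * (A * 2 powr real k)))"
  have M: "?M > 0" using K(1) C(1) A(1) by simp
  show ?thesis
  proof (rule gammaI[OF \<alpha> b(1) k[unfolded N_def] M, folded N_def])
    fix w :: "complex ^ 'n" assume w: "w \<in> ball 0 1"
    \<comment> \<open>The orders start at 0 because the Bergman kernel in the Hankel operator
      supplies the missing factor of order N; the product of the two then has exactly the orders N +
      j that occur in the k-th radial derivative of b.\<close>
    define f where "f \<xi> = (\<Sum>j\<le>k. of_real (c j) * bker (0 + real j) (herm \<xi> w))" for \<xi>
    have f: "Hinf f" unfolding f_def by (rule Hinf_kernel_sum[OF w])
    have fA: "cmod (f z) \<le> A * cmod (1 - herm z w) powr (- real k)" if "z \<in> ball 0 1" for z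
      using A(2)[OF that w] by (simp add: f_def)
    let ?s = "bdef w powr (- N)"
    have d: "0 < bdef w" by (rule bdef_pos[OF w])
    have s: "?s > 0" "1 / (bdef w powr N) = ?s" "bdef w powr N > 0" using d by (auto simp: powr_minus inverse_eq_divide)
    note gp = growth_inv_pos[OF g1 s(1)] growth_inv_pos[OF g2 s(1)]
    define L where "L = A * 2 powr real k * bdef w powr (- real k) / growth_inv \<Phi>1 ?s"
    have L: "L > 0" using A(1) d gp by (simp add: L_def)
    have "lux_norm \<alpha> \<Phi>1 f \<le> ennreal L" unfolding L_def N_def
      by (rule kernel_lux_norm[OF moderate_\<Phi>1 g1 \<alpha> w k[unfolded N_def] A(1) fA])
    then have "lux_norm \<alpha> \<Phi>2 (hankel \<alpha> b f) \<le> ennreal C * ennreal L" using C(2)[OF f] mult_left_mono[of _ "ennreal L" "ennreal C"] by (meson order.trans zero_le)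
    \<comment> \<open>Doubling makes the inequality strict, so that the infimum provides an
      admissible \<mu>.\<close>
    also have "\<dots> < ennreal (2 * (C * L))" using C(1) L by (simp add: ennreal_lessI flip: ennreal_mult)
    finally obtain \<mu> where \<mu>: "\<mu> > 0" "ennreal \<mu> < ennreal (2 * (C * L))" "(\<integral>\<^sup>+z. ennreal (\<Phi>2 (cmod (hankel \<alpha> b f z) / \<mu>)) \<partial>nu \<alpha>) \<le> 1"
      by (rule lux_norm_less)
    have \<mu>L: "\<mu> \<le> 2 * (C * L)" using \<mu>(1,2) by (simp add: ennreal_less_iff)
    have hh: "holomorphic_ball (hankel \<alpha> b f)" unfolding hankel_kint by (rule holomorphic_ball_kint[OF integrable_mult_cnj_Hinf[OF b(2) f]])
    have "cmod (hankel \<alpha> b f w) / (K * \<mu>) \<le> growth_inv \<Phi>2 ?s" by (rule K(2)[OF \<mu>(1) hh \<mu>(3) w])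
    then have "cmod (hankel \<alpha> b f w) \<le> K * \<mu> * growth_inv \<Phi>2 ?s" using K(1) \<mu>(1) by (simp add: field_simps)
    also have "\<dots> \<le> K * (2 * (C * L)) * growth_inv \<Phi>2 ?s" using K(1) gp by (intro mult_right_mono mult_left_mono \<mu>L) auto
    \<comment> \<open>The norm of f carries 1/\<Phi>_1^{-1} and the pointwise bound on its image
      carries \<Phi>_2^{-1}, both at bdef(w)^(-N); their product is \<rho>_\<Phi> at
      bdef(w)^N.\<close>
    also have "\<dots> = ?M * bdef w powr (- real k) * rho \<Phi> (bdef w powr N)"
      by (simp add: L_def rho_eq[OF s(3)] s(2))
    finally have hw: "cmod (hankel \<alpha> b f w) \<le> ?M * bdef w powr (- real k) * rho \<Phi> (bdef w powr N)" .
    have "(radial_deriv ^^ k) b w = (radial_deriv ^^ k) (ktrans \<Lambda> N) w"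
    proof (rule radial_pow_cong[OF b(1) _ w])
      fix z :: "complex ^ 'n" assume z: "z \<in> ball 0 1"
      show "b z = ktrans \<Lambda> N z" using kint_reproducing[OF b(1) \<alpha> b(2) z] kint_ktrans[OF z, of \<alpha> b N] by (simp add: \<Lambda>_def N_def)
    qed
    also have "\<dots> = (\<Sum>j\<le>k. of_real (c j) * kint \<alpha> b (N + real j) w)"
      unfolding c[OF w] using kint_ktrans[OF w, of \<alpha> b] by (simp add: \<Lambda>_def)
    also have "\<dots> = hankel \<alpha> b f w"
    proof -
      have ij: "integrable (nu \<alpha>) (\<lambda>\<xi>. b \<xi> * bker (N + real j) (herm w \<xi>))" for j
      proof -
        have i: "integrable (nu \<alpha>) (\<lambda>\<xi>. b \<xi> * bker (N + real j) (herm \<xi> w))" by (rule integrable_mult_Hinf[OF b(2) Hinf_bker[OF w]])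
        have "(\<lambda>\<xi>. b \<xi> * bker (N + real j) (herm w \<xi>)) \<in> borel_measurable (nu \<alpha>)"
          by (intro borel_measurable_times borel_measurable_integrable[OF b(2)] measurable_compose[OF borel_measurable_herm borel_measurable_bker] borel_measurable_const measurable_ident_nu)
        from Bochner_Integration.integrable_bound[OF i this] show ?thesis by (simp add: norm_mult norm_bker cmod_one_minus_herm_sym)
      qed
      have "hankel \<alpha> b f w = (LINT \<xi>|nu \<alpha>. (\<Sum>j\<le>k. of_real (c j) * (b \<xi> * bker (N + real j) (herm w \<xi>))))"
        unfolding hankel_kint kint_def N_def[symmetric]
      proof (rule Bochner_Integration.integral_cong[OF refl])
        fix \<xi> :: "complex ^ 'n" assume "\<xi> \<in> space (nu \<alpha>)"
        then have "cmod (herm \<xi> w) < 1" using w by (intro norm_herm_less_1) auto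
        then show "b \<xi> * cnj (f \<xi>) * bker N (herm w \<xi>) = (\<Sum>j\<le>k. of_real (c j) * (b \<xi> * bker (N + real j) (herm w \<xi>)))"
          by (simp add: f_def cnj_bker cnj_herm bker_add sum_distrib_left sum_distrib_right mult_ac)
      qed
      also have "\<dots> = (\<Sum>j\<le>k. of_real (c j) * kint \<alpha> b (N + real j) w)" 
        unfolding kint_def by (subst Bochner_Integration.integral_sum) (simp_all add: ij)
      finally show ?thesis ..
    qed
    finally show "cmod ((radial_deriv ^^ k) b w) \<le> ?M * bdef w powr (- real k) * rho \<Phi> (bdef w powr N)" using hw by simp
  qed
qed

end

lemma square_integrable_nu:
  fixes b :: "complex ^ 'n \<Rightarrow> complex"
  assumes \<alpha>: "\<alpha> > -1" and b: "b \<in> bergman_orlicz \<alpha> (\<lambda>t. t\<^sup>2)"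
  shows "holomorphic_ball b" "integrable (nu \<alpha>) b"
proof -
  show h: "holomorphic_ball b" using b by (simp add: bergman_orlicz_def)
  have m[measurable]: "b \<in> borel_measurable (nu \<alpha>)" by (rule holomorphic_ball_measurable[OF h])
  show "integrable (nu \<alpha>) b"
  proof (rule integrableI_bounded[OF m])
    have "(\<integral>\<^sup>+z. ennreal (cmod (b z)) \<partial>nu \<alpha>) \<le> (\<integral>\<^sup>+z. 1 + ennreal ((cmod (b z))\<^sup>2) \<partial>nu \<alpha>)"
    proof (rule nn_integral_mono)
      fix z
      have "cmod (b z) \<le> 1 + (cmod (b z))\<^sup>2" using sum_squares_ge_zero[of "cmod (b z) - 1/2" 0] by (simp add: power2_eq_square algebra_simps)
      then have "ennreal (cmod (b z)) \<le> ennreal (1 + (cmod (b z))\<^sup>2)" by (rule ennreal_leI)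
      then show "ennreal (cmod (b z)) \<le> 1 + ennreal ((cmod (b z))\<^sup>2)" by (simp add: ennreal_plus)
    qed
    also have "\<dots> = emeasure (nu \<alpha>) (space (nu \<alpha> :: (complex ^ 'n) measure)) + (\<integral>\<^sup>+z. ennreal ((cmod (b z))\<^sup>2) \<partial>nu \<alpha>)"
      by (subst nn_integral_add) auto
    also have "\<dots> < \<infinity>" using b by (simp add: emeasure_nu[OF \<alpha>] bergman_orlicz_def)
    finally show "(\<integral>\<^sup>+z. ennreal (norm (b z)) \<partial>nu \<alpha>) < \<infinity>" .
  qed
qed

section \<open>The dual space\<close>

lemma moderate_add_le:
  assumes \<Phi>: "moderate \<Phi>"
  shows "\<exists>C\<ge>0. \<forall>x\<ge>0. \<forall>y\<ge>0. \<Phi> (x + y) \<le> C * (\<Phi> x + \<Phi> y)"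
proof -
  note \<Phi>D = moderateD[OF \<Phi>]
  obtain C q where C: "C \<ge> 1" "q \<ge> 0" "\<And>x M. 1 \<le> x \<Longrightarrow> 0 \<le> M \<Longrightarrow> \<Phi> (x * M) \<le> C * x powr q * \<Phi> M"
    using moderate_upper[OF \<Phi>] by blast
  show ?thesis
  proof (intro exI[of _ "C * 2 powr q"] conjI allI impI)
    show "0 \<le> C * 2 powr q" using C by simp
    fix x y :: real assume x: "x \<ge> 0" and y: "y \<ge> 0"
    have "\<Phi> (x + y) \<le> \<Phi> (2 * max x y)" using x y by (intro \<Phi>D(5)) auto
    also have "\<dots> \<le> C * 2 powr q * \<Phi> (max x y)" using x by (intro C(3)) auto
    also have "\<dots> \<le> C * 2 powr q * (\<Phi> x + \<Phi> y)"
      using \<Phi>D(4)[OF x] \<Phi>D(4)[OF y] C(1) by (intro mult_left_mono) (auto simp: max_def)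
    finally show "\<Phi> (x + y) \<le> C * 2 powr q * (\<Phi> x + \<Phi> y)" .
  qed
qed

lemma bergman_orlicz_add:
  fixes f g :: "complex ^ 'n \<Rightarrow> complex"
  assumes \<Phi>: "moderate \<Phi>" and f: "f \<in> bergman_orlicz \<alpha> \<Phi>" and g: "g \<in> bergman_orlicz \<alpha> \<Phi>"
  shows "(\<lambda>z. f z + g z) \<in> bergman_orlicz \<alpha> \<Phi>"
proof -
  obtain C where C: "C \<ge> 0" "\<And>x y. x \<ge> 0 \<Longrightarrow> y \<ge> 0 \<Longrightarrow> \<Phi> (x + y) \<le> C * (\<Phi> x + \<Phi> y)"
    using moderate_add_le[OF \<Phi>] by blast
  have h: "holomorphic_ball f" "holomorphic_ball g" using f g by (auto simp: bergman_orlicz_def)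
  have [measurable]: "(\<lambda>z. \<Phi> (cmod (f z))) \<in> borel_measurable (nu \<alpha>)" "(\<lambda>z. \<Phi> (cmod (g z))) \<in> borel_measurable (nu \<alpha>)"
    using moderate_cmod_measurable[OF \<Phi> holomorphic_ball_measurable[OF h(1)], of 1] moderate_cmod_measurable[OF \<Phi> holomorphic_ball_measurable[OF h(2)], of 1] by auto
  have "(\<integral>\<^sup>+z. ennreal (\<Phi> (cmod (f z + g z))) \<partial>nu \<alpha>) \<le> (\<integral>\<^sup>+z. ennreal C * (ennreal (\<Phi> (cmod (f z))) + ennreal (\<Phi> (cmod (g z)))) \<partial>nu \<alpha>)"
  proof (rule nn_integral_mono)
    fix z
    have "\<Phi> (cmod (f z + g z)) \<le> \<Phi> (cmod (f z) + cmod (g z))" by (intro moderateD(5)[OF \<Phi>] norm_triangle_ineq) auto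
    also have "\<dots> \<le> C * (\<Phi> (cmod (f z)) + \<Phi> (cmod (g z)))" by (intro C(2)) auto
    finally show "ennreal (\<Phi> (cmod (f z + g z))) \<le> ennreal C * (ennreal (\<Phi> (cmod (f z))) + ennreal (\<Phi> (cmod (g z))))"
      using C(1) moderateD(4)[OF \<Phi>] by (simp add: ennreal_leI flip: ennreal_plus ennreal_mult)
  qed
  also have "\<dots> = ennreal C * ((\<integral>\<^sup>+z. ennreal (\<Phi> (cmod (f z))) \<partial>nu \<alpha>) + (\<integral>\<^sup>+z. ennreal (\<Phi> (cmod (g z))) \<partial>nu \<alpha>))"
    by (subst nn_integral_cmult, measurable, subst nn_integral_add) auto
  also have "\<dots> < \<infinity>" using f g by (simp add: bergman_orlicz_def ennreal_mult_less_top)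
  finally show ?thesis using holomorphic_ball_add[OF h] by (simp add: bergman_orlicz_def)
qed

lemma bergman_orlicz_uminus: "f \<in> bergman_orlicz \<alpha> \<Phi> \<Longrightarrow> (\<lambda>z. - f z) \<in> bergman_orlicz \<alpha> \<Phi>"
  using holomorphic_ball_cmult[of f "-1"] by (simp add: bergman_orlicz_def)

lemma Hinf_bergman_orlicz:
  fixes f :: "complex ^ 'n \<Rightarrow> complex"
  assumes \<Phi>: "moderate \<Phi>" and \<alpha>: "\<alpha> > -1" and f: "Hinf f"
  shows "f \<in> bergman_orlicz \<alpha> \<Phi>"
proof -
  obtain B where B: "B \<ge> 0" "\<And>z. z \<in> ball 0 1 \<Longrightarrow> cmod (f z) \<le> B" using HinfE[OF f] by blast
  have "(\<integral>\<^sup>+z. ennreal (\<Phi> (cmod (f z))) \<partial>nu \<alpha>) \<le> (\<integral>\<^sup>+z. ennreal (\<Phi> B) \<partial>(nu \<alpha> :: (complex ^ 'n) measure))"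
    using B by (intro nn_integral_mono ennreal_leI moderateD(5)[OF \<Phi>]) auto
  also have "\<dots> < \<infinity>" by (simp add: emeasure_nu[OF \<alpha>])
  finally show ?thesis using HinfD[OF f] by (simp add: bergman_orlicz_def)
qed

lemma lux_norm_sup_bound:
  fixes f :: "complex ^ 'n \<Rightarrow> complex"
  assumes \<Phi>: "growth_function \<Phi>" and \<alpha>: "\<alpha> > -1" and B: "B > 0" "\<And>z. z \<in> ball 0 1 \<Longrightarrow> cmod (f z) \<le> B"
  shows "lux_norm \<alpha> \<Phi> f \<le> ennreal (B / growth_inv \<Phi> 1)"
proof (rule lux_norm_le)
  have t: "growth_inv \<Phi> 1 > 0" "\<Phi> (growth_inv \<Phi> 1) = 1" using growth_inv_pos[OF \<Phi>, of 1] growth_inv_props[OF \<Phi>, of 1] by auto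
  show "0 < B / growth_inv \<Phi> 1" using B t by simp
  have "(\<integral>\<^sup>+z. ennreal (\<Phi> (cmod (f z) / (B / growth_inv \<Phi> 1))) \<partial>nu \<alpha>) \<le> (\<integral>\<^sup>+z. 1 \<partial>(nu \<alpha> :: (complex ^ 'n) measure))"
  proof (rule nn_integral_mono)
    fix z :: "complex ^ 'n" assume "z \<in> space (nu \<alpha>)"
    then have "cmod (f z) \<le> B" using B by simp
    then have "cmod (f z) / (B / growth_inv \<Phi> 1) \<le> growth_inv \<Phi> 1" using B t by (simp add: field_simps)
    then have "\<Phi> (cmod (f z) / (B / growth_inv \<Phi> 1)) \<le> 1" using growth_function_mono[OF \<Phi>, of "cmod (f z) / (B / growth_inv \<Phi> 1)" "growth_inv \<Phi> 1"] B t by simp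
    then show "ennreal (\<Phi> (cmod (f z) / (B / growth_inv \<Phi> 1))) \<le> 1" by simp
  qed
  also have "\<dots> = 1" by (simp add: emeasure_nu[OF \<alpha>])
  finally show "(\<integral>\<^sup>+z. ennreal (\<Phi> (cmod (f z) / (B / growth_inv \<Phi> 1))) \<partial>nu \<alpha>) \<le> 1" .
qed

lemma orlicz_dualD:
  assumes "L \<in> orlicz_dual \<alpha> \<Phi>"
  shows "\<And>f g. f \<in> bergman_orlicz \<alpha> \<Phi> \<Longrightarrow> g \<in> bergman_orlicz \<alpha> \<Phi> \<Longrightarrow> L (\<lambda>z. f z + g z) = L f + L g"
    "\<And>f c. f \<in> bergman_orlicz \<alpha> \<Phi> \<Longrightarrow> L (\<lambda>z. c * f z) = c * L f"
    "\<exists>C>0. \<forall>f\<in>bergman_orlicz \<alpha> \<Phi>. ennreal (cmod (L f)) \<le> ennreal C * lux_norm \<alpha> \<Phi> f"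
  using assms by (auto simp: orlicz_dual_def)

text \<open>Makes the calculus of kernel transforms available for an abstract L.\<close>

lemma orlicz_dual_sup_functional:
  fixes L :: "(complex ^ 'n \<Rightarrow> complex) \<Rightarrow> complex"
  assumes \<Phi>: "moderate \<Phi>" "growth_function \<Phi>" and \<alpha>: "\<alpha> > -1" and L: "L \<in> orlicz_dual \<alpha> \<Phi>"
  shows "sup_functional L"
proof -
  note H = Hinf_bergman_orlicz[OF \<Phi>(1) \<alpha>]
  obtain C where C: "C > 0" "\<And>f. f \<in> bergman_orlicz \<alpha> \<Phi> \<Longrightarrow> ennreal (cmod (L f)) \<le> ennreal C * lux_norm \<alpha> \<Phi> f"
    using orlicz_dualD(3)[OF L] by blast
  have t: "growth_inv \<Phi> 1 > 0" by (rule growth_inv_pos[OF \<Phi>(2)]) simp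
  show ?thesis unfolding sup_functional_def
  proof (intro conjI allI impI)
    show "\<exists>C\<ge>0. \<forall>f B. Hinf f \<longrightarrow> (\<forall>z\<in>ball 0 1. cmod (f z) \<le> B) \<longrightarrow> cmod (L f) \<le> C * B"
    proof (intro exI[of _ "C / growth_inv \<Phi> 1"] conjI allI impI)
      show "0 \<le> C / growth_inv \<Phi> 1" using C(1) t by simp
      fix f :: "complex ^ 'n \<Rightarrow> complex" and B assume f: "Hinf f" and B: "\<forall>z\<in>ball 0 1. cmod (f z) \<le> B"
      have "cmod (f 0) \<le> B" using B by simp
      then have B0: "0 \<le> B" by (rule order.trans[OF norm_ge_zero])
      \<comment> \<open>B may be 0, whereas an admissible \<mu> must be positive; hence the
        perturbation by e.\<close>
      have "cmod (L f) \<le> C / growth_inv \<Phi> 1 * B + e" if e: "e > 0" for e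
      proof -
        let ?B = "B + e * growth_inv \<Phi> 1 / C"
        have e': "e * growth_inv \<Phi> 1 / C > 0" using e C(1) t by simp
        have "lux_norm \<alpha> \<Phi> f \<le> ennreal (?B / growth_inv \<Phi> 1)"
          using B B0 e' by (intro lux_norm_sup_bound[OF \<Phi>(2) \<alpha>]) force+
        then have "ennreal C * lux_norm \<alpha> \<Phi> f \<le> ennreal C * ennreal (?B / growth_inv \<Phi> 1)" by (intro mult_left_mono) auto
        also have "\<dots> = ennreal (C * (?B / growth_inv \<Phi> 1))" using C(1) t B0 e' by (subst ennreal_mult) auto
        finally have "ennreal (cmod (L f)) \<le> ennreal (C * (?B / growth_inv \<Phi> 1))" using C(2)[OF H[OF f]] by (rule order.trans[rotated])
        then have "cmod (L f) \<le> C * (?B / growth_inv \<Phi> 1)" using C(1) t B0 e' by (subst (asm) ennreal_le_iff) auto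
        also have "\<dots> = C / growth_inv \<Phi> 1 * B + e" using C(1) t by (simp add: field_simps)
        finally show ?thesis .
      qed
      then show "cmod (L f) \<le> C / growth_inv \<Phi> 1 * B" by (rule field_le_epsilon)
    qed
  next
    fix f g :: "complex ^ 'n \<Rightarrow> complex" assume "Hinf f" "Hinf g"
    then show "L (\<lambda>z. f z + g z) = L f + L g" by (intro orlicz_dualD(1)[OF L] H)
  next
    fix c and f :: "complex ^ 'n \<Rightarrow> complex" assume "Hinf f"
    then show "L (\<lambda>z. c * f z) = c * L f" by (intro orlicz_dualD(2)[OF L] H)
  qed
qed

lemma eventually_at_left_unit: "\<forall>\<^sub>F r in at_left (1::real). r > 0 \<and> r < 1"
  unfolding eventually_at_left_field by (intro exI[of _ 0]) auto

text \<open>Only the Luxemburg size of the difference of f and its dilate enters, so no triangle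
  inequality for that functional is involved.\<close>

lemma orlicz_dual_dilation:
  fixes L :: "(complex ^ 'n \<Rightarrow> complex) \<Rightarrow> complex"
  assumes \<Phi>: "moderate \<Phi>" and \<alpha>: "\<alpha> > -1" and L: "L \<in> orlicz_dual \<alpha> \<Phi>" and f: "f \<in> bergman_orlicz \<alpha> \<Phi>"
  shows "((\<lambda>r. L (\<lambda>z. f (r *\<^sub>R z))) \<longlongrightarrow> L f) (at_left 1)"
proof (rule tendstoI)
  obtain C where C: "C > 0" "\<And>f. f \<in> bergman_orlicz \<alpha> \<Phi> \<Longrightarrow> ennreal (cmod (L f)) \<le> ennreal C * lux_norm \<alpha> \<Phi> f"
    using orlicz_dualD(3)[OF L] by blast
  have fh: "holomorphic_ball f" "(\<integral>\<^sup>+z. ennreal (\<Phi> (cmod (f z))) \<partial>nu \<alpha>) < \<infinity>" using f by (auto simp: bergman_orlicz_def)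
  fix e :: real assume e: "e > 0"
  define \<epsilon> where "\<epsilon> = e / (2 * C)"
  have \<epsilon>: "\<epsilon> > 0" using e C(1) by (simp add: \<epsilon>_def)
  from eventually_at_left_unit dilation_converges[OF \<Phi> \<alpha> fh \<epsilon>]
  show "\<forall>\<^sub>F r in at_left 1. dist (L (\<lambda>z. f (r *\<^sub>R z))) (L f) < e"
  proof eventually_elim
    case (elim r)
    define h where "h z = f (r *\<^sub>R z) + - f z" for z
    have "(\<lambda>z. f (r *\<^sub>R z)) \<in> bergman_orlicz \<alpha> \<Phi>"
      by (intro Hinf_bergman_orlicz[OF \<Phi> \<alpha>] Hinf_dilate[OF fh(1)]) (use elim in auto)
    then have h: "h \<in> bergman_orlicz \<alpha> \<Phi>" unfolding h_def by (intro bergman_orlicz_add[OF \<Phi>] bergman_orlicz_uminus f)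
    have "lux_norm \<alpha> \<Phi> h \<le> ennreal \<epsilon>" using elim by (intro lux_norm_le \<epsilon>) (simp add: h_def)
    then have "ennreal C * lux_norm \<alpha> \<Phi> h \<le> ennreal C * ennreal \<epsilon>" by (intro mult_left_mono) auto
    also have "\<dots> = ennreal (e / 2)" using C(1) \<epsilon> by (simp add: \<epsilon>_def flip: ennreal_mult)
    finally have "ennreal (cmod (L h)) \<le> ennreal (e / 2)" using C(2)[OF h] by (rule order.trans[rotated])
    then have "cmod (L h) \<le> e / 2" using e by simp
    moreover have "L (\<lambda>z. f z + h z) = L f + L h" by (rule orlicz_dualD(1)[OF L f h])
    moreover have "(\<lambda>z. f z + h z) = (\<lambda>z. f (r *\<^sub>R z))" by (simp add: h_def)
    ultimately show ?case using e by (simp add: dist_norm)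
  qed
qed

lemma lux_finite:
  fixes f :: "complex ^ 'n \<Rightarrow> complex"
  assumes \<Phi>: "moderate \<Phi>" and f: "f \<in> bergman_orlicz \<alpha> \<Phi>"
  obtains \<mu> where "\<mu> > 0" "(\<integral>\<^sup>+z. ennreal (\<Phi> (cmod (f z) / \<mu>)) \<partial>nu \<alpha>) \<le> 1"
proof -
  obtain I where I: "I \<ge> 0" "(\<integral>\<^sup>+z. ennreal (\<Phi> (cmod (f z))) \<partial>nu \<alpha>) = ennreal I"
    using f by (cases "\<integral>\<^sup>+z. ennreal (\<Phi> (cmod (f z))) \<partial>nu \<alpha>") (auto simp: bergman_orlicz_def)
  have m: "(\<lambda>z. \<Phi> (cmod (f z))) \<in> borel_measurable (nu \<alpha>)"
    using f moderate_cmod_measurable[OF \<Phi> holomorphic_ball_measurable, of f 1] by (simp add: bergman_orlicz_def)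
  \<comment> \<open>The square compensates the square root in the lower type: dividing by \<mu>
    lowers the integral by the factor 1/(I + 1).\<close>
  let ?\<mu> = "(I + 1)\<^sup>2"
  have \<mu>: "?\<mu> > 0" "?\<mu> \<ge> 1" using I(1) one_le_power[of "I + 1" 2] by auto
  have "(\<integral>\<^sup>+z. ennreal (\<Phi> (cmod (f z) / ?\<mu>)) \<partial>nu \<alpha>) \<le> (\<integral>\<^sup>+z. ennreal (1 / (I + 1)) * ennreal (\<Phi> (cmod (f z))) \<partial>nu \<alpha>)"
  proof (rule nn_integral_mono)
    fix z
    have "\<Phi> (1 / ?\<mu> * cmod (f z)) \<le> sqrt (1 / ?\<mu>) * \<Phi> (cmod (f z))" using \<mu> by (intro moderateD(6)[OF \<Phi>]) auto
    also have "sqrt (1 / ?\<mu>) = 1 / (I + 1)" using I(1) by (simp add: real_sqrt_divide)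
    finally show "ennreal (\<Phi> (cmod (f z) / ?\<mu>)) \<le> ennreal (1 / (I + 1)) * ennreal (\<Phi> (cmod (f z)))"
      using I(1) moderateD(4)[OF \<Phi>] by (simp add: ennreal_leI flip: ennreal_mult)
  qed
  also have "\<dots> = ennreal (1 / (I + 1)) * ennreal I"
    using m unfolding I(2)[symmetric] by (intro nn_integral_cmult) measurable
  also have "\<dots> = ennreal (1 / (I + 1) * I)" using I(1) by (subst ennreal_mult) auto
  also have "\<dots> \<le> ennreal 1" using I(1) by (intro ennreal_leI) (simp add: field_simps)
  finally show ?thesis using that[OF \<mu>(1)] by simp
qed

context growth_triple
begin

lemma gamma_represents:
  fixes g :: "complex ^ 'n \<Rightarrow> complex"
  assumes \<alpha>: "\<alpha> > -1" and g: "g \<in> Gamma_space \<alpha> (rho \<Phi>)"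
  shows "\<exists>L\<in>orlicz_dual \<alpha> \<Phi>. represents \<alpha> \<Phi> g L"
proof -
  define N where "N = real CARD('n) + 1 + \<alpha>"
  obtain k B C where gh: "holomorphic_ball g" "integrable (nu \<alpha>) g" and C: "C > 0"
    and gB: "\<And>z. z \<in> ball 0 1 \<Longrightarrow> cmod (g z) \<le> B * bdef z powr (- ((1 + \<alpha>) / 4))"
    and bD: "\<And>z. z \<in> ball 0 1 \<Longrightarrow> cmod (kint \<alpha> g (N + real k) z) \<le> C * (bdef z powr (- real k) * rho \<Phi> (bdef z powr N))"
    by (rule gamma_regularity[OF \<alpha> g, folded N_def]) (rule that)
  define D where "D = kint \<alpha> g (N + real k)"
  have Dm: "D \<in> borel_measurable (nu \<alpha>)" unfolding D_def by (intro holomorphic_ball_measurable holomorphic_ball_kint gh)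
  define M where "M = nu_mass TYPE('n) \<alpha> / nu_mass TYPE('n) (\<alpha> + real k) * C"
  have k0: "real k \<ge> 0" by simp
  have M: "M > 0" unfolding M_def by (rule nn_integral_kernel_shift(2)[OF \<alpha> k0 Dm Dm C bD[folded D_def]])
  obtain K where K: "K \<ge> 1" "\<And>f \<mu> w. \<mu> > 0 \<Longrightarrow> holomorphic_ball f \<Longrightarrow> (\<integral>\<^sup>+z. ennreal (\<Phi> (cmod (f z) / \<mu>)) \<partial>nu \<alpha>) \<le> 1 \<Longrightarrow>
    w \<in> ball (0 :: complex ^ 'n) 1 \<Longrightarrow> cmod (f w) / (K * \<mu>) \<le> growth_inv \<Phi> (bdef w powr (- N))"
    using moderate_growth_pointwise[OF moderate_\<Phi> \<Phi> \<alpha>, where 'n='n] unfolding N_def by blast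
  \<comment> \<open>The pairing is defined through the derivative D in the weight \<alpha> + k,
    where the integral converges absolutely for every f in the space. With g itself convergence is
    only available for the dilates of f.\<close>
  define L where "L f = (LINT z|nu (\<alpha> + real k). cnj (D z) * f z)" for f
  have bound: "(\<integral>\<^sup>+z. ennreal (cmod (cnj (D z) * f z)) \<partial>nu (\<alpha> + real k)) \<le> ennreal (M * K * \<mu>)"
    if f: "f \<in> bergman_orlicz \<alpha> \<Phi>" and \<mu>: "\<mu> > 0" and I: "(\<integral>\<^sup>+z. ennreal (\<Phi> (cmod (f z) / \<mu>)) \<partial>nu \<alpha>) \<le> 1" for f \<mu>
  proof -
    have fh: "holomorphic_ball f" using f by (simp add: bergman_orlicz_def)
    have fm: "f \<in> borel_measurable (nu \<alpha>)" by (rule holomorphic_ball_measurable[OF fh])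
    have "(\<integral>\<^sup>+z. ennreal (cmod (cnj (D z) * f z)) \<partial>nu (\<alpha> + real k)) = (\<integral>\<^sup>+z. ennreal (cmod (D z * f z)) \<partial>nu (\<alpha> + real k))"
      by (simp add: norm_mult)
    also have "\<dots> \<le> (\<integral>\<^sup>+z. ennreal (M * (rho \<Phi> (bdef z powr N) * cmod (f z))) \<partial>nu \<alpha>)"
      unfolding M_def by (rule nn_integral_kernel_shift(1)[OF \<alpha> k0 Dm fm C bD[folded D_def]])
    also have "\<dots> \<le> (\<integral>\<^sup>+z. ennreal (M * K * \<mu>) * ennreal (\<Phi> (cmod (f z) / \<mu>)) \<partial>nu \<alpha>)"
    proof (rule nn_integral_mono)
      fix z :: "complex ^ 'n" assume "z \<in> space (nu \<alpha>)"
      then have z: "z \<in> ball 0 1" by simp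
      let ?s = "bdef z powr (- N)"
      have s: "?s > 0" "1 / ?s = bdef z powr N" using bdef_pos[OF z] by (simp, simp only: powr_minus inverse_eq_divide divide_divide_eq_right mult_1 div_by_1)
      have "cmod (f z) / (K * \<mu>) * rho \<Phi> (1 / ?s) \<le> \<Phi> (cmod (f z) / (K * \<mu>))"
        using K(1) \<mu> by (intro pairing_domination s(1) K(2)[OF \<mu> fh I z]) auto
      also have "\<dots> \<le> \<Phi> (cmod (f z) / \<mu>)" using K(1) \<mu> by (intro growth_function_mono[OF \<Phi>] divide_left_mono) auto
      finally have "M * K * \<mu> * (cmod (f z) / (K * \<mu>) * rho \<Phi> (bdef z powr N)) \<le> M * K * \<mu> * \<Phi> (cmod (f z) / \<mu>)"
        unfolding s(2) using M K(1) \<mu> by (intro mult_left_mono) auto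
      then have "M * (rho \<Phi> (bdef z powr N) * cmod (f z)) \<le> M * K * \<mu> * \<Phi> (cmod (f z) / \<mu>)"
        using K(1) \<mu> by (simp add: mult_ac)
      then show "ennreal (M * (rho \<Phi> (bdef z powr N) * cmod (f z))) \<le> ennreal (M * K * \<mu>) * ennreal (\<Phi> (cmod (f z) / \<mu>))"
        using M K(1) \<mu> growth_function_nonneg[OF \<Phi>, of "cmod (f z) / \<mu>"] by (simp add: ennreal_leI flip: ennreal_mult)
    qed
    also have "\<dots> = ennreal (M * K * \<mu>) * (\<integral>\<^sup>+z. ennreal (\<Phi> (cmod (f z) / \<mu>)) \<partial>nu \<alpha>)"
      using moderate_cmod_measurable[OF moderate_\<Phi> fm, of \<mu>] \<mu> by (intro nn_integral_cmult) auto
    also have "\<dots> \<le> ennreal (M * K * \<mu>) * 1" by (intro mult_left_mono I) simp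
    finally show ?thesis by simp
  qed
  have int: "integrable (nu (\<alpha> + real k)) (\<lambda>z. cnj (D z) * f z)" if f: "f \<in> bergman_orlicz \<alpha> \<Phi>" for f
  proof (rule integrableI_bounded)
    have "f \<in> borel_measurable (nu \<alpha>)" using f by (intro holomorphic_ball_measurable) (simp add: bergman_orlicz_def)
    then have "(\<lambda>z. cnj (D z) * f z) \<in> borel_measurable (nu \<alpha>)" using Dm by (intro borel_measurable_times measurable_compose[OF Dm borel_measurable_cnj])
    then show "(\<lambda>z. cnj (D z) * f z) \<in> borel_measurable (nu (\<alpha> + real k))" using borel_measurable_nu_cong by blast
    obtain \<mu> where "\<mu> > 0" "(\<integral>\<^sup>+z. ennreal (\<Phi> (cmod (f z) / \<mu>)) \<partial>nu \<alpha>) \<le> 1" using lux_finite[OF moderate_\<Phi> f] by blast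
    from bound[OF f this] show "(\<integral>\<^sup>+z. ennreal (norm (cnj (D z) * f z)) \<partial>nu (\<alpha> + real k)) < \<infinity>"
      by (rule order.strict_trans1) simp
  qed
  have L: "L \<in> orlicz_dual \<alpha> \<Phi>" unfolding orlicz_dual_def mem_Collect_eq
  proof (intro conjI ballI allI)
    fix f h :: "complex ^ 'n \<Rightarrow> complex" assume "f \<in> bergman_orlicz \<alpha> \<Phi>" "h \<in> bergman_orlicz \<alpha> \<Phi>"
    then show "L (\<lambda>z. f z + h z) = L f + L h" unfolding L_def distrib_left by (intro Bochner_Integration.integral_add int)
  next
    fix f :: "complex ^ 'n \<Rightarrow> complex" and c
    have "L (\<lambda>z. c * f z) = (LINT z|nu (\<alpha> + real k). c * (cnj (D z) * f z))" by (simp add: L_def mult_ac)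
    then show "L (\<lambda>z. c * f z) = c * L f" by (simp add: L_def)
  next
    show "\<exists>C>0. \<forall>f\<in>bergman_orlicz \<alpha> \<Phi>. ennreal (cmod (L f)) \<le> ennreal C * lux_norm \<alpha> \<Phi> f"
    proof (intro exI[of _ "M * K"] conjI ballI)
      show MK: "M * K > 0" using M K(1) by simp
      fix f :: "complex ^ 'n \<Rightarrow> complex" assume f: "f \<in> bergman_orlicz \<alpha> \<Phi>"
      show "ennreal (cmod (L f)) \<le> ennreal (M * K) * lux_norm \<alpha> \<Phi> f"
        by (rule le_lux_normI[OF MK]) (unfold L_def, rule order.trans[OF norm_integral_le_nn bound[OF f]])
    qed
  qed
  have "represents \<alpha> \<Phi> g L" unfolding represents_def has_pairing_def
  proof
    fix f :: "complex ^ 'n \<Rightarrow> complex" assume f: "f \<in> bergman_orlicz \<alpha> \<Phi>"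
    have fh: "holomorphic_ball f" using f by (simp add: bergman_orlicz_def)
    \<comment> \<open>Dilates are bounded, so integration by parts identifies the pairing with g and
      the one with D before r tends to 1.\<close>
    from eventually_at_left_unit have ev: "\<forall>\<^sub>F r in at_left 1. L (\<lambda>z. f (r *\<^sub>R z)) = (LINT z|nu \<alpha>. f (r *\<^sub>R z) * cnj (g z))"
    proof eventually_elim
      case (elim r)
      have fr: "Hinf (\<lambda>z. f (r *\<^sub>R z))" by (rule Hinf_dilate[OF fh]) (use elim in auto)
      have "(LINT z|nu \<alpha>. f (r *\<^sub>R z) * cnj (g z)) = (LINT z|nu \<alpha>. cnj (g z * cnj (f (r *\<^sub>R z))))" by (simp add: mult.commute)
      also have "\<dots> = cnj (LINT z|nu \<alpha>. g z * cnj (f (r *\<^sub>R z)))" by (rule Bochner_Integration.integral_cnj)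
      also have "(LINT z|nu \<alpha>. g z * cnj (f (r *\<^sub>R z))) = (LINT z|nu (\<alpha> + real k). D z * cnj (f (r *\<^sub>R z)))"
        unfolding D_def N_def by (rule radial_integration_by_parts[OF \<alpha> k0 gh(1) fr _ _ gB]) (use \<alpha> in auto)
      also have "cnj \<dots> = (LINT z|nu (\<alpha> + real k). cnj (D z * cnj (f (r *\<^sub>R z))))" by (rule Bochner_Integration.integral_cnj[symmetric])
      finally show ?case by (simp add: L_def)
    qed
    show "((\<lambda>r. LINT z|nu \<alpha>. f (r *\<^sub>R z) * cnj (g z)) \<longlongrightarrow> L f) (at_left 1)"
      by (rule Lim_transform_eventually[OF orlicz_dual_dilation[OF moderate_\<Phi> \<alpha> L f] ev])
  qed
  then show ?thesis using L by blast
qed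

text \<open>Pairing g with the dilated kernel at w reproduces g at rw, and r -> 1 gives g(w). A
  representing function is thus determined by L, which is the uniqueness part of the
  duality.\<close>

lemma represents_kernel:
  fixes g :: "complex ^ 'n \<Rightarrow> complex"
  assumes \<alpha>: "\<alpha> > -1" and g: "holomorphic_ball g" "integrable (nu \<alpha>) g" and rep: "represents \<alpha> \<Phi> g L" and w: "w \<in> ball 0 1"
  shows "g w = cnj (L (\<lambda>z. bker (real CARD('n) + 1 + \<alpha>) (herm z w)))"
proof -
  define N where "N = real CARD('n) + 1 + \<alpha>"
  define f where "f z = bker N (herm z w)" for z
  have "f \<in> bergman_orlicz \<alpha> \<Phi>" unfolding f_def by (intro Hinf_bergman_orlicz[OF moderate_\<Phi> \<alpha>] Hinf_bker w)
  then have l: "((\<lambda>r. LINT z|nu \<alpha>. f (r *\<^sub>R z) * cnj (g z)) \<longlongrightarrow> L f) (at_left 1)"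
    using rep by (simp add: represents_def has_pairing_def)
  from eventually_at_left_unit have ev: "\<forall>\<^sub>F r in at_left 1. (LINT z|nu \<alpha>. f (r *\<^sub>R z) * cnj (g z)) = cnj (g (r *\<^sub>R w))"
  proof eventually_elim
    case (elim r)
    have rw: "r *\<^sub>R w \<in> ball 0 1" by (rule scaleR_in_ball[OF _ _ w]) (use elim in auto)
    have "(LINT z|nu \<alpha>. f (r *\<^sub>R z) * cnj (g z)) = (LINT z|nu \<alpha>. cnj (g z) * bker N (herm z (r *\<^sub>R w)))"
      by (simp add: f_def herm_scaleR_swap mult.commute)
    also have "\<dots> = cnj (g (r *\<^sub>R w))"
      unfolding cnj_kint[OF rw] N_def kint_reproducing[OF g(1) \<alpha> g(2) rw] ..
    finally show ?case .
  qed
  have "((\<lambda>r. cnj (g (r *\<^sub>R w))) \<longlongrightarrow> L f) (at_left 1)" by (rule Lim_transform_eventually[OF l ev])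
  moreover have "((\<lambda>r. cnj (g (r *\<^sub>R w))) \<longlongrightarrow> cnj (g (1 *\<^sub>R w))) (at_left 1)"
  proof (intro tendsto_cnj continuous_on_tendsto_compose[OF holomorphic_ball_continuous[OF g(1)]] tendsto_intros)
    show "\<forall>\<^sub>F r in at_left 1. r *\<^sub>R w \<in> ball 0 1" using eventually_at_left_unit
      by eventually_elim (rule scaleR_in_ball[OF _ _ w], auto)
  qed (use w in auto)
  ultimately have "L f = cnj (g w)" using tendsto_unique[of "at_left (1::real)"] by force
  then show ?thesis by (simp add: f_def[abs_def] N_def)
qed

lemma orlicz_dual_represented:
  fixes L :: "(complex ^ 'n \<Rightarrow> complex) \<Rightarrow> complex"
  assumes \<alpha>: "\<alpha> > -1" and L: "L \<in> orlicz_dual \<alpha> \<Phi>"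
  shows "\<exists>g\<in>Gamma_space \<alpha> (rho \<Phi>). represents \<alpha> \<Phi> g L"
proof -
  define N where "N = real CARD('n) + 1 + \<alpha>"
  define k where "k = nat \<lceil>4 * N\<rceil>"
  have N: "N > 0" using \<alpha> by (simp add: N_def)
  have k: "real k \<ge> 4 * N" unfolding k_def by (rule real_nat_ceiling_ge)
  have Nk: "N + real k \<ge> 4 * N" using k N by linarith
  have \<Lambda>: "sup_functional L" by (rule orlicz_dual_sup_functional[OF moderate_\<Phi> \<Phi> \<alpha> L])
  obtain C where C: "C > 0" "\<And>f. f \<in> bergman_orlicz \<alpha> \<Phi> \<Longrightarrow> ennreal (cmod (L f)) \<le> ennreal C * lux_norm \<alpha> \<Phi> f"
    using orlicz_dualD(3)[OF L] by blast
  obtain c :: "nat \<Rightarrow> real" where c: "\<And>w. w \<in> ball 0 1 \<Longrightarrow> (radial_deriv ^^ k) (ktrans L N) w = (\<Sum>j\<le>k. of_real (c j) * ktrans L (N + real j) w)"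
    using radial_pow_ktrans[of k N, where 'n='n] \<Lambda> by blast
  obtain A where A: "A > 0" "\<And>z w. z \<in> ball (0 :: complex ^ 'n) 1 \<Longrightarrow> w \<in> ball 0 1 \<Longrightarrow>
    cmod (\<Sum>j\<le>k. of_real (c j) * bker (N + real j) (herm z w)) \<le> A * cmod (1 - herm z w) powr (- (N + real k))"
    using kernel_sum_bound[where k=k and c=c and s=N and 'n='n] by blast
  define g where "g = ktrans L N"
  have gh: "holomorphic_ball g" unfolding g_def by (rule holomorphic_ball_ktrans[OF \<Lambda>])
  let ?M = "C * (A * 2 powr (N + real k))"
  have M: "?M > 0" using C(1) A(1) by simp
  have gG: "g \<in> Gamma_space \<alpha> (rho \<Phi>)"
  proof (rule gammaI[OF \<alpha> gh k[unfolded N_def] M, folded N_def])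
    fix w :: "complex ^ 'n" assume w: "w \<in> ball 0 1"
    define f where "f \<xi> = (\<Sum>j\<le>k. of_real (c j) * bker (N + real j) (herm \<xi> w))" for \<xi>
    have f: "Hinf f" unfolding f_def by (rule Hinf_kernel_sum[OF w])
    have fA: "cmod (f z) \<le> A * cmod (1 - herm z w) powr (- (N + real k))" if "z \<in> ball 0 1" for z
      using A(2)[OF that w] by (simp add: f_def)
    let ?s = "bdef w powr (- N)"
    have d: "0 < bdef w" by (rule bdef_pos[OF w])
    have s: "?s > 0" "1 / (bdef w powr N) = ?s" "bdef w powr N > 0" using d by (auto simp: powr_minus inverse_eq_divide)
    \<comment> \<open>The kernels here have orders up to N + k. The surplus bdef(w)^(-N) divided by
      \<Phi>^{-1}(bdef(w)^(-N)) is \<rho>_\<Phi>(bdef(w)^N), which leaves the power -k required by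
      \<Gamma>.\<close>
    define l where "l = A * 2 powr (N + real k) * bdef w powr (- (N + real k)) / growth_inv \<Phi> ?s"
    have l: "l \<ge> 0" using A(1) growth_inv_pos[OF \<Phi> s(1)] by (simp add: l_def)
    have "lux_norm \<alpha> \<Phi> f \<le> ennreal l" unfolding l_def N_def
      by (rule kernel_lux_norm[OF moderate_\<Phi> \<Phi> \<alpha> w Nk[unfolded N_def] A(1) fA[unfolded N_def]])
    then have "ennreal C * lux_norm \<alpha> \<Phi> f \<le> ennreal C * ennreal l" by (intro mult_left_mono) auto
    then have "ennreal (cmod (L f)) \<le> ennreal C * ennreal l" by (rule order.trans[OF C(2)[OF Hinf_bergman_orlicz[OF moderate_\<Phi> \<alpha> f]]])
    also have "\<dots> = ennreal (C * l)" using C(1) l by (simp flip: ennreal_mult)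
    finally have "cmod (L f) \<le> C * l" using C(1) l by simp
    also have "C * l = ?M * bdef w powr (- real k) * rho \<Phi> (bdef w powr N)"
    proof -
      have "bdef w powr (- (N + real k)) = bdef w powr (- real k) * ?s" by (simp flip: powr_add add: algebra_simps)
      moreover have "rho \<Phi> (bdef w powr N) = ?s / growth_inv \<Phi> ?s" using rho_inv[OF s(3)] unfolding s(2) .
      ultimately show ?thesis unfolding l_def by simp
    qed
    finally have Lf: "cmod (L f) \<le> ?M * bdef w powr (- real k) * rho \<Phi> (bdef w powr N)" .
    have "L f = (\<Sum>j\<le>k. of_real (c j) * L (\<lambda>z. bker (N + real j) (herm z w)))"
      unfolding f_def by (rule sup_functional_sum[OF \<Lambda> _ Hinf_bker[OF w]]) simp
    then have "(radial_deriv ^^ k) g w = cnj (L f)" unfolding g_def c[OF w] by (simp add: ktrans_def)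
    then show "cmod ((radial_deriv ^^ k) g w) \<le> ?M * bdef w powr (- real k) * rho \<Phi> (bdef w powr N)" using Lf by simp
  qed
  have gi: "integrable (nu \<alpha>) g" by (rule gamma_regularity[OF \<alpha> gG])
  have gic: "integrable (nu \<alpha>) (\<lambda>z. cnj (g z))" using gi by simp
  \<comment> \<open>The defect between L and the pairing with g. It vanishes on all reproducing
    kernels by the choice of g, hence on all dilates, and continuity of L along dilations does the
    rest.\<close>
  define \<Lambda>' where "\<Lambda>' f = L f - (LINT z|nu \<alpha>. cnj (g z) * f z)" for f
  have "sup_functional \<Lambda>'"
  proof -
    note S = sup_functional_cnj[OF gi]
    obtain A where A: "A \<ge> 0" "\<And>f B. Hinf f \<Longrightarrow> (\<And>z. z \<in> ball 0 1 \<Longrightarrow> cmod (f z) \<le> B) \<Longrightarrow> cmod (L f) \<le> A * B"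
      using sup_functional_bound[OF \<Lambda>] by blast
    obtain B where B: "B \<ge> 0" "\<And>f b. Hinf f \<Longrightarrow> (\<And>z. z \<in> ball 0 1 \<Longrightarrow> cmod (f z) \<le> b) \<Longrightarrow> cmod (LINT z|nu \<alpha>. cnj (g z) * f z) \<le> B * b"
      using sup_functional_bound[OF S] by blast
    show ?thesis unfolding sup_functional_def
    proof (intro conjI allI impI)
      show "\<exists>C\<ge>0. \<forall>f b. Hinf f \<longrightarrow> (\<forall>z\<in>ball 0 1. cmod (f z) \<le> b) \<longrightarrow> cmod (\<Lambda>' f) \<le> C * b"
      proof (intro exI[of _ "A + B"] conjI allI impI)
        show "0 \<le> A + B" using A(1) B(1) by simp
        fix f :: "complex ^ 'n \<Rightarrow> complex" and b assume f: "Hinf f" "\<forall>z\<in>ball 0 1. cmod (f z) \<le> b"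
        have "cmod (L f) \<le> A * b" "cmod (LINT z|nu \<alpha>. cnj (g z) * f z) \<le> B * b" using A(2)[OF f(1)] B(2)[OF f(1)] f(2) by auto
        then show "cmod (\<Lambda>' f) \<le> (A + B) * b" unfolding \<Lambda>'_def distrib_right by (intro norm_triangle_le_diff add_mono)
      qed
    qed (simp_all add: \<Lambda>'_def sup_functional_add[OF \<Lambda>] sup_functional_add[OF S] sup_functional_cmult[OF \<Lambda>] sup_functional_cmult[OF S] right_diff_distrib)
  qed
  moreover have "\<Lambda>' (\<lambda>z. bker (real CARD('n) + 1 + \<alpha>) (herm z a)) = 0" if a: "a \<in> ball 0 1" for a
    using cnj_kint[OF a, of \<alpha> g N] kint_reproducing[OF gh \<alpha> gi a] by (simp add: \<Lambda>'_def g_def ktrans_def N_def)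
  ultimately have vanish: "\<Lambda>' (\<lambda>z. f (r *\<^sub>R z)) = 0" if "holomorphic_ball f" "0 \<le> r" "r < 1" for f r
    using functional_vanishes_dilate[OF \<alpha> _ that] by blast
  have "represents \<alpha> \<Phi> g L" unfolding represents_def has_pairing_def
  proof
    fix f :: "complex ^ 'n \<Rightarrow> complex" assume f: "f \<in> bergman_orlicz \<alpha> \<Phi>"
    have fh: "holomorphic_ball f" using f by (simp add: bergman_orlicz_def)
    from eventually_at_left_unit have ev: "\<forall>\<^sub>F r in at_left 1. L (\<lambda>z. f (r *\<^sub>R z)) = (LINT z|nu \<alpha>. f (r *\<^sub>R z) * cnj (g z))"
    proof eventually_elim
      case (elim r)
      then show ?case using vanish[OF fh, of r] by (simp add: \<Lambda>'_def mult.commute)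
    qed
    show "((\<lambda>r. LINT z|nu \<alpha>. f (r *\<^sub>R z) * cnj (g z)) \<longlongrightarrow> L f) (at_left 1)"
      by (rule Lim_transform_eventually[OF orlicz_dual_dilation[OF moderate_\<Phi> \<alpha> L f] ev])
  qed
  then show ?thesis using gG by blast
qed

lemma gamma_is_dual:
  assumes \<alpha>: "\<alpha> > -1"
  shows "is_dual_of_orlicz \<alpha> \<Phi> (Gamma_space \<alpha> (rho \<Phi>) :: (complex ^ 'n \<Rightarrow> complex) set)"
  unfolding is_dual_of_orlicz_def
proof (intro conjI ballI)
  fix g :: "complex ^ 'n \<Rightarrow> complex" assume "g \<in> Gamma_space \<alpha> (rho \<Phi>)"
  then show "\<exists>L\<in>orlicz_dual \<alpha> \<Phi>. represents \<alpha> \<Phi> g L" by (rule gamma_represents[OF \<alpha>])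
next
  fix L :: "(complex ^ 'n \<Rightarrow> complex) \<Rightarrow> complex" assume "L \<in> orlicz_dual \<alpha> \<Phi>"
  then obtain g where g: "g \<in> Gamma_space \<alpha> (rho \<Phi>)" "represents \<alpha> \<Phi> g L" using orlicz_dual_represented[OF \<alpha>] by blast
  \<comment> \<open>An element of \<Gamma> is integrable, so a representing one is given by the
    kernel values of L; two of them coincide on the ball.\<close>
  have eq: "h w = cnj (L (\<lambda>z. bker (real CARD('n) + 1 + \<alpha>) (herm z w)))"
    if "h \<in> Gamma_space \<alpha> (rho \<Phi>)" "represents \<alpha> \<Phi> h L" "w \<in> ball 0 1" for h w
  proof -
    show ?thesis by (rule gamma_regularity[OF \<alpha> that(1)]) (rule represents_kernel[OF \<alpha> _ _ that(2,3)])
  qed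
  show "\<exists>g\<in>Gamma_space \<alpha> (rho \<Phi>). represents \<alpha> \<Phi> g L \<and>
      (\<forall>g'\<in>Gamma_space \<alpha> (rho \<Phi>). represents \<alpha> \<Phi> g' L \<longrightarrow> (\<forall>z\<in>ball 0 1. g' z = g z))"
  proof (intro bexI[OF _ g(1)] conjI ballI impI g(2))
    fix h z assume "h \<in> Gamma_space \<alpha> (rho \<Phi>)" "represents \<alpha> \<Phi> h L" and z: "z \<in> ball (0 :: complex ^ 'n) 1"
    then show "h z = g z" unfolding eq[OF g z] by (rule eq)
  qed
qed

end

theorem proposition4p11:
  fixes \<alpha> q :: real
    and \<Phi>1 \<Phi>2 \<Phi> :: "real \<Rightarrow> real"
    and b :: "complex ^ 'n \<Rightarrow> complex"
  assumes "\<alpha> > -1"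
    and "q \<ge> 1"
    and "\<Phi>1 \<in> growth_U q"
    and "\<Phi>2 \<in> growth_U q"
    and "dini_condition \<Phi>2"
    and "antimono_on {0<..} (\<lambda>t. growth_inv \<Phi>2 (\<Phi>1 t) / t)"
    and "growth_function \<Phi>"
    and "\<forall>t>0. rho \<Phi> t = rho \<Phi>1 t / rho \<Phi>2 t"
    and "b \<in> bergman_orlicz \<alpha> (\<lambda>t. t\<^sup>2)"
  shows "(hankel_bounded \<alpha> \<Phi>1 \<Phi>2 b \<longleftrightarrow> b \<in> Gamma_space \<alpha> (rho \<Phi>)) \<and>
         is_dual_of_orlicz \<alpha> \<Phi> (Gamma_space \<alpha> (rho \<Phi>) :: (complex ^ 'n \<Rightarrow> complex) set)"
proof -
  interpret growth_triple q \<Phi>1 \<Phi>2 \<Phi> by (rule growth_triple.intro) (rule assms)+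
  show ?thesis
    using hankel_bounded_imp_gamma[OF assms(1) square_integrable_nu[OF assms(1,9)]]
      gamma_imp_hankel_bounded[OF assms(1,5)] gamma_is_dual[OF assms(1)] by blast
qed

end
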